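(* Let the perturbed system $\frac{dx}{dt}=\partial_yH(x,y,t)$, $\frac{dy}{dt}=-\partial_xH(x,y,t)+F(x,y,t)$ satisfy the standing assumptions of the context, and let $2\le n,m\le2q$, $\sigma\ge2$, $d\ge1$ be integers such that (with $N\ge n+d$, $M=m$ in the averaging procedure of the context) the following hold. (a) $\Lambda_j(v,\psi)\equiv0$ for $j<n$, $\Omega_i(v,\psi)\equiv0$ for $i<m$; for $n\le z<n+d$, $\Lambda_z(v,\psi)\equiv v^{\frac{\sigma+1}2}\big(\lambda_{z,\sigma}(\psi)+\widetilde\lambda_{z,\sigma}(v,\psi)\big)+v\,\delta_{z,2q}\frac lq$; and $\Lambda_{n+d}(v,\psi)\equiv v\big(\lambda_{n+d}(\psi)+\widetilde\lambda_{n+d}(v,\psi)+\delta_{n+d,2q}\frac lq\big)$, where all $\lambda$'s and $\widetilde\lambda$'s are $2\pi$-periodic in $\psi$ and $\widetilde\lambda_{z,\sigma}=\mathcal O(v^{1/2})$, $\widetilde\lambda_{n+d}=\mathcal O(v^{1/2})$ as $v\to0$ uniformly for $\psi\in\mathbb R$. (b) There is $\Delta_\ast\in(0,\Delta_0]$ such that $\Omega_m(v,\psi)\ne0$ for all $v\in[0,\Delta_\ast]$, $\psi\in\mathbb R$. Let $\omega_m(\psi)=\Omega_m(0,\psi)$, $\langle h\rangle_\psi=\frac1{2\pi}\int_0^{2\pi}h(\psi)\,d\psi$, $\widehat\gamma_{n+d,m}=\langle\lambda_{n+d}(\psi)|\omega_m(\psi)|^{-1}\rangle_\psi$ and $\widehat\gamma_{n,\sigma,m}=\langle\lambda_{n,\sigma}(\psi)|\omega_m(\psi)|^{-1}\rangle_\psi$.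 If $m<n+d\le2q$, $\widehat\gamma_{n+d,m}>0$ and $\widehat\gamma_{n,\sigma,m}<0$, then the equilibrium $(0,0)$ is polynomially stable.
   Context: Perturbed system (standing assumptions). Consider for $t>0$ the system $\frac{dx}{dt}=\partial_yH(x,y,t)$, $\frac{dy}{dt}=-\partial_xH(x,y,t)+F(x,y,t)$, where $H,F$ are infinitely differentiable and, on every compact set of $(x,y)$, $H(x,y,t)\to H_0(x,y)$, $F(x,y,t)\to0$ as $t\to\infty$. Here $H_0=\frac{x^2+y^2}{2}+\mathcal O(r^3)$ as $r=\sqrt{x^2+y^2}\to0$; the limiting system $\dot x=\partial_yH_0$, $\dot y=-\partial_xH_0$ has $(0,0)$ as an isolated fixed point of center type; there are constants $E_0,r_0>0$ such that for $E\in(0,E_0]$ the level lines $\{H_0=E\}$ lying in $D_0=\{r\le r_0\}$ form a family of closed curves, each corresponding to a periodic solution $x_0(t,E),y_0(t,E)$ of the limiting system of period $2\pi/\omega(E)$, with $\omega(E)\ne0$ on $[0,E_0]$ and $\omega(E)=1+\mathcal O(E)$ as $E\to0$. As $t\to\infty$, for $(x,y)\in D_0$, $H=H_0+\sum_{k\ge1}t^{-k/q}H_k(x,y,S(t))$, $F=\sum_{k\ge1}t^{-k/q}F_k(x,y,S(t))$, where $q$ is a positive integer, $H_k,F_k$ are $2\pi$-periodic in $S$, and $S(t)=\sum_{k=0}^{q-1}s_kt^{1-k/q}+s_q\log t+\mathcal O(t^{-1/q})$ with constants $s_k$, $s_0>0$. These asymptotic expansions may be differentiated termwise. Moreover $\partial_xH(0,0,t)\equiv\partial_yH(0,0,t)\equiv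 F(0,0,t)\equiv0$, $H_k=\mathcal O(r^2)$, $F_k=\mathcal O(r)$ as $r\to0$, and the resonance condition $s_0=\varkappa\,\omega(0)$ holds with a positive integer $\varkappa$. Action-angle variables. Put $X(\varphi,E)=x_0(\varphi/\omega(E),E)$, $Y(\varphi,E)=y_0(\varphi/\omega(E),E)$ ($2\pi$-periodic in $\varphi$, phase chosen so that to leading order as $E\to0$, $X=\sqrt{2E}\cos\varphi$, $Y=-\sqrt{2E}\sin\varphi$). The substitution $x=X(\varphi,E)$, $y=Y(\varphi,E)$ gives $\dot E=f(E,\varphi,t)$, $\dot\varphi=\omega(E)+g(E,\varphi,t)$ with $f=-\omega(E)\big(\partial_\varphi[H(X,Y,t)]-F(X,Y,t)\partial_\varphi X\big)$, $g=\omega(E)\big(\partial_E[H(X,Y,t)]-1-F(X,Y,t)\partial_EX\big)$. These have expansions $f=\sum_{k\ge1}t^{-k/q}f_k(E,\varphi,S(t))$, $g=\sum_{k\ge1}t^{-k/q}g_k(E,\varphi,S(t))$, with $f_k=\sum_{j\ge2}E^{j/2}f_{k,j}(\varphi,S)$, $g_k=\sum_{j\ge0}E^{j/2}g_{k,j}(\varphi,S)$ as $E\to0$. Scaling. Put $E=t^{-l/q}\mathcal E$, $\varphi=\theta+\varkappa^{-1}S(t)$ with an integer $l$: $l=0$ if $\omega(E)\equiv$ const, $l\ge1$ otherwise ($l=1$ unless a larger $l$ is needed so that the first nonzero $\Omega_m$ below satisfies $\Omega_m(0,\psi)\not\equiv0$). Then $\dot{\mathcal E}=\mathcal F(\mathcal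 E,\theta,t)+t^{-1}\frac lq\mathcal E$, $\dot\theta=\mathcal G(\mathcal E,\theta,t)$, where $\mathcal F=t^{l/q}f(t^{-l/q}\mathcal E,\theta+\varkappa^{-1}S(t),t)$, $\mathcal G=\omega(t^{-l/q}\mathcal E)-\varkappa^{-1}S'(t)+g(t^{-l/q}\mathcal E,\theta+\varkappa^{-1}S(t),t)$, expanded as $\mathcal F=\sum_{k\ge2}t^{-k/(2q)}\mathcal F_k(\mathcal E,\theta,S(t))$, $\mathcal G=\sum_{k\ge2}t^{-k/(2q)}\mathcal G_k(\mathcal E,\theta,S(t))$, using $S'(t)=\sum_{j=0}^{q-1}(1-\frac jq)s_jt^{-j/q}+s_qt^{-1}$ in the formal expansions. Averaging. For integers $N,M\ge2$ put $V_N=\mathcal E+\sum_{k=2}^Nt^{-k/(2q)}v_k(\mathcal E,\theta,S(t))$, $\Psi_M=\theta+\sum_{k=2}^Mt^{-k/(2q)}\psi_k(\mathcal E,\theta,S(t))$. The functions $v_k,\Lambda_k$ ($2\le k\le N$) and $\psi_k,\Omega_k$ ($2\le k\le M$) are determined recursively in $k$ by the requirements: $v_k,\psi_k$ are $2\pi$-periodic in $\theta$ and $2\pi\varkappa$-periodic in $S$ with zero mean over $S\in[0,2\pi\varkappa]$; $\Lambda_k,\Omega_k$ do not depend on $S$; and, when the total derivatives along the $(\mathcal E,\theta)$-system are expanded in powers of $t^{-1/(2q)}$ with coefficients functions of $(\mathcal E,\theta,S)$, the coefficients of $t^{-k/(2q)}$ agree in $\frac{d}{dt}V_N=\sum_{j=2}^Nt^{-j/(2q)}\Lambda_j(V_N,\Psi_M)$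 for $k\le N$ and in $\frac{d}{dt}\Psi_M=\sum_{j=2}^Mt^{-j/(2q)}\Omega_j(V_N,\Psi_M)$ for $k\le M$. The functions $\Lambda_k(v,\psi)=\mathcal O(v)$ and $\Omega_k(v,\psi)=\mathcal O(1)$ ($v\to0$) are $2\pi$-periodic in $\psi$. Then $v=V_N$, $\psi=\Psi_M$ satisfy $\dot v=\sum_{k=2}^Nt^{-k/(2q)}\Lambda_k(v,\psi)+\tilde\Lambda_N(v,\psi,t)$, $\dot\psi=\sum_{k=2}^Mt^{-k/(2q)}\Omega_k(v,\psi)+\tilde\Omega_M(v,\psi,t)$ with $\tilde\Lambda_N=\mathcal O(t^{-(N+1)/(2q)})$, $\tilde\Omega_M=\mathcal O(t^{-(M+1)/(2q)})$, $\tilde\Lambda_N(0,\psi,t)\equiv0$. Constant $\Delta_0$. Fix $\epsilon\in(0,1)$ and $t_0>1$ such that, with $\mathcal E_0=E_0t_0^{l/(2q)}$ and $\Delta_0=(1-\epsilon)\mathcal E_0$, for all $t\ge t_0$, $\theta\in\mathbb R$, $\mathcal E\in[0,\mathcal E_0]$ one has $|V_N-\mathcal E|\le\epsilon\mathcal E$, $|\Psi_M-\theta|\le\epsilon$, and $(\mathcal E,\theta)\mapsto(v,\psi)$ is invertible for $v\in[0,\Delta_0]$, $\psi\in\mathbb R$. Leading phase term. It is assumed that $\Omega_m(v,\psi)=\omega_m(\psi)+\omega_{m1}(\psi)\sqrt v+\mathcal O(v)$ as $v\to0$, with $2\pi$-periodic $\omega_m\not\equiv0$, $\omega_{m1}$.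 $\delta_{i,j}$ is the Kronecker delta. Stability notions. Stable means Lyapunov stable as $t\to\infty$ for the perturbed system in $(x,y)$. Polynomially stable: stable, and there is a constant $\gamma>0$ such that every solution starting sufficiently close to $(0,0)$ satisfies $x^2(t)+y^2(t)\le Ct^{-\gamma}$ for large $t$, $C$ depending on the solution. *)

theory Defs
  imports "HOL-Analysis.Analysis" "HOL-Library.Landau_Symbols"
begin

section \<open>Infinitely differentiable functions\<close>

primrec iter_dderiv :: "('a::real_normed_vector \<Rightarrow> real) \<Rightarrow> 'a list \<Rightarrow> 'a \<Rightarrow> real" where
  "iter_dderiv f [] = f"
| "iter_dderiv f (b # bs) = (\<lambda>p. deriv (\<lambda>h. iter_dderiv f bs (p + h *\<^sub>R b)) 0)"

definition smooth_on :: "'a::euclidean_space set \<Rightarrow> ('a \<Rightarrow> real) \<Rightarrow> bool" where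
  "smooth_on U f \<longleftrightarrow> open U \<and>
     (\<forall>bs. set bs \<subseteq> Basis \<longrightarrow> (\<forall>p\<in>U. iter_dderiv f bs differentiable (at p)))"

definition smooth_near :: "'a::euclidean_space set \<Rightarrow> ('a \<Rightarrow> real) \<Rightarrow> bool" where
  "smooth_near A f \<longleftrightarrow> (\<exists>U. A \<subseteq> U \<and> smooth_on U f)"

text \<open>Smoothness on \<open>0 \<le> E \<le> R\<close> of a function having an expansion in powers of
  \<open>E\<^sup>1\<^sup>/\<^sup>2\<close> at \<open>E = 0\<close>, as is natural for action-angle variables: it is a smooth
  function of \<open>z = sqrt E\<close>, up to and including \<open>z = 0\<close>.\<close>

definition sqrt_smooth :: "real \<Rightarrow> (real \<Rightarrow> 'a::euclidean_space \<Rightarrow> real) \<Rightarrow> bool" where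
  "sqrt_smooth R w \<longleftrightarrow> (\<exists>w'. smooth_near ({0..sqrt R} \<times> UNIV) w' \<and>
     (\<forall>z\<in>{0..sqrt R}. \<forall>p. w (z\<^sup>2) p = w' (z, p)))"

definition periodic :: "real \<Rightarrow> (real \<Rightarrow> real) \<Rightarrow> bool" where
  "periodic T h \<longleftrightarrow> (\<forall>u. h (u + T) = h u)"

text \<open>\<open>f v \<psi> = O(g v)\<close> as \<open>v \<rightarrow> 0+\<close>, uniformly in \<open>\<psi>\<close>.\<close>

definition unif_bigo :: "(real \<Rightarrow> real \<Rightarrow> real) \<Rightarrow> (real \<Rightarrow> real) \<Rightarrow> bool" where
  "unif_bigo f g \<longleftrightarrow> (\<exists>C. \<forall>\<^sub>F v in at_right 0. \<forall>\<psi>. \<bar>f v \<psi>\<bar> \<le> C * g v)"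


section \<open>The perturbed system and stability of its equilibrium\<close>

definition disc :: "real \<Rightarrow> (real \<times> real) set" where
  "disc r = {(x, y). x\<^sup>2 + y\<^sup>2 \<le> r\<^sup>2}"

definition solves ::
  "(real \<Rightarrow> real \<Rightarrow> real \<Rightarrow> real) \<Rightarrow> (real \<Rightarrow> real \<Rightarrow> real \<Rightarrow> real) \<Rightarrow> real set
     \<Rightarrow> (real \<Rightarrow> real) \<Rightarrow> (real \<Rightarrow> real) \<Rightarrow> bool" where
  "solves H F I x y \<longleftrightarrow> (\<forall>t\<in>I.
     (x has_real_derivative deriv (\<lambda>\<eta>. H (x t) \<eta> t) (y t)) (at t within I) \<and>
     (y has_real_derivative - deriv (\<lambda>\<xi>. H \<xi> (y t) t) (x t) + F (x t) (y t) t) (at t within I))"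

definition lyapunov_stable ::
  "(real \<Rightarrow> real \<Rightarrow> real \<Rightarrow> real) \<Rightarrow> (real \<Rightarrow> real \<Rightarrow> real \<Rightarrow> real) \<Rightarrow> bool" where
  "lyapunov_stable H F \<longleftrightarrow> (\<forall>t1>0. \<forall>\<epsilon>>0. \<exists>\<delta>>0. \<forall>a b. a\<^sup>2 + b\<^sup>2 < \<delta>\<^sup>2 \<longrightarrow>
     (\<exists>x y. solves H F {t1..} x y \<and> x t1 = a \<and> y t1 = b) \<and>
     (\<forall>x y. solves H F {t1..} x y \<and> x t1 = a \<and> y t1 = b \<longrightarrow>
        (\<forall>t\<ge>t1. (x t)\<^sup>2 + (y t)\<^sup>2 < \<epsilon>\<^sup>2)))"

definition polynomially_stable ::
  "(real \<Rightarrow> real \<Rightarrow> real \<Rightarrow> real) \<Rightarrow> (real \<Rightarrow> real \<Rightarrow> real \<Rightarrow> real) \<Rightarrow> bool" where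
  "polynomially_stable H F \<longleftrightarrow> lyapunov_stable H F \<and>
     (\<exists>\<gamma>>0. \<forall>t1>0. \<exists>\<delta>>0. \<forall>x y.
        solves H F {t1..} x y \<and> (x t1)\<^sup>2 + (y t1)\<^sup>2 < \<delta>\<^sup>2 \<longrightarrow>
        (\<exists>C. \<forall>\<^sub>F t in at_top. (x t)\<^sup>2 + (y t)\<^sup>2 \<le> C * t powr (- \<gamma>)))"

text \<open>The limiting Hamiltonian \<open>H0\<close> with its family \<open>x0 t E, y0 t E\<close> of periodic solutions.\<close>

definition angle_par :: "(real \<Rightarrow> real) \<Rightarrow> (real \<Rightarrow> real \<Rightarrow> real) \<Rightarrow> real \<Rightarrow> real \<Rightarrow> real" where
  "angle_par \<omega> x0 \<phi> E = x0 (\<phi> / \<omega> E) E"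

definition limiting_center ::
  "(real \<Rightarrow> real \<Rightarrow> real) \<Rightarrow> real \<Rightarrow> real \<Rightarrow> (real \<Rightarrow> real)
     \<Rightarrow> (real \<Rightarrow> real \<Rightarrow> real) \<Rightarrow> (real \<Rightarrow> real \<Rightarrow> real) \<Rightarrow> bool" where
  "limiting_center H0 r0 E0 \<omega> x0 y0 \<longleftrightarrow>
     r0 > 0 \<and> E0 > 0 \<and>
     smooth_near (disc r0) (\<lambda>(x, y). H0 x y) \<and>
     (\<lambda>(x, y). H0 x y - (x\<^sup>2 + y\<^sup>2) / 2) \<in> O[nhds (0, 0)](\<lambda>(x, y). sqrt (x\<^sup>2 + y\<^sup>2) ^ 3) \<and>
     deriv (\<lambda>\<xi>. H0 \<xi> 0) 0 = 0 \<and> deriv (\<lambda>\<eta>. H0 0 \<eta>) 0 = 0 \<and>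
     (\<exists>\<rho>>0. \<forall>x y. 0 < x\<^sup>2 + y\<^sup>2 \<and> x\<^sup>2 + y\<^sup>2 < \<rho>\<^sup>2 \<longrightarrow>
        \<not> (deriv (\<lambda>\<xi>. H0 \<xi> y) x = 0 \<and> deriv (\<lambda>\<eta>. H0 x \<eta>) y = 0)) \<and>
     (\<forall>E\<in>{0<..E0}.
        solves (\<lambda>x y t. H0 x y) (\<lambda>x y t. 0) UNIV (\<lambda>t. x0 t E) (\<lambda>t. y0 t E) \<and>
        periodic (2 * pi / \<omega> E) (\<lambda>t. x0 t E) \<and> periodic (2 * pi / \<omega> E) (\<lambda>t. y0 t E) \<and>
        inj_on (\<lambda>t. (x0 t E, y0 t E)) {0..<2 * pi / \<omega> E} \<and>
        {(x, y) \<in> disc r0. H0 x y = E} = range (\<lambda>t. (x0 t E, y0 t E))) \<and>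
     (\<forall>E\<in>{0..E0}. \<omega> E \<noteq> 0) \<and> \<omega> 0 = 1 \<and> (\<lambda>E. \<omega> E - 1) \<in> O[at_right 0](\<lambda>E. E)"

text \<open>The choice of the initial phase of the periodic solutions: regular in \<open>sqrt E\<close>, and
  normalized to leading order as \<open>E \<rightarrow> 0\<close>.\<close>

definition phase_normalized ::
  "real \<Rightarrow> (real \<Rightarrow> real) \<Rightarrow> (real \<Rightarrow> real \<Rightarrow> real) \<Rightarrow> (real \<Rightarrow> real \<Rightarrow> real) \<Rightarrow> bool" where
  "phase_normalized E0 \<omega> x0 y0 \<longleftrightarrow>
     sqrt_smooth E0 (\<lambda>E \<phi>. angle_par \<omega> x0 \<phi> E) \<and>
     sqrt_smooth E0 (\<lambda>E \<phi>. angle_par \<omega> y0 \<phi> E) \<and>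
     (\<forall>\<phi>. (\<lambda>E. angle_par \<omega> x0 \<phi> E - sqrt (2 * E) * cos \<phi>) \<in> o[at_right 0](\<lambda>E. sqrt E)) \<and>
     (\<forall>\<phi>. (\<lambda>E. angle_par \<omega> y0 \<phi> E + sqrt (2 * E) * sin \<phi>) \<in> o[at_right 0](\<lambda>E. sqrt E))"

text \<open>Termwise differentiability of an asymptotic expansion means that every iterated partial
  derivative of the remainder satisfies the remainder estimate.\<close>

definition has_perturbation_expansion ::
  "real \<Rightarrow> nat \<Rightarrow> (real \<Rightarrow> real) \<Rightarrow> (real \<Rightarrow> real \<Rightarrow> real \<Rightarrow> real) \<Rightarrow> (real \<Rightarrow> real \<Rightarrow> real)
     \<Rightarrow> (nat \<Rightarrow> real \<Rightarrow> real \<Rightarrow> real \<Rightarrow> real) \<Rightarrow> bool" where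
  "has_perturbation_expansion r0 q S G G0 Gk \<longleftrightarrow> (\<forall>K bs. set bs \<subseteq> Basis \<longrightarrow>
     (\<exists>C. \<forall>\<^sub>F t in at_top. \<forall>(x, y)\<in>disc r0.
        \<bar>iter_dderiv (\<lambda>(x, y, t). G x y t - G0 x y
             - (\<Sum>k=1..K. t powr (- (real k / real q)) * Gk k x y (S t))) bs (x, y, t)\<bar>
        \<le> C * t powr (- (real (K + 1) / real q))))"

definition phase_function :: "nat \<Rightarrow> (nat \<Rightarrow> real) \<Rightarrow> (real \<Rightarrow> real) \<Rightarrow> bool" where
  "phase_function q s S \<longleftrightarrow> s 0 > 0 \<and> smooth_on {0<..} S \<and>
     (\<forall>j. (deriv ^^ j)
        (\<lambda>t. S t - ((\<Sum>k<q. s k * t powr (1 - real k / real q)) + s q * ln t))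
        \<in> O[at_top](\<lambda>t. t powr (- (1 / real q) - real j)))"

definition perturbed_system ::
  "(real \<Rightarrow> real \<Rightarrow> real \<Rightarrow> real) \<Rightarrow> (real \<Rightarrow> real \<Rightarrow> real \<Rightarrow> real) \<Rightarrow> (real \<Rightarrow> real \<Rightarrow> real)
     \<Rightarrow> real \<Rightarrow> nat \<Rightarrow> (nat \<Rightarrow> real) \<Rightarrow> (real \<Rightarrow> real)
     \<Rightarrow> (nat \<Rightarrow> real \<Rightarrow> real \<Rightarrow> real \<Rightarrow> real) \<Rightarrow> (nat \<Rightarrow> real \<Rightarrow> real \<Rightarrow> real \<Rightarrow> real) \<Rightarrow> bool" where
  "perturbed_system H F H0 r0 q s S Hk Fk \<longleftrightarrow>
     q \<ge> 1 \<and>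
     smooth_on (UNIV \<times> UNIV \<times> {0<..}) (\<lambda>(x, y, t). H x y t) \<and>
     smooth_on (UNIV \<times> UNIV \<times> {0<..}) (\<lambda>(x, y, t). F x y t) \<and>
     (\<forall>K. compact K \<longrightarrow>
        uniform_limit K (\<lambda>t (x, y). H x y t) (\<lambda>(x, y). H0 x y) at_top \<and>
        uniform_limit K (\<lambda>t (x, y). F x y t) (\<lambda>(x, y). 0) at_top) \<and>
     phase_function q s S \<and>
     has_perturbation_expansion r0 q S H H0 Hk \<and>
     has_perturbation_expansion r0 q S F (\<lambda>x y. 0) Fk \<and>
     (\<forall>k\<ge>1.
        smooth_near {(x, y, \<sigma>). (x, y) \<in> disc r0} (\<lambda>(x, y, \<sigma>). Hk k x y \<sigma>) \<and>
        smooth_near {(x, y, \<sigma>). (x, y) \<in> disc r0} (\<lambda>(x, y, \<sigma>). Fk k x y \<sigma>) \<and>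
        (\<forall>(x, y)\<in>disc r0. periodic (2 * pi) (Hk k x y) \<and> periodic (2 * pi) (Fk k x y)) \<and>
        (\<forall>\<sigma>. (\<lambda>(x, y). Hk k x y \<sigma>) \<in> O[nhds (0, 0)](\<lambda>(x, y). sqrt (x\<^sup>2 + y\<^sup>2) ^ 2)) \<and>
        (\<forall>\<sigma>. (\<lambda>(x, y). Fk k x y \<sigma>) \<in> O[nhds (0, 0)](\<lambda>(x, y). sqrt (x\<^sup>2 + y\<^sup>2)))) \<and>
     (\<forall>t>0. deriv (\<lambda>\<xi>. H \<xi> 0 t) 0 = 0 \<and> deriv (\<lambda>\<eta>. H 0 \<eta> t) 0 = 0 \<and> F 0 0 t = 0)"


section \<open>Action-angle variables and scaling\<close>

text \<open>\<open>f\<^sub>k\<close> and \<open>g\<^sub>k\<close>, the coefficients of \<open>t\<^sup>-\<^sup>k\<^sup>/\<^sup>q\<close> in the equations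
  \<open>E' = f\<close>, \<open>\<phi>' = \<omega>(E) + g\<close>: here \<open>X, Y\<close> denote \<open>angle_par \<omega> x0\<close>, \<open>angle_par \<omega> y0\<close>, and
  \<open>h, p\<close> are \<open>H\<^sub>k, F\<^sub>k\<close>. The contributions of \<open>H0\<close> are
  \<open>\<partial>\<^sub>\<phi> [H0(X,Y)] = 0\<close> and \<open>\<partial>\<^sub>E [H0(X,Y)] - 1 = 0\<close>.\<close>

definition action_coeff ::
  "(real \<Rightarrow> real) \<Rightarrow> (real \<Rightarrow> real \<Rightarrow> real) \<Rightarrow> (real \<Rightarrow> real \<Rightarrow> real)
     \<Rightarrow> (real \<Rightarrow> real \<Rightarrow> real \<Rightarrow> real) \<Rightarrow> (real \<Rightarrow> real \<Rightarrow> real \<Rightarrow> real)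
     \<Rightarrow> real \<Rightarrow> real \<Rightarrow> real \<Rightarrow> real" where
  "action_coeff \<omega> X Y h p E \<phi> \<sigma> =
     - \<omega> E * (deriv (\<lambda>a. h (X a E) (Y a E) \<sigma>) \<phi> - p (X \<phi> E) (Y \<phi> E) \<sigma> * deriv (\<lambda>a. X a E) \<phi>)"

definition angle_coeff ::
  "(real \<Rightarrow> real) \<Rightarrow> (real \<Rightarrow> real \<Rightarrow> real) \<Rightarrow> (real \<Rightarrow> real \<Rightarrow> real)
     \<Rightarrow> (real \<Rightarrow> real \<Rightarrow> real \<Rightarrow> real) \<Rightarrow> (real \<Rightarrow> real \<Rightarrow> real \<Rightarrow> real)
     \<Rightarrow> real \<Rightarrow> real \<Rightarrow> real \<Rightarrow> real" where
  "angle_coeff \<omega> X Y h p E \<phi> \<sigma> =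
     \<omega> E * (deriv (\<lambda>e. h (X \<phi> e) (Y \<phi> e) \<sigma>) E - p (X \<phi> E) (Y \<phi> E) \<sigma> * deriv (\<lambda>e. X \<phi> e) E)"

text \<open>From here on \<open>\<tau>\<close> stands for \<open>t\<^sup>-\<^sup>1\<^sup>/\<^sup>(\<^sup>2\<^sup>q\<^sup>)\<close>, and in formal expansions \<open>\<tau>\<close> and
  \<open>\<sigma> = S(t)\<close> are independent variables. \<open>formal_dS\<close> is \<open>S'(t)\<close>.\<close>

definition formal_dS :: "nat \<Rightarrow> (nat \<Rightarrow> real) \<Rightarrow> real \<Rightarrow> real" where
  "formal_dS q s \<tau> =
     (\<Sum>j<q. (1 - real j / real q) * s j * \<tau> ^ (2 * j)) + s q * \<tau> ^ (2 * q)"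

definition partial_expansion ::
  "nat \<Rightarrow> (nat \<Rightarrow> real \<Rightarrow> real \<Rightarrow> real \<Rightarrow> real) \<Rightarrow> real \<Rightarrow> real \<Rightarrow> real \<Rightarrow> real \<Rightarrow> real" where
  "partial_expansion K w \<tau> e \<theta> \<sigma> = (\<Sum>k=2..K. \<tau> ^ k * w k e \<theta> \<sigma>)"

text \<open>\<open>cF k, cG k\<close> are the coefficients of \<open>\<tau>\<^sup>k\<close> in the expansions of the right-hand sides
  \<open>\<tau>\<^sup>-\<^sup>2\<^sup>l f\<close> and \<open>\<omega> - S' / \<kappa> + g\<close> of the system for the scaled action
  \<open>e = \<tau>\<^sup>-\<^sup>2\<^sup>l E\<close>, \<open>0 < e < R\<close>, and \<open>\<theta> = \<phi> - S / \<kappa>\<close>. As \<open>fk i = O(E)\<close> and \<open>gk i = O(1)\<close>, the terms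
  of \<open>f\<close> and \<open>g\<close> with \<open>i > K\<close> do not contribute up to the order \<open>K\<close>.\<close>

definition scaled_expansion ::
  "nat \<Rightarrow> nat \<Rightarrow> nat \<Rightarrow> (nat \<Rightarrow> real) \<Rightarrow> (real \<Rightarrow> real) \<Rightarrow> real
     \<Rightarrow> (nat \<Rightarrow> real \<Rightarrow> real \<Rightarrow> real \<Rightarrow> real) \<Rightarrow> (nat \<Rightarrow> real \<Rightarrow> real \<Rightarrow> real \<Rightarrow> real)
     \<Rightarrow> (nat \<Rightarrow> real \<Rightarrow> real \<Rightarrow> real \<Rightarrow> real) \<Rightarrow> (nat \<Rightarrow> real \<Rightarrow> real \<Rightarrow> real \<Rightarrow> real) \<Rightarrow> bool" where
  "scaled_expansion q l \<kappa> s \<omega> R fk gk cF cG \<longleftrightarrow> (\<forall>K. \<forall>e\<in>{0<..<R}. \<forall>\<theta> \<sigma>.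
     (\<lambda>\<tau>. (\<Sum>i=1..K. \<tau> ^ (2 * i) * fk i (\<tau> ^ (2 * l) * e) (\<theta> + \<sigma> / real \<kappa>) \<sigma>) / \<tau> ^ (2 * l)
          - partial_expansion K cF \<tau> e \<theta> \<sigma>) \<in> O[at_right 0](\<lambda>\<tau>. \<tau> ^ (K + 1)) \<and>
     (\<lambda>\<tau>. \<omega> (\<tau> ^ (2 * l) * e) - formal_dS q s \<tau> / real \<kappa>
          + (\<Sum>i=1..K. \<tau> ^ (2 * i) * gk i (\<tau> ^ (2 * l) * e) (\<theta> + \<sigma> / real \<kappa>) \<sigma>)
          - partial_expansion K cG \<tau> e \<theta> \<sigma>) \<in> O[at_right 0](\<lambda>\<tau>. \<tau> ^ (K + 1)))"


section \<open>Averaging\<close>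

definition V_trunc ::
  "nat \<Rightarrow> (nat \<Rightarrow> real \<Rightarrow> real \<Rightarrow> real \<Rightarrow> real) \<Rightarrow> real \<Rightarrow> real \<Rightarrow> real \<Rightarrow> real \<Rightarrow> real" where
  "V_trunc N v \<tau> e \<theta> \<sigma> = e + partial_expansion N v \<tau> e \<theta> \<sigma>"

definition Psi_trunc ::
  "nat \<Rightarrow> (nat \<Rightarrow> real \<Rightarrow> real \<Rightarrow> real \<Rightarrow> real) \<Rightarrow> real \<Rightarrow> real \<Rightarrow> real \<Rightarrow> real \<Rightarrow> real" where
  "Psi_trunc M psi \<tau> e \<theta> \<sigma> = \<theta> + partial_expansion M psi \<tau> e \<theta> \<sigma>"

text \<open>The total derivative of \<open>W\<close> along \<open>e' = cF + t\<^sup>-\<^sup>1 (l/q) e\<close>, \<open>\<theta>' = cG\<close>; the last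
  term comes from \<open>d\<tau>/dt = - \<tau>\<^sup>2\<^sup>q\<^sup>+\<^sup>1 / (2q)\<close>.\<close>

definition total_deriv ::
  "nat \<Rightarrow> nat \<Rightarrow> (nat \<Rightarrow> real) \<Rightarrow> (real \<Rightarrow> real \<Rightarrow> real \<Rightarrow> real \<Rightarrow> real)
     \<Rightarrow> (real \<Rightarrow> real \<Rightarrow> real \<Rightarrow> real \<Rightarrow> real) \<Rightarrow> (real \<Rightarrow> real \<Rightarrow> real \<Rightarrow> real \<Rightarrow> real)
     \<Rightarrow> real \<Rightarrow> real \<Rightarrow> real \<Rightarrow> real \<Rightarrow> real" where
  "total_deriv q l s cF cG W \<tau> e \<theta> \<sigma> =
     deriv (\<lambda>e. W \<tau> e \<theta> \<sigma>) e * (cF \<tau> e \<theta> \<sigma> + \<tau> ^ (2 * q) * (real l / real q) * e)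
     + deriv (\<lambda>\<theta>. W \<tau> e \<theta> \<sigma>) \<theta> * cG \<tau> e \<theta> \<sigma>
     + deriv (\<lambda>\<sigma>. W \<tau> e \<theta> \<sigma>) \<sigma> * formal_dS q s \<tau>
     - deriv (\<lambda>\<tau>. W \<tau> e \<theta> \<sigma>) \<tau> * \<tau> ^ (2 * q + 1) / (2 * real q)"

text \<open>That the coefficients of \<open>\<tau>\<^sup>k\<close> in two expansions agree for all \<open>k \<le> N\<close> is stated as: their
  difference is \<open>O(\<tau>\<^sup>N\<^sup>+\<^sup>1)\<close> for fixed \<open>(e, \<theta>, \<sigma>)\<close>. Terms of the expansions \<open>cF\<close>, \<open>cG\<close> of
  order exceeding \<open>N\<close> do not matter for this.\<close>

definition averaging ::
  "nat \<Rightarrow> nat \<Rightarrow> nat \<Rightarrow> (nat \<Rightarrow> real) \<Rightarrow> real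
     \<Rightarrow> (nat \<Rightarrow> real \<Rightarrow> real \<Rightarrow> real \<Rightarrow> real) \<Rightarrow> (nat \<Rightarrow> real \<Rightarrow> real \<Rightarrow> real \<Rightarrow> real)
     \<Rightarrow> nat \<Rightarrow> nat
     \<Rightarrow> (nat \<Rightarrow> real \<Rightarrow> real \<Rightarrow> real \<Rightarrow> real) \<Rightarrow> (nat \<Rightarrow> real \<Rightarrow> real \<Rightarrow> real \<Rightarrow> real)
     \<Rightarrow> (nat \<Rightarrow> real \<Rightarrow> real \<Rightarrow> real) \<Rightarrow> (nat \<Rightarrow> real \<Rightarrow> real \<Rightarrow> real) \<Rightarrow> bool" where
  "averaging q l \<kappa> s R cF cG N M v psi Lam Om \<longleftrightarrow>
     (\<forall>k\<in>{2..N}. sqrt_smooth R (\<lambda>e (\<theta>, \<sigma>). v k e \<theta> \<sigma>) \<and> sqrt_smooth R (Lam k)) \<and>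
     (\<forall>k\<in>{2..M}. sqrt_smooth R (\<lambda>e (\<theta>, \<sigma>). psi k e \<theta> \<sigma>) \<and> sqrt_smooth R (Om k)) \<and>
     (\<forall>k\<in>{2..N}. \<forall>e\<in>{0..R}.
        (\<forall>\<sigma>. periodic (2 * pi) (\<lambda>\<theta>. v k e \<theta> \<sigma>)) \<and>
        (\<forall>\<theta>. periodic (2 * pi * real \<kappa>) (v k e \<theta>) \<and>
             integral {0..2 * pi * real \<kappa>} (v k e \<theta>) = 0) \<and>
        periodic (2 * pi) (Lam k e)) \<and>
     (\<forall>k\<in>{2..M}. \<forall>e\<in>{0..R}.
        (\<forall>\<sigma>. periodic (2 * pi) (\<lambda>\<theta>. psi k e \<theta> \<sigma>)) \<and>
        (\<forall>\<theta>. periodic (2 * pi * real \<kappa>) (psi k e \<theta>) \<and>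
             integral {0..2 * pi * real \<kappa>} (psi k e \<theta>) = 0) \<and>
        periodic (2 * pi) (Om k e)) \<and>
     (\<forall>e\<in>{0<..<R}. \<forall>\<theta> \<sigma>.
        (\<lambda>\<tau>. total_deriv q l s (partial_expansion N cF) (partial_expansion N cG)
                (V_trunc N v) \<tau> e \<theta> \<sigma>
             - (\<Sum>j=2..N. \<tau> ^ j * Lam j (V_trunc N v \<tau> e \<theta> \<sigma>) (Psi_trunc M psi \<tau> e \<theta> \<sigma>)))
          \<in> O[at_right 0](\<lambda>\<tau>. \<tau> ^ (N + 1)) \<and>
        (\<lambda>\<tau>. total_deriv q l s (partial_expansion M cF) (partial_expansion M cG)
                (Psi_trunc M psi) \<tau> e \<theta> \<sigma>
             - (\<Sum>j=2..M. \<tau> ^ j * Om j (V_trunc N v \<tau> e \<theta> \<sigma>) (Psi_trunc M psi \<tau> e \<theta> \<sigma>)))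
          \<in> O[at_right 0](\<lambda>\<tau>. \<tau> ^ (M + 1)))"

text \<open>The exponent \<open>l\<close> of the scaling is \<open>0\<close> iff \<open>\<omega>\<close> is constant; otherwise it is the least
  \<open>l \<ge> 1\<close> for which the first nonzero \<open>\<Omega>\<^sub>m\<close> does not vanish identically at \<open>v = 0\<close>. For \<open>l\<close> itself
  the latter property is a hypothesis of the theorem (\<open>\<omega>\<^sub>m\<close> is not identically zero), so
  only the failure of smaller positive exponents is stated here.\<close>

definition nondegenerate_scale ::
  "nat \<Rightarrow> nat \<Rightarrow> (nat \<Rightarrow> real) \<Rightarrow> (real \<Rightarrow> real) \<Rightarrow> real
     \<Rightarrow> (nat \<Rightarrow> real \<Rightarrow> real \<Rightarrow> real \<Rightarrow> real) \<Rightarrow> (nat \<Rightarrow> real \<Rightarrow> real \<Rightarrow> real \<Rightarrow> real)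
     \<Rightarrow> nat \<Rightarrow> bool" where
  "nondegenerate_scale q \<kappa> s \<omega> E0 fk gk l \<longleftrightarrow>
     (\<exists>cF cG N m v psi Lam Om. 2 \<le> m \<and> m \<le> N \<and>
        scaled_expansion q l \<kappa> s \<omega> E0 fk gk cF cG \<and>
        averaging q l \<kappa> s E0 cF cG N m v psi Lam Om \<and>
        (\<forall>i\<in>{2..<m}. \<forall>u\<in>{0..E0}. \<forall>\<psi>. Om i u \<psi> = 0) \<and>
        (\<exists>\<psi>. Om m 0 \<psi> \<noteq> 0))"

definition scale_exponent ::
  "nat \<Rightarrow> nat \<Rightarrow> (nat \<Rightarrow> real) \<Rightarrow> (real \<Rightarrow> real) \<Rightarrow> real
     \<Rightarrow> (nat \<Rightarrow> real \<Rightarrow> real \<Rightarrow> real \<Rightarrow> real) \<Rightarrow> (nat \<Rightarrow> real \<Rightarrow> real \<Rightarrow> real \<Rightarrow> real)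
     \<Rightarrow> nat \<Rightarrow> bool" where
  "scale_exponent q \<kappa> s \<omega> E0 fk gk l \<longleftrightarrow>
     (l = 0 \<longleftrightarrow> (\<forall>E\<in>{0..E0}. \<omega> E = \<omega> 0)) \<and>
     (\<forall>l'\<in>{1..<l}. \<not> nondegenerate_scale q \<kappa> s \<omega> E0 fk gk l')"

text \<open>The near-identity change of variables \<open>(e, \<theta>) \<mapsto> (v, \<psi>)\<close> is controlled on
  \<open>[0, R] \<times> \<real>\<close> by \<open>\<epsilon>\<close> from the time \<open>t0\<close> on.\<close>

definition near_identity ::
  "nat \<Rightarrow> (real \<Rightarrow> real) \<Rightarrow> real \<Rightarrow> real \<Rightarrow> real \<Rightarrow> nat \<Rightarrow> nat
     \<Rightarrow> (nat \<Rightarrow> real \<Rightarrow> real \<Rightarrow> real \<Rightarrow> real) \<Rightarrow> (nat \<Rightarrow> real \<Rightarrow> real \<Rightarrow> real \<Rightarrow> real) \<Rightarrow> bool" where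
  "near_identity q S \<epsilon> t0 R N M v psi \<longleftrightarrow> (\<forall>t\<ge>t0.
     let \<tau> = t powr (- 1 / (2 * real q)) in
     (\<forall>e\<in>{0..R}. \<forall>\<theta>.
        \<bar>V_trunc N v \<tau> e \<theta> (S t) - e\<bar> \<le> \<epsilon> * e \<and> \<bar>Psi_trunc M psi \<tau> e \<theta> (S t) - \<theta>\<bar> \<le> \<epsilon>) \<and>
     (\<forall>u\<in>{0..(1 - \<epsilon>) * R}. \<forall>\<psi>. \<exists>!p. fst p \<in> {0..R} \<and>
        V_trunc N v \<tau> (fst p) (snd p) (S t) = u \<and>
        Psi_trunc M psi \<tau> (fst p) (snd p) (S t) = \<psi>))"

definition kronecker :: "nat \<Rightarrow> nat \<Rightarrow> real" where
  "kronecker i j = (if i = j then 1 else 0)"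

definition psi_mean :: "(real \<Rightarrow> real) \<Rightarrow> real" where
  "psi_mean h = (1 / (2 * pi)) * integral {0..2 * pi} h"

end

theory Submission
  imports Defs
begin

text \<open>
  Put \<open>a = (\<sigma> - 1) / 2\<close> and \<open>\<tau> = t\<^sup>-\<^sup>1\<^sup>/\<^sup>(\<^sup>2\<^sup>q\<^sup>)\<close>. To leading order the averaged equations are
  \<open>v' = \<tau>\<^sup>n \<lambda>\<^sub>n(\<psi>) v\<^sup>a\<^sup>+\<^sup>1 + O(\<tau>\<^sup>n\<^sup>+\<^sup>d v)\<close> and \<open>\<psi>' = \<tau>\<^sup>m \<omega>\<^sub>m(\<psi>)\<close>. Let \<open>D = d - 1 / 2\<close>, let \<open>P\<close> be a periodic
  primitive of \<open>\<lambda>\<^sub>n / \<bar>\<omega>\<^sub>m\<bar> - \<gamma>\<close>, where \<open>\<gamma> < 0\<close> is the mean value of \<open>\<lambda>\<^sub>n / \<bar>\<omega>\<^sub>m\<bar>\<close>, and consider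
  \<open>L = \<tau>\<^sup>D v\<^sup>-\<^sup>a + a sgn(\<omega>\<^sub>m) \<tau>\<^sup>n\<^sup>+\<^sup>D\<^sup>-\<^sup>m P(\<psi>)\<close>. As long as \<open>v\<close> is comparable to \<open>t\<^sup>-\<^sup>\<beta>\<close> with \<open>\<beta> a = D / (2q)\<close>, one
  has \<open>L' = - a \<gamma> \<bar>\<omega>\<^sub>m\<bar> \<tau>\<^sup>n\<^sup>+\<^sup>D + o(\<tau>\<^sup>n\<^sup>+\<^sup>D) > 0\<close>: the linear terms contribute only \<open>O(\<tau>\<^sup>n\<^sup>+\<^sup>d)\<close>, and \<open>m < n + d\<close>
  makes the second term of \<open>L\<close> tend to zero. Hence \<open>v t\<^sup>\<beta>\<close> cannot grow from \<open>1 / 16\<close> to \<open>1 / 2\<close> at large times,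
  which gives \<open>x\<^sup>2 + y\<^sup>2 = O(t\<^sup>-\<^sup>\<beta>\<^sup>-\<^sup>l\<^sup>/\<^sup>q)\<close>; bounded time intervals are dealt with by continuous dependence on the
  initial data.

  The averaged equations hold for the true solutions with remainders uniform up to the equilibrium because all
  functions involved are smooth in \<open>(\<tau>, z, \<theta>, \<sigma>)\<close>, \<open>z\<close> being the square root of the action: then a pointwise
  estimate in powers of \<open>\<tau>\<close> is uniform on compact sets, and the factor \<open>z\<^sup>2\<close> can be split off.
\<close>

section \<open>Smooth functions\<close>

text \<open>The exponent \<open>D\<close> must satisfy \<open>D < d\<close>, so that linear terms
  are smaller than the leading one, \<open>D > m - n\<close>, so that the corrector dies out, and
  \<open>D > 0\<close>, so that the scale decays. For integers \<open>m < n + d\<close> and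
  \<open>d \<ge> 1\<close> the number \<open>d - 1 / 2\<close> does, with a power
  \<open>1 / 2\<close> of \<tau> to spare. The thresholds 1 / 16 and 1 / 2 concern the action,
  whereas \<open>L\<close> sees \<open>v\<close>, which agrees with it up to a factor 2: a passage
  leads from \<open>v t\<^sup>\<beta> \<le> 1 / 8\<close> to
  \<open>v t\<^sup>\<beta> \<ge> 1 / 4\<close>, so the main term of \<open>L\<close> would have to
  drop from at least \<open>8 powr a\<close> to at most \<open>4 powr a\<close>. Uniformity comes
  from Hadamard's lemma: a smooth function vanishing on a coordinate hyperplane is the coordinate
  times a smooth function. Orders of magnitude at single points would not provide it. The angle has
  no continuous choice around the equilibrium. Derivatives are therefore computed with local
  branches, and only quantities insensitive to multiples of 2\<pi> are used globally. Solutions for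
  all times are obtained from a field truncated outside a ball.\<close>

lemma smooth_on_open: "smooth_on U f \<Longrightarrow> open U"
  by (simp add: smooth_on_def)

lemma iter_dderiv_append: "iter_dderiv (iter_dderiv f bs) as = iter_dderiv f (as @ bs)"
  by (induction as) auto

lemma smooth_on_iter_dderiv:
  assumes "smooth_on U f" "set bs \<subseteq> Basis"
  shows "smooth_on U (iter_dderiv f bs)"
  using assms by (auto simp: smooth_on_def iter_dderiv_append)

lemma deriv_along:
  assumes "(f has_derivative D) (at p)"
  shows "((\<lambda>h. f (p + h *\<^sub>R b)) has_real_derivative D b) (at 0)"
proof -
  have lin: "linear D" using assms has_derivative_linear by blast
  have "((\<lambda>h. f (p + h *\<^sub>R b)) has_derivative (\<lambda>h. D (h *\<^sub>R b))) (at 0)"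
    by (rule has_derivative_compose[where f="\<lambda>h. p + h *\<^sub>R b" and g=f])
       (auto intro!: derivative_eq_intros assms)
  moreover have "(\<lambda>h. D (h *\<^sub>R b)) = (*) (D b)"
    using lin by (auto simp: linear_cmul mult.commute)
  ultimately show ?thesis by (simp add: has_field_derivative_def)
qed

lemma has_derivative_dderiv:
  fixes f :: "'a::euclidean_space \<Rightarrow> real"
  assumes "f differentiable (at p)"
  shows "(f has_derivative (\<lambda>h. \<Sum>b\<in>Basis. (h \<bullet> b) * iter_dderiv f [b] p)) (at p)"
proof -
  obtain D where D: "(f has_derivative D) (at p)"
    using assms by (auto simp: differentiable_def)
  have lin: "linear D" using D has_derivative_linear by blast
  have b: "iter_dderiv f [b] p = D b" for b
    using deriv_along[OF D] by (simp add: DERIV_imp_deriv)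
  have "D h = (\<Sum>b\<in>Basis. (h \<bullet> b) * iter_dderiv f [b] p)" for h
  proof -
    have "D h = D (\<Sum>b\<in>Basis. (h \<bullet> b) *\<^sub>R b)" by (simp add: euclidean_representation)
    also have "\<dots> = (\<Sum>b\<in>Basis. (h \<bullet> b) * D b)"
      by (simp add: linear_sum[OF lin] linear_cmul[OF lin])
    finally show ?thesis by (simp only: b)
  qed
  then have "D = (\<lambda>h. \<Sum>b\<in>Basis. (h \<bullet> b) * iter_dderiv f [b] p)" by auto
  with D show ?thesis by metis
qed

lemma smooth_on_has_derivative:
  assumes "smooth_on U f" "p \<in> U"
  shows "(f has_derivative (\<lambda>h. \<Sum>b\<in>Basis. (h \<bullet> b) * iter_dderiv f [b] p)) (at p)"
proof (rule has_derivative_dderiv)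
  have "\<forall>bs. set bs \<subseteq> Basis \<longrightarrow> (\<forall>p\<in>U. iter_dderiv f bs differentiable (at p))"
    using assms unfolding smooth_on_def by blast
  from this[rule_format, of "[]", OF _ assms(2)]
  show "f differentiable (at p)" by simp
qed

lemma smooth_on_continuous:
  assumes "smooth_on U f"
  shows "continuous_on U f"
  by (intro continuous_at_imp_continuous_on ballI)
     (rule has_derivative_continuous[OF smooth_on_has_derivative[OF assms]])

text \<open>Smoothness concerns all iterated derivatives at once, so it is proved by coinduction:
  the invariant \<open>Q\<close> passes from a function to its partial derivatives. An iterated
  derivative of \<open>f\<close> has to agree with a member of \<open>Q\<close> on the open set
  \<open>U\<close> only, since derivatives at points of \<open>U\<close> do not see the
  outside.\<close>

lemma smooth_on_coinduct:
  fixes f :: "'a::euclidean_space \<Rightarrow> real"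
  assumes "open U" "Q f"
    and step: "\<And>g. Q g \<Longrightarrow> \<exists>g'. (\<forall>b\<in>Basis. Q (g' b)) \<and>
      (\<forall>p\<in>U. (g has_derivative (\<lambda>h. \<Sum>b\<in>Basis. (h \<bullet> b) * g' b p)) (at p))"
  shows "smooth_on U f"
proof -
  have *: "\<exists>g. Q g \<and> (\<forall>p\<in>U. iter_dderiv f bs p = g p)" if "set bs \<subseteq> Basis" for bs
    using that
  proof (induction bs)
    case Nil
    then show ?case using assms(2) by auto
  next
    case (Cons b bs)
    then obtain g where g: "Q g" "\<forall>p\<in>U. iter_dderiv f bs p = g p" by auto
    obtain g' where g': "\<forall>b\<in>Basis. Q (g' b)"
      "\<forall>p\<in>U. (g has_derivative (\<lambda>h. \<Sum>b\<in>Basis. (h \<bullet> b) * g' b p)) (at p)"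
      using step[OF g(1)] by blast
    have "iter_dderiv f (b # bs) p = g' b p" if p: "p \<in> U" for p
    proof -
      have "(iter_dderiv f bs has_derivative (\<lambda>h. \<Sum>b\<in>Basis. (h \<bullet> b) * g' b p)) (at p)"
        by (rule has_derivative_transform_within_open[OF g'(2)[rule_format, OF p] assms(1) p])
           (use g in auto)
      from deriv_along[OF this, of b]
      have "iter_dderiv f (b # bs) p = (\<Sum>b'\<in>Basis. (b \<bullet> b') * g' b' p)"
        by (simp add: DERIV_imp_deriv)
      also have "\<dots> = (\<Sum>b'\<in>Basis. (if b' = b then g' b' p else 0))"
        using Cons.prems by (intro sum.cong) (auto simp: inner_Basis)
      also have "\<dots> = g' b p" using Cons.prems by simp
      finally show ?thesis .
    qed
    then show ?case using g' Cons.prems by auto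
  qed
  show ?thesis unfolding smooth_on_def
  proof (intro conjI allI impI ballI)
    fix bs :: "'a list" and p assume bs: "set bs \<subseteq> Basis" and p: "p \<in> U"
    from *[OF bs] obtain g where g: "Q g" "\<forall>p\<in>U. iter_dderiv f bs p = g p" by auto
    from step[OF g(1)] obtain D where "(g has_derivative D) (at p)" using p by blast
    then have "(iter_dderiv f bs has_derivative D) (at p)"
      by (rule has_derivative_transform_within_open[OF _ assms(1) p]) (use g in auto)
    then show "iter_dderiv f bs differentiable at p" by (auto simp: differentiable_def)
  qed fact
qed

lemma smooth_on_cong:
  assumes "smooth_on U f" "\<And>p. p \<in> U \<Longrightarrow> f p = g p"
  shows "smooth_on U g"
proof (rule smooth_on_coinduct[where Q="\<lambda>g. \<exists>f. smooth_on U f \<and> (\<forall>p\<in>U. f p = g p)"])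
  show "open U" using assms smooth_on_open by auto
  show "\<exists>f. smooth_on U f \<and> (\<forall>p\<in>U. f p = g p)" using assms by auto
  fix g assume "\<exists>f. smooth_on U f \<and> (\<forall>p\<in>U. f p = g p)"
  then obtain f where f: "smooth_on U f" "\<forall>p\<in>U. f p = g p" by auto
  show "\<exists>g'. (\<forall>b\<in>Basis. \<exists>f. smooth_on U f \<and> (\<forall>p\<in>U. f p = g' b p)) \<and>
    (\<forall>p\<in>U. (g has_derivative (\<lambda>h. \<Sum>b\<in>Basis. (h \<bullet> b) * g' b p)) (at p))"
  proof (intro exI[where x="\<lambda>b. iter_dderiv f [b]"] conjI ballI)
    fix p assume p: "p \<in> U"
    show "(g has_derivative (\<lambda>h. \<Sum>b\<in>Basis. h \<bullet> b * iter_dderiv f [b] p)) (at p)"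
      using has_derivative_transform_within_open[OF smooth_on_has_derivative[OF f(1) p]
        smooth_on_open[OF f(1)] p] f by auto
  next
    fix b :: 'a assume "b \<in> Basis"
    then show "\<exists>fa. smooth_on U fa \<and> (\<forall>p\<in>U. fa p = iter_dderiv f [b] p)"
      using smooth_on_iter_dderiv[OF f(1), of "[b]"] by auto
  qed
qed

lemma smooth_on_subset: "smooth_on U f \<Longrightarrow> open V \<Longrightarrow> V \<subseteq> U \<Longrightarrow> smooth_on V f"
  by (auto simp: smooth_on_def)

text \<open>Smoothness of sums, products and compositions: all partial derivatives stay in the algebra
  generated by the partial derivatives of the constituents.\<close>

inductive_set fun_algebra :: "('a \<Rightarrow> real) set \<Rightarrow> ('a \<Rightarrow> real) set" for B where
  base: "g \<in> B \<Longrightarrow> g \<in> fun_algebra B"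
| const: "(\<lambda>p. c) \<in> fun_algebra B"
| add: "g \<in> fun_algebra B \<Longrightarrow> h \<in> fun_algebra B \<Longrightarrow> (\<lambda>p. g p + h p) \<in> fun_algebra B"
| mult: "g \<in> fun_algebra B \<Longrightarrow> h \<in> fun_algebra B \<Longrightarrow> (\<lambda>p. g p * h p) \<in> fun_algebra B"

lemma fun_algebra_sum:
  "finite I \<Longrightarrow> (\<And>i. i \<in> I \<Longrightarrow> g i \<in> fun_algebra B) \<Longrightarrow> (\<lambda>p. \<Sum>i\<in>I. g i p) \<in> fun_algebra B"
  by (induction I rule: finite_induct) (auto intro: fun_algebra.intros)

lemma smooth_on_fun_algebra:
  fixes B :: "('a::euclidean_space \<Rightarrow> real) set"
  assumes "open U" "f \<in> fun_algebra B"
    and step: "\<And>g. g \<in> B \<Longrightarrow> \<exists>g'. (\<forall>b\<in>Basis. g' b \<in> fun_algebra B) \<and>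
      (\<forall>p\<in>U. (g has_derivative (\<lambda>h. \<Sum>b\<in>Basis. (h \<bullet> b) * g' b p)) (at p))"
  shows "smooth_on U f"
proof (rule smooth_on_coinduct[where Q="\<lambda>f. f \<in> fun_algebra B"])
  fix g assume "g \<in> fun_algebra B"
  then show "\<exists>g'. (\<forall>b\<in>Basis. g' b \<in> fun_algebra B) \<and>
      (\<forall>p\<in>U. (g has_derivative (\<lambda>h. \<Sum>b\<in>Basis. (h \<bullet> b) * g' b p)) (at p))"
  proof induction
    case (base g)
    then show ?case by (rule step)
  next
    case (const c)
    then show ?case
      by (intro exI[where x="\<lambda>b p. 0"]) (auto intro: fun_algebra.intros)
  next
    case (add g h)
    then obtain g' h' where *: "\<forall>b\<in>Basis. g' b \<in> fun_algebra B" "\<forall>b\<in>Basis. h' b \<in> fun_algebra B"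
      "\<forall>p\<in>U. (g has_derivative (\<lambda>h. \<Sum>b\<in>Basis. (h \<bullet> b) * g' b p)) (at p)"
      "\<forall>p\<in>U. (h has_derivative (\<lambda>h. \<Sum>b\<in>Basis. (h \<bullet> b) * h' b p)) (at p)" by blast
    show ?case
    proof (intro exI[where x="\<lambda>b p. g' b p + h' b p"] conjI ballI)
      fix p assume p: "p \<in> U"
      show "((\<lambda>p. g p + h p) has_derivative (\<lambda>ha. \<Sum>b\<in>Basis. ha \<bullet> b * (g' b p + h' b p))) (at p)"
        using has_derivative_add[OF *(3)[rule_format, OF p] *(4)[rule_format, OF p]]
        by (simp add: distrib_left sum.distrib)
    next
      fix b :: 'a assume "b \<in> Basis"
      then show "(\<lambda>p. g' b p + h' b p) \<in> fun_algebra B"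
        using * by (intro fun_algebra.add) auto
    qed
  next
    case (mult g h)
    then obtain g' h' where *: "\<forall>b\<in>Basis. g' b \<in> fun_algebra B" "\<forall>b\<in>Basis. h' b \<in> fun_algebra B"
      "\<forall>p\<in>U. (g has_derivative (\<lambda>h. \<Sum>b\<in>Basis. (h \<bullet> b) * g' b p)) (at p)"
      "\<forall>p\<in>U. (h has_derivative (\<lambda>h. \<Sum>b\<in>Basis. (h \<bullet> b) * h' b p)) (at p)" by blast
    show ?case
    proof (intro exI[where x="\<lambda>b p. g p * h' b p + g' b p * h p"] conjI ballI)
      fix p assume p: "p \<in> U"
      show "((\<lambda>p. g p * h p) has_derivative
          (\<lambda>ha. \<Sum>b\<in>Basis. ha \<bullet> b * (g p * h' b p + g' b p * h p))) (at p)"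
        using has_derivative_mult[OF *(3)[rule_format, OF p] *(4)[rule_format, OF p]]
        by (simp add: distrib_left sum.distrib sum_distrib_left sum_distrib_right mult_ac)
    next
      fix b :: 'a assume "b \<in> Basis"
      then show "(\<lambda>p. g p * h' b p + g' b p * h p) \<in> fun_algebra B"
        using * mult.hyps by (intro fun_algebra.add fun_algebra.mult) auto
    qed
  qed
qed fact+

lemma smooth_on_algebra:
  assumes "f \<in> fun_algebra {g. smooth_on U g}" "open U"
  shows "smooth_on U f"
proof (rule smooth_on_fun_algebra[OF assms(2,1)])
  fix g assume "g \<in> {g. smooth_on U g}"
  then have g: "smooth_on U g" by simp
  show "\<exists>g'. (\<forall>b\<in>Basis. g' b \<in> fun_algebra {g. smooth_on U g}) \<and>
      (\<forall>p\<in>U. (g has_derivative (\<lambda>h. \<Sum>b\<in>Basis. (h \<bullet> b) * g' b p)) (at p))"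
    by (intro exI[where x="\<lambda>b. iter_dderiv g [b]"])
       (auto intro!: fun_algebra.base smooth_on_iter_dderiv[OF g, of "[_]", simplified]
         smooth_on_has_derivative[OF g, simplified])
qed

lemma smooth_on_const: "open U \<Longrightarrow> smooth_on U (\<lambda>p. c)"
  by (rule smooth_on_algebra[OF fun_algebra.const])

lemma smooth_on_add:
  assumes "smooth_on U f" "smooth_on U g"
  shows "smooth_on U (\<lambda>p. f p + g p)"
  by (rule smooth_on_algebra[OF fun_algebra.add[OF fun_algebra.base fun_algebra.base]])
     (use assms smooth_on_open in auto)

lemma smooth_on_mult:
  assumes "smooth_on U f" "smooth_on U g"
  shows "smooth_on U (\<lambda>p. f p * g p)"
  by (rule smooth_on_algebra[OF fun_algebra.mult[OF fun_algebra.base fun_algebra.base]])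
     (use assms smooth_on_open in auto)

lemma smooth_on_inner:
  fixes b :: "'a::euclidean_space"
  assumes "open U"
  shows "smooth_on U (\<lambda>p. p \<bullet> b)"
proof (rule smooth_on_coinduct[where Q="\<lambda>f. \<exists>b c. f = (\<lambda>p::'a. p \<bullet> b + c)"])
  fix g assume "\<exists>b c. g = (\<lambda>p::'a. p \<bullet> b + c)"
  then obtain b c where g: "g = (\<lambda>p::'a. p \<bullet> b + c)" by auto
  have "(\<lambda>h. \<Sum>b'\<in>Basis. (h \<bullet> b') * (b' \<bullet> b)) = (\<lambda>h. h \<bullet> b)"
    by (subst (2) euclidean_inner) (simp add: inner_commute)
  then show "\<exists>g'. (\<forall>b\<in>Basis. \<exists>ba c. g' b = (\<lambda>p. p \<bullet> ba + c)) \<and>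
      (\<forall>p\<in>U. (g has_derivative (\<lambda>h. \<Sum>b\<in>Basis. h \<bullet> b * g' b p)) (at p))"
    by (intro exI[where x="\<lambda>b' p. b' \<bullet> b"] conjI ballI exI[where x=0] exI[where x="_ \<bullet> b"])
       (auto simp: g intro!: derivative_eq_intros)
next
  show "\<exists>b' c. (\<lambda>p. p \<bullet> b) = (\<lambda>p::'a. p \<bullet> b' + c)"
    by (intro exI[where x=b] exI[where x=0]) simp
qed fact

lemma smooth_on_compose:
  fixes g :: "'b::euclidean_space \<Rightarrow> real" and \<Phi> :: "'a::euclidean_space \<Rightarrow> 'b"
  assumes "smooth_on W g" "\<And>b. b \<in> Basis \<Longrightarrow> smooth_on U (\<lambda>p. \<Phi> p \<bullet> b)" "\<Phi> ` U \<subseteq> W" "open U"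
  shows "smooth_on U (\<lambda>p. g (\<Phi> p))"
proof -
  \<comment> \<open>The generators are the smooth functions on \<open>U\<close> and the pullbacks
    along \<open>\<Phi>\<close>: by the chain rule the derivatives of a pullback are sums of
    products of both kinds.\<close>
  let ?B = "{g. smooth_on U g} \<union> {\<lambda>p. g (\<Phi> p) | g. smooth_on W g}"
  show ?thesis
  proof (rule smooth_on_fun_algebra[where B = ?B])
    show "(\<lambda>p. g (\<Phi> p)) \<in> fun_algebra ?B"
      using assms(1) by (intro fun_algebra.base) auto
    fix h assume "h \<in> ?B"
    then consider "smooth_on U h" | g where "smooth_on W g" "h = (\<lambda>p. g (\<Phi> p))" by auto
    then show "\<exists>g'. (\<forall>b\<in>Basis. g' b \<in> fun_algebra ?B) \<and>
      (\<forall>p\<in>U. (h has_derivative (\<lambda>k. \<Sum>b\<in>Basis. (k \<bullet> b) * g' b p)) (at p))"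
    proof cases
      case 1
      show ?thesis
        by (intro exI[where x="\<lambda>b. iter_dderiv h [b]"])
           (auto intro!: fun_algebra.base smooth_on_iter_dderiv[OF 1, of "[_]", simplified]
             smooth_on_has_derivative[OF 1, simplified])
    next
      case 2
      let ?g' = "\<lambda>b p. \<Sum>c\<in>Basis. iter_dderiv (\<lambda>p. \<Phi> p \<bullet> c) [b] p * iter_dderiv g [c] (\<Phi> p)"
      show ?thesis
      proof (intro exI[where x="?g'"] conjI ballI)
        fix b :: 'a assume b: "b \<in> Basis"
        show "?g' b \<in> fun_algebra ?B"
        proof (intro fun_algebra_sum fun_algebra.mult finite_Basis)
          fix c :: 'b assume c: "c \<in> Basis"
          show "(\<lambda>p. iter_dderiv (\<lambda>p. \<Phi> p \<bullet> c) [b] p) \<in> fun_algebra ?B"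
            using smooth_on_iter_dderiv[OF assms(2)[OF c], of "[b]"] b
            by (intro fun_algebra.base) auto
          show "(\<lambda>p. iter_dderiv g [c] (\<Phi> p)) \<in> fun_algebra ?B"
            using smooth_on_iter_dderiv[OF 2(1), of "[c]"] c
            by (intro fun_algebra.base UnI2 CollectI exI[where x="iter_dderiv g [c]"] conjI refl)
               simp
        qed
      next
        fix p assume p: "p \<in> U"
        have 1: "(\<Phi> has_derivative
            (\<lambda>h. \<Sum>c\<in>Basis. (\<Sum>b\<in>Basis. (h \<bullet> b) * iter_dderiv (\<lambda>p. \<Phi> p \<bullet> c) [b] p) *\<^sub>R c)) (at p)"
        proof (subst has_derivative_componentwise_within, intro ballI)
          fix c :: 'b assume c: "c \<in> Basis"
          show "((\<lambda>x. \<Phi> x \<bullet> c) has_derivative (\<lambda>x. (\<Sum>c\<in>Basis. (\<Sum>b\<in>Basis. x \<bullet> b *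
             iter_dderiv (\<lambda>p. \<Phi> p \<bullet> c) [b] p) *\<^sub>R c) \<bullet> c)) (at p)"
            using smooth_on_has_derivative[OF assms(2)[OF c] p] c by simp
        qed
        have "\<Phi> p \<in> W" using p assms(3) by auto
        from has_derivative_compose[OF 1 smooth_on_has_derivative[OF 2(1) this]]
        have "(h has_derivative (\<lambda>k. \<Sum>c\<in>Basis. (\<Sum>b\<in>Basis. k \<bullet> b * iter_dderiv (\<lambda>p. \<Phi> p \<bullet> c) [b] p)
            * iter_dderiv g [c] (\<Phi> p))) (at p)"
          using 2(2) by simp
        then show "(h has_derivative (\<lambda>k. \<Sum>b\<in>Basis. (k \<bullet> b) * ?g' b p)) (at p)"
          by (simp add: sum_distrib_left sum_distrib_right mult.assoc) (subst sum.swap, assumption)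
      qed
    qed
  qed fact
qed

lemma smooth_on_powr: "smooth_on {0<..} (\<lambda>x::real. x powr a)"
proof (rule smooth_on_coinduct[where Q="\<lambda>f. \<exists>c a. f = (\<lambda>x::real. c * x powr a)"])
  show "\<exists>c aa. (\<lambda>x::real. x powr a) = (\<lambda>x. c * x powr aa)"
    by (intro exI[where x=1] exI[where x=a]) simp
  fix g assume "\<exists>c a. g = (\<lambda>x::real. c * x powr a)"
  then obtain c a where g: "g = (\<lambda>x::real. c * x powr a)" by auto
  have "(g has_derivative (\<lambda>h. \<Sum>b\<in>Basis. (h \<bullet> b) * (c * a * p powr (a - 1)))) (at p)"
    if "p \<in> {0<..}" for p
    using that by (auto simp: g intro!: derivative_eq_intros simp: powr_diff)
  then show "\<exists>g'. (\<forall>b\<in>Basis. \<exists>c a. g' b = (\<lambda>x. c * x powr a)) \<and>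
      (\<forall>p\<in>{0<..}. (g has_derivative (\<lambda>h. \<Sum>b\<in>Basis. h \<bullet> b * g' b p)) (at p))"
    by (intro exI[where x="\<lambda>b p. c * a * p powr (a - 1)"]) auto
qed auto


section \<open>Smoothness near a set and its closure properties\<close>

lemma smooth_nearE:
  assumes "smooth_near A f"
  obtains U where "open U" "A \<subseteq> U" "smooth_on U f"
  using assms smooth_on_open unfolding smooth_near_def by blast

lemma smooth_near_subset: "smooth_near A f \<Longrightarrow> B \<subseteq> A \<Longrightarrow> smooth_near B f"
  unfolding smooth_near_def by blast

lemma smooth_near_iter_dderiv:
  "smooth_near A f \<Longrightarrow> set bs \<subseteq> Basis \<Longrightarrow> smooth_near A (iter_dderiv f bs)"
  unfolding smooth_near_def using smooth_on_iter_dderiv by blast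

lemma smooth_near_pd:
  "smooth_near A f \<Longrightarrow> b \<in> Basis \<Longrightarrow> smooth_near A (iter_dderiv f [b])"
  by (rule smooth_near_iter_dderiv) auto

lemma smooth_near_has_derivative:
  assumes "smooth_near A f" "p \<in> A"
  shows "(f has_derivative (\<lambda>h. \<Sum>b\<in>Basis. (h \<bullet> b) * iter_dderiv f [b] p)) (at p)"
  using assms smooth_on_has_derivative unfolding smooth_near_def by blast

lemma smooth_near_isCont: "smooth_near A f \<Longrightarrow> p \<in> A \<Longrightarrow> isCont f p"
  by (rule has_derivative_continuous[OF smooth_near_has_derivative])

lemma smooth_near_continuous_on: "smooth_near A f \<Longrightarrow> continuous_on A f"
  by (intro continuous_at_imp_continuous_on ballI smooth_near_isCont)

definition smap_near :: "'a::euclidean_space set \<Rightarrow> ('a \<Rightarrow> 'b::euclidean_space) \<Rightarrow> bool" where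
  "smap_near A \<Phi> \<longleftrightarrow> (\<forall>b\<in>Basis. smooth_near A (\<lambda>p. \<Phi> p \<bullet> b))"

lemma smap_near_real: "smap_near A (f :: _ \<Rightarrow> real) \<longleftrightarrow> smooth_near A f"
  by (simp add: smap_near_def)

named_theorems smooth_intros

lemma smooth_near_const [smooth_intros]: "smooth_near A (\<lambda>p. c)"
  unfolding smooth_near_def by (intro exI[where x=UNIV]) (simp add: smooth_on_const)

lemma smooth_near_add [smooth_intros]:
  assumes "smooth_near A f" "smooth_near A g"
  shows "smooth_near A (\<lambda>p. f p + g p)"
proof -
  obtain U V where "open U" "A \<subseteq> U" "smooth_on U f" "open V" "A \<subseteq> V" "smooth_on V g"
    using assms by (meson smooth_nearE)
  then show ?thesis unfolding smooth_near_def
    by (intro exI[where x="U \<inter> V"] conjI smooth_on_add)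
       (auto intro: smooth_on_subset[of U] smooth_on_subset[of V])
qed

lemma smooth_near_mult [smooth_intros]:
  assumes "smooth_near A f" "smooth_near A g"
  shows "smooth_near A (\<lambda>p. f p * g p)"
proof -
  obtain U V where "open U" "A \<subseteq> U" "smooth_on U f" "open V" "A \<subseteq> V" "smooth_on V g"
    using assms by (meson smooth_nearE)
  then show ?thesis unfolding smooth_near_def
    by (intro exI[where x="U \<inter> V"] conjI smooth_on_mult)
       (auto intro: smooth_on_subset[of U] smooth_on_subset[of V])
qed

lemma smooth_near_minus [smooth_intros]: "smooth_near A f \<Longrightarrow> smooth_near A (\<lambda>p. - f p)"
  using smooth_near_mult[OF smooth_near_const[of A "-1"], of f] by simp

lemma smooth_near_diff [smooth_intros]:
  "smooth_near A f \<Longrightarrow> smooth_near A g \<Longrightarrow> smooth_near A (\<lambda>p. f p - g p)"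
  using smooth_near_add[OF _ smooth_near_minus, of A f g] by simp

lemma smooth_near_sum [smooth_intros]:
  "(\<And>i. i \<in> I \<Longrightarrow> smooth_near A (f i)) \<Longrightarrow> smooth_near A (\<lambda>p. \<Sum>i\<in>I. f i p)"
  by (induction I rule: infinite_finite_induct) (auto intro: smooth_intros)

lemma smooth_near_power [smooth_intros]:
  "smooth_near A f \<Longrightarrow> smooth_near A (\<lambda>p. f p ^ n)"
  by (induction n) (auto intro: smooth_intros)

lemma smooth_near_divide_const [smooth_intros]:
  "smooth_near A f \<Longrightarrow> smooth_near A (\<lambda>p. f p / c)"
  using smooth_near_mult[OF _ smooth_near_const, of A f "inverse c"] by (simp add: divide_inverse)

lemma smooth_near_compose:
  assumes "smooth_near B g" "smap_near A \<Phi>" "\<Phi> ` A \<subseteq> B"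
  shows "smooth_near A (\<lambda>p. g (\<Phi> p))"
proof -
  obtain W where W: "open W" "B \<subseteq> W" "smooth_on W g" using assms(1) by (rule smooth_nearE)
  have "\<exists>U. open U \<and> A \<subseteq> U \<and> smooth_on U (\<lambda>p. \<Phi> p \<bullet> b)" if "b \<in> Basis" for b
  proof -
    have "smooth_near A (\<lambda>p. \<Phi> p \<bullet> b)" using assms(2) that by (auto simp: smap_near_def)
    then show ?thesis by (rule smooth_nearE) blast
  qed
  then obtain U where U: "\<And>b. b \<in> Basis \<Longrightarrow> open (U b) \<and> A \<subseteq> U b \<and> smooth_on (U b) (\<lambda>p. \<Phi> p \<bullet> b)"
    by (metis (no_types))
  define V where "V = (\<Inter>b\<in>Basis. U b)"
  have V: "open V" "A \<subseteq> V" using U by (auto simp: V_def intro!: open_INT)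
  have sV: "smooth_on V (\<lambda>p. \<Phi> p \<bullet> b)" if "b \<in> Basis" for b
    using U[OF that] V(1) that by (rule_tac smooth_on_subset[of "U b"]) (auto simp: V_def)
  have "continuous_on V \<Phi>"
    using sV smooth_on_continuous by (subst continuous_on_componentwise) auto
  then have O: "open (V \<inter> \<Phi> -` W)"
    using V(1) W(1) continuous_open_preimage by blast
  have "smooth_on (V \<inter> \<Phi> -` W) (\<lambda>p. g (\<Phi> p))"
    by (rule smooth_on_compose[OF W(3)]) (use O in \<open>auto intro: smooth_on_subset[OF sV]\<close>)
  moreover have "A \<subseteq> V \<inter> \<Phi> -` W" using V(2) assms(3) W(2) by auto
  ultimately show ?thesis unfolding smooth_near_def by blast
qed

lemma smap_near_realI [smooth_intros]:
  "smooth_near A f \<Longrightarrow> smap_near A (f :: _ \<Rightarrow> real)"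
  by (simp add: smap_near_real)

lemma smap_near_ident [smooth_intros]: "smap_near A (\<lambda>p. p)"
  unfolding smap_near_def smooth_near_def
  by (intro ballI exI[where x=UNIV]) (auto intro: smooth_on_inner)

lemma smap_near_const [smooth_intros]: "smap_near A (\<lambda>p. c)"
  by (auto simp: smap_near_def intro: smooth_intros)

lemma smap_near_Pair [smooth_intros]:
  "smap_near A f \<Longrightarrow> smap_near A g \<Longrightarrow> smap_near A (\<lambda>p. (f p, g p))"
  by (auto simp: smap_near_def Basis_prod_def)

lemma smap_near_fst [smooth_intros]:
  assumes "smap_near A f" shows "smap_near A (\<lambda>p. fst (f p))"
  unfolding smap_near_def
proof
  fix b :: 'b assume "b \<in> Basis"
  then have "smooth_near A (\<lambda>p. f p \<bullet> (b, 0))"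
    using assms by (auto simp: smap_near_def Basis_prod_def)
  then show "smooth_near A (\<lambda>p. fst (f p) \<bullet> b)"
    by (simp add: inner_prod_def)
qed

lemma smap_near_snd [smooth_intros]:
  assumes "smap_near A f" shows "smap_near A (\<lambda>p. snd (f p))"
  unfolding smap_near_def
proof
  fix b :: 'c assume "b \<in> Basis"
  then have "smooth_near A (\<lambda>p. f p \<bullet> (0, b))"
    using assms by (auto simp: smap_near_def Basis_prod_def)
  then show "smooth_near A (\<lambda>p. snd (f p) \<bullet> b)"
    by (simp add: inner_prod_def)
qed

lemma smooth_near_fst [smooth_intros]:
  "smap_near A f \<Longrightarrow> smooth_near A (\<lambda>p. fst (f p))" for f :: "_ \<Rightarrow> real \<times> _"
  using smap_near_fst smap_near_real by blast

lemma smooth_near_snd [smooth_intros]: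
  "smap_near A f \<Longrightarrow> smooth_near A (\<lambda>p. snd (f p))" for f :: "_ \<Rightarrow> _ \<times> real"
  using smap_near_snd smap_near_real by blast

lemma smooth_near_ident [smooth_intros]: "smooth_near A (\<lambda>p::real. p)"
  using smap_near_ident smap_near_real by blast

lemma smooth_near_cong:
  assumes "smooth_near A f" "A \<subseteq> U" "open U" "\<And>p. p \<in> U \<Longrightarrow> f p = g p"
  shows "smooth_near A g"
proof -
  obtain V where V: "open V" "A \<subseteq> V" "smooth_on V f" using assms(1) by (rule smooth_nearE)
  have "smooth_on (U \<inter> V) g"
    by (rule smooth_on_cong[OF smooth_on_subset[OF V(3)]]) (use V assms in auto)
  then show ?thesis using V assms unfolding smooth_near_def by (intro exI[where x="U \<inter> V"]) auto
qed

lemma smooth_near_powr [smooth_intros]: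
  assumes "smooth_near A f" "\<And>p. p \<in> A \<Longrightarrow> f p > 0"
  shows "smooth_near A (\<lambda>p. f p powr a)"
proof (rule smooth_near_compose[where B="{0<..}" and g="\<lambda>x. x powr a"])
  show "smooth_near {0<..} (\<lambda>x::real. x powr a)"
    using smooth_on_powr unfolding smooth_near_def by blast
qed (use assms in \<open>auto intro: smooth_intros\<close>)

lemma smooth_near_divide [smooth_intros]:
  assumes "smooth_near A f" "smooth_near A g" "\<And>p. p \<in> A \<Longrightarrow> g p \<noteq> 0"
  shows "smooth_near A (\<lambda>p. f p / g p)"
proof -
  \<comment> \<open>The square makes the base of the power positive whatever the sign of
    \<open>g p\<close>; the spare factor \<open>g p\<close> is multiplied back afterwards.\<close>
  have "smooth_near A (\<lambda>p. (g p ^ 2) powr (-1))"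
    by (intro smooth_intros assms) (use assms in auto)
  then have "smooth_near A (\<lambda>p. f p * g p * (g p ^ 2) powr (-1))"
    by (intro smooth_near_mult assms(1,2))
  moreover have "(\<lambda>p. f p * g p * (g p ^ 2) powr (-1)) = (\<lambda>p. f p / g p)"
  proof
    fix p show "f p * g p * (g p ^ 2) powr (-1) = f p / g p"
    proof (cases "g p = 0")
      case False
      then have "(g p ^ 2) powr (-1) = inverse (g p ^ 2)" by (simp add: powr_minus)
      then show ?thesis using False by (simp add: power2_eq_square field_simps)
    qed simp
  qed
  ultimately show ?thesis by simp
qed

section \<open>Hadamard's lemma and uniform estimates\<close>

lemma sum_Basis_Pair:
  "(\<Sum>b\<in>(Basis :: ('a::euclidean_space \<times> 'b::euclidean_space) set). f b)
    = (\<Sum>i\<in>Basis. f (i, 0)) + (\<Sum>i\<in>Basis. f (0, i))"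
proof -
  have "inj_on (\<lambda>u. (u::'a, 0::'b)) Basis" "inj_on (\<lambda>u. (0::'a, u::'b)) Basis"
    by (auto intro!: inj_onI)
  moreover have "(\<lambda>u. (u::'a, 0::'b)) ` Basis \<inter> (\<lambda>u. (0::'a, u::'b)) ` Basis = {}" by auto
  ultimately show ?thesis
    unfolding Basis_prod_def by (subst sum.union_disjoint) (auto simp: sum.reindex)
qed

text \<open>The unit interval is compact, so the tube lemma applies. The result is an open domain on
  which integrals along segments towards \<open>z = 0\<close> are defined.\<close>

lemma open_star_part:
  fixes U :: "(real \<times> 'a::euclidean_space) set"
  assumes "open U"
  shows "open {(z, p). \<forall>s\<in>{0..1}. (s * z, p) \<in> U}"
proof (rule openI)
  fix x assume "x \<in> {(z, p). \<forall>s\<in>{0..1}. (s * z, p) \<in> U}"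
  then obtain z p where x: "x = (z, p)" and *: "\<And>s. s \<in> {0..1} \<Longrightarrow> (s * z, p) \<in> U" by auto
  define W where "W = (\<lambda>(y::real \<times> 'a, s). (s * fst y, snd y)) -` U"
  have "open W" unfolding W_def
    by (rule open_vimage[OF assms]) (auto intro!: continuous_intros simp: split_beta)
  moreover have "{x} \<times> {0..1} \<subseteq> W" using * by (auto simp: W_def x)
  ultimately obtain X where X: "x \<in> X" "open X" "X \<times> {0..1} \<subseteq> W"
    using Elementary_Topology.tube_lemma[OF compact_Icc[of "0::real" 1]] by metis
  then obtain e where "e > 0" "ball x e \<subseteq> X" by (meson open_contains_ball)
  moreover have "X \<subseteq> {(z, p). \<forall>s\<in>{0..1}. (s * z, p) \<in> U}"
    using X(3) by (fastforce simp: W_def)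
  ultimately show "\<exists>e>0. ball x e \<subseteq> {(z, p). \<forall>s\<in>{0..1}. (s * z, p) \<in> U}" by blast
qed

text \<open>Differentiation under the integral sign. A derivative in the first coordinate brings out
  one more factor \<open>s\<close>, so the weight \<open>s ^ j\<close> is carried along to make the
  class of such integrals closed under partial derivatives; \<open>snd b = 0\<close> picks out the
  first basis vector.\<close>

lemma hadamard_step:
  fixes h :: "real \<times> 'a::euclidean_space \<Rightarrow> real"
  assumes "smooth_on U h" "open V" "\<And>z p s. (z, p) \<in> V \<Longrightarrow> s \<in> {0..1} \<Longrightarrow> (s * z, p) \<in> U" "x \<in> V"
  shows "((\<lambda>x. integral {0..1} (\<lambda>s. s ^ j * h (s * fst x, snd x))) has_derivative
    (\<lambda>k. \<Sum>b\<in>Basis. (k \<bullet> b) * integral {0..1}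
       (\<lambda>s. s ^ (if snd b = 0 then Suc j else j) * iter_dderiv h [b] (s * fst x, snd x)))) (at x)"
proof -
  let ?D = "\<lambda>x s k. s ^ j * (\<Sum>b\<in>Basis. ((s * fst k, snd k) \<bullet> b) * iter_dderiv h [b] (s * fst x, snd x))"
  obtain e where e: "e > 0" "ball x e \<subseteq> V" using assms(2,4) open_contains_ball by blast
  have inU: "(s * fst y, snd y) \<in> U" if "y \<in> ball x e" "s \<in> {0..1}" for y s
    using assms(3)[of "fst y" "snd y" s] that e by auto
  define fx where "fx = (\<lambda>y s. \<Sum>b\<in>Basis. (s ^ (if snd b = 0 then Suc j else j)
     * iter_dderiv h [b] (s * fst y, snd y)) *\<^sub>R blinfun_inner_left b)"
  have fx: "blinfun_apply (fx y s) k = (\<Sum>b\<in>Basis. (k \<bullet> b) * (s ^ (if snd b = 0 then Suc j else j)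
     * iter_dderiv h [b] (s * fst y, snd y)))" for y s k
    by (simp add: fx_def blinfun.sum_left blinfun.scaleR_left mult.commute inner_commute)
  have hc: "continuous_on U (iter_dderiv h [b])" if "b \<in> Basis" for b
    using smooth_on_continuous[OF smooth_on_iter_dderiv[OF assms(1), of "[b]"]] that by auto
  have "((\<lambda>x. integral (cbox 0 1) (\<lambda>s. s ^ j * h (s * fst x, snd x))) has_derivative
     integral (cbox 0 1) (fx x)) (at x within ball x e)"
  proof (rule leibniz_rule[where fx=fx])
    fix y and s :: real assume y: "y \<in> ball x e" and s: "s \<in> cbox 0 1"
    have "((\<lambda>y. s ^ j * h (s * fst y, snd y)) has_derivative ?D y s) (at y)"
    proof (intro has_derivative_mult_right)
      show "((\<lambda>y. h (s * fst y, snd y)) has_derivative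
         (\<lambda>k. \<Sum>b\<in>Basis. (s * fst k, snd k) \<bullet> b * iter_dderiv h [b] (s * fst y, snd y))) (at y)"
        by (rule has_derivative_compose[where f="\<lambda>y. (s * fst y, snd y)" and g=h,
              OF _ smooth_on_has_derivative[OF assms(1) inU[OF y]]])
           (use s in \<open>auto intro!: derivative_eq_intros\<close>)
    qed
    moreover have "?D y s = blinfun_apply (fx y s)"
    proof
      fix k
      have "?D y s k = (\<Sum>b\<in>Basis. s ^ j * ((s * fst k, snd k) \<bullet> b * iter_dderiv h [b] (s * fst y, snd y)))"
        by (simp only: sum_distrib_left)
      also have "\<dots> = blinfun_apply (fx y s) k"
        unfolding fx by (intro sum.cong) (auto simp: Basis_prod_def inner_prod_def)
      finally show "?D y s k = blinfun_apply (fx y s) k" .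
    qed
    ultimately show "((\<lambda>y. s ^ j * h (s * fst y, snd y)) has_derivative blinfun_apply (fx y s))
       (at y within ball x e)"
      by (simp add: has_derivative_at_withinI)
  next
    fix y assume y: "y \<in> ball x e"
    have "continuous_on {0..1} (\<lambda>s. s ^ j * h (s * fst y, snd y))"
      by (intro continuous_intros continuous_on_compose2[OF smooth_on_continuous[OF assms(1)]])
         (use inU[OF y] in auto)
    then show "(\<lambda>s. s ^ j * h (s * fst y, snd y)) integrable_on cbox 0 1"
      using integrable_continuous_interval by auto
  next
    show "continuous_on (ball x e \<times> cbox 0 1) (\<lambda>(y, s). fx y s)"
      unfolding fx_def split_beta
      by (intro continuous_intros continuous_on_compose2[OF hc])
         (use inU in auto)
  qed (use e in auto)
  then have "((\<lambda>x. integral (cbox 0 1) (\<lambda>s. s ^ j * h (s * fst x, snd x))) has_derivative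
     integral (cbox 0 1) (fx x)) (at x)"
    using e by (simp add: at_within_open[of x "ball x e"])
  moreover have *: "blinfun_apply (integral (cbox 0 1) (fx x)) k = (\<Sum>b\<in>Basis. (k \<bullet> b) * integral {0..1}
       (\<lambda>s. s ^ (if snd b = 0 then Suc j else j) * iter_dderiv h [b] (s * fst x, snd x)))" for k
  proof -
    have c: "continuous_on {0..1} (\<lambda>s. iter_dderiv h [b] (s * fst x, snd x))" if "b \<in> Basis" for b
      by (intro continuous_intros continuous_on_compose2[OF hc[OF that]])
         (use inU[of x] e in auto)
    have "fx x integrable_on cbox 0 1"
      unfolding fx_def by (intro integrable_continuous continuous_intros) (use c in auto)
    then have "blinfun_apply (integral (cbox 0 1) (fx x)) k = integral (cbox 0 1) (\<lambda>s. fx x s k)"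
      by (rule blinfun_apply_integral)
    also have "\<dots> = (\<Sum>b\<in>Basis. integral {0..1} (\<lambda>s. (k \<bullet> b) *
         (s ^ (if snd b = 0 then Suc j else j) * iter_dderiv h [b] (s * fst x, snd x))))"
      unfolding fx
      by (subst integral_sum)
         (use c in \<open>auto intro!: integrable_continuous_interval continuous_intros\<close>)
    finally show ?thesis by simp
  qed
  moreover from * have "blinfun_apply (integral (cbox 0 1) (fx x)) = (\<lambda>k. \<Sum>b\<in>Basis. (k \<bullet> b) * integral {0..1}
       (\<lambda>s. s ^ (if snd b = 0 then Suc j else j) * iter_dderiv h [b] (s * fst x, snd x)))" by auto
  ultimately show ?thesis by (simp only: cbox_interval)
qed

text \<open>The quotient is the mean of the first partial derivative over the segment from
  \<open>(0, p)\<close> to \<open>(z, p)\<close>, a form in which smoothness at \<open>z = 0\<close>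
  is visible. All divisions by \<tau> and by the root of the action rest on it.\<close>

lemma hadamard:
  fixes G :: "real \<times> 'a::euclidean_space \<Rightarrow> real"
  assumes "smooth_near A G" "\<And>z p s. (z, p) \<in> A \<Longrightarrow> s \<in> {0..1} \<Longrightarrow> (s * z, p) \<in> A"
  obtains G' where "smooth_near A G'" "\<And>z p. (z, p) \<in> A \<Longrightarrow> G (z, p) = G (0, p) + z * G' (z, p)"
proof -
  obtain U where U: "open U" "A \<subseteq> U" "smooth_on U G" using assms(1) by (rule smooth_nearE)
  define V where "V = {(z, p). \<forall>s\<in>{0..1}. (s * z, p) \<in> U}"
  have V: "open V" "A \<subseteq> V" using open_star_part[OF U(1)] assms(2) U(2) by (auto simp: V_def)
  have VU: "(s * z, p) \<in> U" if "(z, p) \<in> V" "s \<in> {0..1}" for z p s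
    using that by (auto simp: V_def)
  define G' where "G' = (\<lambda>x. integral {0..1} (\<lambda>s. s ^ 0 * iter_dderiv G [(1, 0)] (s * fst x, snd x)))"
  define Q where "Q = (\<lambda>g. \<exists>h j. smooth_on U h \<and>
     g = (\<lambda>x. integral {0..1} (\<lambda>s. s ^ j * h (s * fst x, snd x))))"
  have "smooth_on V G'"
  proof (rule smooth_on_coinduct[where Q=Q])
    have "smooth_on U (iter_dderiv G [(1, 0)])"
      by (rule smooth_on_iter_dderiv[OF U(3)]) (simp add: Basis_prod_def)
    then show "Q G'" unfolding Q_def G'_def by blast
    fix g assume "Q g"
    then obtain h j where h: "smooth_on U h" "g = (\<lambda>x. integral {0..1} (\<lambda>s. s ^ j * h (s * fst x, snd x)))"
      unfolding Q_def by blast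
    show "\<exists>g'. (\<forall>b\<in>Basis. Q (g' b)) \<and>
      (\<forall>p\<in>V. (g has_derivative (\<lambda>h. \<Sum>b\<in>Basis. (h \<bullet> b) * g' b p)) (at p))"
    proof (intro exI conjI ballI)
      fix p assume "p \<in> V"
      from hadamard_step[OF h(1) V(1) VU this, of j]
      show "(g has_derivative (\<lambda>k. \<Sum>b\<in>Basis. (k \<bullet> b) * (\<lambda>b x. integral {0..1}
       (\<lambda>s. s ^ (if snd b = 0 then Suc j else j) * iter_dderiv h [b] (s * fst x, snd x))) b p)) (at p)"
        by (simp only: h(2))
    next
      fix b :: "real \<times> 'a" assume "b \<in> Basis"
      then have "smooth_on U (iter_dderiv h [b])" by (intro smooth_on_iter_dderiv[OF h(1)]) simp
      then show "Q ((\<lambda>b x. integral {0..1}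
       (\<lambda>s. s ^ (if snd b = 0 then Suc j else j) * iter_dderiv h [b] (s * fst x, snd x))) b)"
        unfolding Q_def by blast
    qed
  qed fact
  moreover have "G (z, p) = G (0, p) + z * G' (z, p)" if zp: "(z, p) \<in> A" for z p
  proof -
    have "((\<lambda>s. z * iter_dderiv G [(1, 0)] (s * z, p)) has_integral
       (G (1 * z, p) - G (0 * z, p))) {0..1}"
    proof (rule fundamental_theorem_of_calculus)
      fix s :: real assume s: "s \<in> {0..1}"
      then have "(s * z, p) \<in> U" using assms(2)[OF zp s] U(2) by auto
      from smooth_on_has_derivative[OF U(3) this]
      have "((\<lambda>s. G (s * z, p)) has_derivative (\<lambda>h. \<Sum>b\<in>Basis. (h * z, 0) \<bullet> b * iter_dderiv G [b] (s * z, p)))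
         (at s within {0..1})"
        by (rule has_derivative_compose[where f="\<lambda>s. (s * z, p)" and g=G, rotated])
           (auto intro!: derivative_eq_intros)
      moreover have "(\<Sum>b\<in>Basis. (h * z, 0) \<bullet> b * iter_dderiv G [b] (s * z, p))
         = h * (z * iter_dderiv G [(1, 0)] (s * z, p))" for h
        by (subst sum_Basis_Pair) (simp add: inner_prod_def)
      ultimately show "((\<lambda>s. G (s * z, p)) has_vector_derivative z * iter_dderiv G [(1, 0)] (s * z, p))
         (at s within {0..1})"
        by (simp add: has_vector_derivative_def)
    qed simp
    then show ?thesis
      by (simp add: G'_def has_integral_iff)
  qed
  ultimately show ?thesis using V that unfolding smooth_near_def by blast
qed

lemma smooth_near_bounded:
  assumes "smooth_near A f" "compact A"
  obtains B where "B > 0" "\<And>p. p \<in> A \<Longrightarrow> \<bar>f p\<bar> \<le> B"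
proof -
  have "bounded (f ` A)"
    by (intro compact_imp_bounded compact_continuous_image smooth_near_continuous_on assms)
  then show ?thesis using that by (auto simp: bounded_pos)
qed

lemma unit_mult_Icc: "z \<in> {0..T} \<Longrightarrow> s \<in> {0..1} \<Longrightarrow> s * z \<in> {0..T}" for z :: real
  using mult_right_mono[of s 1 z] by auto

text \<open>A function that is \<open>O(\<tau> ^ Suc K)\<close> for each single \<open>p\<close>
  vanishes at \<tau> = 0, hence is \<tau> times a smooth function that is
  \<open>O(\<tau> ^ K)\<close>; after all divisions the quotient is bounded on a compact set. The
  pointwise estimate is required on the subset \<open>P\<close> of \<open>C\<close> only, which need
  not be closed, so points of zero action may be left out.\<close>

lemma flat_uniform:
  fixes G :: "real \<times> 'a::euclidean_space \<Rightarrow> real"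
  assumes "smooth_near ({0..T} \<times> C) G" "compact C" "P \<subseteq> C" "T > 0"
    and "\<And>p. p \<in> P \<Longrightarrow> (\<lambda>\<tau>. G (\<tau>, p)) \<in> O[at_right 0](\<lambda>\<tau>. \<tau> ^ K)"
  obtains B where "B > 0" "\<And>\<tau> p. \<tau> \<in> {0..T} \<Longrightarrow> p \<in> P \<Longrightarrow> \<bar>G (\<tau>, p)\<bar> \<le> B * \<tau> ^ K"
  using assms(1,5)
proof (induction K arbitrary: G thesis)
  case 0
  obtain B where "B > 0" "\<And>p. p \<in> {0..T} \<times> C \<Longrightarrow> \<bar>G p\<bar> \<le> B"
    by (rule smooth_near_bounded[OF 0(2)]) (auto intro: compact_Times assms)
  then show ?case using assms(3) by (intro 0(1)[of B]) auto
next
  case (Suc K)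
  obtain G' where G': "smooth_near ({0..T} \<times> C) G'"
    "\<And>z p. (z, p) \<in> {0..T} \<times> C \<Longrightarrow> G (z, p) = G (0, p) + z * G' (z, p)"
    by (rule hadamard[OF Suc.prems(2)]) (auto simp del: atLeastAtMost_iff intro: unit_mult_Icc)
  have ev: "\<forall>\<^sub>F \<tau> in at_right 0. \<tau> \<in> {0<..<T}"
    using eventually_at_right_real[OF assms(4)] by simp
  have G0: "G (0, p) = 0" if p: "p \<in> P" for p
  proof -
    have pC: "(0, p) \<in> {0..T} \<times> C" using p assms by auto
    obtain c where "\<forall>\<^sub>F \<tau> in at_right 0. norm (G (\<tau>, p)) \<le> c * norm (\<tau> ^ Suc K)"
      using Suc.prems(3)[OF p] by (auto elim: landau_o.bigE)
    moreover have "((\<lambda>\<tau>. c * norm (\<tau> ^ Suc K)) \<longlongrightarrow> 0) (at_right (0::real))"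
      by (auto intro!: tendsto_eq_intros)
    ultimately have 1: "((\<lambda>\<tau>. G (\<tau>, p)) \<longlongrightarrow> 0) (at_right 0)"
      by (rule Lim_null_comparison)
    have "isCont G (0, p)" by (rule smooth_near_isCont[OF Suc.prems(2) pC])
    then have "((\<lambda>\<tau>. G (\<tau>, p)) \<longlongrightarrow> G (0, p)) (at_right 0)"
      by (rule isCont_tendsto_compose) (auto intro!: tendsto_intros)
    then show ?thesis using 1 tendsto_unique[OF trivial_limit_at_right_real] by blast
  qed
  have *: "G (\<tau>, p) = \<tau> * G' (\<tau>, p)" if "\<tau> \<in> {0..T}" "p \<in> P" for \<tau> p
    using G'(2)[of \<tau> p] G0[OF that(2)] that assms(3) by auto
  have O': "(\<lambda>\<tau>. G' (\<tau>, p)) \<in> O[at_right 0](\<lambda>\<tau>. \<tau> ^ K)" if p: "p \<in> P" for p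
  proof -
    obtain c where c: "\<forall>\<^sub>F \<tau> in at_right 0. norm (G (\<tau>, p)) \<le> c * norm (\<tau> ^ Suc K)"
      using Suc.prems(3)[OF p] by (auto elim: landau_o.bigE)
    have "\<forall>\<^sub>F \<tau> in at_right 0. norm (G' (\<tau>, p)) \<le> c * norm (\<tau> ^ K)"
      using c ev by eventually_elim (use * p in \<open>auto simp: abs_mult\<close>)
    then show ?thesis by (rule bigoI)
  qed
  obtain B where "B > 0" "\<And>\<tau> p. \<tau> \<in> {0..T} \<Longrightarrow> p \<in> P \<Longrightarrow> \<bar>G' (\<tau>, p)\<bar> \<le> B * \<tau> ^ K"
    using Suc.IH[OF _ G'(1) O'] by blast
  then show ?case
    by (intro Suc.prems(1)[of B]) (auto simp: * abs_mult mult.left_commute mult_left_mono)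
qed

section \<open>Global solutions of Lipschitz equations\<close>

text \<open>Picard iteration. The Lipschitz constant may grow with the horizon \<open>T\<close>, so
  convergence is shown on each \<open>{t1..T}\<close> with a factorial majorant; the limit is
  written as a pointwise sum and is thus the same function for all \<open>T\<close>.\<close>

lemma global_solution:
  fixes f :: "real \<Rightarrow> 'a::euclidean_space \<Rightarrow> 'a"
  assumes cont: "continuous_on ({t1..} \<times> UNIV) (\<lambda>(t, x). f t x)"
    and lip: "\<And>T. \<exists>L\<ge>0. \<forall>t\<in>{t1..T}. \<forall>x y. norm (f t x - f t y) \<le> L * norm (x - y)"
  obtains u where "u t1 = a"
    "\<And>t. t \<ge> t1 \<Longrightarrow> (u has_vector_derivative f t (u t)) (at t within {t1..})"
proof -
  define U where "U = rec_nat (\<lambda>t. a) (\<lambda>n u t. a + integral {t1..t} (\<lambda>s. f s (u s)))"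
  have U0: "U 0 t = a" and US: "U (Suc n) t = a + integral {t1..t} (\<lambda>s. f s (U n s))" for n t
    by (simp_all add: U_def)
  have fc: "continuous_on {t1..T} (\<lambda>s. f s (w s))" if "continuous_on {t1..T} w" for w T
  proof -
    have "continuous_on {t1..T} (\<lambda>s. (s, w s))" by (intro continuous_intros that)
    then show ?thesis
      using continuous_on_compose2[OF cont, of "{t1..T}" "\<lambda>s. (s, w s)"] by fastforce
  qed
  have Uc: "continuous_on {t1..T} (U n)" for n T
  proof (induction n)
    case 0
    then show ?case by (simp add: U0)
  next
    case (Suc n)
    have "continuous_on {t1..T} (\<lambda>t. a + integral {t1..t} (\<lambda>s. f s (U n s)))"
      by (intro continuous_intros indefinite_integral_continuous_1 integrable_continuous_interval fc Suc)
    then show ?case by (simp add: US)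
  qed
  have fi: "(\<lambda>s. f s (w s)) integrable_on {t1..t}" if "continuous_on {t1..t} w" for w t
    by (intro integrable_continuous_interval fc that)
  define u where "u = (\<lambda>t. a + (\<Sum>i. U (Suc i) t - U i t))"
  have ul: "uniform_limit {t1..T} U u sequentially" for T
  proof -
    obtain L where L: "L \<ge> 0" "\<And>t x y. t \<in> {t1..T} \<Longrightarrow> norm (f t x - f t y) \<le> L * norm (x - y)"
      using lip[of T] by auto
    obtain M where M: "\<And>t. t \<in> {t1..T} \<Longrightarrow> norm (U 1 t - U 0 t) \<le> M"
    proof -
      have "compact ((\<lambda>t. U 1 t - U 0 t) ` {t1..T})"
        by (intro compact_continuous_image continuous_intros Uc) auto
      then obtain b where "\<And>y. y \<in> (\<lambda>t. U 1 t - U 0 t) ` {t1..T} \<Longrightarrow> norm y \<le> b"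
        using compact_imp_bounded bounded_iff by metis
      then show ?thesis by (intro that[of b]) blast
    qed
    have B: "norm (U (Suc n) t - U n t) \<le> M * (L ^ n * (t - t1) ^ n / fact n)"
      if "t \<in> {t1..T}" for n t
      using that
    proof (induction n arbitrary: t)
      case 0
      then show ?case using M[of t] by simp
    next
      case (Suc n)
      have "U (Suc (Suc n)) t - U (Suc n) t
         = integral {t1..t} (\<lambda>s. f s (U (Suc n) s) - f s (U n s))"
        unfolding US[of "Suc n" t] US[of n t] integral_diff[OF fi[OF Uc] fi[OF Uc]] by simp
      also have "norm \<dots> \<le> integral {t1..t} (\<lambda>s. L * (M * (L ^ n * (s - t1) ^ n / fact n)))"
      proof (rule integral_norm_bound_integral)
        fix s assume s: "s \<in> {t1..t}"
        then have "norm (f s (U (Suc n) s) - f s (U n s)) \<le> L * norm (U (Suc n) s - U n s)"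
          using L(2) Suc.prems by auto
        also have "\<dots> \<le> L * (M * (L ^ n * (s - t1) ^ n / fact n))"
          using L(1) Suc s by (intro mult_left_mono) auto
        finally show "norm (f s (U (Suc n) s) - f s (U n s)) \<le> \<dots>" .
      next
        show "(\<lambda>s. f s (U (Suc n) s) - f s (U n s)) integrable_on {t1..t}"
          by (intro integrable_diff fi Uc)
        show "(\<lambda>s. L * (M * (L ^ n * (s - t1) ^ n / fact n))) integrable_on {t1..t}"
          by (intro integrable_continuous_interval continuous_intros) auto
      qed
      also have "((\<lambda>s. L * (M * (L ^ n * (s - t1) ^ n / fact n))) has_integral
          (M * (L ^ Suc n * (t - t1) ^ Suc n / fact (Suc n))
           - M * (L ^ Suc n * (t1 - t1) ^ Suc n / fact (Suc n)))) {t1..t}"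
      proof (rule fundamental_theorem_of_calculus)
        fix s
        have "((\<lambda>s. M * (L ^ Suc n * (s - t1) ^ Suc n / fact (Suc n))) has_real_derivative
           M * (L ^ Suc n * (real (Suc n) * (s - t1) ^ n) / fact (Suc n))) (at s within {t1..t})"
          by (auto intro!: derivative_eq_intros simp del: power_Suc)
        moreover have "M * (L ^ Suc n * (real (Suc n) * (s - t1) ^ n) / fact (Suc n))
           = L * (M * (L ^ n * (s - t1) ^ n / fact n))"
          by (simp add: field_simps del: of_nat_Suc)
        ultimately show "((\<lambda>s. M * (L ^ Suc n * (s - t1) ^ Suc n / fact (Suc n))) has_vector_derivative
           L * (M * (L ^ n * (s - t1) ^ n / fact n))) (at s within {t1..t})"
          unfolding has_real_derivative_iff_has_vector_derivative by (rule has_vector_derivative_eq_rhs)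
      qed (use Suc.prems in auto)
      then have "integral {t1..t} (\<lambda>s. L * (M * (L ^ n * (s - t1) ^ n / fact n)))
         = M * (L ^ Suc n * (t - t1) ^ Suc n / fact (Suc n))"
        by (rule integral_unique[THEN trans]) simp
      finally show ?case .
    qed
    have "summable (\<lambda>n. \<bar>M\<bar> * ((L * (\<bar>T - t1\<bar>)) ^ n / fact n))"
      using summable_exp_generic[of "L * \<bar>T - t1\<bar>"]
      by (intro summable_mult) (simp add: scaleR_conv_of_real divide_inverse mult.commute)
    then have "uniform_limit {t1..T} (\<lambda>n t. \<Sum>i<n. U (Suc i) t - U i t) (\<lambda>t. \<Sum>i. U (Suc i) t - U i t) sequentially"
    proof (rule Weierstrass_m_test[rotated])
      fix n t assume t: "t \<in> {t1..T}"
      have "norm (U (Suc n) t - U n t) \<le> M * (L ^ n * (t - t1) ^ n / fact n)" by (rule B[OF t])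
      also have "\<dots> \<le> \<bar>M\<bar> * ((L * (\<bar>T - t1\<bar>)) ^ n / fact n)"
        unfolding power_mult_distrib[symmetric]
        using t L(1) by (intro mult_mono divide_right_mono power_mono mult_left_mono) auto
      finally show "norm (U (Suc n) t - U n t) \<le> \<dots>" .
    qed
    then have "uniform_limit {t1..T} (\<lambda>n t. a + (\<Sum>i<n. U (Suc i) t - U i t)) u sequentially"
      unfolding u_def by (intro uniform_limit_intros)
    moreover have "(\<lambda>n t. a + (\<Sum>i<n. U (Suc i) t - U i t)) = U"
    proof (intro ext)
      show "a + (\<Sum>i<n. U (Suc i) t - U i t) = U n t" for n t
        using sum_lessThan_telescope[of "\<lambda>i. U i t" n] by (simp add: U0)
    qed
    ultimately show ?thesis by simp
  qed
  have uc: "continuous_on {t1..T} u" for T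
    by (rule uniform_limit_theorem[OF _ ul]) (auto simp: Uc)
  have ueq: "u t = a + integral {t1..t} (\<lambda>s. f s (u s))" if t: "t \<ge> t1" for t
  proof -
    obtain L where L: "L \<ge> 0" "\<And>s x y. s \<in> {t1..t} \<Longrightarrow> norm (f s x - f s y) \<le> L * norm (x - y)"
      using lip[of t] by auto
    have "uniform_limit {t1..t} (\<lambda>n s. f s (U n s)) (\<lambda>s. f s (u s)) sequentially"
    proof (rule uniform_limitI)
      fix e :: real assume "e > 0"
      then have "e / (L + 1) > 0" using L(1) by auto
      from uniform_limitD[OF ul this, of t]
      show "\<forall>\<^sub>F n in sequentially. \<forall>x\<in>{t1..t}. dist (f x (U n x)) (f x (u x)) < e"
      proof eventually_elim
        case (elim n)
        show ?case
        proof
          fix x assume x: "x \<in> {t1..t}"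
          have "dist (f x (U n x)) (f x (u x)) \<le> L * norm (U n x - u x)"
            using L(2)[OF x] by (simp add: dist_norm)
          also have "\<dots> \<le> L * (e / (L + 1))"
            using elim x L(1) by (intro mult_left_mono) (auto simp: dist_norm intro: less_imp_le)
          also have "\<dots> < e" using L(1) \<open>e > 0\<close> by (simp add: field_simps)
          finally show "dist (f x (U n x)) (f x (u x)) < e" .
        qed
      qed
    qed
    then have "(\<lambda>n. integral {t1..t} (\<lambda>s. f s (U n s))) \<longlonglongrightarrow> integral {t1..t} (\<lambda>s. f s (u s))"
    proof (rule uniform_limit_integral)
      fix I J assume I: "\<And>n. ((\<lambda>s. f s (U n s)) has_integral I n) {t1..t}"
        "((\<lambda>s. f s (u s)) has_integral J) {t1..t}" "I \<longlonglongrightarrow> J"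
      then show ?thesis by (simp add: integral_unique[OF I(1)] integral_unique[OF I(2)])
    qed (auto intro: fc Uc)
    then have "(\<lambda>n. U (Suc n) t) \<longlonglongrightarrow> a + integral {t1..t} (\<lambda>s. f s (u s))"
      unfolding US by (intro tendsto_intros)
    moreover have "(\<lambda>n. U (Suc n) t) \<longlonglongrightarrow> u t"
      using tendsto_uniform_limitI[OF ul, of t t] t by (intro LIMSEQ_Suc) auto
    ultimately show ?thesis using LIMSEQ_unique by blast
  qed
  show ?thesis
  proof (rule that)
    show "u t1 = a" using ueq[of t1] by simp
    fix t assume t: "t \<ge> t1"
    have "((\<lambda>t. integral {t1..t} (\<lambda>s. f s (u s))) has_vector_derivative f t (u t)) (at t within {t1..t + 1})"
      by (rule integral_has_vector_derivative[OF fc[OF uc]]) (use t in auto)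
    then have "((\<lambda>t. a + integral {t1..t} (\<lambda>s. f s (u s))) has_vector_derivative f t (u t)) (at t within {t1..t + 1})"
      by (auto intro!: derivative_eq_intros)
    then have "(u has_vector_derivative f t (u t)) (at t within {t1..t + 1})"
      by (rule has_vector_derivative_transform[rotated -1]) (use t ueq in auto)
    then show "(u has_vector_derivative f t (u t)) (at t within {t1..})"
      using at_within_nhd[of t "{..<t + 1}" "{t1..t + 1}" "{t1..}"] by fastforce
  qed
qed

section \<open>Chain rules in two and three variables\<close>

lemma smooth_near_derivative2:
  fixes f :: "real \<times> real \<Rightarrow> real"
  assumes "smooth_near A f" "p \<in> A"
  shows "(f has_derivative (\<lambda>h. fst h * iter_dderiv f [(1, 0)] p + snd h * iter_dderiv f [(0, 1)] p)) (at p)"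
  by (rule has_derivative_eq_rhs[OF smooth_near_has_derivative[OF assms]])
     (auto simp: sum_Basis_Pair inner_prod_def simp del: iter_dderiv.simps)

lemma smooth_near_derivative3:
  fixes f :: "real \<times> real \<times> real \<Rightarrow> real"
  assumes "smooth_near A f" "p \<in> A"
  shows "(f has_derivative (\<lambda>h. fst h * iter_dderiv f [(1, 0, 0)] p
     + fst (snd h) * iter_dderiv f [(0, 1, 0)] p + snd (snd h) * iter_dderiv f [(0, 0, 1)] p)) (at p)"
  by (rule has_derivative_eq_rhs[OF smooth_near_has_derivative[OF assms]])
     (auto simp: sum_Basis_Pair inner_prod_def zero_prod_def simp del: iter_dderiv.simps)

lemma chain2:
  fixes f :: "real \<times> real \<Rightarrow> real"
  assumes "smooth_near A f"
    "(a has_real_derivative a') (at t within I)" "(b has_real_derivative b') (at t within I)"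
    "(a t, b t) \<in> A"
  shows "((\<lambda>t. f (a t, b t)) has_real_derivative
    a' * iter_dderiv f [(1, 0)] (a t, b t) + b' * iter_dderiv f [(0, 1)] (a t, b t)) (at t within I)"
proof -
  have "((\<lambda>t. (a t, b t)) has_derivative (\<lambda>h. (a' * h, b' * h))) (at t within I)"
    using assms(2,3) by (intro has_derivative_Pair) (auto simp: has_field_derivative_def)
  from has_derivative_compose[OF this smooth_near_derivative2[OF assms(1,4)]]
  show ?thesis
    unfolding has_field_derivative_def
    by (rule has_derivative_eq_rhs) (auto simp: algebra_simps simp del: iter_dderiv.simps)
qed

lemma chain3:
  fixes f :: "real \<times> real \<times> real \<Rightarrow> real"
  assumes "smooth_near A f"
    "(a has_real_derivative a') (at t within I)" "(b has_real_derivative b') (at t within I)"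
    "(c has_real_derivative c') (at t within I)" "(a t, b t, c t) \<in> A"
  shows "((\<lambda>t. f (a t, b t, c t)) has_real_derivative
    a' * iter_dderiv f [(1, 0, 0)] (a t, b t, c t) + b' * iter_dderiv f [(0, 1, 0)] (a t, b t, c t)
    + c' * iter_dderiv f [(0, 0, 1)] (a t, b t, c t)) (at t within I)"
proof -
  have "((\<lambda>t. (a t, b t, c t)) has_derivative (\<lambda>h. (a' * h, b' * h, c' * h))) (at t within I)"
    using assms(2-4) by (intro has_derivative_Pair) (auto simp: has_field_derivative_def)
  from has_derivative_compose[OF this smooth_near_derivative3[OF assms(1,5)]]
  show ?thesis
    unfolding has_field_derivative_def
    by (rule has_derivative_eq_rhs) (auto simp: algebra_simps simp del: iter_dderiv.simps)
qed

lemma norm_pair_eq: "norm (x::real, y::real) = sqrt (x\<^sup>2 + y\<^sup>2)"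
  by (simp add: norm_Pair)

lemma bigo_square_gradient_zero:
  fixes f :: "real \<times> real \<Rightarrow> real"
  assumes "(f has_derivative D) (at 0)" and "f \<in> O[nhds 0](\<lambda>p. norm p ^ 2)"
  shows "f 0 = 0" "D b = 0"
proof -
  obtain c where c: "\<forall>\<^sub>F p in nhds 0. norm (f p) \<le> c * norm (norm p ^ 2)"
    using assms(2) by (auto elim: landau_o.bigE)
  \<comment> \<open>The filter \<open>nhds 0\<close> sees the point itself, where the bound is
    zero.\<close>
  then show f0: "f 0 = 0" using eventually_nhds_x_imp_x by fastforce
  have "((\<lambda>h. f (0 + h *\<^sub>R b)) has_real_derivative D b) (at 0)"
    by (rule deriv_along[OF assms(1)])
  then have lim: "((\<lambda>h. f (h *\<^sub>R b) / h) \<longlongrightarrow> D b) (at 0)"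
    by (simp add: has_field_derivative_iff f0)
  have t: "((\<lambda>h. h *\<^sub>R b) \<longlongrightarrow> 0) (at (0::real))"
    by (auto intro!: tendsto_eq_intros)
  have ev: "\<forall>\<^sub>F h in at (0::real). norm (f (h *\<^sub>R b) / h) \<le> c * norm b ^ 2 * \<bar>h\<bar>"
    using eventually_compose_filterlim[OF c t] eventually_neq_at_within[of 0 0]
    by eventually_elim (auto simp: power2_eq_square field_simps)
  have "((\<lambda>h. c * norm b ^ 2 * \<bar>h\<bar>) \<longlongrightarrow> 0) (at (0::real))"
    by (auto intro!: tendsto_eq_intros)
  from Lim_null_comparison[OF ev this] lim show "D b = 0"
    using tendsto_unique[OF trivial_limit_at] by blast
qed

lemma filterlim_square_at_right: "filterlim (\<lambda>z::real. z\<^sup>2) (at_right 0) (at_right 0)"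
  by (auto simp: filterlim_at eventually_at_filter intro!: tendsto_eq_intros)

section \<open>Action-angle variables of the limiting system\<close>

text \<open>The square root \<open>z\<close> of the action is used as a coordinate, in which everything is smooth up to
  \<open>z = 0\<close>; \<open>Xz, Yz\<close> are \<open>X, Y\<close> in the coordinates \<open>(z, \<phi>)\<close>.\<close>

locale center =
  fixes H0 :: "real \<Rightarrow> real \<Rightarrow> real" and r0 E0 :: real and \<omega> :: "real \<Rightarrow> real"
    and x0 y0 :: "real \<Rightarrow> real \<Rightarrow> real" and Xz Yz :: "real \<times> real \<Rightarrow> real"
  assumes lc: "limiting_center H0 r0 E0 \<omega> x0 y0"
    and pn: "phase_normalized E0 \<omega> x0 y0"
    and smX: "smooth_near ({0..sqrt E0} \<times> UNIV) Xz"
    and smY: "smooth_near ({0..sqrt E0} \<times> UNIV) Yz"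
    and Xeq: "z \<in> {0..sqrt E0} \<Longrightarrow> angle_par \<omega> x0 \<phi> (z\<^sup>2) = Xz (z, \<phi>)"
    and Yeq: "z \<in> {0..sqrt E0} \<Longrightarrow> angle_par \<omega> y0 \<phi> (z\<^sup>2) = Yz (z, \<phi>)"
begin

definition "H0p = (\<lambda>(x, y). H0 x y)"
definition "Hx = iter_dderiv H0p [(1, 0)]"
definition "Hy = iter_dderiv H0p [(0, 1)]"
definition "Phi = (\<lambda>(z, \<phi>). (Xz (z, \<phi>), Yz (z, \<phi>)))"

lemma r0: "r0 > 0" and E0: "E0 > 0"
  and smH0: "smooth_near (disc r0) H0p"
  and w0: "\<omega> 0 = 1" and wO: "(\<lambda>E. \<omega> E - 1) \<in> O[at_right 0](\<lambda>E. E)"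
  using lc by (auto simp: limiting_center_def H0p_def)

lemma disc0: "(0, 0) \<in> disc r0" "0 \<in> disc r0" using r0 by (auto simp: disc_def zero_prod_def)

lemma orbit:
  assumes "E \<in> {0<..E0}"
  shows "solves (\<lambda>x y t. H0 x y) (\<lambda>x y t. 0) UNIV (\<lambda>t. x0 t E) (\<lambda>t. y0 t E)"
    "periodic (2 * pi / \<omega> E) (\<lambda>t. x0 t E)" "periodic (2 * pi / \<omega> E) (\<lambda>t. y0 t E)"
    "inj_on (\<lambda>t. (x0 t E, y0 t E)) {0..<2 * pi / \<omega> E}"
    "{(x, y) \<in> disc r0. H0 x y = E} = range (\<lambda>t. (x0 t E, y0 t E))"
    "\<omega> E \<noteq> 0"
  using lc assms by (auto simp: limiting_center_def)

lemma smHx: "smooth_near (disc r0) Hx" and smHy: "smooth_near (disc r0) Hy"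
  unfolding Hx_def Hy_def by (intro smooth_near_pd smH0; simp add: Basis_prod_def)+

lemma Hx_deriv: "(x, y) \<in> disc r0 \<Longrightarrow> deriv (\<lambda>\<xi>. H0 \<xi> y) x = Hx (x, y)"
  using chain2[OF smH0 DERIV_ident DERIV_const, of x y]
  by (auto simp: H0p_def Hx_def intro!: DERIV_imp_deriv simp del: iter_dderiv.simps)

lemma Hy_deriv: "(x, y) \<in> disc r0 \<Longrightarrow> deriv (\<lambda>\<eta>. H0 x \<eta>) y = Hy (x, y)"
  using chain2[OF smH0 DERIV_const DERIV_ident, of x y]
  by (auto simp: H0p_def Hy_def intro!: DERIV_imp_deriv simp del: iter_dderiv.simps)

lemma Hx0: "Hx (0, 0) = 0" and Hy0: "Hy (0, 0) = 0"
  using lc Hx_deriv[OF disc0(1)] Hy_deriv[OF disc0(1)] by (auto simp: limiting_center_def)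

lemma Phi_orbit:
  assumes "z \<in> {0<..sqrt E0}"
  shows "Phi (z, \<phi>) = (x0 (\<phi> / \<omega> (z\<^sup>2)) (z\<^sup>2), y0 (\<phi> / \<omega> (z\<^sup>2)) (z\<^sup>2))"
  using assms Xeq[of z \<phi>] Yeq[of z \<phi>] by (auto simp: Phi_def angle_par_def)

lemma square_range: "z \<in> {0<..sqrt E0} \<Longrightarrow> z\<^sup>2 \<in> {0<..E0}"
  using E0 by (auto simp: real_le_rsqrt) (metis less_imp_le real_le_rsqrt real_sqrt_le_iff real_sqrt_abs abs_of_pos)

lemma Phi_level:
  assumes "z \<in> {0<..sqrt E0}"
  shows "Phi (z, \<phi>) \<in> disc r0" "H0p (Phi (z, \<phi>)) = z\<^sup>2"
proof -
  have "Phi (z, \<phi>) \<in> {(x, y) \<in> disc r0. H0 x y = z\<^sup>2}"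
    unfolding orbit(5)[OF square_range[OF assms]] Phi_orbit[OF assms] by blast
  then show "Phi (z, \<phi>) \<in> disc r0" "H0p (Phi (z, \<phi>)) = z\<^sup>2" by (auto simp: H0p_def)
qed

lemma limX: "((\<lambda>z. Xz (z, \<phi>) / z) \<longlongrightarrow> sqrt 2 * cos \<phi>) (at_right 0)"
proof -
  have "(\<lambda>E. angle_par \<omega> x0 \<phi> E - sqrt (2 * E) * cos \<phi>) \<in> o[at_right 0](\<lambda>E. sqrt E)"
    using pn by (auto simp: phase_normalized_def)
  then have "((\<lambda>E. (angle_par \<omega> x0 \<phi> E - sqrt (2 * E) * cos \<phi>) / sqrt E) \<longlongrightarrow> 0) (at_right 0)"
    by (rule smalloD_tendsto)
  from filterlim_compose[OF this filterlim_square_at_right]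
  have "((\<lambda>z. (angle_par \<omega> x0 \<phi> (z\<^sup>2) - sqrt (2 * z\<^sup>2) * cos \<phi>) / sqrt (z\<^sup>2)) \<longlongrightarrow> 0) (at_right 0)" .
  moreover have "\<forall>\<^sub>F z in at_right 0. (angle_par \<omega> x0 \<phi> (z\<^sup>2) - sqrt (2 * z\<^sup>2) * cos \<phi>) / sqrt (z\<^sup>2)
     = Xz (z, \<phi>) / z - sqrt 2 * cos \<phi>"
    using eventually_at_right_real[of 0 "sqrt E0"] E0
    by (auto elim!: eventually_mono simp: Xeq real_sqrt_mult field_simps)
  ultimately have "((\<lambda>z. Xz (z, \<phi>) / z - sqrt 2 * cos \<phi>) \<longlongrightarrow> 0) (at_right 0)"
    by (rule Lim_transform_eventually)
  then show ?thesis by (simp add: LIM_zero_iff)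
qed

lemma limY: "((\<lambda>z. Yz (z, \<phi>) / z) \<longlongrightarrow> - (sqrt 2 * sin \<phi>)) (at_right 0)"
proof -
  have "(\<lambda>E. angle_par \<omega> y0 \<phi> E + sqrt (2 * E) * sin \<phi>) \<in> o[at_right 0](\<lambda>E. sqrt E)"
    using pn by (auto simp: phase_normalized_def)
  then have "((\<lambda>E. (angle_par \<omega> y0 \<phi> E + sqrt (2 * E) * sin \<phi>) / sqrt E) \<longlongrightarrow> 0) (at_right 0)"
    by (rule smalloD_tendsto)
  from filterlim_compose[OF this filterlim_square_at_right]
  have "((\<lambda>z. (angle_par \<omega> y0 \<phi> (z\<^sup>2) + sqrt (2 * z\<^sup>2) * sin \<phi>) / sqrt (z\<^sup>2)) \<longlongrightarrow> 0) (at_right 0)" .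
  moreover have "\<forall>\<^sub>F z in at_right 0. (angle_par \<omega> y0 \<phi> (z\<^sup>2) + sqrt (2 * z\<^sup>2) * sin \<phi>) / sqrt (z\<^sup>2)
     = Yz (z, \<phi>) / z + sqrt 2 * sin \<phi>"
    using eventually_at_right_real[of 0 "sqrt E0"] E0
    by (auto elim!: eventually_mono simp: Yeq real_sqrt_mult field_simps)
  ultimately have "((\<lambda>z. Yz (z, \<phi>) / z + sqrt 2 * sin \<phi>) \<longlongrightarrow> 0) (at_right 0)"
    by (rule Lim_transform_eventually)
  then have "((\<lambda>z. Yz (z, \<phi>) / z - (- (sqrt 2 * sin \<phi>))) \<longlongrightarrow> 0) (at_right 0)" by simp
  then show ?thesis by (simp only: LIM_zero_iff)
qed

lemma at_zero_limit:
  assumes "smooth_near ({0..sqrt E0} \<times> UNIV) W" "((\<lambda>z. W (z, \<phi>)) \<longlongrightarrow> c) (at_right 0)"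
  shows "W (0, \<phi>::real) = c"
proof -
  have "isCont W (0, \<phi>)" by (rule smooth_near_isCont[OF assms(1)]) (use E0 in auto)
  then have "((\<lambda>z. W (z, \<phi>)) \<longlongrightarrow> W (0, \<phi>)) (at_right 0)"
    by (rule isCont_tendsto_compose) (auto intro!: tendsto_intros)
  then show ?thesis using assms(2) tendsto_unique[OF trivial_limit_at_right_real] by blast
qed

lemma lim_div_zero:
  assumes "((\<lambda>z. w z / z) \<longlongrightarrow> c) (at_right (0::real))"
  shows "(w \<longlongrightarrow> 0) (at_right 0)"
proof -
  have "((\<lambda>z. w z / z * z) \<longlongrightarrow> c * 0) (at_right 0)"
    by (intro tendsto_mult assms tendsto_ident_at)
  then have "((\<lambda>z. w z / z * z) \<longlongrightarrow> 0) (at_right 0)" by simp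
  then show ?thesis
    by (rule Lim_transform_eventually) (auto simp: eventually_at_filter)
qed

lemma XY0: "Xz (0, \<phi>) = 0" "Yz (0, \<phi>) = 0" "Phi (0, \<phi>) = (0, 0)"
  using at_zero_limit[OF smX lim_div_zero[OF limX]] at_zero_limit[OF smY lim_div_zero[OF limY]]
  by (auto simp: Phi_def)

lemma Phi_disc: "z \<in> {0..sqrt E0} \<Longrightarrow> Phi (z, \<phi>) \<in> disc r0"
  using Phi_level(1)[of z \<phi>] XY0[of \<phi>] disc0 by (cases "z = 0") auto

text \<open>Hamilton's equations for the unperturbed orbits, reparametrized from time to the angle
  \<phi> = \<omega> t.\<close>

lemma ode_Phi:
  assumes "z \<in> {0<..sqrt E0}"
  shows "\<omega> (z\<^sup>2) * iter_dderiv Xz [(0, 1)] (z, \<phi>) = Hy (Phi (z, \<phi>))"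
    "\<omega> (z\<^sup>2) * iter_dderiv Yz [(0, 1)] (z, \<phi>) = - Hx (Phi (z, \<phi>))"
proof -
  define E where "E = z\<^sup>2"
  have E: "E \<in> {0<..E0}" using square_range[OF assms] by (simp add: E_def)
  define t where "t = \<phi> / \<omega> E"
  have w: "\<omega> E \<noteq> 0" by (rule orbit[OF E])
  have xe: "x0 t E = Xz (z, \<omega> E * t)" "y0 t E = Yz (z, \<omega> E * t)" for t
    using Phi_orbit[OF assms, of "\<omega> E * t"] w by (auto simp: Phi_def E_def)
  have zA: "(z, \<omega> E * t) \<in> {0..sqrt E0} \<times> UNIV" using assms by auto
  have P: "(x0 t E, y0 t E) = Phi (z, \<phi>)" unfolding xe t_def using w by (simp add: Phi_def)
  then have d: "(x0 t E, y0 t E) \<in> disc r0" using Phi_disc[of z \<phi>] assms by simp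
  have *: "((\<lambda>t. x0 t E) has_real_derivative Hy (Phi (z, \<phi>))) (at t)"
    "((\<lambda>t. y0 t E) has_real_derivative - Hx (Phi (z, \<phi>))) (at t)"
    using orbit(1)[OF E] unfolding P[symmetric] Hy_deriv[OF d, symmetric] Hx_deriv[OF d, symmetric]
    by (auto simp: solves_def)
  have "((\<lambda>t. Xz (z, \<omega> E * t)) has_real_derivative
     0 * iter_dderiv Xz [(1, 0)] (z, \<omega> E * t) + \<omega> E * iter_dderiv Xz [(0, 1)] (z, \<omega> E * t)) (at t)"
    by (rule chain2[OF smX]) (use zA in \<open>auto intro!: derivative_eq_intros\<close>)
  with *(1) have "\<omega> E * iter_dderiv Xz [(0, 1)] (z, \<omega> E * t) = Hy (Phi (z, \<phi>))"
    unfolding xe using DERIV_unique by fastforce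
  then show "\<omega> (z\<^sup>2) * iter_dderiv Xz [(0, 1)] (z, \<phi>) = Hy (Phi (z, \<phi>))"
    using w by (simp add: t_def E_def del: iter_dderiv.simps)
  have "((\<lambda>t. Yz (z, \<omega> E * t)) has_real_derivative
     0 * iter_dderiv Yz [(1, 0)] (z, \<omega> E * t) + \<omega> E * iter_dderiv Yz [(0, 1)] (z, \<omega> E * t)) (at t)"
    by (rule chain2[OF smY]) (use zA in \<open>auto intro!: derivative_eq_intros\<close>)
  with *(2) have "\<omega> E * iter_dderiv Yz [(0, 1)] (z, \<omega> E * t) = - Hx (Phi (z, \<phi>))"
    unfolding xe using DERIV_unique by fastforce
  then show "\<omega> (z\<^sup>2) * iter_dderiv Yz [(0, 1)] (z, \<phi>) = - Hx (Phi (z, \<phi>))"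
    using w by (simp add: t_def E_def del: iter_dderiv.simps)
qed

lemma energy_Phi:
  assumes "z \<in> {0<..<sqrt E0}"
  shows "Hx (Phi (z, \<phi>)) * iter_dderiv Xz [(1, 0)] (z, \<phi>)
    + Hy (Phi (z, \<phi>)) * iter_dderiv Yz [(1, 0)] (z, \<phi>) = 2 * z"
proof -
  have zA: "(z, \<phi>) \<in> {0..sqrt E0} \<times> UNIV" using assms by auto
  have X: "((\<lambda>z. Xz (z, \<phi>)) has_real_derivative iter_dderiv Xz [(1, 0)] (z, \<phi>)) (at z)"
    using chain2[OF smX DERIV_ident DERIV_const zA] by (simp del: iter_dderiv.simps)
  have Y: "((\<lambda>z. Yz (z, \<phi>)) has_real_derivative iter_dderiv Yz [(1, 0)] (z, \<phi>)) (at z)"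
    using chain2[OF smY DERIV_ident DERIV_const zA] by (simp del: iter_dderiv.simps)
  have d: "(Xz (z, \<phi>), Yz (z, \<phi>)) \<in> disc r0" using Phi_disc[of z \<phi>] assms by (auto simp: Phi_def)
  have "((\<lambda>z. H0p (Xz (z, \<phi>), Yz (z, \<phi>))) has_real_derivative
    iter_dderiv Xz [(1, 0)] (z, \<phi>) * Hx (Phi (z, \<phi>)) + iter_dderiv Yz [(1, 0)] (z, \<phi>) * Hy (Phi (z, \<phi>))) (at z)"
    using chain2[OF smH0 X Y d] by (simp add: Phi_def Hx_def Hy_def del: iter_dderiv.simps)
  moreover have "((\<lambda>z. H0p (Xz (z, \<phi>), Yz (z, \<phi>))) has_real_derivative 2 * z) (at z)"
  proof (rule has_field_derivative_transform_within_open[where S="{0<..<sqrt E0}" and f="\<lambda>z. z\<^sup>2"])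
    fix u assume "u \<in> {0<..<sqrt E0}"
    then show "u\<^sup>2 = H0p (Xz (u, \<phi>), Yz (u, \<phi>))"
      using Phi_level(2)[of u \<phi>] by (auto simp: Phi_def)
  qed (use assms in \<open>auto intro!: derivative_eq_intros\<close>)
  ultimately have "iter_dderiv Xz [(1, 0)] (z, \<phi>) * Hx (Phi (z, \<phi>)) + iter_dderiv Yz [(1, 0)] (z, \<phi>) * Hy (Phi (z, \<phi>)) = 2 * z"
    by (rule DERIV_unique)
  then show ?thesis by (simp add: mult.commute del: iter_dderiv.simps)
qed

text \<open>\<open>Phi\<close> collapses the whole line \<open>z = 0\<close> to the equilibrium, so
  a function vanishing there becomes divisible by \<open>z\<close> after composition with it. The
  gradients of \<open>H0\<close> and \<open>H\<^sub>k\<close> and the force \<open>F\<^sub>k\<close>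
  thereby contribute one factor \<open>z\<close> each.\<close>

lemma quotient:
  fixes u :: "real \<times> real \<times> real \<Rightarrow> real"
  assumes "smooth_near {(x, y, \<sigma>). (x, y) \<in> disc r0} u" "\<And>\<sigma>. u (0, 0, \<sigma>) = 0"
  obtains w where "smooth_near ({0..sqrt E0} \<times> UNIV \<times> UNIV) w"
    "\<And>z \<phi> \<sigma>. z \<in> {0..sqrt E0} \<Longrightarrow> u (Xz (z, \<phi>), Yz (z, \<phi>), \<sigma>) = z * w (z, \<phi>, \<sigma>)"
proof -
  let ?A = "{0..sqrt E0} \<times> (UNIV :: real set) \<times> (UNIV :: real set)"
  have 1: "smooth_near ?A (\<lambda>p. Xz (fst p, fst (snd p)))" "smooth_near ?A (\<lambda>p. Yz (fst p, fst (snd p)))"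
    by (rule smooth_near_compose[OF smX] smooth_near_compose[OF smY]; force intro!: smooth_intros)+
  have "smooth_near ?A (\<lambda>p. u (Xz (fst p, fst (snd p)), Yz (fst p, fst (snd p)), snd (snd p)))"
  proof (rule smooth_near_compose[OF assms(1)])
    show "(\<lambda>p. (Xz (fst p, fst (snd p)), Yz (fst p, fst (snd p)), snd (snd p))) ` ?A
      \<subseteq> {(x, y, \<sigma>). (x, y) \<in> disc r0}"
      using Phi_disc by (auto simp: Phi_def)
  qed (intro smooth_intros 1)
  from hadamard[OF this] obtain w where w: "smooth_near ?A w"
    "\<And>z p. (z, p) \<in> ?A \<Longrightarrow> u (Xz (z, fst p), Yz (z, fst p), snd p)
      = u (Xz (0, fst p), Yz (0, fst p), snd p) + z * w (z, p)"
    by (auto simp del: atLeastAtMost_iff intro: unit_mult_Icc)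
  show ?thesis
    by (rule that[OF w(1)]) (use w(2) in \<open>auto simp: XY0 assms(2)\<close>)
qed

end

section \<open>Periodic functions and reduction to one period\<close>

lemma periodic_nat: "periodic T h \<Longrightarrow> h (u + real k * T) = h u"
proof (induction k)
  case (Suc k)
  have "h (u + real (Suc k) * T) = h ((u + real k * T) + T)" by (simp add: algebra_simps)
  then show ?case using Suc unfolding periodic_def by metis
qed simp

lemma periodic_int: "periodic T h \<Longrightarrow> h (u + of_int k * T) = h u"
proof (cases "k \<ge> 0")
  case True
  assume "periodic T h"
  from periodic_nat[OF this, of u "nat k"] show ?thesis using True by simp
next
  case False
  assume "periodic T h"
  from periodic_nat[OF this, of "u + of_int k * T" "nat (- k)"] show ?thesis using False by simp
qed

lemma mod_interval:
  fixes u c T :: real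
  assumes "T > 0"
  obtains k :: int where "u + of_int k * T \<in> {c..<c + T}"
proof
  let ?k = "\<lfloor>(u - c) / T\<rfloor>"
  have "of_int ?k \<le> (u - c) / T" "(u - c) / T < of_int ?k + 1" by linarith+
  then have "of_int ?k * T \<le> u - c" "u - c < (of_int ?k + 1) * T"
    by (simp_all only: pos_le_divide_eq[OF assms] pos_divide_less_eq[OF assms])
  moreover have "u + of_int (- ?k) * T = u - of_int ?k * T" "(of_int ?k + 1) * T = of_int ?k * T + T"
    by (simp_all add: algebra_simps)
  ultimately show "u + of_int (- ?k) * T \<in> {c..<c + T}"
    unfolding atLeastLessThan_iff by linarith
qed

lemma int_multiple_zero:
  fixes u w c T :: real
  assumes "u \<in> {c..<c + T}" "w \<in> {c..<c + T}" "u - w = of_int k * T" "T > 0"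
  shows "u = w"
proof -
  have "\<bar>of_int k * T\<bar> < T" using assms by auto
  then have "\<bar>of_int k :: real\<bar> < 1" using assms(4) by (simp add: abs_mult)
  then have "k = 0" by linarith
  then show ?thesis using assms by simp
qed

section \<open>The frequency near the equilibrium and uniqueness of the angle\<close>

context center
begin

text \<open>The frequency is assumed nonzero, and for a negative one the interval
  \<open>{0..<2 * pi / \<omega> E}\<close> of the injectivity condition would be empty. Since
  \<omega> tends to 1, that condition has content for small action and makes the angle unique modulo
  2\<pi> there.\<close>

lemma omega_pos: "\<exists>z1\<in>{0<..<sqrt E0}. \<forall>z\<in>{0<..z1}. \<omega> (z\<^sup>2) > 1 / 2"
proof -
  obtain c where c: "\<forall>\<^sub>F E in at_right 0. norm (\<omega> E - 1) \<le> c * norm E"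
    using wO by (auto elim: landau_o.bigE)
  have "((\<lambda>E. c * norm E) \<longlongrightarrow> 0) (at_right (0::real))" by (auto intro!: tendsto_eq_intros)
  from Lim_null_comparison[OF c this] have "(\<omega> \<longlongrightarrow> 1) (at_right 0)" by (simp add: LIM_zero_iff)
  from filterlim_compose[OF this filterlim_square_at_right]
  have "\<forall>\<^sub>F z in at_right 0. \<omega> (z\<^sup>2) > 1 / 2" by (rule order_tendstoD) simp
  then obtain b where b: "b > 0" "\<And>z. 0 < z \<Longrightarrow> z < b \<Longrightarrow> \<omega> (z\<^sup>2) > 1 / 2"
    by (auto simp: eventually_at_right_field)
  show ?thesis
    by (rule bexI[where x="min (b / 2) (sqrt E0 / 2)"]) (use b E0 in \<open>auto simp: min_less_iff_disj\<close>)
qed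

lemma Phi_periodic:
  assumes "z \<in> {0<..sqrt E0}"
  shows "Phi (z, \<phi> + of_int k * (2 * pi)) = Phi (z, \<phi>)"
proof -
  define E where "E = z\<^sup>2"
  have E: "E \<in> {0<..E0}" using square_range[OF assms] by (simp add: E_def)
  have *: "(\<phi> + of_int k * (2 * pi)) / \<omega> E = \<phi> / \<omega> E + of_int k * (2 * pi / \<omega> E)"
    by (simp add: add_divide_distrib)
  show ?thesis unfolding Phi_orbit[OF assms] E_def[symmetric] *
    using periodic_int[OF orbit(2)[OF E]] periodic_int[OF orbit(3)[OF E]] by simp
qed

lemma Phi_surj:
  assumes "z \<in> {0<..sqrt E0}" "p \<in> disc r0" "H0p p = z\<^sup>2"
  obtains \<phi> where "\<phi> \<in> {c..<c + 2 * pi}" "Phi (z, \<phi>) = p"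
proof -
  define E where "E = z\<^sup>2"
  have E: "E \<in> {0<..E0}" using square_range[OF assms(1)] by (simp add: E_def)
  have "p \<in> {(x, y) \<in> disc r0. H0 x y = E}" using assms by (auto simp: E_def H0p_def)
  then obtain t where "p = (x0 t E, y0 t E)" unfolding orbit(5)[OF E] by auto
  then have "Phi (z, \<omega> E * t) = p"
    using Phi_orbit[OF assms(1)] orbit(6)[OF E] by (simp add: E_def)
  moreover obtain k where "\<omega> E * t + of_int k * (2 * pi) \<in> {c..<c + 2 * pi}"
    using mod_interval[of "2 * pi"] by auto
  ultimately show ?thesis using that Phi_periodic[OF assms(1)] by metis
qed

lemma Phi_inj:
  assumes "z \<in> {0<..sqrt E0}" "\<omega> (z\<^sup>2) > 0" "Phi (z, \<phi>1) = Phi (z, \<phi>2)"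
  obtains k :: int where "\<phi>1 - \<phi>2 = of_int k * (2 * pi)"
proof -
  define E where "E = z\<^sup>2"
  have E: "E \<in> {0<..E0}" using square_range[OF assms(1)] by (simp add: E_def)
  have w: "\<omega> E > 0" using assms by (simp add: E_def)
  obtain k1 where k1: "\<phi>1 + of_int k1 * (2 * pi) \<in> {0..<2 * pi}" using mod_interval[of "2 * pi" "\<phi>1" 0] by auto
  obtain k2 where k2: "\<phi>2 + of_int k2 * (2 * pi) \<in> {0..<2 * pi}" using mod_interval[of "2 * pi" "\<phi>2" 0] by auto
  have "(\<lambda>t. (x0 t E, y0 t E)) ((\<phi>1 + of_int k1 * (2 * pi)) / \<omega> E)
    = (\<lambda>t. (x0 t E, y0 t E)) ((\<phi>2 + of_int k2 * (2 * pi)) / \<omega> E)"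
    using Phi_periodic[OF assms(1), of \<phi>1 k1] Phi_periodic[OF assms(1), of \<phi>2 k2] assms(3)
    by (simp add: Phi_orbit[OF assms(1)] E_def)
  moreover have "(\<phi>1 + of_int k1 * (2 * pi)) / \<omega> E \<in> {0..<2 * pi / \<omega> E}"
    "(\<phi>2 + of_int k2 * (2 * pi)) / \<omega> E \<in> {0..<2 * pi / \<omega> E}"
    using k1 k2 w by (auto simp: divide_right_mono divide_strict_right_mono)
  ultimately have "(\<phi>1 + of_int k1 * (2 * pi)) / \<omega> E = (\<phi>2 + of_int k2 * (2 * pi)) / \<omega> E"
    by (rule inj_onD[OF orbit(4)[OF E]])
  then have "\<phi>1 - \<phi>2 = of_int (k2 - k1) * (2 * pi)" using w by (simp add: field_simps)
  then show ?thesis by (rule that)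
qed

text \<open>Smoothness of the frequency as a function of \<open>z = sqrt E\<close> comes from
  \<open>\<omega> X\<^sub>\<phi> = \<partial>\<^sub>y H0\<close> at \<open>\<phi> = \<pi> / 2\<close>, where \<open>X\<^sub>\<phi>\<close> vanishes to first order only.\<close>

lemma omega_smooth:
  "\<exists>z1 wz. z1 > 0 \<and> smooth_near {0..z1} wz \<and> (\<forall>z\<in>{0<..z1}. \<omega> (z\<^sup>2) = wz z)"
proof -
  let ?A = "{0..sqrt E0} \<times> (UNIV :: real set)"
  obtain Xq where Xq: "smooth_near ?A Xq" "\<And>z \<phi>. (z, \<phi>) \<in> ?A \<Longrightarrow> Xz (z, \<phi>) = Xz (0, \<phi>) + z * Xq (z, \<phi>)"
    using hadamard[OF smX] by (auto simp del: atLeastAtMost_iff intro: unit_mult_Icc)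
  have Xq0: "Xq (0, \<phi>) = sqrt 2 * cos \<phi>" for \<phi>
  proof (rule at_zero_limit[OF Xq(1)])
    have "\<forall>\<^sub>F z in at_right 0. Xz (z, \<phi>) / z = Xq (z, \<phi>)"
      using eventually_at_right_real[of 0 "sqrt E0"] E0
      by (auto elim!: eventually_mono simp: Xq(2) XY0)
    with limX show "((\<lambda>z. Xq (z, \<phi>)) \<longlongrightarrow> sqrt 2 * cos \<phi>) (at_right 0)"
      by (rule Lim_transform_eventually)
  qed
  \<comment> \<open>\<open>D\<close> is \<open>X\<^sub>\<phi> / z\<close> at \<phi> = \<pi> / 2. Its
    value at \<open>z = 0\<close> is the derivative of \<open>sqrt 2 * cos \<phi>\<close>, namely
    \<open>- sqrt 2\<close>, so it stays nonzero for small \<open>z\<close> and may serve as a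
    denominator.\<close>
  define D where "D = (\<lambda>z::real. iter_dderiv Xq [(0, 1)] (z, pi / 2))"
  have smD: "smooth_near {0..sqrt E0} D" unfolding D_def
    by (rule smooth_near_compose[OF smooth_near_pd[OF Xq(1)]])
       (auto simp: Basis_prod_def intro!: smooth_intros)
  have "((\<lambda>\<phi>. Xq (0, \<phi>)) has_real_derivative 0 * iter_dderiv Xq [(1, 0)] (0, pi / 2)
     + 1 * iter_dderiv Xq [(0, 1)] (0, pi / 2)) (at (pi / 2))"
    by (rule chain2[OF Xq(1) DERIV_const DERIV_ident]) (use E0 in auto)
  moreover have "((\<lambda>\<phi>. sqrt 2 * cos \<phi>) has_real_derivative - sqrt 2) (at (pi / 2))"
    by (auto intro!: derivative_eq_intros)
  ultimately have D0: "D 0 = - sqrt 2"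
    using DERIV_unique unfolding Xq0 D_def by fastforce
  have XD: "iter_dderiv Xz [(0, 1)] (z, pi / 2) = z * D z" if z: "z \<in> {0..sqrt E0}" for z
  proof -
    have zA: "(z, pi / 2) \<in> ?A" using z by auto
    have "((\<lambda>\<phi>. Xz (z, \<phi>)) has_real_derivative 0 * iter_dderiv Xz [(1, 0)] (z, pi / 2)
     + 1 * iter_dderiv Xz [(0, 1)] (z, pi / 2)) (at (pi / 2))"
      by (rule chain2[OF smX DERIV_const DERIV_ident zA])
    moreover have "((\<lambda>\<phi>. Xq (z, \<phi>)) has_real_derivative 0 * iter_dderiv Xq [(1, 0)] (z, pi / 2)
     + 1 * D z) (at (pi / 2))"
      unfolding D_def by (rule chain2[OF Xq(1) DERIV_const DERIV_ident zA])
    then have "((\<lambda>\<phi>. z * Xq (z, \<phi>)) has_real_derivative z * D z) (at (pi / 2))"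
      by (auto intro!: derivative_eq_intros)
    moreover have "(\<lambda>\<phi>. Xz (z, \<phi>)) = (\<lambda>\<phi>. z * Xq (z, \<phi>))" using Xq(2) z by (auto simp: XY0)
    ultimately show ?thesis using DERIV_unique by fastforce
  qed
  have smHy': "smooth_near {(x, y, \<sigma>). (x, y) \<in> disc r0} (\<lambda>p. Hy (fst p, fst (snd p)))"
    by (rule smooth_near_compose[OF smHy]) (auto intro!: smooth_intros)
  obtain w where w: "smooth_near ({0..sqrt E0} \<times> (UNIV::real set) \<times> (UNIV::real set)) w"
    "\<And>z \<phi> \<sigma>. z \<in> {0..sqrt E0} \<Longrightarrow> Hy (Xz (z, \<phi>), Yz (z, \<phi>)) = z * w (z, \<phi>, \<sigma>)"
    using quotient[OF smHy'] Hy0 by auto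
  have "isCont D 0" by (rule smooth_near_isCont[OF smD]) (use E0 in auto)
  then have "\<forall>\<^sub>F z in at 0. D z < 0"
    using D0 by (intro order_tendstoD(2)[OF isContD]) auto
  then have "\<forall>\<^sub>F z in at_right 0. D z < 0" by (auto simp: eventually_at_split)
  then obtain b where b: "b > 0" "\<And>z. 0 < z \<Longrightarrow> z < b \<Longrightarrow> D z < 0"
    by (auto simp: eventually_at_right_field)
  define z1 where "z1 = min (b / 2) (sqrt E0)"
  have z1: "z1 > 0" "z1 \<le> sqrt E0" "z1 < b" using b E0 by (auto simp: z1_def)
  have Dn: "D z \<noteq> 0" if "z \<in> {0..z1}" for z
    using b(2)[of z] z1 that D0 by (cases "z = 0") auto
  have smw: "smooth_near {0..z1} (\<lambda>z. w (z, pi / 2, 0))"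
    by (rule smooth_near_compose[OF w(1)]) (use z1 in \<open>auto intro!: smooth_intros\<close>)
  have "smooth_near {0..z1} (\<lambda>z. w (z, pi / 2, 0) / D z)"
    by (intro smooth_near_divide smw smooth_near_subset[OF smD] Dn) (use z1 in auto)
  moreover have "\<omega> (z\<^sup>2) = w (z, pi / 2, 0) / D z" if z: "z \<in> {0<..z1}" for z
  proof -
    have "\<omega> (z\<^sup>2) * (z * D z) = z * w (z, pi / 2, 0)"
      using ode_Phi(1)[of z "pi / 2"] XD[of z] w(2)[of z "pi / 2" 0] z z1 by (auto simp: Phi_def)
    then have "\<omega> (z\<^sup>2) * D z = w (z, pi / 2, 0)" using z by simp
    then show ?thesis using Dn[of z] z by (auto simp: field_simps)
  qed
  ultimately show ?thesis using z1 by (intro exI[of _ z1] exI) auto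
qed

end

section \<open>Action and angle as local coordinates\<close>

locale center_rate = center +
  fixes z1 :: real and wz :: "real \<Rightarrow> real"
  assumes z1: "0 < z1" "z1 < sqrt E0"
    and wpos: "z \<in> {0<..z1} \<Longrightarrow> \<omega> (z\<^sup>2) > 1 / 2"
    and smw: "smooth_near {0..z1} wz"
    and weq: "z \<in> {0<..z1} \<Longrightarrow> \<omega> (z\<^sup>2) = wz z"
begin

lemma z1_range: "z \<in> {0<..z1} \<Longrightarrow> z \<in> {0<..sqrt E0}" "z \<in> {0<..z1} \<Longrightarrow> z \<in> {0<..<sqrt E0}"
  "z \<in> {0..z1} \<Longrightarrow> z \<in> {0..sqrt E0}"
  using z1 by auto

abbreviation "X1 \<equiv> iter_dderiv Xz [(1, 0)]"
abbreviation "X2 \<equiv> iter_dderiv Xz [(0, 1)]"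
abbreviation "Y1 \<equiv> iter_dderiv Yz [(1, 0)]"
abbreviation "Y2 \<equiv> iter_dderiv Yz [(0, 1)]"

text \<open>By Hamilton's equations, \<omega> times the determinant is the derivative in
  \<open>z\<close> of \<open>H0\<close> along \<open>Phi\<close>, and \<open>H0 = z\<^sup>2\<close>
  there.\<close>

lemma jacobian:
  assumes "z \<in> {0<..z1}"
  shows "\<omega> (z\<^sup>2) * (X2 (z, \<phi>) * Y1 (z, \<phi>) - Y2 (z, \<phi>) * X1 (z, \<phi>)) = 2 * z"
proof -
  have "\<omega> (z\<^sup>2) * (X2 (z, \<phi>) * Y1 (z, \<phi>) - Y2 (z, \<phi>) * X1 (z, \<phi>))
    = (\<omega> (z\<^sup>2) * X2 (z, \<phi>)) * Y1 (z, \<phi>) - (\<omega> (z\<^sup>2) * Y2 (z, \<phi>)) * X1 (z, \<phi>)"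
    by (simp add: algebra_simps del: iter_dderiv.simps)
  then show ?thesis
    using energy_Phi[OF z1_range(2)[OF assms], of \<phi>]
    unfolding ode_Phi[OF z1_range(1)[OF assms]] by (simp add: algebra_simps del: iter_dderiv.simps)
qed

text \<open>A punctured disc carries no continuous angle, so a branch with values in a window of
  length 2\<pi> centred at \<phi> is used. Inside the window it inverts \<open>Phi\<close>, because
  the angle is unique modulo 2\<pi>, and the inverse function theorem gives its derivative at the
  centre. The last conclusion, that it is an angle at all, holds at every point of small positive
  energy.\<close>

lemma angle_branch:
  assumes z: "z \<in> {0<..<z1}"
  obtains ang where "ang (Phi (z, \<phi>)) = \<phi>"
    "(ang has_derivative (\<lambda>k. \<omega> (z\<^sup>2) * (Y1 (z, \<phi>) * fst k - X1 (z, \<phi>) * snd k) / (2 * z))) (at (Phi (z, \<phi>)))"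
    "\<And>q. q \<in> disc r0 \<Longrightarrow> 0 < H0p q \<Longrightarrow> H0p q < z1\<^sup>2 \<Longrightarrow> Phi (sqrt (H0p q), ang q) = q"
proof -
  define Q where "Q = {q \<in> disc r0. 0 < H0p q \<and> H0p q < z1\<^sup>2}"
  have "\<exists>a. a \<in> {\<phi> - pi..<\<phi> + pi} \<and> Phi (sqrt (H0p q), a) = q" if "q \<in> Q" for q
  proof -
    have q: "q \<in> disc r0" "0 < H0p q" "H0p q < z1\<^sup>2" using that by (auto simp: Q_def)
    have "sqrt (H0p q) \<in> {0<..z1}" using q z1
      by (auto intro!: real_less_lsqrt less_imp_le)
    from z1_range(1)[OF this] obtain a where "a \<in> {\<phi> - pi..<(\<phi> - pi) + 2 * pi}" "Phi (sqrt (H0p q), a) = q"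
      by (rule Phi_surj[where p=q and c="\<phi> - pi"]) (use q in auto)
    then show ?thesis by (intro exI[of _ a]) auto
  qed
  then obtain ang where ang: "\<And>q. q \<in> Q \<Longrightarrow> ang q \<in> {\<phi> - pi..<\<phi> + pi}"
    "\<And>q. q \<in> Q \<Longrightarrow> Phi (sqrt (H0p q), ang q) = q" by metis
  define G where "G = (\<lambda>q. (sqrt (H0p q), ang q))"
  \<comment> \<open>On this open box the angle lies strictly inside the window, so
    \<open>ang\<close> recovers it without ambiguity.\<close>
  define S where "S = {0<..<z1} \<times> {\<phi> - pi<..<\<phi> + pi}"
  have GS: "G (Phi x) = x" if xS: "x \<in> S" for x
  proof -
    obtain u a where x: "x = (u, a)" "u \<in> {0<..<z1}" "a \<in> {\<phi> - pi<..<\<phi> + pi}"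
      using xS unfolding S_def by blast
    have u: "u \<in> {0<..z1}" using x by auto
    have H: "H0p (Phi (u, a)) = u\<^sup>2" "Phi (u, a) \<in> disc r0" using Phi_level[OF z1_range(1)[OF u]] by auto
    then have q: "Phi (u, a) \<in> Q" using x by (auto simp: Q_def intro: power_strict_mono)
    have s: "sqrt (H0p (Phi (u, a))) = u" using H x by simp
    obtain k where "ang (Phi (u, a)) - a = of_int k * (2 * pi)"
      using Phi_inj[OF z1_range(1)[OF u] _ ang(2)[OF q, unfolded s]] wpos[OF u] by auto
    then have "ang (Phi (u, a)) = a"
      using int_multiple_zero[of "ang (Phi (u, a))" "\<phi> - pi" "2 * pi" a] ang(1)[OF q] x by auto
    then show ?thesis by (simp add: G_def s x)
  qed
  have zS: "(z, \<phi>) \<in> S" using z by (auto simp: S_def)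
  have SA: "x \<in> {0..sqrt E0} \<times> UNIV" if "x \<in> S" for x using that z1 by (auto simp: S_def)
  have dPhi: "(Phi has_derivative (\<lambda>h. (fst h * X1 p + snd h * X2 p, fst h * Y1 p + snd h * Y2 p))) (at p)"
    if "p \<in> S" for p
    using smooth_near_derivative2[OF smX SA[OF that]] smooth_near_derivative2[OF smY SA[OF that]]
    unfolding Phi_def split_beta prod.collapse by (rule has_derivative_Pair)
  define w where "w = \<omega> (z\<^sup>2)"
  have zz: "z \<in> {0<..z1}" "z > 0" using z by auto
  have J: "w * (X2 (z, \<phi>) * Y1 (z, \<phi>) - Y2 (z, \<phi>) * X1 (z, \<phi>)) = 2 * z"
    using jacobian[OF zz(1)] by (simp add: w_def)
  \<comment> \<open>The inverse of the Jacobian matrix of \<open>Phi\<close>, whose determinant has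
    absolute value \<open>2 * z / w\<close>.\<close>
  define g' where "g' = (\<lambda>k. (w * (X2 (z, \<phi>) * snd k - Y2 (z, \<phi>) * fst k) / (2 * z),
     w * (Y1 (z, \<phi>) * fst k - X1 (z, \<phi>) * snd k) / (2 * z)))"
  have "(G has_derivative g') (at (Phi (z, \<phi>)))"
  proof (rule has_derivative_inverse_strong[where f=Phi and S=S])
    show "open S" by (auto simp: S_def intro!: open_Times)
    show "continuous_on S Phi"
      by (intro continuous_at_imp_continuous_on ballI has_derivative_continuous[OF dPhi])
    show "(\<lambda>h. (fst h * X1 (z, \<phi>) + snd h * X2 (z, \<phi>), fst h * Y1 (z, \<phi>) + snd h * Y2 (z, \<phi>))) \<circ> g' = id"
    proof
      fix k :: "real \<times> real"
      define a b c d where "a = X1 (z, \<phi>)" "b = X2 (z, \<phi>)" "c = Y1 (z, \<phi>)" "d = Y2 (z, \<phi>)"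
      have J': "w * (b * c - d * a) = 2 * z" using J by (simp only: a_b_c_d_def)
      have "w * (b * snd k - d * fst k) / (2 * z) * a + w * (c * fst k - a * snd k) / (2 * z) * b
        = (w * (b * c - d * a)) * fst k / (2 * z)" by (simp add: algebra_simps diff_divide_distrib add_divide_distrib)
      moreover have "w * (b * snd k - d * fst k) / (2 * z) * c + w * (c * fst k - a * snd k) / (2 * z) * d
        = (w * (b * c - d * a)) * snd k / (2 * z)" by (simp add: algebra_simps diff_divide_distrib add_divide_distrib)
      ultimately show "((\<lambda>h. (fst h * X1 (z, \<phi>) + snd h * X2 (z, \<phi>), fst h * Y1 (z, \<phi>) + snd h * Y2 (z, \<phi>))) \<circ> g') k = id k"
        using zz(2) unfolding J' by (simp add: g'_def a_b_c_d_def[symmetric] del: iter_dderiv.simps)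
    qed
  qed (use zS GS dPhi in auto)
  then have "((\<lambda>q. snd (G q)) has_derivative (\<lambda>k. snd (g' k))) (at (Phi (z, \<phi>)))"
    by (rule has_derivative_snd)
  then have 2: "(ang has_derivative (\<lambda>k. w * (Y1 (z, \<phi>) * fst k - X1 (z, \<phi>) * snd k) / (2 * z))) (at (Phi (z, \<phi>)))"
    by (simp add: G_def g'_def del: iter_dderiv.simps)
  have 1: "ang (Phi (z, \<phi>)) = \<phi>" using GS[OF zS] by (simp add: G_def)
  show ?thesis by (rule that[OF 1 2[unfolded w_def]]) (use ang(2) in \<open>auto simp: Q_def\<close>)
qed

text \<open>In the action equation a gradient of \<open>H0\<close> is multiplied by a gradient of
  \<open>h\<close> or by the force \<open>p\<close>; each factor is divisible by \<open>z\<close>,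
  whence \<open>z\<^sup>2\<close>. In the angle equation the derivative in \<open>E\<close> costs
  \<open>1 / (2 * z)\<close>, which the single factor \<open>z\<close> cancels. The last two
  conclusions keep the formulas in terms of gradients, because that is how the rates along true
  solutions are expressed.\<close>

lemma coefficients:
  fixes h p :: "real \<Rightarrow> real \<Rightarrow> real \<Rightarrow> real"
  defines "hA \<equiv> \<lambda>(x, y, \<sigma>). h x y \<sigma>" and "pA \<equiv> \<lambda>(x, y, \<sigma>). p x y \<sigma>"
  assumes smh: "smooth_near {(x, y, \<sigma>). (x, y) \<in> disc r0} hA"
    and smp: "smooth_near {(x, y, \<sigma>). (x, y) \<in> disc r0} pA"
    and h0: "\<And>\<sigma>. iter_dderiv hA [(1, 0, 0)] (0, 0, \<sigma>) = 0"
      "\<And>\<sigma>. iter_dderiv hA [(0, 1, 0)] (0, 0, \<sigma>) = 0"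
    and p0: "\<And>\<sigma>. pA (0, 0, \<sigma>) = 0"
  obtains fq gq where
    "smooth_near ({0..z1} \<times> UNIV \<times> UNIV) fq" "smooth_near ({0..z1} \<times> UNIV \<times> UNIV) gq"
    "\<And>z \<phi> \<sigma>. z \<in> {0<..z1} \<Longrightarrow>
       action_coeff \<omega> (angle_par \<omega> x0) (angle_par \<omega> y0) h p (z\<^sup>2) \<phi> \<sigma> = z\<^sup>2 * fq (z, \<phi>, \<sigma>)"
    "\<And>z \<phi> \<sigma>. z \<in> {0<..z1} \<Longrightarrow>
       angle_coeff \<omega> (angle_par \<omega> x0) (angle_par \<omega> y0) h p (z\<^sup>2) \<phi> \<sigma> = gq (z, \<phi>, \<sigma>)"
    "\<And>z \<phi> \<sigma>. z \<in> {0<..z1} \<Longrightarrow> z\<^sup>2 * fq (z, \<phi>, \<sigma>) =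
       Hx (Phi (z, \<phi>)) * iter_dderiv hA [(0, 1, 0)] (Xz (z, \<phi>), Yz (z, \<phi>), \<sigma>)
       - Hy (Phi (z, \<phi>)) * iter_dderiv hA [(1, 0, 0)] (Xz (z, \<phi>), Yz (z, \<phi>), \<sigma>)
       + Hy (Phi (z, \<phi>)) * pA (Xz (z, \<phi>), Yz (z, \<phi>), \<sigma>)"
    "\<And>z \<phi> \<sigma>. z \<in> {0<..z1} \<Longrightarrow> gq (z, \<phi>, \<sigma>) = \<omega> (z\<^sup>2) / (2 * z) * (
       iter_dderiv hA [(1, 0, 0)] (Xz (z, \<phi>), Yz (z, \<phi>), \<sigma>) * X1 (z, \<phi>)
       + iter_dderiv hA [(0, 1, 0)] (Xz (z, \<phi>), Yz (z, \<phi>), \<sigma>) * Y1 (z, \<phi>)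
       - pA (Xz (z, \<phi>), Yz (z, \<phi>), \<sigma>) * X1 (z, \<phi>))"
proof -
  let ?C = "{(x, y, \<sigma>::real). (x, y) \<in> disc r0}"
  let ?A = "{0..sqrt E0} \<times> (UNIV :: real set) \<times> (UNIV :: real set)"
  let ?A1 = "{0..z1} \<times> (UNIV :: real set) \<times> (UNIV :: real set)"
  define h1 h2 where "h1 = iter_dderiv hA [(1, 0, 0)]" and "h2 = iter_dderiv hA [(0, 1, 0)]"
  have sm1: "smooth_near ?C h1" and sm2: "smooth_near ?C h2"
    unfolding h1_def h2_def by (intro smooth_near_pd smh; simp add: Basis_prod_def zero_prod_def)+
  have smHx': "smooth_near ?C (\<lambda>q. Hx (fst q, fst (snd q)))"
    by (rule smooth_near_compose[OF smHx]) (auto intro!: smooth_intros)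
  have smHy': "smooth_near ?C (\<lambda>q. Hy (fst q, fst (snd q)))"
    by (rule smooth_near_compose[OF smHy]) (auto intro!: smooth_intros)
  obtain a1 where a1: "smooth_near ?A a1"
    "\<And>z \<phi> \<sigma>. z \<in> {0..sqrt E0} \<Longrightarrow> Hx (Xz (z, \<phi>), Yz (z, \<phi>)) = z * a1 (z, \<phi>, \<sigma>)"
    using quotient[OF smHx'] Hx0 by auto
  obtain a2 where a2: "smooth_near ?A a2"
    "\<And>z \<phi> \<sigma>. z \<in> {0..sqrt E0} \<Longrightarrow> Hy (Xz (z, \<phi>), Yz (z, \<phi>)) = z * a2 (z, \<phi>, \<sigma>)"
    using quotient[OF smHy'] Hy0 by auto
  obtain b1 where b1: "smooth_near ?A b1"
    "\<And>z \<phi> \<sigma>. z \<in> {0..sqrt E0} \<Longrightarrow> h1 (Xz (z, \<phi>), Yz (z, \<phi>), \<sigma>) = z * b1 (z, \<phi>, \<sigma>)"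
    using quotient[OF sm1] h0 by (auto simp: h1_def)
  obtain b2 where b2: "smooth_near ?A b2"
    "\<And>z \<phi> \<sigma>. z \<in> {0..sqrt E0} \<Longrightarrow> h2 (Xz (z, \<phi>), Yz (z, \<phi>), \<sigma>) = z * b2 (z, \<phi>, \<sigma>)"
    using quotient[OF sm2] h0 by (auto simp: h2_def)
  obtain b3 where b3: "smooth_near ?A b3"
    "\<And>z \<phi> \<sigma>. z \<in> {0..sqrt E0} \<Longrightarrow> pA (Xz (z, \<phi>), Yz (z, \<phi>), \<sigma>) = z * b3 (z, \<phi>, \<sigma>)"
    using quotient[OF smp] p0 by auto
  define fq where "fq = (\<lambda>q. a1 q * b2 q - a2 q * b1 q + a2 q * b3 q)"
  define gq where "gq = (\<lambda>q. wz (fst q) / 2 * (b1 q * X1 (fst q, fst (snd q))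
     + b2 q * Y1 (fst q, fst (snd q)) - b3 q * X1 (fst q, fst (snd q))))"
  have sub: "?A1 \<subseteq> ?A" using z1 by auto
  have sms: "smooth_near ?A1 a1" "smooth_near ?A1 a2" "smooth_near ?A1 b1" "smooth_near ?A1 b2" "smooth_near ?A1 b3"
    using smooth_near_subset[OF _ sub] a1 a2 b1 b2 b3 by blast+
  have smX1: "smooth_near ?A1 (\<lambda>q. X1 (fst q, fst (snd q)))"
    by (rule smooth_near_compose[OF smooth_near_pd[OF smX]])
       (use z1 in \<open>auto simp: Basis_prod_def intro!: smooth_intros\<close>)
  have smY1: "smooth_near ?A1 (\<lambda>q. Y1 (fst q, fst (snd q)))"
    by (rule smooth_near_compose[OF smooth_near_pd[OF smY]])
       (use z1 in \<open>auto simp: Basis_prod_def intro!: smooth_intros\<close>)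
  have smwz: "smooth_near ?A1 (\<lambda>q. wz (fst q))"
    by (rule smooth_near_compose[OF smw]) (auto intro!: smooth_intros)
  have s1: "smooth_near ?A1 fq" unfolding fq_def by (intro smooth_intros sms)
  have s2: "smooth_near ?A1 gq" unfolding gq_def by (intro smooth_intros sms smX1 smY1 smwz)
  have f1: "z\<^sup>2 * fq (z, \<phi>, \<sigma>) =
       Hx (Phi (z, \<phi>)) * h2 (Xz (z, \<phi>), Yz (z, \<phi>), \<sigma>)
       - Hy (Phi (z, \<phi>)) * h1 (Xz (z, \<phi>), Yz (z, \<phi>), \<sigma>)
       + Hy (Phi (z, \<phi>)) * pA (Xz (z, \<phi>), Yz (z, \<phi>), \<sigma>)" if "z \<in> {0<..z1}" for z \<phi> \<sigma>
  proof -
    have z: "z \<in> {0..sqrt E0}" using that z1 by auto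
    show ?thesis
      unfolding fq_def Phi_def prod.case a1(2)[OF z, of \<phi> \<sigma>] a2(2)[OF z, of \<phi> \<sigma>] b1(2)[OF z] b2(2)[OF z] b3(2)[OF z]
      by (simp add: algebra_simps power2_eq_square)
  qed
  have g1: "gq (z, \<phi>, \<sigma>) = \<omega> (z\<^sup>2) / (2 * z) * (h1 (Xz (z, \<phi>), Yz (z, \<phi>), \<sigma>) * X1 (z, \<phi>)
       + h2 (Xz (z, \<phi>), Yz (z, \<phi>), \<sigma>) * Y1 (z, \<phi>)
       - pA (Xz (z, \<phi>), Yz (z, \<phi>), \<sigma>) * X1 (z, \<phi>))" if "z \<in> {0<..z1}" for z \<phi> \<sigma>
  proof -
    have z: "z \<in> {0..sqrt E0}" "z > 0" using that z1 by auto
    show ?thesis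
      unfolding gq_def b1(2)[OF z(1)] b2(2)[OF z(1)] b3(2)[OF z(1)] weq[OF that]
      using z(2) by (simp add: field_simps del: iter_dderiv.simps)
  qed
  have f2: "action_coeff \<omega> (angle_par \<omega> x0) (angle_par \<omega> y0) h p (z\<^sup>2) \<phi> \<sigma> = z\<^sup>2 * fq (z, \<phi>, \<sigma>)"
    if "z \<in> {0<..z1}" for z \<phi> \<sigma>
  proof -
    have z: "z \<in> {0..sqrt E0}" using that z1 by auto
    have zA: "(z, \<phi>) \<in> {0..sqrt E0} \<times> UNIV" using z by auto
    have X: "((\<lambda>a. Xz (z, a)) has_real_derivative X2 (z, \<phi>)) (at \<phi>)"
      using chain2[OF smX DERIV_const DERIV_ident zA] by (simp del: iter_dderiv.simps)
    have Y: "((\<lambda>a. Yz (z, a)) has_real_derivative Y2 (z, \<phi>)) (at \<phi>)"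
      using chain2[OF smY DERIV_const DERIV_ident zA] by (simp del: iter_dderiv.simps)
    have d: "(Xz (z, \<phi>), Yz (z, \<phi>), \<sigma>) \<in> ?C" using Phi_disc[OF z] by (auto simp: Phi_def)
    have "((\<lambda>a. hA (Xz (z, a), Yz (z, a), \<sigma>)) has_real_derivative
       X2 (z, \<phi>) * h1 (Xz (z, \<phi>), Yz (z, \<phi>), \<sigma>) + Y2 (z, \<phi>) * h2 (Xz (z, \<phi>), Yz (z, \<phi>), \<sigma>)) (at \<phi>)"
      using chain3[OF smh X Y DERIV_const d] by (simp add: h1_def h2_def del: iter_dderiv.simps)
    then have 1: "deriv (\<lambda>a. h (Xz (z, a)) (Yz (z, a)) \<sigma>) \<phi>
       = X2 (z, \<phi>) * h1 (Xz (z, \<phi>), Yz (z, \<phi>), \<sigma>) + Y2 (z, \<phi>) * h2 (Xz (z, \<phi>), Yz (z, \<phi>), \<sigma>)"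
      by (intro DERIV_imp_deriv) (simp add: hA_def)
    have 2: "deriv (\<lambda>a. Xz (z, a)) \<phi> = X2 (z, \<phi>)" using X by (rule DERIV_imp_deriv)
    \<comment> \<open>Hamilton's equations exchange \<omega> times the angular derivatives of
      \<open>Xz\<close> and \<open>Yz\<close> for the gradient of \<open>H0\<close>.\<close>
    note ode = ode_Phi[OF z1_range(1)[OF that], of \<phi>]
    have ode2: "Hx (Phi (z, \<phi>)) = - (\<omega> (z\<^sup>2) * Y2 (z, \<phi>))" using ode(2) by simp
    show ?thesis
      unfolding action_coeff_def Xeq[OF z] Yeq[OF z] 1 2 f1[OF that] ode(1)[symmetric] ode2
      by (simp add: pA_def algebra_simps del: iter_dderiv.simps)
  qed
  have g2: "angle_coeff \<omega> (angle_par \<omega> x0) (angle_par \<omega> y0) h p (z\<^sup>2) \<phi> \<sigma> = gq (z, \<phi>, \<sigma>)"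
    if "z \<in> {0<..z1}" for z \<phi> \<sigma>
  proof -
    have z: "z \<in> {0..sqrt E0}" "z > 0" "sqrt (z\<^sup>2) = z" "z < sqrt E0" using that z1 by auto
    have zA: "(sqrt (z\<^sup>2), \<phi>) \<in> {0..sqrt E0} \<times> UNIV" using z by auto
    have S: "(sqrt has_real_derivative 1 / (2 * z)) (at (z\<^sup>2))"
      using z by (auto intro!: derivative_eq_intros simp: field_simps)
    have X: "((\<lambda>e. Xz (sqrt e, \<phi>)) has_real_derivative X1 (z, \<phi>) / (2 * z)) (at (z\<^sup>2))"
      using chain2[OF smX S DERIV_const zA] z by (simp del: iter_dderiv.simps)
    have Y: "((\<lambda>e. Yz (sqrt e, \<phi>)) has_real_derivative Y1 (z, \<phi>) / (2 * z)) (at (z\<^sup>2))"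
      using chain2[OF smY S DERIV_const zA] z by (simp del: iter_dderiv.simps)
    have d: "(Xz (sqrt (z\<^sup>2), \<phi>), Yz (sqrt (z\<^sup>2), \<phi>), \<sigma>) \<in> ?C"
      using Phi_disc[OF z(1)] z by (auto simp: Phi_def)
    have Z: "((\<lambda>e. hA (Xz (sqrt e, \<phi>), Yz (sqrt e, \<phi>), \<sigma>)) has_real_derivative
       (X1 (z, \<phi>) * h1 (Xz (z, \<phi>), Yz (z, \<phi>), \<sigma>) + Y1 (z, \<phi>) * h2 (Xz (z, \<phi>), Yz (z, \<phi>), \<sigma>)) / (2 * z)) (at (z\<^sup>2))"
      using chain3[OF smh X Y DERIV_const d] z by (simp add: h1_def h2_def add_divide_distrib del: iter_dderiv.simps)
    have O: "open {0<..<E0}" "z\<^sup>2 \<in> {0<..<E0}"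
      using z by (auto simp: real_less_rsqrt) (metis real_less_rsqrt real_sqrt_less_iff real_sqrt_abs abs_of_pos)
    have e: "sqrt e \<in> {0..sqrt E0} \<and> (sqrt e)\<^sup>2 = e" if "e \<in> {0<..<E0}" for e using that by auto
    have Xe: "angle_par \<omega> x0 \<phi> e = Xz (sqrt e, \<phi>)" "angle_par \<omega> y0 \<phi> e = Yz (sqrt e, \<phi>)" if "e \<in> {0<..<E0}" for e
      using e[OF that] Xeq[of "sqrt e" \<phi>] Yeq[of "sqrt e" \<phi>] by auto
    have 1: "deriv (\<lambda>e. h (angle_par \<omega> x0 \<phi> e) (angle_par \<omega> y0 \<phi> e) \<sigma>) (z\<^sup>2) =
      (X1 (z, \<phi>) * h1 (Xz (z, \<phi>), Yz (z, \<phi>), \<sigma>) + Y1 (z, \<phi>) * h2 (Xz (z, \<phi>), Yz (z, \<phi>), \<sigma>)) / (2 * z)"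
      by (intro DERIV_imp_deriv has_field_derivative_transform_within_open[OF Z O])
         (simp add: hA_def Xe)
    have 2: "deriv (\<lambda>e. angle_par \<omega> x0 \<phi> e) (z\<^sup>2) = X1 (z, \<phi>) / (2 * z)"
      by (intro DERIV_imp_deriv has_field_derivative_transform_within_open[OF X O]) (simp add: Xe)
    show ?thesis
      unfolding angle_coeff_def 1 2 g1[OF that] Xeq[OF z(1)] Yeq[OF z(1)]
      by (simp add: pA_def algebra_simps add_divide_distrib diff_divide_distrib del: iter_dderiv.simps)
  qed
  show ?thesis
    by (rule that[OF s1 s2 f2 g2]) (use f1 g1 in \<open>simp_all add: h1_def h2_def del: iter_dderiv.simps\<close>)
qed

end

section \<open>Expansions of the perturbed equations\<close>

lemma smooth_near_on: "smooth_on U f \<Longrightarrow> A \<subseteq> U \<Longrightarrow> smooth_near A f"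
  unfolding smooth_near_def by blast

lemma disc_scale:
  assumes "(x, y) \<in> disc r" "u \<in> {0..1}"
  shows "(u * x, u * y) \<in> disc r"
proof -
  have "u\<^sup>2 \<le> 1" using assms(2) by (simp add: power_le_one)
  then have "u\<^sup>2 * (x\<^sup>2 + y\<^sup>2) \<le> 1 * (x\<^sup>2 + y\<^sup>2)" by (intro mult_right_mono) auto
  then show ?thesis using assms(1) by (simp add: disc_def power_mult_distrib algebra_simps)
qed

lemma abs_le_norm_pair: "\<bar>x\<bar> \<le> norm (x, y)" "\<bar>y\<bar> \<le> norm (x, y)" for x y :: real
  using norm_fst_le[of x y] norm_snd_le[of y x] by auto

lemma pd3_slices:
  fixes f :: "real \<times> real \<times> real \<Rightarrow> real"
  assumes "smooth_near A f" "(x, y, t) \<in> A"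
  shows "((\<lambda>u. f (u, y, t)) has_real_derivative iter_dderiv f [(1, 0, 0)] (x, y, t)) (at x)"
    "((\<lambda>u. f (x, u, t)) has_real_derivative iter_dderiv f [(0, 1, 0)] (x, y, t)) (at y)"
  using chain3[OF assms(1) DERIV_ident DERIV_const DERIV_const assms(2)]
    chain3[OF assms(1) DERIV_const DERIV_ident DERIV_const assms(2)]
  by (simp_all del: iter_dderiv.simps)

lemma pd2_slices:
  fixes f :: "real \<times> real \<Rightarrow> real"
  assumes "smooth_near A f" "(x, y) \<in> A"
  shows "((\<lambda>u. f (u, y)) has_real_derivative iter_dderiv f [(1, 0)] (x, y)) (at x)"
    "((\<lambda>u. f (x, u)) has_real_derivative iter_dderiv f [(0, 1)] (x, y)) (at y)"
  using chain2[OF assms(1) DERIV_ident DERIV_const assms(2)]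
    chain2[OF assms(1) DERIV_const DERIV_ident assms(2)]
  by (simp_all del: iter_dderiv.simps)

text \<open>Stated for a generic function, so that it applies both to \<open>H\<close> with limit
  \<open>H0\<close> and to \<open>F\<close> with limit zero.\<close>

locale expansion =
  fixes r0 :: real and q :: nat and S :: "real \<Rightarrow> real" and G :: "real \<Rightarrow> real \<Rightarrow> real \<Rightarrow> real"
    and G0 :: "real \<Rightarrow> real \<Rightarrow> real" and Gk :: "nat \<Rightarrow> real \<Rightarrow> real \<Rightarrow> real \<Rightarrow> real"
  assumes exp: "has_perturbation_expansion r0 q S G G0 Gk"
    and smG: "smooth_on (UNIV \<times> UNIV \<times> {0<..}) (\<lambda>(x, y, t). G x y t)"
    and smG0: "smooth_near (disc r0) (\<lambda>(x, y). G0 x y)"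
    and smGk: "k \<ge> 1 \<Longrightarrow> smooth_near {(x, y, \<sigma>). (x, y) \<in> disc r0} (\<lambda>(x, y, \<sigma>). Gk k x y \<sigma>)"
    and smS: "smooth_on {0<..} S"
begin

definition "rem K = (\<lambda>(x, y, t). G x y t - G0 x y - (\<Sum>k=1..K. t powr (- (real k / real q)) * Gk k x y (S t)))"

abbreviation "T \<equiv> {(x, y, t). (x, y) \<in> disc r0 \<and> t > (0::real)}"

lemma rem_bound:
  assumes "set bs \<subseteq> Basis"
  shows "\<exists>C. \<forall>\<^sub>F t in at_top. \<forall>(x, y)\<in>disc r0.
     \<bar>iter_dderiv (rem K) bs (x, y, t)\<bar> \<le> C * t powr (- (real (K + 1) / real q))"
  using exp assms unfolding has_perturbation_expansion_def rem_def by blast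

lemma smG': "smooth_near T (\<lambda>(x, y, t). G x y t)"
  by (rule smooth_near_on[OF smG]) auto

lemma rem_smooth: "smooth_near T (rem K)"
proof -
  have 0: "smooth_near T (\<lambda>p. (\<lambda>(x, y). G0 x y) (fst p, fst (snd p)))"
    by (rule smooth_near_compose[OF smG0]) (auto intro!: smooth_intros)
  have S: "smooth_near T (\<lambda>p. S (snd (snd p)))"
    by (rule smooth_near_compose[OF smooth_near_on[OF smS order_refl]]) (auto intro!: smooth_intros)
  have k: "smooth_near T (\<lambda>p. (\<lambda>(x, y, \<sigma>). Gk k x y \<sigma>) (fst p, fst (snd p), S (snd (snd p))))" if "k \<ge> 1" for k
    by (rule smooth_near_compose[OF smGk[OF that]]) (auto intro!: smooth_intros S)
  have p: "smooth_near T (\<lambda>p. snd (snd p) powr a)" for a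
    by (intro smooth_intros) auto
  have "smooth_near T (\<lambda>p. (\<lambda>(x, y, t). G x y t) p - (\<lambda>(x, y). G0 x y) (fst p, fst (snd p))
    - (\<Sum>k=1..K. snd (snd p) powr (- (real k / real q)) *
        (\<lambda>(x, y, \<sigma>). Gk k x y \<sigma>) (fst p, fst (snd p), S (snd (snd p)))))"
    by (intro smooth_near_diff smooth_near_sum smooth_near_mult smG' 0 p k) auto
  then show ?thesis by (simp add: rem_def case_prod_beta')
qed

text \<open>The expansion may be differentiated once more, which bounds the gradient of the
  remainder; by the mean value theorem on the segment from the origin, a remainder vanishing at the
  equilibrium gains the factor \<open>norm (x, y)\<close>. Such relative errors are required because
  estimates are made at arbitrarily small distance from the equilibrium.\<close>

lemma rem_lipschitz:
  assumes bs: "set bs \<subseteq> Basis" and z: "\<And>t. t > 0 \<Longrightarrow> iter_dderiv (rem K) bs (0, 0, t) = 0"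
  obtains C where "C > 0" "\<forall>\<^sub>F t in at_top. \<forall>(x, y)\<in>disc r0.
     \<bar>iter_dderiv (rem K) bs (x, y, t)\<bar> \<le> C * norm (x, y) * t powr (- (real (K + 1) / real q))"
proof -
  let ?D = "iter_dderiv (rem K) bs"
  have smD: "smooth_near T ?D" by (rule smooth_near_iter_dderiv[OF rem_smooth bs])
  obtain C1 where C1: "\<forall>\<^sub>F t in at_top. \<forall>(x, y)\<in>disc r0.
     \<bar>iter_dderiv (rem K) ((1, 0, 0) # bs) (x, y, t)\<bar> \<le> C1 * t powr (- (real (K + 1) / real q))"
    using rem_bound[of "(1, 0, 0) # bs" K] bs by (auto simp: Basis_prod_def zero_prod_def simp del: iter_dderiv.simps)
  obtain C2 where C2: "\<forall>\<^sub>F t in at_top. \<forall>(x, y)\<in>disc r0.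
     \<bar>iter_dderiv (rem K) ((0, 1, 0) # bs) (x, y, t)\<bar> \<le> C2 * t powr (- (real (K + 1) / real q))"
    using rem_bound[of "(0, 1, 0) # bs" K] bs by (auto simp: Basis_prod_def zero_prod_def simp del: iter_dderiv.simps)
  show ?thesis
  proof (rule that[of "\<bar>C1\<bar> + \<bar>C2\<bar> + 1"])
    show "\<forall>\<^sub>F t in at_top. \<forall>(x, y)\<in>disc r0. \<bar>?D (x, y, t)\<bar>
       \<le> (\<bar>C1\<bar> + \<bar>C2\<bar> + 1) * norm (x, y) * t powr (- (real (K + 1) / real q))"
      using C1 C2 eventually_gt_at_top[of 0]
    proof eventually_elim
      case (elim t)
      define w where "w = t powr (- (real (K + 1) / real q))"
      show ?case unfolding w_def[symmetric]
      proof safe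
        fix x y assume xy: "(x, y) \<in> disc r0"
        have "((\<lambda>u. ?D (u * x, u * y, t)) has_real_derivative
            x * iter_dderiv ?D [(1, 0, 0)] (u * x, u * y, t) + y * iter_dderiv ?D [(0, 1, 0)] (u * x, u * y, t)
            + 0 * iter_dderiv ?D [(0, 0, 1)] (u * x, u * y, t)) (at u)" if "u \<in> {0..1}" for u
          by (rule chain3[OF smD]) (use disc_scale[OF xy that] elim in \<open>auto intro!: derivative_eq_intros\<close>)
        then have d: "((\<lambda>u. ?D (u * x, u * y, t)) has_real_derivative
            x * iter_dderiv (rem K) ((1, 0, 0) # bs) (u * x, u * y, t)
            + y * iter_dderiv (rem K) ((0, 1, 0) # bs) (u * x, u * y, t)) (at u)" if "0 \<le> u" "u \<le> 1" for u
          using that by (simp add: iter_dderiv_append del: iter_dderiv.simps)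
        obtain u where u: "0 < u" "u < 1" "?D (1 * x, 1 * y, t) - ?D (0 * x, 0 * y, t) = (1 - 0) *
            (x * iter_dderiv (rem K) ((1, 0, 0) # bs) (u * x, u * y, t)
            + y * iter_dderiv (rem K) ((0, 1, 0) # bs) (u * x, u * y, t))"
          using MVT2[OF zero_less_one d] by auto
        have w0: "w \<ge> 0" by (simp add: w_def)
        have uu: "(u * x, u * y) \<in> disc r0" using disc_scale[OF xy, of u] u by auto
        have "\<bar>iter_dderiv (rem K) ((1, 0, 0) # bs) (u * x, u * y, t)\<bar> \<le> C1 * w"
          using elim(1) uu unfolding w_def by blast
        then have b1: "\<bar>iter_dderiv (rem K) ((1, 0, 0) # bs) (u * x, u * y, t)\<bar> \<le> \<bar>C1\<bar> * w"
          using mult_right_mono[OF abs_ge_self[of C1] w0] by linarith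
        have "\<bar>iter_dderiv (rem K) ((0, 1, 0) # bs) (u * x, u * y, t)\<bar> \<le> C2 * w"
          using elim(2) uu unfolding w_def by blast
        then have b2: "\<bar>iter_dderiv (rem K) ((0, 1, 0) # bs) (u * x, u * y, t)\<bar> \<le> \<bar>C2\<bar> * w"
          using mult_right_mono[OF abs_ge_self[of C2] w0] by linarith
        have "?D (x, y, t) = x * iter_dderiv (rem K) ((1, 0, 0) # bs) (u * x, u * y, t)
            + y * iter_dderiv (rem K) ((0, 1, 0) # bs) (u * x, u * y, t)"
          using u(3) z[OF elim(3)] by simp
        also have "\<bar>\<dots>\<bar> \<le> \<bar>x\<bar> * (\<bar>C1\<bar> * w) + \<bar>y\<bar> * (\<bar>C2\<bar> * w)"
          by (intro order_trans[OF abs_triangle_ineq] add_mono)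
             (auto simp only: abs_mult intro!: mult_left_mono b1 b2)
        also have "\<dots> \<le> norm (x, y) * (\<bar>C1\<bar> * w) + norm (x, y) * (\<bar>C2\<bar> * w)"
          using w0 by (intro add_mono mult_mono abs_le_norm_pair mult_right_mono) auto
        also have "\<dots> \<le> (\<bar>C1\<bar> + \<bar>C2\<bar> + 1) * norm (x, y) * w"
          using w0 by (simp add: algebra_simps)
        finally show "\<bar>?D (x, y, t)\<bar> \<le> (\<bar>C1\<bar> + \<bar>C2\<bar> + 1) * norm (x, y) * w" .
      qed
    qed
  qed auto
qed

lemma rem_partials:
  assumes "(x, y) \<in> disc r0" "t > 0"
  shows "iter_dderiv (rem K) [(1, 0, 0)] (x, y, t) = iter_dderiv (\<lambda>(x, y, t). G x y t) [(1, 0, 0)] (x, y, t)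
      - iter_dderiv (\<lambda>(x, y). G0 x y) [(1, 0)] (x, y) - (\<Sum>k=1..K. t powr (- (real k / real q)) *
         iter_dderiv (\<lambda>(x, y, \<sigma>). Gk k x y \<sigma>) [(1, 0, 0)] (x, y, S t))"
    "iter_dderiv (rem K) [(0, 1, 0)] (x, y, t) = iter_dderiv (\<lambda>(x, y, t). G x y t) [(0, 1, 0)] (x, y, t)
      - iter_dderiv (\<lambda>(x, y). G0 x y) [(0, 1)] (x, y) - (\<Sum>k=1..K. t powr (- (real k / real q)) *
         iter_dderiv (\<lambda>(x, y, \<sigma>). Gk k x y \<sigma>) [(0, 1, 0)] (x, y, S t))"
proof -
  have T: "(x, y, t) \<in> T" using assms by auto
  have k: "(x, y, S t) \<in> {(x, y, \<sigma>). (x, y) \<in> disc r0}" using assms by auto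
  note A = pd3_slices[OF rem_smooth T, of K] pd3_slices[OF smG' T]
    pd2_slices[OF smG0 assms(1)]
  have B: "1 \<le> k \<Longrightarrow> ((\<lambda>u. Gk k u y (S t)) has_real_derivative iter_dderiv (\<lambda>(x, y, \<sigma>). Gk k x y \<sigma>) [(1, 0, 0)] (x, y, S t)) (at x)"
    "1 \<le> k \<Longrightarrow> ((\<lambda>u. Gk k x u (S t)) has_real_derivative iter_dderiv (\<lambda>(x, y, \<sigma>). Gk k x y \<sigma>) [(0, 1, 0)] (x, y, S t)) (at y)" for k
    using pd3_slices[OF smGk k, of k] by (auto simp del: iter_dderiv.simps)
  have "((\<lambda>u. rem K (u, y, t)) has_real_derivative iter_dderiv (\<lambda>(x, y, t). G x y t) [(1, 0, 0)] (x, y, t)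
      - iter_dderiv (\<lambda>(x, y). G0 x y) [(1, 0)] (x, y) - (\<Sum>k=1..K. t powr (- (real k / real q)) *
         iter_dderiv (\<lambda>(x, y, \<sigma>). Gk k x y \<sigma>) [(1, 0, 0)] (x, y, S t))) (at x)"
    unfolding rem_def prod.case using A(3,5)
    by (intro DERIV_diff DERIV_sum DERIV_cmult B) (auto simp del: iter_dderiv.simps)
  then show "iter_dderiv (rem K) [(1, 0, 0)] (x, y, t) = iter_dderiv (\<lambda>(x, y, t). G x y t) [(1, 0, 0)] (x, y, t)
      - iter_dderiv (\<lambda>(x, y). G0 x y) [(1, 0)] (x, y) - (\<Sum>k=1..K. t powr (- (real k / real q)) *
         iter_dderiv (\<lambda>(x, y, \<sigma>). Gk k x y \<sigma>) [(1, 0, 0)] (x, y, S t))"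
    by (rule DERIV_unique[OF A(1)])
  have "((\<lambda>u. rem K (x, u, t)) has_real_derivative iter_dderiv (\<lambda>(x, y, t). G x y t) [(0, 1, 0)] (x, y, t)
      - iter_dderiv (\<lambda>(x, y). G0 x y) [(0, 1)] (x, y) - (\<Sum>k=1..K. t powr (- (real k / real q)) *
         iter_dderiv (\<lambda>(x, y, \<sigma>). Gk k x y \<sigma>) [(0, 1, 0)] (x, y, S t))) (at y)"
    unfolding rem_def prod.case using A(4,6)
    by (intro DERIV_diff DERIV_sum DERIV_cmult B) (auto simp del: iter_dderiv.simps)
  then show "iter_dderiv (rem K) [(0, 1, 0)] (x, y, t) = iter_dderiv (\<lambda>(x, y, t). G x y t) [(0, 1, 0)] (x, y, t)
      - iter_dderiv (\<lambda>(x, y). G0 x y) [(0, 1)] (x, y) - (\<Sum>k=1..K. t powr (- (real k / real q)) *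
         iter_dderiv (\<lambda>(x, y, \<sigma>). Gk k x y \<sigma>) [(0, 1, 0)] (x, y, S t))"
    by (rule DERIV_unique[OF A(2)])
qed

end

section \<open>The perturbed vector field near the equilibrium\<close>

locale perturbed = center_rate +
  fixes H F :: "real \<Rightarrow> real \<Rightarrow> real \<Rightarrow> real" and q :: nat and s :: "nat \<Rightarrow> real" and S :: "real \<Rightarrow> real"
    and Hk Fk :: "nat \<Rightarrow> real \<Rightarrow> real \<Rightarrow> real \<Rightarrow> real"
  assumes ps: "perturbed_system H F H0 r0 q s S Hk Fk"
begin

lemma q1: "q \<ge> 1" and phase: "phase_function q s S" and smS: "smooth_on {0<..} S"
  using ps by (auto simp: perturbed_system_def phase_function_def)

lemma smH0': "smooth_near (disc r0) (\<lambda>(x, y). H0 x y)"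
  using smH0 by (simp add: H0p_def)

sublocale HE: expansion r0 q S H H0 Hk
  using ps smH0' smS by unfold_locales (auto simp: perturbed_system_def)

lemma const_smooth: "smooth_near A (\<lambda>(x::real, y::real). 0::real)"
  by (simp add: case_prod_beta' smooth_intros)

sublocale FE: expansion r0 q S F "\<lambda>x y. 0" Fk
  using ps smS const_smooth by unfold_locales (auto simp: perturbed_system_def)

abbreviation "hA k \<equiv> \<lambda>(x, y, \<sigma>). Hk k x y \<sigma>"
abbreviation "pA k \<equiv> \<lambda>(x, y, \<sigma>). Fk k x y \<sigma>"

lemma equilibrium: "t > 0 \<Longrightarrow> deriv (\<lambda>\<xi>. H \<xi> 0 t) 0 = 0" "t > 0 \<Longrightarrow> deriv (\<lambda>\<eta>. H 0 \<eta> t) 0 = 0" "t > 0 \<Longrightarrow> F 0 0 t = 0"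
  using ps by (auto simp: perturbed_system_def)

lemma pA0:
  assumes "k \<ge> 1" shows "pA k (0, 0, \<sigma>) = 0"
proof -
  have "(\<lambda>(x, y). Fk k x y \<sigma>) \<in> O[nhds (0, 0)](\<lambda>(x, y). sqrt (x\<^sup>2 + y\<^sup>2))"
    using ps assms by (auto simp: perturbed_system_def)
  then obtain c where "\<forall>\<^sub>F p in nhds (0, 0). norm ((\<lambda>(x, y). Fk k x y \<sigma>) p) \<le> c * norm ((\<lambda>(x, y). sqrt (x\<^sup>2 + y\<^sup>2)) p)"
    by (rule landau_o.bigE)
  then show ?thesis using eventually_nhds_x_imp_x by fastforce
qed

text \<open>A function of order \<open>O(r\<^sup>2)\<close> has zero gradient at the origin. The
  phase is frozen first, as the order is known for each \<sigma> separately.\<close>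

lemma hA0:
  assumes "k \<ge> 1"
  shows "iter_dderiv (hA k) [(1, 0, 0)] (0, 0, \<sigma>) = 0" "iter_dderiv (hA k) [(0, 1, 0)] (0, 0, \<sigma>) = 0"
proof -
  let ?f = "\<lambda>p. hA k (fst p, snd p, \<sigma>)"
  have "(\<lambda>(x, y). Hk k x y \<sigma>) \<in> O[nhds (0, 0)](\<lambda>(x, y). sqrt (x\<^sup>2 + y\<^sup>2) ^ 2)"
    using ps assms by (auto simp: perturbed_system_def)
  then have O: "?f \<in> O[nhds 0](\<lambda>p. norm p ^ 2)"
    by (simp add: case_prod_beta' norm_prod_def zero_prod_def)
  have A: "(0, 0, \<sigma>) \<in> {(x, y, \<sigma>). (x, y) \<in> disc r0}" using disc0 by auto
  have sm: "smooth_near {0} ?f"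
    by (rule smooth_near_compose[OF HE.smGk[OF assms]]) (use disc0 in \<open>auto intro!: smooth_intros simp: zero_prod_def\<close>)
  have 0: "(0::real, 0::real) \<in> {0}" by (simp add: zero_prod_def)
  note z = bigo_square_gradient_zero(2)[OF smooth_near_derivative2[OF sm singletonI] O]
  have "iter_dderiv ?f [(1, 0)] (0, 0) = 0" "iter_dderiv ?f [(0, 1)] (0, 0) = 0"
    using z[of "(1, 0)"] z[of "(0, 1)"] by (simp_all add: zero_prod_def del: iter_dderiv.simps)
  moreover have "iter_dderiv ?f [(1, 0)] (0, 0) = iter_dderiv (hA k) [(1, 0, 0)] (0, 0, \<sigma>)"
    using DERIV_unique[OF pd2_slices(1)[OF sm 0, simplified] pd3_slices(1)[OF HE.smGk[OF assms] A, simplified]]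
    by simp
  moreover have "iter_dderiv ?f [(0, 1)] (0, 0) = iter_dderiv (hA k) [(0, 1, 0)] (0, 0, \<sigma>)"
    using DERIV_unique[OF pd2_slices(2)[OF sm 0, simplified] pd3_slices(2)[OF HE.smGk[OF assms] A, simplified]]
    by simp
  ultimately show "iter_dderiv (hA k) [(1, 0, 0)] (0, 0, \<sigma>) = 0" "iter_dderiv (hA k) [(0, 1, 0)] (0, 0, \<sigma>) = 0"
    by metis+
qed

definition "HX x y t = deriv (\<lambda>\<xi>. H \<xi> y t) x"
definition "HY x y t = deriv (\<lambda>\<eta>. H x \<eta> t) y"

lemma HXY:
  assumes "t > 0"
  shows "HX x y t = iter_dderiv (\<lambda>(x, y, t). H x y t) [(1, 0, 0)] (x, y, t)"
    "HY x y t = iter_dderiv (\<lambda>(x, y, t). H x y t) [(0, 1, 0)] (x, y, t)"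
proof -
  have U: "smooth_near (UNIV \<times> UNIV \<times> {0<..}) (\<lambda>(x, y, t). H x y t)"
    by (rule smooth_near_on[OF HE.smG order_refl])
  have A: "(x, y, t) \<in> UNIV \<times> UNIV \<times> {0<..}" using assms by auto
  show "HX x y t = iter_dderiv (\<lambda>(x, y, t). H x y t) [(1, 0, 0)] (x, y, t)"
    unfolding HX_def using pd3_slices(1)[OF U A] by (intro DERIV_imp_deriv) (simp del: iter_dderiv.simps)
  show "HY x y t = iter_dderiv (\<lambda>(x, y, t). H x y t) [(0, 1, 0)] (x, y, t)"
    unfolding HY_def using pd3_slices(2)[OF U A] by (intro DERIV_imp_deriv) (simp del: iter_dderiv.simps)
qed

text \<open>At the origin everything vanishes: the exact field because \<open>(0, 0)\<close> is an
  equilibrium, the coefficients by their orders \<open>O(r\<^sup>2)\<close> and \<open>O(r)\<close>.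
  Hence \<open>rem_lipschitz\<close> applies to all three remainders.\<close>

lemma gradient_expansion:
  obtains C where "C > 0" "\<forall>\<^sub>F t in at_top. \<forall>(x, y)\<in>disc r0.
     \<bar>HX x y t - Hx (x, y) - (\<Sum>k=1..K. t powr (- (real k / real q)) * iter_dderiv (hA k) [(1, 0, 0)] (x, y, S t))\<bar>
        \<le> C * norm (x, y) * t powr (- (real (K + 1) / real q)) \<and>
     \<bar>HY x y t - Hy (x, y) - (\<Sum>k=1..K. t powr (- (real k / real q)) * iter_dderiv (hA k) [(0, 1, 0)] (x, y, S t))\<bar>
        \<le> C * norm (x, y) * t powr (- (real (K + 1) / real q)) \<and>
     \<bar>F x y t - (\<Sum>k=1..K. t powr (- (real k / real q)) * pA k (x, y, S t))\<bar>
        \<le> C * norm (x, y) * t powr (- (real (K + 1) / real q))"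
proof -
  have e1: "iter_dderiv (HE.rem K) [(1, 0, 0)] (x, y, t) = HX x y t - Hx (x, y)
      - (\<Sum>k=1..K. t powr (- (real k / real q)) * iter_dderiv (hA k) [(1, 0, 0)] (x, y, S t))"
    and e2: "iter_dderiv (HE.rem K) [(0, 1, 0)] (x, y, t) = HY x y t - Hy (x, y)
      - (\<Sum>k=1..K. t powr (- (real k / real q)) * iter_dderiv (hA k) [(0, 1, 0)] (x, y, S t))"
    if "(x, y) \<in> disc r0" "t > 0" for x y t
    using HE.rem_partials[OF that, of K] HXY[OF that(2), of x y]
    by (simp_all add: Hx_def Hy_def H0p_def del: iter_dderiv.simps)
  have e3: "iter_dderiv (FE.rem K) [] (x, y, t) = F x y t - (\<Sum>k=1..K. t powr (- (real k / real q)) * pA k (x, y, S t))" for x y t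
    by (simp add: FE.rem_def)
  have z1: "iter_dderiv (HE.rem K) [(1, 0, 0)] (0, 0, t) = 0" and z2: "iter_dderiv (HE.rem K) [(0, 1, 0)] (0, 0, t) = 0"
    and z3: "iter_dderiv (FE.rem K) [] (0, 0, t) = 0" if "t > 0" for t
    using e1[OF disc0(1) that] e2[OF disc0(1) that] e3[of 0 0 t] equilibrium[OF that] hA0 pA0
    by (simp_all add: HX_def HY_def Hx0 Hy0 del: iter_dderiv.simps)
  obtain C1 where C1: "C1 > 0" "\<forall>\<^sub>F t in at_top. \<forall>(x, y)\<in>disc r0.
     \<bar>iter_dderiv (HE.rem K) [(1, 0, 0)] (x, y, t)\<bar> \<le> C1 * norm (x, y) * t powr (- (real (K + 1) / real q))"
    using HE.rem_lipschitz[OF _ z1] by (auto simp: Basis_prod_def zero_prod_def simp del: iter_dderiv.simps)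
  obtain C2 where C2: "C2 > 0" "\<forall>\<^sub>F t in at_top. \<forall>(x, y)\<in>disc r0.
     \<bar>iter_dderiv (HE.rem K) [(0, 1, 0)] (x, y, t)\<bar> \<le> C2 * norm (x, y) * t powr (- (real (K + 1) / real q))"
    using HE.rem_lipschitz[OF _ z2] by (auto simp: Basis_prod_def zero_prod_def simp del: iter_dderiv.simps)
  obtain C3 where C3: "C3 > 0" "\<forall>\<^sub>F t in at_top. \<forall>(x, y)\<in>disc r0.
     \<bar>iter_dderiv (FE.rem K) [] (x, y, t)\<bar> \<le> C3 * norm (x, y) * t powr (- (real (K + 1) / real q))"
    using FE.rem_lipschitz[OF _ z3] by (auto simp del: iter_dderiv.simps)
  define C where "C = C1 + C2 + C3"
  show ?thesis
  proof (rule that[of C])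
    show "C > 0" using C1 C2 C3 by (simp add: C_def)
    show "\<forall>\<^sub>F t in at_top. \<forall>(x, y)\<in>disc r0.
     \<bar>HX x y t - Hx (x, y) - (\<Sum>k=1..K. t powr (- (real k / real q)) * iter_dderiv (hA k) [(1, 0, 0)] (x, y, S t))\<bar>
        \<le> C * norm (x, y) * t powr (- (real (K + 1) / real q)) \<and>
     \<bar>HY x y t - Hy (x, y) - (\<Sum>k=1..K. t powr (- (real k / real q)) * iter_dderiv (hA k) [(0, 1, 0)] (x, y, S t))\<bar>
        \<le> C * norm (x, y) * t powr (- (real (K + 1) / real q)) \<and>
     \<bar>F x y t - (\<Sum>k=1..K. t powr (- (real k / real q)) * pA k (x, y, S t))\<bar>
        \<le> C * norm (x, y) * t powr (- (real (K + 1) / real q))"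
      using C1(2) C2(2) C3(2) eventually_gt_at_top[of 0]
    proof eventually_elim
      case (elim t)
      define w where "w = t powr (- (real (K + 1) / real q))"
      have w: "w \<ge> 0" by (simp add: w_def)
      have up: "C' * norm (x, y) * w \<le> C * norm (x, y) * w" if "C' \<le> C" for C' and x y :: real
        using that w by (intro mult_right_mono) auto
      have "\<bar>HX x y t - Hx (x, y) - (\<Sum>k=1..K. t powr (- (real k / real q)) * iter_dderiv (hA k) [(1, 0, 0)] (x, y, S t))\<bar>
          \<le> C * norm (x, y) * w \<and>
        \<bar>HY x y t - Hy (x, y) - (\<Sum>k=1..K. t powr (- (real k / real q)) * iter_dderiv (hA k) [(0, 1, 0)] (x, y, S t))\<bar>
          \<le> C * norm (x, y) * w \<and>
        \<bar>F x y t - (\<Sum>k=1..K. t powr (- (real k / real q)) * pA k (x, y, S t))\<bar> \<le> C * norm (x, y) * w"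
        if xy: "(x, y) \<in> disc r0" for x y
      proof -
        have A: "\<bar>HX x y t - Hx (x, y) - (\<Sum>k=1..K. t powr (- (real k / real q)) * iter_dderiv (hA k) [(1, 0, 0)] (x, y, S t))\<bar> \<le> C * norm (x, y) * w"
          unfolding e1[OF xy elim(4), symmetric]
          by (rule order_trans[OF _ up[of C1]]) (use elim(1) xy C1 C2 C3 in \<open>auto simp: C_def w_def simp del: iter_dderiv.simps\<close>)
        have B: "\<bar>HY x y t - Hy (x, y) - (\<Sum>k=1..K. t powr (- (real k / real q)) * iter_dderiv (hA k) [(0, 1, 0)] (x, y, S t))\<bar> \<le> C * norm (x, y) * w"
          unfolding e2[OF xy elim(4), symmetric]
          by (rule order_trans[OF _ up[of C2]]) (use elim(2) xy C1 C2 C3 in \<open>auto simp: C_def w_def simp del: iter_dderiv.simps\<close>)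
        have C: "\<bar>F x y t - (\<Sum>k=1..K. t powr (- (real k / real q)) * pA k (x, y, S t))\<bar> \<le> C * norm (x, y) * w"
          unfolding e3[symmetric]
          by (rule order_trans[OF _ up[of C3]]) (use elim(3) xy C1 C2 C3 in \<open>auto simp: C_def w_def simp del: iter_dderiv.simps\<close>)
        show ?thesis using A B C by blast
      qed
      then show ?case unfolding w_def by (auto simp del: iter_dderiv.simps)
    qed
  qed
qed

end

section \<open>Rates of energy and angle along true solutions\<close>

context perturbed
begin

lemma Phi_in_disc: "z \<in> {0<..z1} \<Longrightarrow> (Xz (z, \<phi>), Yz (z, \<phi>)) \<in> disc r0"
  using Phi_disc[of z \<phi>] z1 by (auto simp: Phi_def)

lemma Hk_periodic:
  assumes "k \<ge> 1" "(x, y) \<in> disc r0"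
  shows "Hk k x y (\<sigma> + of_int j * (2 * pi)) = Hk k x y \<sigma>" "Fk k x y (\<sigma> + of_int j * (2 * pi)) = Fk k x y \<sigma>"
proof -
  have "periodic (2 * pi) (Hk k x y)" "periodic (2 * pi) (Fk k x y)"
    using ps assms by (auto simp: perturbed_system_def)
  then show "Hk k x y (\<sigma> + of_int j * (2 * pi)) = Hk k x y \<sigma>" "Fk k x y (\<sigma> + of_int j * (2 * pi)) = Fk k x y \<sigma>"
    by (auto intro: periodic_int)
qed

text \<open>With \<phi> fixed, the phase may be replaced by any representative modulo 2\<pi>; this
  brings the unbounded \<open>S t\<close> into a compact interval.\<close>

lemma action_coeff_periodic:
  assumes "k \<ge> 1" "z \<in> {0<..z1}"
  shows "action_coeff \<omega> (angle_par \<omega> x0) (angle_par \<omega> y0) (Hk k) (Fk k) (z\<^sup>2) \<phi> (\<sigma> + of_int j * (2 * pi))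
    = action_coeff \<omega> (angle_par \<omega> x0) (angle_par \<omega> y0) (Hk k) (Fk k) (z\<^sup>2) \<phi> \<sigma>"
proof -
  have z: "z \<in> {0..sqrt E0}" using assms z1 by auto
  show ?thesis
    unfolding action_coeff_def Xeq[OF z] Yeq[OF z] Hk_periodic[OF assms(1) Phi_in_disc[OF assms(2)]] ..
qed

lemma angle_coeff_periodic:
  assumes "k \<ge> 1" "z \<in> {0<..z1}"
  shows "angle_coeff \<omega> (angle_par \<omega> x0) (angle_par \<omega> y0) (Hk k) (Fk k) (z\<^sup>2) \<phi> (\<sigma> + of_int j * (2 * pi))
    = angle_coeff \<omega> (angle_par \<omega> x0) (angle_par \<omega> y0) (Hk k) (Fk k) (z\<^sup>2) \<phi> \<sigma>"
proof -
  have z: "z \<in> {0..sqrt E0}" "z > 0" "z < sqrt E0" using assms z1 by auto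
  have "z\<^sup>2 \<in> {0<..<E0}"
    using z E0 by (auto simp: real_less_rsqrt) (metis real_less_rsqrt real_sqrt_less_iff real_sqrt_abs abs_of_pos)
  \<comment> \<open>The coefficient contains a derivative in \<open>E\<close>, so periodicity is
    needed on a whole neighbourhood of \<open>z\<^sup>2\<close>.\<close>
  then have "\<forall>\<^sub>F e in nhds (z\<^sup>2). e \<in> {0<..<E0}"
    by (intro eventually_nhds_in_open) auto
  then have "\<forall>\<^sub>F e in nhds (z\<^sup>2).
      Hk k (angle_par \<omega> x0 \<phi> e) (angle_par \<omega> y0 \<phi> e) (\<sigma> + of_int j * (2 * pi))
      = Hk k (angle_par \<omega> x0 \<phi> e) (angle_par \<omega> y0 \<phi> e) \<sigma>"
  proof eventually_elim
    case (elim e)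
    then have s: "sqrt e \<in> {0<..sqrt E0}" "sqrt e \<in> {0..sqrt E0}" "(sqrt e)\<^sup>2 = e" by auto
    show ?case
      using Hk_periodic(1)[OF assms(1), of "Xz (sqrt e, \<phi>)" "Yz (sqrt e, \<phi>)" \<sigma> j]
        Phi_level(1)[OF s(1), of \<phi>] Xeq[OF s(2), of \<phi>] Yeq[OF s(2), of \<phi>] s(3) by (simp add: Phi_def)
  qed
  then have "deriv (\<lambda>e. Hk k (angle_par \<omega> x0 \<phi> e) (angle_par \<omega> y0 \<phi> e) (\<sigma> + of_int j * (2 * pi))) (z\<^sup>2)
    = deriv (\<lambda>e. Hk k (angle_par \<omega> x0 \<phi> e) (angle_par \<omega> y0 \<phi> e) \<sigma>) (z\<^sup>2)"
    by (rule deriv_cong_ev) simp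
  then show ?thesis
    unfolding angle_coeff_def Xeq[OF z(1)] Yeq[OF z(1)] Hk_periodic[OF assms(1) Phi_in_disc[OF assms(2)]] by simp
qed

text \<open>Two periods of \<phi> are covered because later \<phi> = \<theta> + \<sigma> / \<kappa>,
  where \<theta> and \<sigma> / \<kappa> range over one period each.\<close>

lemma action_angle_bounds:
  obtains B where "B > 0"
    "\<And>z \<phi>. z \<in> {0<..z1} \<Longrightarrow> \<phi> \<in> {0..4 * pi} \<Longrightarrow> \<bar>Hx (Phi (z, \<phi>))\<bar> \<le> B * z \<and> \<bar>Hy (Phi (z, \<phi>))\<bar> \<le> B * z
       \<and> norm (Phi (z, \<phi>)) \<le> B * z \<and> \<bar>X1 (z, \<phi>)\<bar> \<le> B \<and> \<bar>Y1 (z, \<phi>)\<bar> \<le> B \<and> \<bar>\<omega> (z\<^sup>2)\<bar> \<le> B"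
proof -
  let ?A = "{0..sqrt E0} \<times> (UNIV :: real set)"
  let ?C = "{0..z1} \<times> {0..4 * pi}"
  have CA: "?C \<subseteq> ?A" using z1 by auto
  have cC: "compact ?C" by (intro compact_Times) auto
  have star: "(z, p) \<in> ?A \<Longrightarrow> u \<in> {0..1} \<Longrightarrow> (u * z, p) \<in> ?A" for z u p
    by (auto simp del: atLeastAtMost_iff intro: unit_mult_Icc)
  have PA: "Phi ` ?A \<subseteq> disc r0" using Phi_disc by auto
  have smPhi: "smap_near ?A Phi"
  proof -
    have "smap_near ?A (\<lambda>p. (Xz p, Yz p))" by (intro smooth_intros smX smY)
    then show ?thesis by (simp add: Phi_def case_prod_beta')
  qed
  have bound: "\<exists>B>0. \<forall>z\<in>{0<..z1}. \<forall>\<phi>\<in>{0..4 * pi}. \<bar>w (z, \<phi>)\<bar> \<le> B * z"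
    if sm: "smooth_near ?A w" and 0: "\<And>\<phi>. w (0, \<phi>) = 0" for w
  proof -
    obtain w' where w': "smooth_near ?A w'" "\<And>z p. (z, p) \<in> ?A \<Longrightarrow> w (z, p) = w (0, p) + z * w' (z, p)"
      using hadamard[OF sm star] by blast
    obtain B where B: "B > 0" "\<And>p. p \<in> ?C \<Longrightarrow> \<bar>w' p\<bar> \<le> B"
      using smooth_near_bounded[OF smooth_near_subset[OF w'(1) CA] cC] by blast
    have "\<bar>w (z, \<phi>)\<bar> \<le> B * z" if "z \<in> {0<..z1}" "\<phi> \<in> {0..4 * pi}" for z \<phi>
      using w'(2)[of z \<phi>] B(2)[of "(z, \<phi>)"] that z1 0[of \<phi>]
      by (auto simp: abs_mult mult.commute mult_right_mono)
    then show ?thesis using B(1) by blast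
  qed
  obtain B1 where B1: "B1 > 0" "\<And>z \<phi>. z \<in> {0<..z1} \<Longrightarrow> \<phi> \<in> {0..4 * pi} \<Longrightarrow> \<bar>Hx (Phi (z, \<phi>))\<bar> \<le> B1 * z"
    using bound[OF smooth_near_compose[OF smHx smPhi PA]] by (auto simp: XY0 Hx0)
  obtain B2 where B2: "B2 > 0" "\<And>z \<phi>. z \<in> {0<..z1} \<Longrightarrow> \<phi> \<in> {0..4 * pi} \<Longrightarrow> \<bar>Hy (Phi (z, \<phi>))\<bar> \<le> B2 * z"
    using bound[OF smooth_near_compose[OF smHy smPhi PA]] by (auto simp: XY0 Hy0)
  obtain B3 where B3: "B3 > 0" "\<And>z \<phi>. z \<in> {0<..z1} \<Longrightarrow> \<phi> \<in> {0..4 * pi} \<Longrightarrow> \<bar>Xz (z, \<phi>)\<bar> \<le> B3 * z"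
    using bound[OF smX] by (auto simp: XY0)
  obtain B4 where B4: "B4 > 0" "\<And>z \<phi>. z \<in> {0<..z1} \<Longrightarrow> \<phi> \<in> {0..4 * pi} \<Longrightarrow> \<bar>Yz (z, \<phi>)\<bar> \<le> B4 * z"
    using bound[OF smY] by (auto simp: XY0)
  obtain B5 where B5: "B5 > 0" "\<And>p. p \<in> ?C \<Longrightarrow> \<bar>X1 p\<bar> \<le> B5"
    by (rule smooth_near_bounded[OF smooth_near_subset[OF smooth_near_pd[OF smX, of "(1, 0)"] CA] cC])
       (auto simp: Basis_prod_def simp del: iter_dderiv.simps)
  obtain B6 where B6: "B6 > 0" "\<And>p. p \<in> ?C \<Longrightarrow> \<bar>Y1 p\<bar> \<le> B6"
    by (rule smooth_near_bounded[OF smooth_near_subset[OF smooth_near_pd[OF smY, of "(1, 0)"] CA] cC])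
       (auto simp: Basis_prod_def simp del: iter_dderiv.simps)
  obtain B7 where B7: "B7 > 0" "\<And>z. z \<in> {0..z1} \<Longrightarrow> \<bar>wz z\<bar> \<le> B7"
    using smooth_near_bounded[OF smw] by auto
  define B where "B = B1 + B2 + (B3 + B4) + B5 + B6 + B7"
  show ?thesis
  proof (rule that[of B])
    show "B > 0" using B1 B2 B3 B4 B5 B6 B7 by (simp add: B_def)
    fix z \<phi> assume z: "z \<in> {0<..z1}" and \<phi>: "\<phi> \<in> {0..4 * pi}"
    have up: "B' * z \<le> B * z" if "B' \<le> B" for B' using that z by (intro mult_right_mono) auto
    have "norm (Phi (z, \<phi>)) \<le> \<bar>Xz (z, \<phi>)\<bar> + \<bar>Yz (z, \<phi>)\<bar>"
      using norm_Pair_le[of "Xz (z, \<phi>)" "Yz (z, \<phi>)"] by (simp add: Phi_def)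
    also have "\<dots> \<le> (B3 + B4) * z" using B3(2)[OF z \<phi>] B4(2)[OF z \<phi>] by (simp add: algebra_simps)
    also have "\<dots> \<le> B * z" by (rule up) (use B1 B2 B5 B6 B7 in \<open>auto simp: B_def\<close>)
    finally have n: "norm (Phi (z, \<phi>)) \<le> B * z" .
    have zC: "(z, \<phi>) \<in> ?C" using z \<phi> by auto
    show "\<bar>Hx (Phi (z, \<phi>))\<bar> \<le> B * z \<and> \<bar>Hy (Phi (z, \<phi>))\<bar> \<le> B * z
       \<and> norm (Phi (z, \<phi>)) \<le> B * z \<and> \<bar>X1 (z, \<phi>)\<bar> \<le> B \<and> \<bar>Y1 (z, \<phi>)\<bar> \<le> B \<and> \<bar>\<omega> (z\<^sup>2)\<bar> \<le> B"
    proof (intro conjI n)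
      show "\<bar>Hx (Phi (z, \<phi>))\<bar> \<le> B * z"
        by (rule order_trans[OF B1(2)[OF z \<phi>] up]) (use B1 B2 B3 B4 B5 B6 B7 in \<open>simp add: B_def\<close>)
      show "\<bar>Hy (Phi (z, \<phi>))\<bar> \<le> B * z"
        by (rule order_trans[OF B2(2)[OF z \<phi>] up]) (use B1 B2 B3 B4 B5 B6 B7 in \<open>simp add: B_def\<close>)
      show "\<bar>X1 (z, \<phi>)\<bar> \<le> B"
        by (rule order_trans[OF B5(2)[OF zC]]) (use B1 B2 B3 B4 B5 B6 B7 in \<open>simp add: B_def\<close>)
      show "\<bar>Y1 (z, \<phi>)\<bar> \<le> B"
        by (rule order_trans[OF B6(2)[OF zC]]) (use B1 B2 B3 B4 B5 B6 B7 in \<open>simp add: B_def\<close>)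
      show "\<bar>\<omega> (z\<^sup>2)\<bar> \<le> B"
        using B7(2)[of z] z B1 B2 B3 B4 B5 B6 B7(1) unfolding weq[OF z] by (auto simp: B_def)
    qed
  qed
qed

lemma abs_sum3_bound:
  fixes a b c x1 x2 x3 :: real
  assumes "\<bar>a\<bar> \<le> A" "\<bar>b\<bar> \<le> A" "\<bar>c\<bar> \<le> A" "\<bar>x1\<bar> \<le> M" "\<bar>x2\<bar> \<le> M" "\<bar>x3\<bar> \<le> M"
  shows "\<bar>a * x1 + b * x2 + c * x3\<bar> \<le> 3 * A * M"
proof -
  have A: "A \<ge> 0" using assms(1) by simp
  have "\<bar>a * x1\<bar> \<le> A * M" "\<bar>b * x2\<bar> \<le> A * M" "\<bar>c * x3\<bar> \<le> A * M"
    unfolding abs_mult by (intro mult_mono assms A; simp)+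
  then show ?thesis by linarith
qed

text \<open>The derivative of \<open>H0\<close> along the perturbed system at the point
  \<open>Phi (z, \<phi>)\<close>.\<close>

definition "energy_rate z \<phi> t = (let x = Xz (z, \<phi>); y = Yz (z, \<phi>) in
   Hx (Phi (z, \<phi>)) * HY x y t + Hy (Phi (z, \<phi>)) * (- HX x y t + F x y t))"

text \<open>The derivative, along the perturbed system at the same point, of the angle provided by
  \<open>angle_branch\<close>.\<close>

definition "angle_rate z \<phi> t = (let x = Xz (z, \<phi>); y = Yz (z, \<phi>) in
   \<omega> (z\<^sup>2) * (Y1 (z, \<phi>) * HY x y t - X1 (z, \<phi>) * (- HX x y t + F x y t)) / (2 * z))"

text \<open>The contributions of \<open>H0\<close> itself cancel in the energy and give \<omega> in
  the angle by \<open>energy_Phi\<close>. Besides the expansions there remain terms linear in the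
  remainders \<open>R1\<close>, \<open>R2\<close>, \<open>R3\<close>, which are \<open>O(z)\<close>
  times the next power of \<open>t\<close>. In the energy the gradient of \<open>H0\<close> supplies
  a second factor \<open>z\<close>; in the angle the factor \<open>z\<close> is cancelled by
  \<open>1 / (2 * z)\<close>.\<close>

lemma true_rates:
  obtains fq gq :: "nat \<Rightarrow> real \<times> real \<times> real \<Rightarrow> real" where
    "\<And>k. k \<ge> 1 \<Longrightarrow> smooth_near ({0..z1} \<times> UNIV) (fq k)"
    "\<And>k. k \<ge> 1 \<Longrightarrow> smooth_near ({0..z1} \<times> UNIV) (gq k)"
    "\<And>k z \<phi> \<sigma>. k \<ge> 1 \<Longrightarrow> z \<in> {0<..z1} \<Longrightarrow>
       action_coeff \<omega> (angle_par \<omega> x0) (angle_par \<omega> y0) (Hk k) (Fk k) (z\<^sup>2) \<phi> \<sigma> = z\<^sup>2 * fq k (z, \<phi>, \<sigma>)"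
    "\<And>k z \<phi> \<sigma>. k \<ge> 1 \<Longrightarrow> z \<in> {0<..z1} \<Longrightarrow>
       angle_coeff \<omega> (angle_par \<omega> x0) (angle_par \<omega> y0) (Hk k) (Fk k) (z\<^sup>2) \<phi> \<sigma> = gq k (z, \<phi>, \<sigma>)"
    "\<And>K. \<exists>C>0. \<forall>\<^sub>F t in at_top. \<forall>z\<in>{0<..z1}. \<forall>\<phi>\<in>{0..4 * pi}.
       \<bar>energy_rate z \<phi> t - z\<^sup>2 * (\<Sum>k=1..K. t powr (- (real k / real q)) * fq k (z, \<phi>, S t))\<bar>
         \<le> C * z\<^sup>2 * t powr (- (real (K + 1) / real q)) \<and>
       \<bar>angle_rate z \<phi> t - \<omega> (z\<^sup>2) - (\<Sum>k=1..K. t powr (- (real k / real q)) * gq k (z, \<phi>, S t))\<bar>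
         \<le> C * t powr (- (real (K + 1) / real q))"
proof -
  let ?P = "\<lambda>k fq gq. smooth_near ({0..z1} \<times> UNIV \<times> UNIV) fq \<and> smooth_near ({0..z1} \<times> UNIV \<times> UNIV) gq \<and>
    (\<forall>z \<phi> \<sigma>. z \<in> {0<..z1} \<longrightarrow>
       action_coeff \<omega> (angle_par \<omega> x0) (angle_par \<omega> y0) (Hk k) (Fk k) (z\<^sup>2) \<phi> \<sigma> = z\<^sup>2 * fq (z, \<phi>, \<sigma>) \<and>
       angle_coeff \<omega> (angle_par \<omega> x0) (angle_par \<omega> y0) (Hk k) (Fk k) (z\<^sup>2) \<phi> \<sigma> = gq (z, \<phi>, \<sigma>) \<and>
       z\<^sup>2 * fq (z, \<phi>, \<sigma>) =
       Hx (Phi (z, \<phi>)) * iter_dderiv (hA k) [(0, 1, 0)] (Xz (z, \<phi>), Yz (z, \<phi>), \<sigma>)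
       - Hy (Phi (z, \<phi>)) * iter_dderiv (hA k) [(1, 0, 0)] (Xz (z, \<phi>), Yz (z, \<phi>), \<sigma>)
       + Hy (Phi (z, \<phi>)) * pA k (Xz (z, \<phi>), Yz (z, \<phi>), \<sigma>) \<and>
       gq (z, \<phi>, \<sigma>) = \<omega> (z\<^sup>2) / (2 * z) * (
       iter_dderiv (hA k) [(1, 0, 0)] (Xz (z, \<phi>), Yz (z, \<phi>), \<sigma>) * X1 (z, \<phi>)
       + iter_dderiv (hA k) [(0, 1, 0)] (Xz (z, \<phi>), Yz (z, \<phi>), \<sigma>) * Y1 (z, \<phi>)
       - pA k (Xz (z, \<phi>), Yz (z, \<phi>), \<sigma>) * X1 (z, \<phi>)))"
  have "\<exists>f g. ?P k f g" if "k \<ge> 1" for k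
  proof (rule coefficients[OF HE.smGk[OF that] FE.smGk[OF that] hA0(1)[OF that] hA0(2)[OF that] pA0[OF that]], goal_cases)
    case (1 f g)
    from 1 show ?case by blast
  qed
  moreover define Q where "Q = (\<lambda>k f g. ?P k f g)"
  ultimately have "\<And>k. k \<ge> 1 \<Longrightarrow> \<exists>f g. Q k f g" by (simp only:)
  then obtain fq gq where "\<And>k. k \<ge> 1 \<Longrightarrow> Q k (fq k) (gq k)" by metis
  then have P: "\<And>k. k \<ge> 1 \<Longrightarrow> ?P k (fq k) (gq k)" unfolding Q_def .
  have rates: "\<exists>C>0. \<forall>\<^sub>F t in at_top. \<forall>z\<in>{0<..z1}. \<forall>\<phi>\<in>{0..4 * pi}.
       \<bar>energy_rate z \<phi> t - z\<^sup>2 * (\<Sum>k=1..K. t powr (- (real k / real q)) * fq k (z, \<phi>, S t))\<bar>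
         \<le> C * z\<^sup>2 * t powr (- (real (K + 1) / real q)) \<and>
       \<bar>angle_rate z \<phi> t - \<omega> (z\<^sup>2) - (\<Sum>k=1..K. t powr (- (real k / real q)) * gq k (z, \<phi>, S t))\<bar>
         \<le> C * t powr (- (real (K + 1) / real q))" for K
  proof -
    obtain B where B: "B > 0"
      "\<And>z \<phi>. z \<in> {0<..z1} \<Longrightarrow> \<phi> \<in> {0..4 * pi} \<Longrightarrow> \<bar>Hx (Phi (z, \<phi>))\<bar> \<le> B * z \<and> \<bar>Hy (Phi (z, \<phi>))\<bar> \<le> B * z
       \<and> norm (Phi (z, \<phi>)) \<le> B * z \<and> \<bar>X1 (z, \<phi>)\<bar> \<le> B \<and> \<bar>Y1 (z, \<phi>)\<bar> \<le> B \<and> \<bar>\<omega> (z\<^sup>2)\<bar> \<le> B"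
      by (rule action_angle_bounds) blast
    obtain C0 where C0: "C0 > 0" "\<forall>\<^sub>F t in at_top. \<forall>(x, y)\<in>disc r0.
     \<bar>HX x y t - Hx (x, y) - (\<Sum>k=1..K. t powr (- (real k / real q)) * iter_dderiv (hA k) [(1, 0, 0)] (x, y, S t))\<bar>
        \<le> C0 * norm (x, y) * t powr (- (real (K + 1) / real q)) \<and>
     \<bar>HY x y t - Hy (x, y) - (\<Sum>k=1..K. t powr (- (real k / real q)) * iter_dderiv (hA k) [(0, 1, 0)] (x, y, S t))\<bar>
        \<le> C0 * norm (x, y) * t powr (- (real (K + 1) / real q)) \<and>
     \<bar>F x y t - (\<Sum>k=1..K. t powr (- (real k / real q)) * pA k (x, y, S t))\<bar>
        \<le> C0 * norm (x, y) * t powr (- (real (K + 1) / real q))"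
      by (rule gradient_expansion)
    \<comment> \<open>One summand for each of the two estimates; the second one leaves room for a
      factor \<open>1 / 2\<close>.\<close>
    define C where "C = 3 * B * C0 * B + 3 * B * B * C0 * B"
    show ?thesis
    proof (intro exI[of _ C] conjI)
      show "C > 0" using B(1) C0(1) by (auto simp: C_def intro!: add_pos_pos)
      show "\<forall>\<^sub>F t in at_top. \<forall>z\<in>{0<..z1}. \<forall>\<phi>\<in>{0..4 * pi}.
       \<bar>energy_rate z \<phi> t - z\<^sup>2 * (\<Sum>k=1..K. t powr (- (real k / real q)) * fq k (z, \<phi>, S t))\<bar>
         \<le> C * z\<^sup>2 * t powr (- (real (K + 1) / real q)) \<and>
       \<bar>angle_rate z \<phi> t - \<omega> (z\<^sup>2) - (\<Sum>k=1..K. t powr (- (real k / real q)) * gq k (z, \<phi>, S t))\<bar>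
         \<le> C * t powr (- (real (K + 1) / real q))"
        using C0(2)
      proof eventually_elim
        case (elim t)
        define W where "W = t powr (- (real (K + 1) / real q))"
        have W: "W \<ge> 0" by (simp add: W_def)
        show ?case unfolding W_def[symmetric]
        proof (intro ballI)
          fix z \<phi> assume z: "z \<in> {0<..z1}" and \<phi>: "\<phi> \<in> {0..4 * pi}"
          define x y where "x = Xz (z, \<phi>)" and "y = Yz (z, \<phi>)"
          have Phi_eq: "Phi (z, \<phi>) = (Xz (z, \<phi>), Yz (z, \<phi>))" by (simp add: Phi_def)
          have Pxy: "Phi (z, \<phi>) = (x, y)" by (simp add: Phi_def x_def y_def)
          have xy: "(x, y) \<in> disc r0" using Phi_in_disc[OF z] by (simp add: x_def y_def)
          define S1 S2 S3 where "S1 = (\<Sum>k=1..K. t powr (- (real k / real q)) * iter_dderiv (hA k) [(1, 0, 0)] (x, y, S t))"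
            and "S2 = (\<Sum>k=1..K. t powr (- (real k / real q)) * iter_dderiv (hA k) [(0, 1, 0)] (x, y, S t))"
            and "S3 = (\<Sum>k=1..K. t powr (- (real k / real q)) * pA k (x, y, S t))"
          define R1 R2 R3 where "R1 = HX x y t - Hx (x, y) - S1" and "R2 = HY x y t - Hy (x, y) - S2"
            and "R3 = F x y t - S3"
          define a b w where "a = X1 (z, \<phi>)" and "b = Y1 (z, \<phi>)" and "w = \<omega> (z\<^sup>2)"
          have zp: "z > 0" using z by auto
          have Bs: "\<bar>Hx (x, y)\<bar> \<le> B * z" "\<bar>Hy (x, y)\<bar> \<le> B * z" "norm (x, y) \<le> B * z" "\<bar>a\<bar> \<le> B" "\<bar>b\<bar> \<le> B" "\<bar>w\<bar> \<le> B"
            using B(2)[OF z \<phi>] by (simp_all add: Pxy a_def b_def w_def del: iter_dderiv.simps)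
          have "\<bar>R1\<bar> \<le> C0 * norm (x, y) * W" "\<bar>R2\<bar> \<le> C0 * norm (x, y) * W" "\<bar>R3\<bar> \<le> C0 * norm (x, y) * W"
            using elim xy unfolding R1_def R2_def R3_def S1_def S2_def S3_def W_def
            by (auto simp del: iter_dderiv.simps)
          moreover have "C0 * norm (x, y) * W \<le> C0 * (B * z) * W"
            using Bs(3) C0(1) W by (intro mult_right_mono mult_left_mono) auto
          ultimately have R: "\<bar>R1\<bar> \<le> C0 * (B * z) * W" "\<bar>R2\<bar> \<le> C0 * (B * z) * W" "\<bar>R3\<bar> \<le> C0 * (B * z) * W"
            by linarith+
          have Ff: "z\<^sup>2 * (\<Sum>k=1..K. t powr (- (real k / real q)) * fq k (z, \<phi>, S t))
            = Hx (x, y) * S2 - Hy (x, y) * S1 + Hy (x, y) * S3"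
          proof -
            have "z\<^sup>2 * (\<Sum>k=1..K. t powr (- (real k / real q)) * fq k (z, \<phi>, S t))
              = (\<Sum>k=1..K. t powr (- (real k / real q)) * (z\<^sup>2 * fq k (z, \<phi>, S t)))"
              unfolding sum_distrib_left by (intro sum.cong refl) (simp add: mult.left_commute)
            also have "\<dots> = (\<Sum>k=1..K. Hx (x, y) * (t powr (- (real k / real q)) * iter_dderiv (hA k) [(0, 1, 0)] (x, y, S t))
               - Hy (x, y) * (t powr (- (real k / real q)) * iter_dderiv (hA k) [(1, 0, 0)] (x, y, S t))
               + Hy (x, y) * (t powr (- (real k / real q)) * pA k (x, y, S t)))"
            proof (intro sum.cong refl)
              fix k assume "k \<in> {1..K}"
              then have k: "k \<ge> 1" by auto
              have "z\<^sup>2 * fq k (z, \<phi>, S t) = Hx (x, y) * iter_dderiv (hA k) [(0, 1, 0)] (x, y, S t)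
                 - Hy (x, y) * iter_dderiv (hA k) [(1, 0, 0)] (x, y, S t) + Hy (x, y) * pA k (x, y, S t)"
                using P[OF k, THEN conjunct2, THEN conjunct2, rule_format, OF z, of \<phi> "S t"]
                unfolding x_def y_def Phi_eq by blast
              then show "t powr (- (real k / real q)) * (z\<^sup>2 * fq k (z, \<phi>, S t)) =
                 Hx (x, y) * (t powr (- (real k / real q)) * iter_dderiv (hA k) [(0, 1, 0)] (x, y, S t))
               - Hy (x, y) * (t powr (- (real k / real q)) * iter_dderiv (hA k) [(1, 0, 0)] (x, y, S t))
               + Hy (x, y) * (t powr (- (real k / real q)) * pA k (x, y, S t))"
                by (simp only:) (simp only: algebra_simps)
            qed
            finally show ?thesis
              by (simp only: sum.distrib sum_subtractf sum_distrib_left S1_def S2_def S3_def)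
          qed
          have Gg: "(\<Sum>k=1..K. t powr (- (real k / real q)) * gq k (z, \<phi>, S t))
            = w / (2 * z) * (S1 * a + S2 * b - S3 * a)"
          proof -
            have "(\<Sum>k=1..K. t powr (- (real k / real q)) * gq k (z, \<phi>, S t)) =
              (\<Sum>k=1..K. w / (2 * z) * a * (t powr (- (real k / real q)) * iter_dderiv (hA k) [(1, 0, 0)] (x, y, S t))
               + w / (2 * z) * b * (t powr (- (real k / real q)) * iter_dderiv (hA k) [(0, 1, 0)] (x, y, S t))
               - w / (2 * z) * a * (t powr (- (real k / real q)) * pA k (x, y, S t)))"
            proof (intro sum.cong refl)
              fix k assume "k \<in> {1..K}"
              then have k: "k \<ge> 1" by auto
              have "gq k (z, \<phi>, S t) = w / (2 * z) * (iter_dderiv (hA k) [(1, 0, 0)] (x, y, S t) * a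
                 + iter_dderiv (hA k) [(0, 1, 0)] (x, y, S t) * b - pA k (x, y, S t) * a)"
                using P[OF k, THEN conjunct2, THEN conjunct2, rule_format, OF z, of \<phi> "S t"]
                unfolding x_def y_def a_def b_def w_def by blast
              then show "t powr (- (real k / real q)) * gq k (z, \<phi>, S t) =
                w / (2 * z) * a * (t powr (- (real k / real q)) * iter_dderiv (hA k) [(1, 0, 0)] (x, y, S t))
               + w / (2 * z) * b * (t powr (- (real k / real q)) * iter_dderiv (hA k) [(0, 1, 0)] (x, y, S t))
               - w / (2 * z) * a * (t powr (- (real k / real q)) * pA k (x, y, S t))"
                by (simp only:) (simp only: algebra_simps)
            qed
            then have "(\<Sum>k=1..K. t powr (- (real k / real q)) * gq k (z, \<phi>, S t)) =
               w / (2 * z) * a * S1 + w / (2 * z) * b * S2 - w / (2 * z) * a * S3"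
              by (simp only: sum.distrib sum_subtractf sum_distrib_left S1_def S2_def S3_def)
            then show ?thesis by (simp only: algebra_simps)
          qed
          have HXe: "HX x y t = Hx (x, y) + S1 + R1" and HYe: "HY x y t = Hy (x, y) + S2 + R2" and Fe: "F x y t = S3 + R3"
            by (simp_all add: R1_def R2_def R3_def)
          have "energy_rate z \<phi> t - z\<^sup>2 * (\<Sum>k=1..K. t powr (- (real k / real q)) * fq k (z, \<phi>, S t))
            = Hx (x, y) * R2 + (- Hy (x, y)) * R1 + Hy (x, y) * R3"
            unfolding Ff energy_rate_def Let_def x_def[symmetric] y_def[symmetric] Pxy HXe HYe Fe
            by (simp add: algebra_simps)
          also have "\<bar>\<dots>\<bar> \<le> 3 * (B * z) * (C0 * (B * z) * W)"
            by (rule abs_sum3_bound) (use Bs R in auto)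
          also have "\<dots> = 3 * B * C0 * B * (z\<^sup>2 * W)" by (simp add: power2_eq_square)
          also have "\<dots> \<le> C * (z\<^sup>2 * W)"
            using B(1) C0(1) W by (intro mult_right_mono) (auto simp: C_def)
          finally have e1: "\<bar>energy_rate z \<phi> t - z\<^sup>2 * (\<Sum>k=1..K. t powr (- (real k / real q)) * fq k (z, \<phi>, S t))\<bar> \<le> C * z\<^sup>2 * W"
            by (simp only: mult.assoc)
          have en: "Hx (x, y) * a + Hy (x, y) * b = 2 * z"
            using energy_Phi[OF z1_range(2)[OF z], of \<phi>] by (simp add: Pxy a_def b_def del: iter_dderiv.simps)
          have "angle_rate z \<phi> t - \<omega> (z\<^sup>2) - (\<Sum>k=1..K. t powr (- (real k / real q)) * gq k (z, \<phi>, S t))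
            = w * (Hx (x, y) * a + Hy (x, y) * b) / (2 * z) - w + w / (2 * z) * (b * R2 + a * R1 + (- a) * R3)"
            unfolding Gg angle_rate_def Let_def x_def[symmetric] y_def[symmetric] Pxy HXe HYe Fe a_def[symmetric] b_def[symmetric] w_def[symmetric]
            by (simp add: algebra_simps add_divide_distrib diff_divide_distrib)
          also have "\<dots> = w / (2 * z) * (b * R2 + a * R1 + (- a) * R3)" unfolding en using zp by simp
          also have "\<bar>\<dots>\<bar> \<le> B / (2 * z) * (3 * B * (C0 * (B * z) * W))"
          proof -
            have 1: "\<bar>w / (2 * z)\<bar> \<le> B / (2 * z)"
              using Bs(6) zp by (simp add: abs_divide divide_right_mono)
            have 2: "\<bar>b * R2 + a * R1 + (- a) * R3\<bar> \<le> 3 * B * (C0 * (B * z) * W)"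
              by (rule abs_sum3_bound) (use Bs R in auto)
            show ?thesis unfolding abs_mult[of "w / (2 * z)"]
              by (rule mult_mono[OF 1 2]) (use B(1) zp in auto)
          qed
          also have "\<dots> = (3 * B * B * C0 * B / 2) * W" using zp by (simp add: field_simps)
          also have "\<dots> \<le> C * W"
            using B(1) C0(1) W by (intro mult_right_mono) (auto simp: C_def)
          finally show "\<bar>energy_rate z \<phi> t - z\<^sup>2 * (\<Sum>k=1..K. t powr (- (real k / real q)) * fq k (z, \<phi>, S t))\<bar> \<le> C * z\<^sup>2 * W \<and>
            \<bar>angle_rate z \<phi> t - \<omega> (z\<^sup>2) - (\<Sum>k=1..K. t powr (- (real k / real q)) * gq k (z, \<phi>, S t))\<bar> \<le> C * W"
            using e1 by blast
        qed
      qed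
    qed
  qed
  show ?thesis
  proof (rule that[of fq gq])
    fix k :: nat assume k: "k \<ge> 1"
    show "smooth_near ({0..z1} \<times> UNIV) (fq k)" "smooth_near ({0..z1} \<times> UNIV) (gq k)"
      using P[OF k] by (metis UNIV_Times_UNIV)+
    fix z \<phi> \<sigma> assume z: "z \<in> {0<..z1}"
    show "action_coeff \<omega> (angle_par \<omega> x0) (angle_par \<omega> y0) (Hk k) (Fk k) (z\<^sup>2) \<phi> \<sigma> = z\<^sup>2 * fq k (z, \<phi>, \<sigma>)"
      "angle_coeff \<omega> (angle_par \<omega> x0) (angle_par \<omega> y0) (Hk k) (Fk k) (z\<^sup>2) \<phi> \<sigma> = gq k (z, \<phi>, \<sigma>)"
      using P[OF k] z by blast+
  qed (rule rates)
qed

end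

section \<open>Detecting orders of vanishing\<close>

lemma poly_zero_if_infinite_roots:
  fixes a :: "nat \<Rightarrow> real"
  assumes "infinite X" "\<And>x. x \<in> X \<Longrightarrow> (\<Sum>k=2..N. x ^ k * a k) = 0" "k \<in> {2..N}"
  shows "a k = 0"
proof -
  define c where "c = (\<lambda>i. if i \<ge> 2 then a i else 0)"
  have eq: "(\<Sum>i\<le>N. c i * x ^ i) = (\<Sum>k=2..N. x ^ k * a k)" for x
    by (rule sum.mono_neutral_cong_right) (auto simp: c_def)
  then have "X \<subseteq> {x. (\<Sum>i\<le>N. c i * x ^ i) = 0}" using assms(2) by auto
  then have "infinite {x. (\<Sum>i\<le>N. c i * x ^ i) = 0}" using assms(1) finite_subset by blast
  then have "c k = 0" using assms(3) polyfun_finite_roots[where c=c and n=N] by auto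
  then show ?thesis using assms(3) by (simp add: c_def)
qed

lemma hadamard_ex:
  fixes G :: "real \<times> 'a::euclidean_space \<Rightarrow> real"
  assumes "smooth_near A G" "\<And>z p s. (z, p) \<in> A \<Longrightarrow> s \<in> {0..1} \<Longrightarrow> (s * z, p) \<in> A"
  shows "\<exists>G'. smooth_near A G' \<and> (\<forall>z p. (z, p) \<in> A \<longrightarrow> G (z, p) = G (0, p) + z * G' (z, p))"
  using hadamard[OF assms] by metis

text \<open>Two divisions by \<open>z\<close>: the bound forces first \<open>G\<close> and then the
  quotient to vanish at \<open>z = 0\<close>, where continuity identifies the value with the limit.
  The constant in the bound may depend on \<open>p\<close>.\<close>

lemma hadamard_square:
  fixes G :: "real \<times> 'a::euclidean_space \<Rightarrow> real"
  assumes sm: "smooth_near ({0..r} \<times> UNIV) G" and r: "r > 0"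
    and bd: "\<And>p. \<exists>C. \<forall>\<^sub>F z in at_right 0. \<bar>G (z, p)\<bar> \<le> C * z\<^sup>2"
  obtains G' where "smooth_near ({0..r} \<times> UNIV) G'"
    "\<And>z p. z \<in> {0..r} \<Longrightarrow> G (z, p) = z\<^sup>2 * G' (z, p)"
proof -
  let ?A = "{0..r} \<times> (UNIV :: 'a set)"
  have star: "(z, p) \<in> ?A \<Longrightarrow> u \<in> {0..1} \<Longrightarrow> (u * z, p) \<in> ?A" for z u p
    by (auto simp del: atLeastAtMost_iff intro: unit_mult_Icc)
  have lim: "((\<lambda>z. W (z, p)) \<longlongrightarrow> W (0, p)) (at_right 0)" if "smooth_near ?A W" for W p
  proof -
    have "isCont W (0, p)" by (rule smooth_near_isCont[OF that]) (use r in auto)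
    then show ?thesis by (rule isCont_tendsto_compose) (auto intro!: tendsto_intros)
  qed
  have small: "\<forall>\<^sub>F z in at_right 0. z \<in> {0<..<r}" using eventually_at_right_real[OF r] by simp
  obtain G1 where G1: "smooth_near ?A G1" "\<And>z p. (z, p) \<in> ?A \<Longrightarrow> G (z, p) = G (0, p) + z * G1 (z, p)"
    using hadamard[OF sm star] by blast
  have G0: "G (0, p) = 0" for p
  proof -
    obtain C where C: "\<forall>\<^sub>F z in at_right 0. \<bar>G (z, p)\<bar> \<le> C * z\<^sup>2" using bd by blast
    have "((\<lambda>z. C * z\<^sup>2) \<longlongrightarrow> 0) (at_right (0::real))" by (auto intro!: tendsto_eq_intros)
    then have "((\<lambda>z. G (z, p)) \<longlongrightarrow> 0) (at_right 0)"
      by (rule Lim_null_comparison[rotated]) (use C in simp)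
    then show ?thesis using lim[OF sm] tendsto_unique[OF trivial_limit_at_right_real] by blast
  qed
  have G10: "G1 (0, p) = 0" for p
  proof -
    obtain C where C: "\<forall>\<^sub>F z in at_right 0. \<bar>G (z, p)\<bar> \<le> C * z\<^sup>2" using bd by blast
    have "\<forall>\<^sub>F z in at_right 0. norm (G1 (z, p)) \<le> C * z"
      using C small
    proof eventually_elim
      case (elim z)
      then have "z * \<bar>G1 (z, p)\<bar> \<le> z * (C * z)"
        using G1(2)[of z p] G0[of p] by (auto simp: abs_mult power2_eq_square mult_ac)
      then show ?case using elim by simp
    qed
    moreover have "((\<lambda>z. C * z) \<longlongrightarrow> 0) (at_right (0::real))" by (auto intro!: tendsto_eq_intros)
    ultimately have "((\<lambda>z. G1 (z, p)) \<longlongrightarrow> 0) (at_right 0)" by (rule Lim_null_comparison)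
    then show ?thesis using lim[OF G1(1)] tendsto_unique[OF trivial_limit_at_right_real] by blast
  qed
  obtain G2 where G2: "smooth_near ?A G2" "\<And>z p. (z, p) \<in> ?A \<Longrightarrow> G1 (z, p) = G1 (0, p) + z * G2 (z, p)"
    using hadamard[OF G1(1) star] by blast
  show ?thesis
    by (rule that[OF G2(1)]) (use G1(2) G2(2) G0 G10 in \<open>auto simp: power2_eq_square\<close>)
qed

section \<open>Growth and derivative of the phase \<open>S\<close>\<close>

context perturbed
begin

lemma s0: "s 0 > 0" using phase by (simp add: phase_function_def)

text \<open>All terms of the expansion of \<open>S\<close> other than \<open>s 0 * t\<close>, the
  logarithm included, are of smaller order than \<open>t\<close>. As \<open>s 0 > 0\<close>, this
  makes \<open>S\<close> tend to infinity.\<close>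

lemma S_over_t: "((\<lambda>t. S t / t) \<longlongrightarrow> s 0) at_top"
proof -
  define P where "P = (\<lambda>t. (\<Sum>k<q. s k * t powr (1 - real k / real q)) + s q * ln t)"
  have "\<forall>j. (deriv ^^ j) (\<lambda>t. S t - P t) \<in> O[at_top](\<lambda>t. t powr (- (1 / real q) - real j))"
    using phase by (auto simp: phase_function_def P_def)
  from this[rule_format, of 0]
  obtain c where c: "\<forall>\<^sub>F t in at_top. norm (S t - P t) \<le> c * norm (t powr (- (1 / real q)))"
    by (auto elim: landau_o.bigE)
  have q0: "real q > 0" using q1 by simp
  have p0: "((\<lambda>t. t powr (- a)) \<longlongrightarrow> 0) at_top" if "a > 0" for a :: real
    using tendsto_neg_powr[OF _ filterlim_ident, of "- a"] that by simp
  have "\<forall>\<^sub>F t in at_top. norm ((S t - P t) / t) \<le> c * t powr (- (1 / real q + 1))"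
    using c eventually_gt_at_top[of 0]
  proof eventually_elim
    case (elim t)
    have "- (1 / real q + 1) = - (1 / real q) - 1" by simp
    then have "t powr (- (1 / real q + 1)) = t powr (- (1 / real q)) / t"
      using elim(2) by (simp only: powr_diff) simp
    then show ?case using divide_right_mono[OF elim(1), of t] elim(2) by simp
  qed
  moreover have "((\<lambda>t. c * t powr (- (1 / real q + 1))) \<longlongrightarrow> 0) at_top"
    using q0 by (intro tendsto_mult_right_zero p0) (auto intro: add_pos_pos)
  ultimately have 1: "((\<lambda>t. (S t - P t) / t) \<longlongrightarrow> 0) at_top" by (rule Lim_null_comparison)
  have "((\<lambda>t. (\<Sum>k<q. s k * t powr (- (real k / real q))) + s q * (ln t / t)) \<longlongrightarrow>
     (\<Sum>k<q. if k = 0 then s 0 else 0) + s q * 0) at_top"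
  proof (intro tendsto_add tendsto_sum tendsto_mult tendsto_const)
    fix k
    show "((\<lambda>t. s k * t powr (- (real k / real q))) \<longlongrightarrow> (if k = 0 then s 0 else 0)) at_top"
    proof (cases "k = 0")
      case True
      have "\<forall>\<^sub>F t::real in at_top. s 0 = s k * t powr (- (real k / real q))"
        using eventually_gt_at_top[of 0] by eventually_elim (simp add: True)
      from Lim_transform_eventually[OF tendsto_const this] show ?thesis using True by simp
    next
      case False
      then show ?thesis using tendsto_mult_right_zero[OF p0[of "real k / real q"], of "s k"] q0 by simp
    qed
  next
    show "((\<lambda>t::real. ln t / t) \<longlongrightarrow> 0) at_top" by (rule ln_x_over_x_tendsto_0)
  qed
  moreover have "\<forall>\<^sub>F t in at_top. (\<Sum>k<q. s k * t powr (- (real k / real q))) + s q * (ln t / t) = P t / t"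
    using eventually_gt_at_top[of 0]
  proof eventually_elim
    case (elim t)
    have "s k * t powr (- (real k / real q)) = s k * t powr (1 - real k / real q) / t" for k
      using elim by (simp add: powr_diff powr_minus divide_inverse)
    then show ?case by (simp add: P_def add_divide_distrib sum_divide_distrib)
  qed
  ultimately have "((\<lambda>t. P t / t) \<longlongrightarrow> (\<Sum>k<q. if k = 0 then s 0 else 0) + s q * 0) at_top"
    by (rule Lim_transform_eventually)
  then have "((\<lambda>t. P t / t) \<longlongrightarrow> s 0) at_top" using q1 by simp
  from tendsto_add[OF 1 this] show ?thesis by (simp add: add_divide_distrib[symmetric])
qed

lemma S_at_top: "filterlim S at_top at_top"
proof -
  have "filterlim (\<lambda>t. S t / t * t) at_top at_top"
    by (rule filterlim_tendsto_pos_mult_at_top[OF S_over_t s0 filterlim_ident])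
  moreover have "\<forall>\<^sub>F t in at_top. S t / t * t = S t"
    using eventually_gt_at_top[of 0] by eventually_elim simp
  ultimately show ?thesis by (simp add: filterlim_cong)
qed

lemma S_deriv: "t > 0 \<Longrightarrow> (S has_real_derivative deriv S t) (at t)"
proof -
  assume "t > 0"
  then have "S differentiable (at t)"
    using smooth_on_has_derivative[OF smS, of t] by (auto simp: differentiable_def)
  then show ?thesis using DERIV_deriv_iff_real_differentiable by blast
qed

lemma S_continuous: "continuous_on {0<..} S"
  by (rule smooth_on_continuous[OF smS])

text \<open>The explicit part of \<open>S\<close> has exactly \<open>formal_dS\<close> as its
  derivative, so what is left is the remainder estimate for the first derivative.\<close>

lemma dS_expansion:
  obtains C where "C > 0" "\<forall>\<^sub>F t in at_top. \<bar>deriv S t - formal_dS q s (t powr (- 1 / (2 * real q)))\<bar>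
    \<le> C * t powr (- (1 / real q) - 1)"
proof -
  define P where "P = (\<lambda>t. (\<Sum>k<q. s k * t powr (1 - real k / real q)) + s q * ln t)"
  have "\<forall>j. (deriv ^^ j) (\<lambda>t. S t - P t) \<in> O[at_top](\<lambda>t. t powr (- (1 / real q) - real j))"
    using phase by (auto simp: phase_function_def P_def)
  from this[rule_format, of 1]
  obtain c where c: "c > 0" "\<forall>\<^sub>F t in at_top. norm (deriv (\<lambda>t. S t - P t) t) \<le> c * norm (t powr (- (1 / real q) - 1))"
    by (auto elim: landau_o.bigE)
  have "\<forall>\<^sub>F t in at_top. \<bar>deriv S t - formal_dS q s (t powr (- 1 / (2 * real q)))\<bar>
    \<le> c * t powr (- (1 / real q) - 1)"
    using c(2) eventually_gt_at_top[of 0]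
  proof eventually_elim
    case (elim t)
    define \<tau> where "\<tau> = t powr (- 1 / (2 * real q))"
    have \<tau>: "\<tau> ^ (2 * j) = t powr (- (real j / real q))" for j
      using elim(2) q1 by (simp add: \<tau>_def powr_realpow[symmetric] powr_powr)
    have "((\<lambda>t. s k * t powr (1 - real k / real q)) has_real_derivative
        (1 - real k / real q) * s k * \<tau> ^ (2 * k)) (at t)" for k
      using DERIV_cmult[OF has_real_derivative_powr[OF elim(2), of "1 - real k / real q"], of "s k"]
      unfolding \<tau> by (simp add: mult_ac)
    moreover have "((\<lambda>t. s q * ln t) has_real_derivative s q * \<tau> ^ (2 * q)) (at t)"
      using elim(2) q1 by (auto intro!: derivative_eq_intros simp: \<tau> powr_minus_divide)
    ultimately have "(P has_real_derivative formal_dS q s \<tau>) (at t)"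
      unfolding P_def formal_dS_def by (intro DERIV_add DERIV_sum) auto
    then have "((\<lambda>t. S t - P t) has_real_derivative deriv S t - formal_dS q s \<tau>) (at t)"
      by (intro DERIV_diff S_deriv elim(2))
    from DERIV_imp_deriv[OF this] show ?case using elim(1) by (simp add: \<tau>_def)
  qed
  with c(1) show ?thesis by (rule that)
qed

text \<open>As \<open>S\<close> is continuous and unbounded above, the intermediate value theorem
  yields a time with \<open>S t = \<sigma> + n * T\<close> for every large \<open>n\<close>. These
  times are distinct, and distinct times have distinct values of \<tau>.\<close>

lemma resonant_times:
  assumes "t0 > 0" "T > 0"
  shows "infinite {t powr (- 1 / (2 * real q)) | t. t \<ge> t0 \<and> (\<exists>j::int. S t = \<sigma> + of_int j * T)}"
    (is "infinite ?X")
proof -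
  obtain n0 :: nat where n0: "S t0 \<le> \<sigma> + real n0 * T"
    using ex_less_of_nat_mult[OF assms(2), of "S t0 - \<sigma>"] by (auto intro: less_imp_le simp: algebra_simps)
  have "\<exists>t\<ge>t0. S t = \<sigma> + real n * T" if "n \<ge> n0" for n
  proof -
    have "real n0 * T \<le> real n * T" using that assms(2) by (intro mult_right_mono) auto
    then have 1: "S t0 \<le> \<sigma> + real n * T" using n0 by simp
    have "\<forall>\<^sub>F t in at_top. \<sigma> + real n * T \<le> S t" using S_at_top by (simp add: filterlim_at_top)
    then obtain b where b: "b \<ge> t0" "\<sigma> + real n * T \<le> S b"
      using eventually_ge_at_top[of t0] by (metis (mono_tags, lifting) eventually_at_top_linorder nle_le)
    have "continuous_on {t0..b} S" by (rule continuous_on_subset[OF S_continuous]) (use assms in auto)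
    from IVT'[OF 1 b(2,1) this] show ?thesis by auto
  qed
  then obtain f where f: "\<And>n. n \<ge> n0 \<Longrightarrow> f n \<ge> t0 \<and> S (f n) = \<sigma> + real n * T" by metis
  define g where "g = (\<lambda>n. f n powr (- 1 / (2 * real q)))"
  have "inj_on g {n0..}"
  proof (rule inj_onI)
    fix a b assume ab: "a \<in> {n0..}" "b \<in> {n0..}" "g a = g b"
    have pos: "f a > 0" "f b > 0" using f[of a] f[of b] ab assms by auto
    have "ln (f a powr (- 1 / (2 * real q))) = ln (f b powr (- 1 / (2 * real q)))"
      using ab(3) by (simp add: g_def)
    then have "ln (f a) = ln (f b)" using pos q1 by (simp add: ln_powr)
    then have "f a = f b" using pos by simp
    then have "real a * T = real b * T" using f[of a] f[of b] ab by auto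
    then show "a = b" using assms(2) by simp
  qed
  then have "infinite (g ` {n0..})" using finite_imageD infinite_Ici by blast
  moreover have "g ` {n0..} \<subseteq> ?X"
  proof
    fix x assume "x \<in> g ` {n0..}"
    then obtain n where n: "n \<ge> n0" "x = g n" by auto
    show "x \<in> ?X" using f[OF n(1)] n(2) unfolding g_def
      by (intro CollectI exI[of _ "f n"]) (auto intro!: exI[of _ "int n"])
  qed
  ultimately show ?thesis using finite_subset by blast
qed

end

lemma eventually_le_square:
  assumes "r > (0::real)" "\<And>z. z \<in> {0<..<r} \<Longrightarrow> P z"
  shows "\<forall>\<^sub>F z in at_right 0. P z"
  using eventually_at_right_real[OF assms(1)] by (rule eventually_mono) (rule assms(2))

section \<open>The averaging transformation at small action\<close>

locale averaged = perturbed +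
  fixes \<kappa> l N m :: nat and R \<epsilon> t0 :: real
    and cF cG v psi :: "nat \<Rightarrow> real \<Rightarrow> real \<Rightarrow> real \<Rightarrow> real" and Lam Om :: "nat \<Rightarrow> real \<Rightarrow> real \<Rightarrow> real"
    and fq gq :: "nat \<Rightarrow> real \<times> real \<times> real \<Rightarrow> real"
  assumes kappa: "\<kappa> \<ge> 1" and R: "R > 0" and t0: "t0 > 1"
    and se: "scaled_expansion q l \<kappa> s \<omega> R
      (\<lambda>k. action_coeff \<omega> (angle_par \<omega> x0) (angle_par \<omega> y0) (Hk k) (Fk k))
      (\<lambda>k. angle_coeff \<omega> (angle_par \<omega> x0) (angle_par \<omega> y0) (Hk k) (Fk k)) cF cG"
    and av: "averaging q l \<kappa> s R cF cG N m v psi Lam Om"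
    and ni: "near_identity q S \<epsilon> t0 R N m v psi"
    and smf: "\<And>k. k \<ge> 1 \<Longrightarrow> smooth_near ({0..z1} \<times> UNIV) (fq k)"
    and smg: "\<And>k. k \<ge> 1 \<Longrightarrow> smooth_near ({0..z1} \<times> UNIV) (gq k)"
    and feq: "\<And>k z \<phi> \<sigma>. k \<ge> 1 \<Longrightarrow> z \<in> {0<..z1} \<Longrightarrow>
       action_coeff \<omega> (angle_par \<omega> x0) (angle_par \<omega> y0) (Hk k) (Fk k) (z\<^sup>2) \<phi> \<sigma> = z\<^sup>2 * fq k (z, \<phi>, \<sigma>)"
    and geq: "\<And>k z \<phi> \<sigma>. k \<ge> 1 \<Longrightarrow> z \<in> {0<..z1} \<Longrightarrow>
       angle_coeff \<omega> (angle_par \<omega> x0) (angle_par \<omega> y0) (Hk k) (Fk k) (z\<^sup>2) \<phi> \<sigma> = gq k (z, \<phi>, \<sigma>)"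
    and rates: "\<And>K. \<exists>C>0. \<forall>\<^sub>F t in at_top. \<forall>z\<in>{0<..z1}. \<forall>\<phi>\<in>{0..4 * pi}.
       \<bar>energy_rate z \<phi> t - z\<^sup>2 * (\<Sum>k=1..K. t powr (- (real k / real q)) * fq k (z, \<phi>, S t))\<bar>
         \<le> C * z\<^sup>2 * t powr (- (real (K + 1) / real q)) \<and>
       \<bar>angle_rate z \<phi> t - \<omega> (z\<^sup>2) - (\<Sum>k=1..K. t powr (- (real k / real q)) * gq k (z, \<phi>, S t))\<bar>
         \<le> C * t powr (- (real (K + 1) / real q))"
begin

abbreviation "rho \<equiv> sqrt R"

lemma rho: "rho > 0" "z \<in> {0..rho} \<Longrightarrow> z\<^sup>2 \<in> {0..R}" "z \<in> {0<..<rho} \<Longrightarrow> z\<^sup>2 \<in> {0<..<R}"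
proof -
  have 1: "z \<in> {0..rho} \<Longrightarrow> z\<^sup>2 \<le> R" for z using R power_mono[of z rho 2] by auto
  have 2: "z \<in> {0<..<rho} \<Longrightarrow> z\<^sup>2 < R" for z using R power_strict_mono[of z rho 2] by auto
  show "rho > 0" using R by simp
  show "z \<in> {0..rho} \<Longrightarrow> z\<^sup>2 \<in> {0..R}" using 1 by auto
  show "z \<in> {0<..<rho} \<Longrightarrow> z\<^sup>2 \<in> {0<..<R}" using 2 by auto
qed

lemma v_periodic:
  assumes "k \<in> {2..N}" "e \<in> {0..R}"
  shows "v k e (\<theta> + of_int i * (2 * pi)) (\<sigma> + of_int j * (2 * pi * real \<kappa>)) = v k e \<theta> \<sigma>"
proof -
  have "periodic (2 * pi * real \<kappa>) (v k e \<theta>)" "periodic (2 * pi) (\<lambda>\<theta>. v k e \<theta> \<sigma>)" for \<theta> \<sigma>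
    using av assms unfolding averaging_def by blast+
  then show ?thesis using periodic_int[of "2 * pi * real \<kappa>" "v k e _" \<sigma> j] periodic_int[of "2 * pi" "\<lambda>\<theta>. v k e \<theta> \<sigma>" \<theta> i]
    by simp
qed

lemma psi_periodic:
  assumes "k \<in> {2..m}" "e \<in> {0..R}"
  shows "psi k e (\<theta> + of_int i * (2 * pi)) (\<sigma> + of_int j * (2 * pi * real \<kappa>)) = psi k e \<theta> \<sigma>"
proof -
  have "periodic (2 * pi * real \<kappa>) (psi k e \<theta>)" "periodic (2 * pi) (\<lambda>\<theta>. psi k e \<theta> \<sigma>)" for \<theta> \<sigma>
    using av assms unfolding averaging_def by blast+
  then show ?thesis using periodic_int[of "2 * pi * real \<kappa>" "psi k e _" \<sigma> j] periodic_int[of "2 * pi" "\<lambda>\<theta>. psi k e \<theta> \<sigma>" \<theta> i]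
    by simp
qed

text \<open>The bound \<open>\<bar>V\<^sub>N - e\<bar> \<le> \<epsilon> e\<close> at the infinitely many times with the same phase
  \<open>S t\<close> modulo \<open>2\<pi>\<kappa>\<close> forces each coefficient \<open>v\<^sub>k\<close> to be \<open>O(e)\<close>.\<close>

lemma v_order:
  assumes k: "k \<in> {2..N}"
  obtains vh where "smooth_near ({0..rho} \<times> UNIV) vh"
    "\<And>z \<theta> \<sigma>. z \<in> {0..rho} \<Longrightarrow> v k (z\<^sup>2) \<theta> \<sigma> = z\<^sup>2 * vh (z, \<theta>, \<sigma>)"
proof -
  let ?A = "{0..rho} \<times> (UNIV :: (real \<times> real) set)"
  have "\<forall>k\<in>{2..N}. sqrt_smooth R (\<lambda>e (\<theta>, \<sigma>). v k e \<theta> \<sigma>)" using av unfolding averaging_def by blast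
  then have "\<exists>w. smooth_near ?A w \<and> (\<forall>z\<in>{0..rho}. \<forall>p. (\<lambda>(\<theta>, \<sigma>). v k (z\<^sup>2) \<theta> \<sigma>) p = w (z, p))" if "k \<in> {2..N}" for k
    using that unfolding sqrt_smooth_def by blast
  then obtain w where w: "\<And>k. k \<in> {2..N} \<Longrightarrow> smooth_near ?A (w k) \<and>
     (\<forall>z\<in>{0..rho}. \<forall>p. (\<lambda>(\<theta>, \<sigma>). v k (z\<^sup>2) \<theta> \<sigma>) p = w k (z, p))" by metis
  have star: "(z, p) \<in> ?A \<Longrightarrow> u \<in> {0..1} \<Longrightarrow> (u * z, p) \<in> ?A" for z u p
    by (auto simp del: atLeastAtMost_iff intro: unit_mult_Icc)
  have "\<exists>u. smooth_near ?A u \<and> (\<forall>z p. (z, p) \<in> ?A \<longrightarrow> w k (z, p) = w k (0, p) + z * u (z, p))" if k: "k \<in> {2..N}" for k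
    by (rule hadamard_ex[OF conjunct1[OF w[OF k]] star])
  then obtain u where u: "\<And>k. k \<in> {2..N} \<Longrightarrow> smooth_near ?A (u k) \<and>
     (\<forall>z p. (z, p) \<in> ?A \<longrightarrow> w k (z, p) = w k (0, p) + z * u k (z, p))" by metis
  \<comment> \<open>The values of \<tau> at which the phase is \<sigma> modulo 2\<pi>\<kappa>. At
    these, \<open>near_identity\<close> bounds a polynomial in \<tau> whose coefficients are frozen
    at \<sigma>.\<close>
  define X where "X = (\<lambda>\<sigma>. {t powr (- 1 / (2 * real q)) | t. t \<ge> t0 \<and> (\<exists>j::int. S t = \<sigma> + of_int j * (2 * pi * real \<kappa>))})"
  have X: "infinite (X \<sigma>)" for \<sigma>
    unfolding X_def by (rule resonant_times) (use t0 kappa in auto)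
  have bound: "\<bar>\<Sum>k=2..N. \<tau> ^ k * w k (z, \<theta>, \<sigma>)\<bar> \<le> \<epsilon> * z\<^sup>2" if \<tau>: "\<tau> \<in> X \<sigma>" and z: "z \<in> {0..rho}" for \<tau> z \<theta> \<sigma>
  proof -
    obtain t and j :: int where t: "\<tau> = t powr (- 1 / (2 * real q))" "t \<ge> t0" "S t = \<sigma> + of_int j * (2 * pi * real \<kappa>)"
      using \<tau> by (auto simp: X_def)
    have "\<bar>V_trunc N v \<tau> (z\<^sup>2) \<theta> (S t) - z\<^sup>2\<bar> \<le> \<epsilon> * z\<^sup>2"
      using ni t(2) rho(2)[OF z] unfolding near_identity_def Let_def t(1) by blast
    moreover have "V_trunc N v \<tau> (z\<^sup>2) \<theta> (S t) - z\<^sup>2 = (\<Sum>k=2..N. \<tau> ^ k * w k (z, \<theta>, \<sigma>))"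
    proof -
      have "v k (z\<^sup>2) \<theta> (S t) = w k (z, \<theta>, \<sigma>)" if k: "k \<in> {2..N}" for k
      proof -
        have "v k (z\<^sup>2) \<theta> (S t) = v k (z\<^sup>2) \<theta> \<sigma>" using v_periodic[OF k rho(2)[OF z], of \<theta> 0 \<sigma> j] t(3) by simp
        also have "\<dots> = w k (z, \<theta>, \<sigma>)" using w[OF k] z by auto
        finally show ?thesis .
      qed
      then show ?thesis by (simp add: V_trunc_def partial_expansion_def)
    qed
    ultimately show ?thesis by simp
  qed
  \<comment> \<open>At \<open>z = 0\<close> the bound is zero, so the polynomial has infinitely many
    roots.\<close>
  have w0: "w k (0, \<theta>, \<sigma>) = 0" if "k \<in> {2..N}" for k \<theta> \<sigma>
  proof (rule poly_zero_if_infinite_roots[OF X[of \<sigma>] _ that])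
    fix \<tau> assume "\<tau> \<in> X \<sigma>"
    from bound[OF this, of 0 \<theta>] show "(\<Sum>k=2..N. \<tau> ^ k * w k (0, \<theta>, \<sigma>)) = 0" using R by simp
  qed
  \<comment> \<open>After division by \<open>z\<close> the bound is \<open>\<epsilon> * z\<close>,
    which again vanishes in the limit, so the same argument applies to the first-order
    coefficients.\<close>
  have u0: "u k (0, \<theta>, \<sigma>) = 0" if "k \<in> {2..N}" for k \<theta> \<sigma>
  proof (rule poly_zero_if_infinite_roots[OF X[of \<sigma>] _ that])
    fix \<tau> assume \<tau>: "\<tau> \<in> X \<sigma>"
    have "\<forall>\<^sub>F z in at_right 0. norm (\<Sum>k=2..N. \<tau> ^ k * u k (z, \<theta>, \<sigma>)) \<le> \<epsilon> * z"
    proof (rule eventually_le_square[OF rho(1)])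
      fix z assume z: "z \<in> {0<..<rho}"
      have "(\<Sum>k=2..N. \<tau> ^ k * w k (z, \<theta>, \<sigma>)) = z * (\<Sum>k=2..N. \<tau> ^ k * u k (z, \<theta>, \<sigma>))"
        unfolding sum_distrib_left
      proof (intro sum.cong refl)
        fix k assume k: "k \<in> {2..N}"
        have "w k (z, \<theta>, \<sigma>) = w k (0, \<theta>, \<sigma>) + z * u k (z, \<theta>, \<sigma>)"
          using u[OF k] z by auto
        then show "\<tau> ^ k * w k (z, \<theta>, \<sigma>) = z * (\<tau> ^ k * u k (z, \<theta>, \<sigma>))"
          using w0[OF k] by (simp add: mult.left_commute)
      qed
      then have "z * \<bar>\<Sum>k=2..N. \<tau> ^ k * u k (z, \<theta>, \<sigma>)\<bar> \<le> z * (\<epsilon> * z)"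
        using bound[OF \<tau>, of z \<theta>] z by (auto simp: abs_mult power2_eq_square mult_ac)
      then show "norm (\<Sum>k=2..N. \<tau> ^ k * u k (z, \<theta>, \<sigma>)) \<le> \<epsilon> * z" using z by simp
    qed
    moreover have "((\<lambda>z. \<epsilon> * z) \<longlongrightarrow> 0) (at_right (0::real))" by (auto intro!: tendsto_eq_intros)
    ultimately have 1: "((\<lambda>z. \<Sum>k=2..N. \<tau> ^ k * u k (z, \<theta>, \<sigma>)) \<longlongrightarrow> 0) (at_right 0)"
      by (rule Lim_null_comparison)
    have "((\<lambda>z. \<Sum>k=2..N. \<tau> ^ k * u k (z, \<theta>, \<sigma>)) \<longlongrightarrow> (\<Sum>k=2..N. \<tau> ^ k * u k (0, \<theta>, \<sigma>))) (at_right 0)"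
    proof (intro tendsto_sum tendsto_mult tendsto_const)
      fix k assume k: "k \<in> {2..N}"
      have "isCont (u k) (0, \<theta>, \<sigma>)" by (rule smooth_near_isCont[OF conjunct1[OF u[OF k]]]) (use R in auto)
      then show "((\<lambda>z. u k (z, \<theta>, \<sigma>)) \<longlongrightarrow> u k (0, \<theta>, \<sigma>)) (at_right 0)"
        by (rule isCont_tendsto_compose) (auto intro!: tendsto_intros)
    qed
    with 1 show "(\<Sum>k=2..N. \<tau> ^ k * u k (0, \<theta>, \<sigma>)) = 0"
      using tendsto_unique[OF trivial_limit_at_right_real] by blast
  qed
  obtain vh where vh: "smooth_near ?A vh" "\<And>z p. (z, p) \<in> ?A \<Longrightarrow> u k (z, p) = u k (0, p) + z * vh (z, p)"
    using hadamard[OF conjunct1[OF u[OF k]] star] by blast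
  show ?thesis
  proof (rule that[OF vh(1)])
    fix z \<theta> \<sigma> assume z: "z \<in> {0..rho}"
    have "v k (z\<^sup>2) \<theta> \<sigma> = w k (z, \<theta>, \<sigma>)" using w[OF k] z by auto
    also have "\<dots> = z * u k (z, \<theta>, \<sigma>)" using u[OF k] z w0[OF k, of \<theta> \<sigma>] by auto
    also have "\<dots> = z\<^sup>2 * vh (z, \<theta>, \<sigma>)" using vh(2)[of z "(\<theta>, \<sigma>)"] z u0[OF k, of \<theta> \<sigma>] by (auto simp: power2_eq_square)
    finally show "v k (z\<^sup>2) \<theta> \<sigma> = z\<^sup>2 * vh (z, \<theta>, \<sigma>)" .
  qed
qed

end

section \<open>The near-identity transformation\<close>

lemma smooth_near_sqrt [smooth_intros]:
  assumes "smooth_near A f" "\<And>p. p \<in> A \<Longrightarrow> f p > 0"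
  shows "smooth_near A (\<lambda>p. sqrt (f p))"
proof (rule smooth_near_compose[where B="{0<..}" and g=sqrt])
  show "smooth_near {0<..} sqrt"
    by (rule smooth_near_cong[OF smooth_near_powr[OF smooth_near_ident, of "{0<..}" "1/2"], where U="{0<..}"])
       (auto simp: powr_half_sqrt)
qed (use assms in \<open>auto intro: smooth_intros\<close>)

lemma power_bigo_at_right_0: "a \<ge> b \<Longrightarrow> (\<lambda>\<tau>::real. \<tau> ^ a) \<in> O[at_right 0](\<lambda>\<tau>. \<tau> ^ b)"
proof -
  assume ab: "a \<ge> b"
  have "\<forall>\<^sub>F \<tau> in at_right 0. norm (\<tau> ^ a) \<le> 1 * norm ((\<tau>::real) ^ b)"
    using eventually_at_right_real[OF zero_less_one]
    by eventually_elim (use ab in \<open>auto intro!: power_decreasing\<close>)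
  then show ?thesis by (rule bigoI)
qed

lemma bigo_power_mono:
  "f \<in> O[at_right 0](\<lambda>\<tau>::real. \<tau> ^ a) \<Longrightarrow> a \<ge> b \<Longrightarrow> f \<in> O[at_right 0](\<lambda>\<tau>. \<tau> ^ b)"
  using landau_o.big_trans power_bigo_at_right_0 by blast

lemma bigo_cong_at_right:
  assumes "f \<in> O[at_right 0](g)" "T > 0" "\<And>\<tau>::real. 0 < \<tau> \<Longrightarrow> \<tau> < T \<Longrightarrow> f \<tau> = h \<tau>"
  shows "h \<in> O[at_right 0](g)"
proof -
  have "\<forall>\<^sub>F \<tau> in at_right 0. f \<tau> = h \<tau>"
    using eventually_at_right_real[OF assms(2)] by (rule eventually_mono) (use assms(3) in auto)
  then show ?thesis using landau_o.big.in_cong assms(1) by blast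
qed

lemma smooth_bigo_1:
  assumes "smooth_near ({0..T} \<times> C) f" "compact C" "T > 0" "p \<in> C"
  shows "(\<lambda>\<tau>. f (\<tau>, p)) \<in> O[at_right 0](\<lambda>\<tau>::real. 1)"
proof -
  obtain B where B: "B > 0" "\<And>x. x \<in> {0..T} \<times> C \<Longrightarrow> \<bar>f x\<bar> \<le> B"
    by (rule smooth_near_bounded[OF assms(1)]) (auto intro: compact_Times assms(2))
  have "\<forall>\<^sub>F \<tau> in at_right 0. norm (f (\<tau>, p)) \<le> B * norm (1::real)"
    using eventually_at_right_real[OF assms(3)] by (rule eventually_mono) (use B assms(4) in auto)
  then show ?thesis by (rule bigoI)
qed

lemma bigo_mult_bounded:
  assumes "f \<in> O[at_right 0](\<lambda>\<tau>::real. 1)" "g \<in> O[at_right 0](\<lambda>\<tau>. \<tau> ^ a)"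
  shows "(\<lambda>\<tau>. f \<tau> * g \<tau>) \<in> O[at_right 0](\<lambda>\<tau>. \<tau> ^ a)"
  using landau_o.big.mult[OF assms] by simp

lemma sqrt_square_curve:
  fixes f :: "real \<times> real \<times> real \<Rightarrow> real"
  assumes sm: "smooth_near ({0..r} \<times> UNIV) f" and z: "z \<in> {0<..<r}" and e: "e t = z\<^sup>2"
    and d: "(e has_real_derivative e') (at t)" "(th has_real_derivative th') (at t)" "(sg has_real_derivative sg') (at t)"
  shows "((\<lambda>t. f (sqrt (e t), th t, sg t)) has_real_derivative
    e' / (2 * z) * iter_dderiv f [(1, 0, 0)] (z, th t, sg t) + th' * iter_dderiv f [(0, 1, 0)] (z, th t, sg t)
    + sg' * iter_dderiv f [(0, 0, 1)] (z, th t, sg t)) (at t)"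
proof -
  have s: "sqrt (e t) = z" using z e by simp
  have "((\<lambda>t. sqrt (e t)) has_real_derivative e' / (2 * z)) (at t)"
    using DERIV_chain2[OF DERIV_real_sqrt d(1)] z s by (auto simp: e field_simps)
  from chain3[OF sm this d(2,3)] show ?thesis unfolding s using z by auto
qed

text \<open>All coefficients are given by functions smooth in the root \<open>z\<close> of the
  action. \<open>La\<close> represents \<Lambda> at every order up to \<open>N\<close>, whereas
  \<open>Lh\<close> exists at the orders from \<open>n\<close> to \<open>n + d\<close>, where the
  factor \<open>z\<^sup>2\<close> can be split off.\<close>

locale reduced = averaged +
  fixes n d :: nat and D0 :: real and vh ph :: "nat \<Rightarrow> real \<times> real \<times> real \<Rightarrow> real"
    and La Lh :: "nat \<Rightarrow> real \<times> real \<Rightarrow> real" and Oh :: "real \<times> real \<Rightarrow> real"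
  assumes D0: "0 < D0" and nd: "2 \<le> n" "n + d \<le> N" "n + d \<le> 2 * q" and m2: "2 \<le> m" "m \<le> 2 * q"
    and smvh: "\<And>k. k \<in> {2..N} \<Longrightarrow> smooth_near ({0..rho} \<times> UNIV) (vh k)"
    and veq: "\<And>k z \<theta> \<sigma>. k \<in> {2..N} \<Longrightarrow> z \<in> {0..rho} \<Longrightarrow> v k (z\<^sup>2) \<theta> \<sigma> = z\<^sup>2 * vh k (z, \<theta>, \<sigma>)"
    and smph: "\<And>k. k \<in> {2..m} \<Longrightarrow> smooth_near ({0..rho} \<times> UNIV) (ph k)"
    and peq: "\<And>k z \<theta> \<sigma>. k \<in> {2..m} \<Longrightarrow> z \<in> {0..rho} \<Longrightarrow> psi k (z\<^sup>2) \<theta> \<sigma> = ph k (z, \<theta>, \<sigma>)"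
    and smLa: "\<And>j. j \<in> {2..N} \<Longrightarrow> smooth_near ({0..rho} \<times> UNIV) (La j)"
    and Laeq: "\<And>j z \<psi>. j \<in> {2..N} \<Longrightarrow> z \<in> {0..rho} \<Longrightarrow> Lam j (z\<^sup>2) \<psi> = La j (z, \<psi>)"
    and smLh: "\<And>j. j \<in> {n..n + d} \<Longrightarrow> smooth_near ({0..rho} \<times> UNIV) (Lh j)"
    and Lheq: "\<And>j z \<psi>. j \<in> {n..n + d} \<Longrightarrow> z \<in> {0..rho} \<Longrightarrow> Lam j (z\<^sup>2) \<psi> = z\<^sup>2 * Lh j (z, \<psi>)"
    and smOh: "smooth_near ({0..rho} \<times> UNIV) Oh"
    and Oheq: "\<And>z \<psi>. z \<in> {0..rho} \<Longrightarrow> Om m (z\<^sup>2) \<psi> = Oh (z, \<psi>)"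
    and Lam0: "\<And>j u \<psi>. j \<in> {2..<n} \<Longrightarrow> u \<in> {0..D0} \<Longrightarrow> Lam j u \<psi> = 0"
    and Om0: "\<And>j u \<psi>. j \<in> {2..<m} \<Longrightarrow> u \<in> {0..D0} \<Longrightarrow> Om j u \<psi> = 0"
begin

text \<open>Here \<open>x = (\<tau>, z, \<theta>, \<sigma>)\<close>, the action being \<open>z\<^sup>2\<close>. The defects of the averaged equations for
  \<open>V = z\<^sup>2 Vh\<close> and \<open>\<Psi> = Ph\<close> are \<open>z\<^sup>2 DV\<close> and \<open>DP\<close>; \<open>QF\<close> and \<open>QG\<close> replace \<open>cF / z\<^sup>2\<close> and \<open>cG\<close> by
  functions that are smooth up to \<open>z = 0\<close> and agree with them to the required order.\<close>

definition "Vh = (\<lambda>(\<tau>, p). 1 + (\<Sum>k=2..N. \<tau> ^ k * vh k p))"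
definition "Vz = (\<lambda>(\<tau>, p). \<Sum>k=2..N. \<tau> ^ k * iter_dderiv (vh k) [(1, 0, 0)] p)"
definition "Vt = (\<lambda>(\<tau>, p). \<Sum>k=2..N. \<tau> ^ k * iter_dderiv (vh k) [(0, 1, 0)] p)"
definition "Vs = (\<lambda>(\<tau>, p). \<Sum>k=2..N. \<tau> ^ k * iter_dderiv (vh k) [(0, 0, 1)] p)"
definition "Vtau = (\<lambda>(\<tau>, p). \<Sum>k=2..N. real k * \<tau> ^ (k - 1) * vh k p)"
definition "Ph = (\<lambda>(\<tau>, p). fst (snd p) + (\<Sum>k=2..m. \<tau> ^ k * ph k p))"
definition "Pz = (\<lambda>(\<tau>, p). \<Sum>k=2..m. \<tau> ^ k * iter_dderiv (ph k) [(1, 0, 0)] p)"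
definition "Pt = (\<lambda>(\<tau>, p). 1 + (\<Sum>k=2..m. \<tau> ^ k * iter_dderiv (ph k) [(0, 1, 0)] p))"
definition "Ps = (\<lambda>(\<tau>, p). \<Sum>k=2..m. \<tau> ^ k * iter_dderiv (ph k) [(0, 0, 1)] p)"
definition "Ptau = (\<lambda>(\<tau>, p). \<Sum>k=2..m. real k * \<tau> ^ (k - 1) * ph k p)"
definition "QF K = (\<lambda>(\<tau>, p). \<Sum>i=1..K. \<tau> ^ (2 * i) *
   fq i (\<tau> ^ l * fst p, fst (snd p) + snd (snd p) / real \<kappa>, snd (snd p)))"
definition "QG K = (\<lambda>(\<tau>, p). wz (\<tau> ^ l * fst p) - formal_dS q s \<tau> / real \<kappa> + (\<Sum>i=1..K. \<tau> ^ (2 * i) *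
   gq i (\<tau> ^ l * fst p, fst (snd p) + snd (snd p) / real \<kappa>, snd (snd p))))"
definition "DV = (\<lambda>x. (Vh x + fst (snd x) / 2 * Vz x) * (QF N x + fst x ^ (2 * q) * (real l / real q))
   + Vt x * QG N x + Vs x * formal_dS q s (fst x) - Vtau x * fst x ^ (2 * q + 1) / (2 * real q)
   - (\<Sum>j=n..n + d. fst x ^ j * (Vh x * Lh j (fst (snd x) * sqrt (Vh x), Ph x))))"
definition "DP = (\<lambda>x. fst (snd x) / 2 * Pz x * (QF m x + fst x ^ (2 * q) * (real l / real q))
   + Pt x * QG m x + Ps x * formal_dS q s (fst x) - Ptau x * fst x ^ (2 * q + 1) / (2 * real q)
   - fst x ^ m * Oh (fst (snd x) * sqrt (Vh x), Ph x))"

lemma V_eq: "z \<in> {0..rho} \<Longrightarrow> V_trunc N v \<tau> (z\<^sup>2) \<theta> \<sigma> = z\<^sup>2 * Vh (\<tau>, z, \<theta>, \<sigma>)"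
  by (simp add: V_trunc_def partial_expansion_def Vh_def veq distrib_left sum_distrib_left mult.left_commute)

lemma Psi_eq: "z \<in> {0..rho} \<Longrightarrow> Psi_trunc m psi \<tau> (z\<^sup>2) \<theta> \<sigma> = Ph (\<tau>, z, \<theta>, \<sigma>)"
  by (simp add: Psi_trunc_def partial_expansion_def Ph_def peq)

text \<open>An arbitrary curve is allowed so that the formula serves twice: with one variable
  moving, for the partial derivatives in \<open>total_deriv\<close>, and later along true solutions.
  The action enters through its square root, which is differentiable because
  \<open>z > 0\<close>.\<close>

lemma V_curve:
  assumes z: "z \<in> {0<..<rho}" and e: "e t = z\<^sup>2"
    and dT: "(T has_real_derivative T') (at t)"
    and dd: "(e has_real_derivative e') (at t)" "(th has_real_derivative th') (at t)" "(sg has_real_derivative sg') (at t)"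
  shows "((\<lambda>t. V_trunc N v (T t) (e t) (th t) (sg t)) has_real_derivative
    e' * (Vh (T t, z, th t, sg t) + z / 2 * Vz (T t, z, th t, sg t))
    + z\<^sup>2 * (th' * Vt (T t, z, th t, sg t) + sg' * Vs (T t, z, th t, sg t) + T' * Vtau (T t, z, th t, sg t))) (at t)"
proof -
  have s: "sqrt (e t) = z" using z e by simp
  let ?W = "\<lambda>t. e t * (1 + (\<Sum>k=2..N. T t ^ k * vh k (sqrt (e t), th t, sg t)))"
  let ?f' = "\<lambda>k. e' / (2 * z) * iter_dderiv (vh k) [(1, 0, 0)] (z, th t, sg t)
    + th' * iter_dderiv (vh k) [(0, 1, 0)] (z, th t, sg t) + sg' * iter_dderiv (vh k) [(0, 0, 1)] (z, th t, sg t)"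
  have k: "((\<lambda>t. T t ^ k * vh k (sqrt (e t), th t, sg t)) has_real_derivative
     real k * T t ^ (k - 1) * T' * vh k (z, th t, sg t) + ?f' k * T t ^ k) (at t)" if "k \<in> {2..N}" for k
    using DERIV_mult[OF DERIV_power[OF dT, of k] sqrt_square_curve[OF smvh[OF that] z e dd]]
    by (simp add: s mult_ac del: iter_dderiv.simps)
  have sum: "((\<lambda>t. \<Sum>k=2..N. T t ^ k * vh k (sqrt (e t), th t, sg t)) has_real_derivative
     (\<Sum>k=2..N. real k * T t ^ (k - 1) * T' * vh k (z, th t, sg t) + ?f' k * T t ^ k)) (at t)"
    by (intro DERIV_sum k)
  have "(\<Sum>k=2..N. real k * T t ^ (k - 1) * T' * vh k (z, th t, sg t) + ?f' k * T t ^ k)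
    = T' * Vtau (T t, z, th t, sg t) + e' / (2 * z) * Vz (T t, z, th t, sg t) + th' * Vt (T t, z, th t, sg t) + sg' * Vs (T t, z, th t, sg t)"
    unfolding Vtau_def Vz_def Vt_def Vs_def prod.case sum_distrib_left sum.distrib[symmetric]
    by (intro sum.cong refl) (simp add: algebra_simps del: iter_dderiv.simps)
  note sum' = sum[unfolded this]
  have "(?W has_real_derivative e' * Vh (T t, z, th t, sg t) + (T' * Vtau (T t, z, th t, sg t)
     + e' / (2 * z) * Vz (T t, z, th t, sg t) + th' * Vt (T t, z, th t, sg t) + sg' * Vs (T t, z, th t, sg t)) * z\<^sup>2) (at t)"
    using DERIV_mult[OF dd(1) DERIV_add[OF DERIV_const[of 1] sum']] z
    by (simp add: s e Vh_def mult.commute del: iter_dderiv.simps)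
  moreover have "e' * Vh (T t, z, th t, sg t) + (T' * Vtau (T t, z, th t, sg t)
     + e' / (2 * z) * Vz (T t, z, th t, sg t) + th' * Vt (T t, z, th t, sg t) + sg' * Vs (T t, z, th t, sg t)) * z\<^sup>2
    = e' * (Vh (T t, z, th t, sg t) + z / 2 * Vz (T t, z, th t, sg t))
    + z\<^sup>2 * (th' * Vt (T t, z, th t, sg t) + sg' * Vs (T t, z, th t, sg t) + T' * Vtau (T t, z, th t, sg t))"
    using z by (simp add: field_simps power2_eq_square)
  ultimately have W: "(?W has_real_derivative e' * (Vh (T t, z, th t, sg t) + z / 2 * Vz (T t, z, th t, sg t))
    + z\<^sup>2 * (th' * Vt (T t, z, th t, sg t) + sg' * Vs (T t, z, th t, sg t) + T' * Vtau (T t, z, th t, sg t))) (at t)"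
    by simp
  have "(e \<longlongrightarrow> z\<^sup>2) (nhds t)"
    using DERIV_isCont[OF dd(1)] e by (simp add: continuous_at tendsto_nhds_iff)
  then have "\<forall>\<^sub>F t in nhds t. e t \<in> {0<..<R}"
    using rho(3)[OF z] by (intro topological_tendstoD) auto
  then have "\<forall>\<^sub>F t in nhds t. ?W t = V_trunc N v (T t) (e t) (th t) (sg t)"
  proof eventually_elim
    case (elim t)
    then have "sqrt (e t) \<in> {0..rho}" "(sqrt (e t))\<^sup>2 = e t" by auto
    then show ?case using V_eq[of "sqrt (e t)" "T t" "th t" "sg t"] by (simp add: Vh_def)
  qed
  from iffD1[OF DERIV_cong_ev[OF refl this refl] W] show ?thesis .
qed

lemma Psi_curve:
  assumes z: "z \<in> {0<..<rho}" and e: "e t = z\<^sup>2"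
    and dT: "(T has_real_derivative T') (at t)"
    and dd: "(e has_real_derivative e') (at t)" "(th has_real_derivative th') (at t)" "(sg has_real_derivative sg') (at t)"
  shows "((\<lambda>t. Psi_trunc m psi (T t) (e t) (th t) (sg t)) has_real_derivative
    e' / (2 * z) * Pz (T t, z, th t, sg t)
    + th' * Pt (T t, z, th t, sg t) + sg' * Ps (T t, z, th t, sg t) + T' * Ptau (T t, z, th t, sg t)) (at t)"
proof -
  have s: "sqrt (e t) = z" using z e by simp
  let ?W = "\<lambda>t. th t + (\<Sum>k=2..m. T t ^ k * ph k (sqrt (e t), th t, sg t))"
  let ?f' = "\<lambda>k. e' / (2 * z) * iter_dderiv (ph k) [(1, 0, 0)] (z, th t, sg t)
    + th' * iter_dderiv (ph k) [(0, 1, 0)] (z, th t, sg t) + sg' * iter_dderiv (ph k) [(0, 0, 1)] (z, th t, sg t)"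
  have k: "((\<lambda>t. T t ^ k * ph k (sqrt (e t), th t, sg t)) has_real_derivative
     real k * T t ^ (k - 1) * T' * ph k (z, th t, sg t) + ?f' k * T t ^ k) (at t)" if "k \<in> {2..m}" for k
    using DERIV_mult[OF DERIV_power[OF dT, of k] sqrt_square_curve[OF smph[OF that] z e dd]]
    by (simp add: s mult_ac del: iter_dderiv.simps)
  have sum: "((\<lambda>t. \<Sum>k=2..m. T t ^ k * ph k (sqrt (e t), th t, sg t)) has_real_derivative
     (\<Sum>k=2..m. real k * T t ^ (k - 1) * T' * ph k (z, th t, sg t) + ?f' k * T t ^ k)) (at t)"
    by (intro DERIV_sum k)
  have "(\<Sum>k=2..m. real k * T t ^ (k - 1) * T' * ph k (z, th t, sg t) + ?f' k * T t ^ k)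
    = T' * Ptau (T t, z, th t, sg t) + e' / (2 * z) * Pz (T t, z, th t, sg t) + th' * (Pt (T t, z, th t, sg t) - 1) + sg' * Ps (T t, z, th t, sg t)"
    unfolding Ptau_def Pz_def Pt_def Ps_def prod.case add_diff_cancel_left' sum_distrib_left sum.distrib[symmetric]
    by (intro sum.cong refl) (simp add: algebra_simps del: iter_dderiv.simps)
  note sum' = sum[unfolded this]
  have W: "(?W has_real_derivative e' / (2 * z) * Pz (T t, z, th t, sg t)
    + th' * Pt (T t, z, th t, sg t) + sg' * Ps (T t, z, th t, sg t) + T' * Ptau (T t, z, th t, sg t)) (at t)"
    by (rule DERIV_cong[OF DERIV_add[OF dd(2) sum']]) (simp add: algebra_simps)
  have "(e \<longlongrightarrow> z\<^sup>2) (nhds t)"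
    using DERIV_isCont[OF dd(1)] e by (simp add: continuous_at tendsto_nhds_iff)
  then have "\<forall>\<^sub>F t in nhds t. e t \<in> {0<..<R}"
    using rho(3)[OF z] by (intro topological_tendstoD) auto
  then have "\<forall>\<^sub>F t in nhds t. ?W t = Psi_trunc m psi (T t) (e t) (th t) (sg t)"
  proof eventually_elim
    case (elim t)
    then have "sqrt (e t) \<in> {0..rho}" "(sqrt (e t))\<^sup>2 = e t" by auto
    then show ?case using Psi_eq[of "sqrt (e t)" "T t" "th t" "sg t"] by (simp add: Ph_def)
  qed
  from iffD1[OF DERIV_cong_ev[OF refl this refl] W] show ?thesis .
qed

lemma V_total_deriv:
  assumes z: "z \<in> {0<..<rho}"
  shows "total_deriv q l s f g (V_trunc N v) \<tau> (z\<^sup>2) \<theta> \<sigma> =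
    (Vh (\<tau>, z, \<theta>, \<sigma>) + z / 2 * Vz (\<tau>, z, \<theta>, \<sigma>)) * (f \<tau> (z\<^sup>2) \<theta> \<sigma> + z\<^sup>2 * (\<tau> ^ (2 * q) * (real l / real q)))
    + z\<^sup>2 * (Vt (\<tau>, z, \<theta>, \<sigma>) * g \<tau> (z\<^sup>2) \<theta> \<sigma> + Vs (\<tau>, z, \<theta>, \<sigma>) * formal_dS q s \<tau>
      - Vtau (\<tau>, z, \<theta>, \<sigma>) * \<tau> ^ (2 * q + 1) / (2 * real q))"
proof -
  have "deriv (\<lambda>e. V_trunc N v \<tau> e \<theta> \<sigma>) (z\<^sup>2) = Vh (\<tau>, z, \<theta>, \<sigma>) + z / 2 * Vz (\<tau>, z, \<theta>, \<sigma>)"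
    using V_curve[OF z _ DERIV_const DERIV_ident DERIV_const DERIV_const] by (auto intro!: DERIV_imp_deriv)
  moreover have "deriv (\<lambda>\<theta>. V_trunc N v \<tau> (z\<^sup>2) \<theta> \<sigma>) \<theta> = z\<^sup>2 * Vt (\<tau>, z, \<theta>, \<sigma>)"
    using V_curve[OF z refl DERIV_const DERIV_const DERIV_ident DERIV_const] by (auto intro!: DERIV_imp_deriv)
  moreover have "deriv (\<lambda>\<sigma>. V_trunc N v \<tau> (z\<^sup>2) \<theta> \<sigma>) \<sigma> = z\<^sup>2 * Vs (\<tau>, z, \<theta>, \<sigma>)"
    using V_curve[OF z refl DERIV_const DERIV_const DERIV_const DERIV_ident] by (auto intro!: DERIV_imp_deriv)
  moreover have "deriv (\<lambda>\<tau>. V_trunc N v \<tau> (z\<^sup>2) \<theta> \<sigma>) \<tau> = z\<^sup>2 * Vtau (\<tau>, z, \<theta>, \<sigma>)"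
    using V_curve[OF z refl DERIV_ident DERIV_const DERIV_const DERIV_const] by (auto intro!: DERIV_imp_deriv)
  ultimately show ?thesis unfolding total_deriv_def by (simp only:) (simp add: algebra_simps)
qed

lemma Psi_total_deriv:
  assumes z: "z \<in> {0<..<rho}"
  shows "total_deriv q l s f g (Psi_trunc m psi) \<tau> (z\<^sup>2) \<theta> \<sigma> =
    Pz (\<tau>, z, \<theta>, \<sigma>) / (2 * z) * (f \<tau> (z\<^sup>2) \<theta> \<sigma> + z\<^sup>2 * (\<tau> ^ (2 * q) * (real l / real q)))
    + Pt (\<tau>, z, \<theta>, \<sigma>) * g \<tau> (z\<^sup>2) \<theta> \<sigma> + Ps (\<tau>, z, \<theta>, \<sigma>) * formal_dS q s \<tau>
      - Ptau (\<tau>, z, \<theta>, \<sigma>) * \<tau> ^ (2 * q + 1) / (2 * real q)"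
proof -
  have "deriv (\<lambda>e. Psi_trunc m psi \<tau> e \<theta> \<sigma>) (z\<^sup>2) = Pz (\<tau>, z, \<theta>, \<sigma>) / (2 * z)"
    using Psi_curve[OF z _ DERIV_const DERIV_ident DERIV_const DERIV_const] by (auto intro!: DERIV_imp_deriv)
  moreover have "deriv (\<lambda>\<theta>. Psi_trunc m psi \<tau> (z\<^sup>2) \<theta> \<sigma>) \<theta> = Pt (\<tau>, z, \<theta>, \<sigma>)"
    using Psi_curve[OF z refl DERIV_const DERIV_const DERIV_ident DERIV_const] by (auto intro!: DERIV_imp_deriv)
  moreover have "deriv (\<lambda>\<sigma>. Psi_trunc m psi \<tau> (z\<^sup>2) \<theta> \<sigma>) \<sigma> = Ps (\<tau>, z, \<theta>, \<sigma>)"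
    using Psi_curve[OF z refl DERIV_const DERIV_const DERIV_const DERIV_ident] by (auto intro!: DERIV_imp_deriv)
  moreover have "deriv (\<lambda>\<tau>. Psi_trunc m psi \<tau> (z\<^sup>2) \<theta> \<sigma>) \<tau> = Ptau (\<tau>, z, \<theta>, \<sigma>)"
    using Psi_curve[OF z refl DERIV_ident DERIV_const DERIV_const DERIV_const] by (auto intro!: DERIV_imp_deriv)
  ultimately show ?thesis unfolding total_deriv_def by (simp only:) (simp add: algebra_simps)
qed

lemma domain_exists:
  obtains \<tau>1 z2 where "0 < \<tau>1" "\<tau>1 \<le> 1" "0 < z2" "z2 < z1" "2 * z2 < rho" "2 * z2\<^sup>2 \<le> D0"
    "\<And>x. x \<in> {0..\<tau>1} \<times> {0..z2} \<times> {0..2 * pi} \<times> {0..2 * pi * real \<kappa>} \<Longrightarrow> Vh x \<in> {1 / 2..2}"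
proof -
  \<comment> \<open>\<open>V = z\<^sup>2 * Vh\<close> with \<open>Vh \<le> 2\<close>: the bound
    \<open>2 * z2\<^sup>2 \<le> D0\<close> keeps \<open>V\<close> in the range where the form of
    \<Lambda> is known, and \<open>2 * z2 < rho\<close> keeps its root where the coefficients are
    smooth.\<close>
  define z2 where "z2 = min (z1 / 2) (min (rho / 3) (sqrt (D0 / 2)))"
  have z2: "0 < z2" "z2 < z1" "2 * z2 < rho" "z2 \<le> sqrt (D0 / 2)"
  proof -
    have "z2 \<le> z1 / 2" "z2 \<le> rho / 3" "z2 \<le> sqrt (D0 / 2)" by (auto simp: z2_def)
    then show "z2 < z1" "2 * z2 < rho" "z2 \<le> sqrt (D0 / 2)" using z1 rho(1) by linarith+
    show "0 < z2" using z1 rho(1) D0 by (auto simp: z2_def)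
  qed
  have "z2\<^sup>2 \<le> (sqrt (D0 / 2))\<^sup>2" using z2 by (intro power_mono) auto
  then have z2D: "2 * z2\<^sup>2 \<le> D0" using D0 by simp
  let ?C = "{0..z2} \<times> {0..2 * pi} \<times> {0..2 * pi * real \<kappa>}"
  have cC: "compact ?C" by (intro compact_Times) auto
  have "\<exists>B>0. \<forall>p\<in>?C. \<bar>vh k p\<bar> \<le> B" if "k \<in> {2..N}" for k
  proof -
    have "smooth_near ?C (vh k)" by (rule smooth_near_subset[OF smvh[OF that]]) (use z2 in auto)
    from smooth_near_bounded[OF this cC] show ?thesis by metis
  qed
  then obtain B where B: "\<And>k. k \<in> {2..N} \<Longrightarrow> B k > 0 \<and> (\<forall>p\<in>?C. \<bar>vh k p\<bar> \<le> B k)" by metis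
  define M where "M = (\<Sum>k=2..N. B k)"
  have M: "M \<ge> 0" unfolding M_def using B by (intro sum_nonneg) (auto intro: less_imp_le)
  \<comment> \<open>All exponents are at least 2 and \<open>\<tau>1 \<le> 1\<close>, so the sum in
    \<open>Vh\<close> is at most \<open>\<tau>1 * M \<le> 1 / 2\<close>.\<close>
  define \<tau>1 where "\<tau>1 = 1 / (2 * (M + 1))"
  have t1: "0 < \<tau>1" "\<tau>1 \<le> 1" "\<tau>1 * M \<le> 1 / 2" using M by (auto simp: \<tau>1_def field_simps)
  show ?thesis
  proof (rule that[OF t1(1,2) z2(1-3) z2D])
    fix x assume "x \<in> {0..\<tau>1} \<times> ?C"
    then obtain \<tau> p where x: "x = (\<tau>, p)" "\<tau> \<in> {0..\<tau>1}" "p \<in> ?C" by blast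
    have "\<bar>\<Sum>k=2..N. \<tau> ^ k * vh k p\<bar> \<le> (\<Sum>k=2..N. \<bar>\<tau> ^ k * vh k p\<bar>)" by (rule sum_abs)
    also have "\<dots> \<le> (\<Sum>k=2..N. \<tau>1 * B k)"
    proof (rule sum_mono)
      fix k assume k: "k \<in> {2..N}"
      have "\<tau> ^ k \<le> \<tau> ^ 1" using k x t1 by (intro power_decreasing) auto
      then have "\<tau> ^ k \<le> \<tau>1" using x by auto
      then show "\<bar>\<tau> ^ k * vh k p\<bar> \<le> \<tau>1 * B k"
        unfolding abs_mult using B[OF k] x t1 by (intro mult_mono) auto
    qed
    also have "\<dots> = \<tau>1 * M" by (simp add: M_def sum_distrib_left)
    finally show "Vh x \<in> {1 / 2..2}" using t1 by (auto simp: Vh_def x)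
  qed
qed

end

section \<open>Uniform smallness of the defects\<close>

locale domain = reduced +
  fixes \<tau>1 z2 :: real
  assumes dom: "0 < \<tau>1" "\<tau>1 \<le> 1" "0 < z2" "z2 < z1" "2 * z2 < rho" "2 * z2\<^sup>2 \<le> D0"
    "\<And>x. x \<in> {0..\<tau>1} \<times> {0..z2} \<times> {0..2 * pi} \<times> {0..2 * pi * real \<kappa>} \<Longrightarrow> Vh x \<in> {1 / 2..2}"
begin

text \<open>The averaging identities are stated for positive action and hence available on
  \<open>PP\<close>; compactness is provided by \<open>CC\<close>, which includes
  \<open>z = 0\<close>. One period of \<theta> and one of \<sigma> suffice by periodicity.\<close>

abbreviation "CC \<equiv> {0..z2} \<times> {0..2 * pi} \<times> {0..2 * pi * real \<kappa>}"
abbreviation "PP \<equiv> {0<..z2} \<times> {0..2 * pi} \<times> {0..2 * pi * real \<kappa>}"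
abbreviation "AA \<equiv> {0..\<tau>1} \<times> CC"

lemma compact_CC: "compact CC" by (intro compact_Times) auto

lemma z_sqrt_range:
  assumes "x \<in> AA" shows "fst (snd x) * sqrt (Vh x) \<in> {0..rho}" "Vh x > 0"
    "(fst (snd x))\<^sup>2 * Vh x \<in> {0..D0}" "(fst (snd x) * sqrt (Vh x))\<^sup>2 = (fst (snd x))\<^sup>2 * Vh x"
proof -
  have V: "Vh x \<in> {1 / 2..2}" by (rule dom(7)[OF assms])
  then show "Vh x > 0" by auto
  have "sqrt (Vh x) \<le> sqrt 4" using V by (intro real_sqrt_le_mono) auto
  then have s: "sqrt (Vh x) \<le> 2" by simp
  have z: "fst (snd x) \<in> {0..z2}" using assms by auto
  have "fst (snd x) * sqrt (Vh x) \<le> z2 * 2" using z s V by (intro mult_mono) auto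
  then show "fst (snd x) * sqrt (Vh x) \<in> {0..rho}" using z V dom(5) by auto
  have "(fst (snd x))\<^sup>2 * Vh x \<le> z2\<^sup>2 * 2" using z V by (intro mult_mono power_mono) auto
  then show "(fst (snd x))\<^sup>2 * Vh x \<in> {0..D0}" using V dom(6) by auto
  show "(fst (snd x) * sqrt (Vh x))\<^sup>2 = (fst (snd x))\<^sup>2 * Vh x" using V by (simp add: power_mult_distrib)
qed

lemma sm_p: 
  assumes "smooth_near ({0..rho} \<times> UNIV) f"
  shows "smooth_near AA (\<lambda>x. f (snd x))"
  by (rule smooth_near_compose[OF assms]) (use dom in \<open>auto intro!: smooth_intros\<close>)

lemma sm_coords: "smooth_near AA (\<lambda>x. fst x)" "smooth_near AA (\<lambda>x. fst (snd x))"
  "smooth_near AA (\<lambda>x. fst (snd (snd x)))" "smooth_near AA (\<lambda>x. snd (snd (snd x)))"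
  by (intro smooth_intros)+

lemma basis3: "(1, 0, 0) \<in> (Basis :: (real \<times> real \<times> real) set)" "(0, 1, 0) \<in> (Basis :: (real \<times> real \<times> real) set)"
  "(0, 0, 1) \<in> (Basis :: (real \<times> real \<times> real) set)"
  by (auto simp: Basis_prod_def zero_prod_def)

lemma sm_V: "smooth_near AA Vh" "smooth_near AA Vz" "smooth_near AA Vt" "smooth_near AA Vs" "smooth_near AA Vtau"
  unfolding Vh_def Vz_def Vt_def Vs_def Vtau_def case_prod_beta'
  by (intro smooth_near_add smooth_near_sum smooth_near_mult smooth_near_power smooth_near_const sm_coords
       sm_p smvh smooth_near_pd basis3; simp)+

lemma sm_P: "smooth_near AA Ph" "smooth_near AA Pz" "smooth_near AA Pt" "smooth_near AA Ps" "smooth_near AA Ptau"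
  unfolding Ph_def Pz_def Pt_def Ps_def Ptau_def case_prod_beta'
  by (intro smooth_near_add smooth_near_sum smooth_near_mult smooth_near_power smooth_near_const sm_coords
       sm_p smph smooth_near_pd basis3; simp)+

lemma scaled_range: "\<tau> \<in> {0..\<tau>1} \<Longrightarrow> z \<in> {0..z2} \<Longrightarrow> \<tau> ^ l * z \<in> {0..z1}"
  "\<tau> \<in> {0<..\<tau>1} \<Longrightarrow> z \<in> {0<..z2} \<Longrightarrow> \<tau> ^ l * z \<in> {0<..<z1}"
proof -
  have 1: "\<tau> ^ l * z \<le> z2" if "\<tau> \<in> {0..\<tau>1}" "z \<in> {0..z2}"
  proof -
    have "\<tau> ^ l * z \<le> 1 * z" using that dom by (intro mult_right_mono power_le_one) auto
    then show ?thesis using that by auto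
  qed
  show "\<tau> \<in> {0..\<tau>1} \<Longrightarrow> z \<in> {0..z2} \<Longrightarrow> \<tau> ^ l * z \<in> {0..z1}" using 1 dom by auto
  show "\<tau> \<in> {0<..\<tau>1} \<Longrightarrow> z \<in> {0<..z2} \<Longrightarrow> \<tau> ^ l * z \<in> {0<..<z1}" using 1 dom by auto
qed

lemma sm_scaled:
  assumes "smooth_near ({0..z1} \<times> UNIV) f"
  shows "smooth_near AA (\<lambda>x. f (fst x ^ l * fst (snd x), fst (snd (snd x)) + snd (snd (snd x)) / real \<kappa>, snd (snd (snd x))))"
  by (rule smooth_near_compose[OF assms])
     (use scaled_range(1) in \<open>auto intro!: smooth_intros simp del: atLeastAtMost_iff\<close>)

lemma sm_wz: "smooth_near AA (\<lambda>x. wz (fst x ^ l * fst (snd x)))"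
  by (rule smooth_near_compose[OF smw])
     (use scaled_range(1) in \<open>auto intro!: smooth_intros simp del: atLeastAtMost_iff\<close>)

lemma sm_dS: "smooth_near AA (\<lambda>x. formal_dS q s (fst x))"
  unfolding formal_dS_def by (intro smooth_intros)

lemma sm_Q: "smooth_near AA (QF K)" "smooth_near AA (QG K)"
  unfolding QF_def QG_def case_prod_beta'
  by (intro smooth_near_add smooth_near_diff smooth_near_sum smooth_near_mult smooth_near_power smooth_near_divide_const
       smooth_near_const sm_coords sm_scaled sm_wz sm_dS smf smg; simp)+

text \<open>The root of \<open>V\<close> is written as \<open>z * sqrt (Vh x)\<close>: since
  \<open>Vh\<close> stays positive, this is smooth up to \<open>z = 0\<close>, where a root of
  \<open>V\<close> itself would be singular.\<close>

lemma sm_zV: 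
  assumes "smooth_near ({0..rho} \<times> UNIV) f"
  shows "smooth_near AA (\<lambda>x. f (fst (snd x) * sqrt (Vh x), Ph x))"
proof (rule smooth_near_compose[OF assms])
  show "smap_near AA (\<lambda>x. (fst (snd x) * sqrt (Vh x), Ph x))"
    by (intro smap_near_Pair smap_near_realI smooth_near_mult smooth_near_sqrt sm_V sm_P sm_coords z_sqrt_range)
  show "(\<lambda>x. (fst (snd x) * sqrt (Vh x), Ph x)) ` AA \<subseteq> {0..rho} \<times> UNIV"
    using z_sqrt_range(1) by blast
qed

lemma sm_DV: "smooth_near AA DV"
  unfolding DV_def
  by (intro smooth_near_add smooth_near_diff smooth_near_sum smooth_near_mult smooth_near_power smooth_near_divide_const
       smooth_near_const sm_coords sm_V sm_Q sm_dS sm_zV smLh)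

lemma sm_DP: "smooth_near AA DP"
  unfolding DP_def
  by (intro smooth_near_add smooth_near_diff smooth_near_sum smooth_near_mult smooth_near_power smooth_near_divide_const
       smooth_near_const sm_coords sm_P sm_Q sm_dS sm_zV smOh)

text \<open>The action coefficients carry the factor \<open>(\<tau> ^ l * z)\<^sup>2\<close>, whose
  power of \<tau> cancels the division by \<open>\<tau> ^ (2 * l)\<close> in the scaling, so no
  negative power of \<tau> remains.\<close>

lemma scaled_F:
  assumes "z \<in> {0<..z2}"
  shows "(\<lambda>\<tau>. z\<^sup>2 * QF K (\<tau>, z, \<theta>, \<sigma>) - partial_expansion K cF \<tau> (z\<^sup>2) \<theta> \<sigma>) \<in> O[at_right 0](\<lambda>\<tau>. \<tau> ^ (K + 1))"
    "(\<lambda>\<tau>. QG K (\<tau>, z, \<theta>, \<sigma>) - partial_expansion K cG \<tau> (z\<^sup>2) \<theta> \<sigma>) \<in> O[at_right 0](\<lambda>\<tau>. \<tau> ^ (K + 1))"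
proof -
  have z: "z\<^sup>2 \<in> {0<..<R}" using rho(3)[of z] assms dom by auto
  note se' = se[unfolded scaled_expansion_def, THEN spec[of _ K], THEN bspec[OF _ z], THEN spec[of _ \<theta>], THEN spec[of _ \<sigma>]]
  have sq: "\<tau> ^ (2 * l) * z\<^sup>2 = (\<tau> ^ l * z)\<^sup>2" for \<tau>
    by (simp add: power_mult_distrib power_mult[symmetric] mult.commute)
  show "(\<lambda>\<tau>. z\<^sup>2 * QF K (\<tau>, z, \<theta>, \<sigma>) - partial_expansion K cF \<tau> (z\<^sup>2) \<theta> \<sigma>) \<in> O[at_right 0](\<lambda>\<tau>. \<tau> ^ (K + 1))"
  proof (rule bigo_cong_at_right[OF conjunct1[OF se'] dom(1)])
    fix \<tau> :: real assume \<tau>: "0 < \<tau>" "\<tau> < \<tau>1"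
    then have r: "\<tau> ^ l * z \<in> {0<..z1}" using scaled_range(2)[of \<tau> z] assms by auto
    have "(\<Sum>i=1..K. \<tau> ^ (2 * i) * action_coeff \<omega> (angle_par \<omega> x0) (angle_par \<omega> y0) (Hk i) (Fk i)
        (\<tau> ^ (2 * l) * z\<^sup>2) (\<theta> + \<sigma> / real \<kappa>) \<sigma>) = \<tau> ^ (2 * l) * (z\<^sup>2 * QF K (\<tau>, z, \<theta>, \<sigma>))"
      unfolding QF_def prod.case sum_distrib_left
    proof (intro sum.cong refl)
      fix i assume "i \<in> {1..K}"
      then have i: "i \<ge> 1" by auto
      show "\<tau> ^ (2 * i) * action_coeff \<omega> (angle_par \<omega> x0) (angle_par \<omega> y0) (Hk i) (Fk i)
        (\<tau> ^ (2 * l) * z\<^sup>2) (\<theta> + \<sigma> / real \<kappa>) \<sigma> = \<tau> ^ (2 * l) * (z\<^sup>2 * (\<tau> ^ (2 * i) * fq i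
        (\<tau> ^ l * fst (z, \<theta>, \<sigma>), fst (snd (z, \<theta>, \<sigma>)) + snd (snd (z, \<theta>, \<sigma>)) / real \<kappa>, snd (snd (z, \<theta>, \<sigma>)))))"
        unfolding sq feq[OF i r] by (simp add: sq[symmetric])
    qed
    then show "(\<Sum>i=1..K. \<tau> ^ (2 * i) * action_coeff \<omega> (angle_par \<omega> x0) (angle_par \<omega> y0) (Hk i) (Fk i)
        (\<tau> ^ (2 * l) * z\<^sup>2) (\<theta> + \<sigma> / real \<kappa>) \<sigma>) / \<tau> ^ (2 * l) - partial_expansion K cF \<tau> (z\<^sup>2) \<theta> \<sigma>
      = z\<^sup>2 * QF K (\<tau>, z, \<theta>, \<sigma>) - partial_expansion K cF \<tau> (z\<^sup>2) \<theta> \<sigma>"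
      using \<tau> by simp
  qed
  show "(\<lambda>\<tau>. QG K (\<tau>, z, \<theta>, \<sigma>) - partial_expansion K cG \<tau> (z\<^sup>2) \<theta> \<sigma>) \<in> O[at_right 0](\<lambda>\<tau>. \<tau> ^ (K + 1))"
  proof (rule bigo_cong_at_right[OF conjunct2[OF se'] dom(1)])
    fix \<tau> :: real assume \<tau>: "0 < \<tau>" "\<tau> < \<tau>1"
    then have r: "\<tau> ^ l * z \<in> {0<..z1}" using scaled_range(2)[of \<tau> z] assms by auto
    have "(\<Sum>i=1..K. \<tau> ^ (2 * i) * angle_coeff \<omega> (angle_par \<omega> x0) (angle_par \<omega> y0) (Hk i) (Fk i)
        (\<tau> ^ (2 * l) * z\<^sup>2) (\<theta> + \<sigma> / real \<kappa>) \<sigma>) = (\<Sum>i=1..K. \<tau> ^ (2 * i) * gq i (\<tau> ^ l * z, \<theta> + \<sigma> / real \<kappa>, \<sigma>))"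
      unfolding sq by (intro sum.cong refl arg_cong2[where f="(*)"] geq[OF _ r]) auto
    then show "\<omega> (\<tau> ^ (2 * l) * z\<^sup>2) - formal_dS q s \<tau> / real \<kappa> + (\<Sum>i=1..K. \<tau> ^ (2 * i) * angle_coeff \<omega> (angle_par \<omega> x0) (angle_par \<omega> y0) (Hk i) (Fk i)
        (\<tau> ^ (2 * l) * z\<^sup>2) (\<theta> + \<sigma> / real \<kappa>) \<sigma>) - partial_expansion K cG \<tau> (z\<^sup>2) \<theta> \<sigma>
      = QG K (\<tau>, z, \<theta>, \<sigma>) - partial_expansion K cG \<tau> (z\<^sup>2) \<theta> \<sigma>"
      unfolding QG_def using weq[OF r] by (simp add: sq)
  qed
qed

lemma PP_AA: "\<tau> \<in> {0..\<tau>1} \<Longrightarrow> p \<in> PP \<Longrightarrow> (\<tau>, p) \<in> AA" by auto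

lemma V_range:
  assumes "\<tau> \<in> {0..\<tau>1}" "(z, \<theta>, \<sigma>) \<in> PP"
  shows "V_trunc N v \<tau> (z\<^sup>2) \<theta> \<sigma> = (z * sqrt (Vh (\<tau>, z, \<theta>, \<sigma>)))\<^sup>2"
    "V_trunc N v \<tau> (z\<^sup>2) \<theta> \<sigma> \<in> {0..D0}" "z * sqrt (Vh (\<tau>, z, \<theta>, \<sigma>)) \<in> {0..rho}"
    "Psi_trunc m psi \<tau> (z\<^sup>2) \<theta> \<sigma> = Ph (\<tau>, z, \<theta>, \<sigma>)"
proof -
  have z: "z \<in> {0..rho}" using assms dom by auto
  note r = z_sqrt_range[OF PP_AA[OF assms]]
  show "V_trunc N v \<tau> (z\<^sup>2) \<theta> \<sigma> = (z * sqrt (Vh (\<tau>, z, \<theta>, \<sigma>)))\<^sup>2"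
    "V_trunc N v \<tau> (z\<^sup>2) \<theta> \<sigma> \<in> {0..D0}" "z * sqrt (Vh (\<tau>, z, \<theta>, \<sigma>)) \<in> {0..rho}"
    "Psi_trunc m psi \<tau> (z\<^sup>2) \<theta> \<sigma> = Ph (\<tau>, z, \<theta>, \<sigma>)"
    using r unfolding V_eq[OF z] Psi_eq[OF z] by simp_all
qed

text \<open>For fixed \<open>p\<close>, \<open>z\<^sup>2 * DV\<close> is the defect of the averaging
  identity, except that \<open>cF\<close> and \<open>cG\<close> are replaced by
  \<open>z\<^sup>2 * QF\<close> and \<open>QG\<close> and that the orders of \<Lambda> above
  \<open>n + d\<close> are dropped; each change is \<open>O(\<tau> ^ (n + d + 1))\<close>. Dividing
  by the fixed number \<open>z\<^sup>2\<close> changes the constant, and \<open>flat_uniform\<close>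
  removes its dependence on \<open>p\<close>.\<close>

lemma DV_flat:
  obtains B where "B > 0" "\<And>\<tau> p. \<tau> \<in> {0..\<tau>1} \<Longrightarrow> p \<in> PP \<Longrightarrow> \<bar>DV (\<tau>, p)\<bar> \<le> B * \<tau> ^ (n + d + 1)"
proof (rule flat_uniform[OF sm_DV compact_CC _ dom(1)])
  show "PP \<subseteq> CC" by auto
  fix p assume pP: "p \<in> PP"
  then obtain z \<theta> \<sigma> where p: "p = (z, \<theta>, \<sigma>)" and zp: "z \<in> {0<..z2}" by auto
  have pC: "p \<in> CC" using pP by auto
  have z: "z \<in> {0<..<rho}" using zp dom by auto
  have e: "z\<^sup>2 \<in> {0<..<R}" by (rule rho(3)[OF z])
  let ?O = "O[at_right 0](\<lambda>\<tau>::real. \<tau> ^ (n + d + 1))"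
  let ?td = "\<lambda>\<tau>. total_deriv q l s (partial_expansion N cF) (partial_expansion N cG) (V_trunc N v) \<tau> (z\<^sup>2) \<theta> \<sigma>"
  let ?L = "\<lambda>j \<tau>. Lam j (V_trunc N v \<tau> (z\<^sup>2) \<theta> \<sigma>) (Psi_trunc m psi \<tau> (z\<^sup>2) \<theta> \<sigma>)"
  have "(\<lambda>\<tau>. ?td \<tau> - (\<Sum>j=2..N. \<tau> ^ j * ?L j \<tau>)) \<in> O[at_right 0](\<lambda>\<tau>. \<tau> ^ (N + 1))"
    using av e unfolding averaging_def by blast
  then have 1: "(\<lambda>\<tau>. ?td \<tau> - (\<Sum>j=2..N. \<tau> ^ j * ?L j \<tau>)) \<in> ?O"
    by (rule bigo_power_mono) (use nd in simp)
  have 2: "(\<lambda>\<tau>. (Vh (\<tau>, p) + fst (snd (\<tau>, p)) / 2 * Vz (\<tau>, p)) *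
     (z\<^sup>2 * QF N (\<tau>, p) - partial_expansion N cF \<tau> (z\<^sup>2) \<theta> \<sigma>)) \<in> ?O"
  proof (rule bigo_mult_bounded[OF smooth_bigo_1[OF _ compact_CC dom(1) pC]])
    show "smooth_near AA (\<lambda>x. Vh x + fst (snd x) / 2 * Vz x)"
      by (intro smooth_near_add smooth_near_mult smooth_near_divide_const sm_V sm_coords)
    show "(\<lambda>\<tau>. z\<^sup>2 * QF N (\<tau>, p) - partial_expansion N cF \<tau> (z\<^sup>2) \<theta> \<sigma>) \<in> ?O"
      unfolding p by (rule bigo_power_mono[OF scaled_F(1)[OF zp]]) (use nd in simp)
  qed
  have 3: "(\<lambda>\<tau>. z\<^sup>2 * Vt (\<tau>, p) * (QG N (\<tau>, p) - partial_expansion N cG \<tau> (z\<^sup>2) \<theta> \<sigma>)) \<in> ?O"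
  proof (rule bigo_mult_bounded[OF smooth_bigo_1[OF _ compact_CC dom(1) pC]])
    show "smooth_near AA (\<lambda>x. z\<^sup>2 * Vt x)" by (intro smooth_near_mult smooth_near_const sm_V)
    show "(\<lambda>\<tau>. QG N (\<tau>, p) - partial_expansion N cG \<tau> (z\<^sup>2) \<theta> \<sigma>) \<in> ?O"
      unfolding p by (rule bigo_power_mono[OF scaled_F(2)[OF zp]]) (use nd in simp)
  qed
  have 4: "(\<lambda>\<tau>. \<Sum>j=n + d + 1..N. La j (z * sqrt (Vh (\<tau>, p)), Ph (\<tau>, p)) * \<tau> ^ j) \<in> ?O"
  proof (intro big_sum_in_bigo)
    fix j assume j: "j \<in> {n + d + 1..N}"
    then have j2: "j \<in> {2..N}" using nd by auto
    have "smooth_near AA (\<lambda>x. La j (fst (snd x) * sqrt (Vh x), Ph x))" by (rule sm_zV[OF smLa[OF j2]])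
    from smooth_bigo_1[OF this compact_CC dom(1) pC]
    show "(\<lambda>\<tau>. La j (z * sqrt (Vh (\<tau>, p)), Ph (\<tau>, p)) * \<tau> ^ j) \<in> ?O"
      by (intro bigo_mult_bounded power_bigo_at_right_0) (use j p in auto)
  qed
  have sum: "(\<lambda>\<tau>. (?td \<tau> - (\<Sum>j=2..N. \<tau> ^ j * ?L j \<tau>)) + (Vh (\<tau>, p) + fst (snd (\<tau>, p)) / 2 * Vz (\<tau>, p)) *
     (z\<^sup>2 * QF N (\<tau>, p) - partial_expansion N cF \<tau> (z\<^sup>2) \<theta> \<sigma>)
     + z\<^sup>2 * Vt (\<tau>, p) * (QG N (\<tau>, p) - partial_expansion N cG \<tau> (z\<^sup>2) \<theta> \<sigma>)
     + (\<Sum>j=n + d + 1..N. La j (z * sqrt (Vh (\<tau>, p)), Ph (\<tau>, p)) * \<tau> ^ j)) \<in> ?O"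
    by (intro sum_in_bigo 1 2 3 4)
  have "(\<lambda>\<tau>. z\<^sup>2 * DV (\<tau>, p)) \<in> ?O"
  proof (rule bigo_cong_at_right[OF sum dom(1)])
    fix \<tau> :: real assume \<tau>: "0 < \<tau>" "\<tau> < \<tau>1"
    have \<tau>': "\<tau> \<in> {0..\<tau>1}" using \<tau> by auto
    note r = V_range[OF \<tau>' pP[unfolded p]]
    define E where "E = (\<lambda>j. \<tau> ^ j * ?L j \<tau>)"
    have E0: "(\<Sum>j=2..<n. E j) = 0"
      by (intro sum.neutral ballI) (use Lam0 r(2) in \<open>auto simp: E_def\<close>)
    have Em: "(\<Sum>j=n..n + d. E j) = z\<^sup>2 * (\<Sum>j=n..n + d. \<tau> ^ j * (Vh (\<tau>, p) * Lh j (z * sqrt (Vh (\<tau>, p)), Ph (\<tau>, p))))"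
      unfolding sum_distrib_left
    proof (intro sum.cong refl)
      fix j assume j: "j \<in> {n..n + d}"
      show "E j = z\<^sup>2 * (\<tau> ^ j * (Vh (\<tau>, p) * Lh j (z * sqrt (Vh (\<tau>, p)), Ph (\<tau>, p))))"
        unfolding E_def r(1) r(4) Lheq[OF j r(3)]
        using z_sqrt_range(4)[OF PP_AA[OF \<tau>' pP]] by (simp add: p mult_ac)
    qed
    have Eh: "(\<Sum>j=n + d + 1..N. E j) = (\<Sum>j=n + d + 1..N. La j (z * sqrt (Vh (\<tau>, p)), Ph (\<tau>, p)) * \<tau> ^ j)"
    proof (intro sum.cong refl)
      fix j assume j: "j \<in> {n + d + 1..N}"
      then have j2: "j \<in> {2..N}" using nd by auto
      show "E j = La j (z * sqrt (Vh (\<tau>, p)), Ph (\<tau>, p)) * \<tau> ^ j"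
        unfolding E_def r(1) r(4) Laeq[OF j2 r(3)] by (simp add: p mult_ac)
    qed
    have "{2..N} = {2..<n} \<union> {n..n + d} \<union> {n + d + 1..N}" using nd by auto
    then have "(\<Sum>j=2..N. E j) = (\<Sum>j=2..<n. E j) + (\<Sum>j=n..n + d. E j) + (\<Sum>j=n + d + 1..N. E j)"
      by (simp only:) (subst sum.union_disjoint; (subst sum.union_disjoint)?; force)+
    then have Es: "(\<Sum>j=2..N. \<tau> ^ j * ?L j \<tau>) = z\<^sup>2 * (\<Sum>j=n..n + d. \<tau> ^ j * (Vh (\<tau>, p) * Lh j (z * sqrt (Vh (\<tau>, p)), Ph (\<tau>, p))))
      + (\<Sum>j=n + d + 1..N. La j (z * sqrt (Vh (\<tau>, p)), Ph (\<tau>, p)) * \<tau> ^ j)"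
      unfolding E0 Em Eh by (simp only: E_def add_0)
    show "(?td \<tau> - (\<Sum>j=2..N. \<tau> ^ j * ?L j \<tau>)) + (Vh (\<tau>, p) + fst (snd (\<tau>, p)) / 2 * Vz (\<tau>, p)) *
     (z\<^sup>2 * QF N (\<tau>, p) - partial_expansion N cF \<tau> (z\<^sup>2) \<theta> \<sigma>)
     + z\<^sup>2 * Vt (\<tau>, p) * (QG N (\<tau>, p) - partial_expansion N cG \<tau> (z\<^sup>2) \<theta> \<sigma>)
     + (\<Sum>j=n + d + 1..N. La j (z * sqrt (Vh (\<tau>, p)), Ph (\<tau>, p)) * \<tau> ^ j) = z\<^sup>2 * DV (\<tau>, p)"
      unfolding Es V_total_deriv[OF z] DV_def by (simp add: p algebra_simps)
  qed
  moreover have "(\<lambda>\<tau>. inverse (z\<^sup>2)) \<in> O[at_right 0](\<lambda>\<tau>::real. 1)"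
    by (rule bigoI[of _ "inverse (z\<^sup>2)"]) simp
  ultimately have "(\<lambda>\<tau>. inverse (z\<^sup>2) * (z\<^sup>2 * DV (\<tau>, p))) \<in> ?O"
    by (rule bigo_mult_bounded[rotated])
  then show "(\<lambda>\<tau>. DV (\<tau>, p)) \<in> ?O" using z by simp
qed (use that in auto)

text \<open>As for \<open>DV\<close>, with the expansion cut at \<open>m\<close>: the orders of
  \<Omega> below \<open>m\<close> vanish, and the defect is one order smaller than the leading
  term.\<close>

lemma DP_flat:
  obtains B where "B > 0" "\<And>\<tau> p. \<tau> \<in> {0..\<tau>1} \<Longrightarrow> p \<in> PP \<Longrightarrow> \<bar>DP (\<tau>, p)\<bar> \<le> B * \<tau> ^ (m + 1)"
proof (rule flat_uniform[OF sm_DP compact_CC _ dom(1)])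
  show "PP \<subseteq> CC" by auto
  fix p assume pP: "p \<in> PP"
  then obtain z \<theta> \<sigma> where p: "p = (z, \<theta>, \<sigma>)" and zp: "z \<in> {0<..z2}" by auto
  have pC: "p \<in> CC" using pP by auto
  have z: "z \<in> {0<..<rho}" using zp dom by auto
  have e: "z\<^sup>2 \<in> {0<..<R}" by (rule rho(3)[OF z])
  let ?O = "O[at_right 0](\<lambda>\<tau>::real. \<tau> ^ (m + 1))"
  let ?td = "\<lambda>\<tau>. total_deriv q l s (partial_expansion m cF) (partial_expansion m cG) (Psi_trunc m psi) \<tau> (z\<^sup>2) \<theta> \<sigma>"
  let ?L = "\<lambda>j \<tau>. Om j (V_trunc N v \<tau> (z\<^sup>2) \<theta> \<sigma>) (Psi_trunc m psi \<tau> (z\<^sup>2) \<theta> \<sigma>)"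
  have 1: "(\<lambda>\<tau>. ?td \<tau> - (\<Sum>j=2..m. \<tau> ^ j * ?L j \<tau>)) \<in> ?O"
    using av e unfolding averaging_def by blast
  have 2: "(\<lambda>\<tau>. inverse (2 * z) * Pz (\<tau>, p) *
     (z\<^sup>2 * QF m (\<tau>, p) - partial_expansion m cF \<tau> (z\<^sup>2) \<theta> \<sigma>)) \<in> ?O"
  proof (rule bigo_mult_bounded[OF smooth_bigo_1[OF _ compact_CC dom(1) pC]])
    show "smooth_near AA (\<lambda>x. inverse (2 * z) * Pz x)"
      by (intro smooth_near_mult smooth_near_const sm_P)
    show "(\<lambda>\<tau>. z\<^sup>2 * QF m (\<tau>, p) - partial_expansion m cF \<tau> (z\<^sup>2) \<theta> \<sigma>) \<in> ?O"
      unfolding p by (rule scaled_F(1)[OF zp])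
  qed
  have 3: "(\<lambda>\<tau>. Pt (\<tau>, p) * (QG m (\<tau>, p) - partial_expansion m cG \<tau> (z\<^sup>2) \<theta> \<sigma>)) \<in> ?O"
  proof (rule bigo_mult_bounded[OF smooth_bigo_1[OF sm_P(3) compact_CC dom(1) pC]])
    show "(\<lambda>\<tau>. QG m (\<tau>, p) - partial_expansion m cG \<tau> (z\<^sup>2) \<theta> \<sigma>) \<in> ?O"
      unfolding p by (rule scaled_F(2)[OF zp])
  qed
  have sum: "(\<lambda>\<tau>. (?td \<tau> - (\<Sum>j=2..m. \<tau> ^ j * ?L j \<tau>)) + inverse (2 * z) * Pz (\<tau>, p) *
     (z\<^sup>2 * QF m (\<tau>, p) - partial_expansion m cF \<tau> (z\<^sup>2) \<theta> \<sigma>)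
     + Pt (\<tau>, p) * (QG m (\<tau>, p) - partial_expansion m cG \<tau> (z\<^sup>2) \<theta> \<sigma>)) \<in> ?O"
    by (intro sum_in_bigo 1 2 3)
  show "(\<lambda>\<tau>. DP (\<tau>, p)) \<in> ?O"
  proof (rule bigo_cong_at_right[OF sum dom(1)])
    fix \<tau> :: real assume \<tau>: "0 < \<tau>" "\<tau> < \<tau>1"
    have \<tau>': "\<tau> \<in> {0..\<tau>1}" using \<tau> by auto
    note r = V_range[OF \<tau>' pP[unfolded p]]
    define E where "E = (\<lambda>j. \<tau> ^ j * ?L j \<tau>)"
    have E0: "(\<Sum>j=2..<m. E j) = 0"
      by (intro sum.neutral ballI) (use Om0 r(2) in \<open>auto simp: E_def\<close>)
    have "{2..m} = insert m {2..<m}" using m2 by auto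
    then have "(\<Sum>j=2..m. E j) = E m" using E0 by simp
    also have "\<dots> = \<tau> ^ m * Oh (z * sqrt (Vh (\<tau>, p)), Ph (\<tau>, p))"
      unfolding E_def r(1) r(4) Oheq[OF r(3)] by (simp add: p)
    finally have Es: "(\<Sum>j=2..m. \<tau> ^ j * ?L j \<tau>) = \<tau> ^ m * Oh (z * sqrt (Vh (\<tau>, p)), Ph (\<tau>, p))"
      by (simp only: E_def)
    show "(?td \<tau> - (\<Sum>j=2..m. \<tau> ^ j * ?L j \<tau>)) + inverse (2 * z) * Pz (\<tau>, p) *
     (z\<^sup>2 * QF m (\<tau>, p) - partial_expansion m cF \<tau> (z\<^sup>2) \<theta> \<sigma>)
     + Pt (\<tau>, p) * (QG m (\<tau>, p) - partial_expansion m cG \<tau> (z\<^sup>2) \<theta> \<sigma>) = DP (\<tau>, p)"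
      unfolding Es Psi_total_deriv[OF z] DP_def using z by (simp add: p field_simps power2_eq_square)
  qed
qed (use that in auto)

end

section \<open>Averaged variables along true solutions\<close>

context perturbed
begin

definition "tau t = t powr (- 1 / (2 * real q))"

lemma tau_pos: "t > 0 \<Longrightarrow> tau t > 0" by (simp add: tau_def)

lemma tau_even: "t > 0 \<Longrightarrow> tau t ^ (2 * j) = t powr (- (real j / real q))"
  using q1 by (simp add: tau_def powr_realpow[symmetric] powr_powr)

lemma tau_2q: "t > 0 \<Longrightarrow> tau t ^ (2 * q) = 1 / t"
  using q1 by (simp add: tau_even powr_minus_divide)

lemma tau_tendsto: "(tau \<longlongrightarrow> 0) at_top"
  unfolding tau_def using tendsto_neg_powr[OF _ filterlim_ident, of "- 1 / (2 * real q)"] q1 by simp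

lemma tau_deriv: "t > 0 \<Longrightarrow> (tau has_real_derivative - (tau t ^ (2 * q + 1) / (2 * real q))) (at t)"
proof -
  assume t: "t > 0"
  have "(tau has_real_derivative (- 1 / (2 * real q)) * t powr (- 1 / (2 * real q) - 1)) (at t)"
    unfolding tau_def by (rule has_real_derivative_powr[OF t])
  moreover have "t powr (- 1 / (2 * real q) - 1) = tau t ^ (2 * q + 1)"
    using t tau_2q[OF t] by (simp add: powr_diff tau_def)
  ultimately show ?thesis by simp
qed

end

context averaged
begin

text \<open>The form in which the rates are compared with \<open>QF\<close> and \<open>QG\<close>:
  relative to the action, in powers of \<tau>, and with the phase replaced by any representative
  modulo 2\<pi>\<kappa>.\<close>

lemma rates_tau:
  "\<exists>C>0. \<forall>\<^sub>F t in at_top. \<forall>z\<in>{0<..z1}. \<forall>\<phi>\<in>{0..4 * pi}. \<forall>b::int. \<forall>\<sigma>. \<sigma> = S t + of_int b * (2 * pi * real \<kappa>) \<longrightarrow>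
     \<bar>energy_rate z \<phi> t / z\<^sup>2 - (\<Sum>i=1..K. tau t ^ (2 * i) * fq i (z, \<phi>, \<sigma>))\<bar> \<le> C * tau t ^ (2 * K + 2) \<and>
     \<bar>angle_rate z \<phi> t - wz z - (\<Sum>i=1..K. tau t ^ (2 * i) * gq i (z, \<phi>, \<sigma>))\<bar> \<le> C * tau t ^ (2 * K + 2)"
proof -
  obtain C where C: "C > 0" "\<forall>\<^sub>F t in at_top. \<forall>z\<in>{0<..z1}. \<forall>\<phi>\<in>{0..4 * pi}.
       \<bar>energy_rate z \<phi> t - z\<^sup>2 * (\<Sum>k=1..K. t powr (- (real k / real q)) * fq k (z, \<phi>, S t))\<bar>
         \<le> C * z\<^sup>2 * t powr (- (real (K + 1) / real q)) \<and>
       \<bar>angle_rate z \<phi> t - \<omega> (z\<^sup>2) - (\<Sum>k=1..K. t powr (- (real k / real q)) * gq k (z, \<phi>, S t))\<bar>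
         \<le> C * t powr (- (real (K + 1) / real q))"
    using rates[of K] by blast
  show ?thesis
  proof (intro exI[of _ C] conjI)
    show "\<forall>\<^sub>F t in at_top. \<forall>z\<in>{0<..z1}. \<forall>\<phi>\<in>{0..4 * pi}. \<forall>b::int. \<forall>\<sigma>. \<sigma> = S t + of_int b * (2 * pi * real \<kappa>) \<longrightarrow>
     \<bar>energy_rate z \<phi> t / z\<^sup>2 - (\<Sum>i=1..K. tau t ^ (2 * i) * fq i (z, \<phi>, \<sigma>))\<bar> \<le> C * tau t ^ (2 * K + 2) \<and>
     \<bar>angle_rate z \<phi> t - wz z - (\<Sum>i=1..K. tau t ^ (2 * i) * gq i (z, \<phi>, \<sigma>))\<bar> \<le> C * tau t ^ (2 * K + 2)"
      using C(2) eventually_gt_at_top[of 0]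
    proof eventually_elim
      case (elim t)
      show ?case
      proof (intro ballI allI impI)
        fix z \<phi> \<sigma> and b :: int assume z: "z \<in> {0<..z1}" and \<phi>: "\<phi> \<in> {0..4 * pi}"
          and \<sigma>: "\<sigma> = S t + of_int b * (2 * pi * real \<kappa>)"
        have \<sigma>': "\<sigma> = S t + of_int (b * int \<kappa>) * (2 * pi)" by (simp add: \<sigma>)
        have f: "fq k (z, \<phi>, S t) = fq k (z, \<phi>, \<sigma>)" "gq k (z, \<phi>, S t) = gq k (z, \<phi>, \<sigma>)" if k: "k \<ge> 1" for k
        proof -
          have "z\<^sup>2 * fq k (z, \<phi>, \<sigma>) = z\<^sup>2 * fq k (z, \<phi>, S t)"
            unfolding feq[OF k z, symmetric] \<sigma>' by (rule action_coeff_periodic[OF k z])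
          then show "fq k (z, \<phi>, S t) = fq k (z, \<phi>, \<sigma>)" using z by simp
          show "gq k (z, \<phi>, S t) = gq k (z, \<phi>, \<sigma>)"
            unfolding geq[OF k z, symmetric] \<sigma>' by (rule angle_coeff_periodic[OF k z, symmetric])
        qed
        have s1: "(\<Sum>k=1..K. t powr (- (real k / real q)) * fq k (z, \<phi>, S t)) = (\<Sum>i=1..K. tau t ^ (2 * i) * fq i (z, \<phi>, \<sigma>))"
          by (intro sum.cong refl) (use elim(2) in \<open>simp add: f tau_even\<close>)
        have s2: "(\<Sum>k=1..K. t powr (- (real k / real q)) * gq k (z, \<phi>, S t)) = (\<Sum>i=1..K. tau t ^ (2 * i) * gq i (z, \<phi>, \<sigma>))"
          by (intro sum.cong refl) (use elim(2) in \<open>simp add: f tau_even\<close>)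
        have pw: "t powr (- (real (K + 1) / real q)) = tau t ^ (2 * K + 2)"
          using tau_even[OF elim(2), of "K + 1"] by simp
        have z2: "z\<^sup>2 > 0" using z by simp
        note e = elim(1)[rule_format, OF z \<phi>, unfolded s1 s2 pw]
        have "energy_rate z \<phi> t / z\<^sup>2 - (\<Sum>i=1..K. tau t ^ (2 * i) * fq i (z, \<phi>, \<sigma>))
          = (energy_rate z \<phi> t - z\<^sup>2 * (\<Sum>i=1..K. tau t ^ (2 * i) * fq i (z, \<phi>, \<sigma>))) / z\<^sup>2"
          using z2 by (simp add: diff_divide_distrib)
        also have "\<bar>\<dots>\<bar> \<le> C * tau t ^ (2 * K + 2)"
          using conjunct1[OF e] z2 by (simp add: abs_divide pos_divide_le_eq mult_ac)
        finally show "\<bar>energy_rate z \<phi> t / z\<^sup>2 - (\<Sum>i=1..K. tau t ^ (2 * i) * fq i (z, \<phi>, \<sigma>))\<bar> \<le> C * tau t ^ (2 * K + 2) \<and>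
           \<bar>angle_rate z \<phi> t - wz z - (\<Sum>i=1..K. tau t ^ (2 * i) * gq i (z, \<phi>, \<sigma>))\<bar> \<le> C * tau t ^ (2 * K + 2)"
          using conjunct2[OF e] unfolding weq[OF z] by blast
      qed
    qed
  qed (rule C(1))
qed

definition "ang0 p = (SOME \<phi>. Phi (sqrt (H0p p), \<phi>) = p)"
definition "action_curve x y t = t powr (real l / real q) * H0p (x t, y t)"
definition "V_traj x y t = V_trunc N v (tau t) (action_curve x y t) (ang0 (x t, y t) - S t / real \<kappa>) (S t)"
definition "Psi_traj x y t = Psi_trunc m psi (tau t) (action_curve x y t) (ang0 (x t, y t) - S t / real \<kappa>) (S t)"

lemma V_trunc_periodic: "e \<in> {0..R} \<Longrightarrow>
    V_trunc N v \<tau> e (\<theta> + of_int i * (2 * pi)) (\<sigma> + of_int j * (2 * pi * real \<kappa>)) = V_trunc N v \<tau> e \<theta> \<sigma>"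
  by (simp add: V_trunc_def partial_expansion_def v_periodic)

lemma Psi_trunc_periodic: "e \<in> {0..R} \<Longrightarrow>
    Psi_trunc m psi \<tau> e (\<theta> + of_int i * (2 * pi)) (\<sigma> + of_int j * (2 * pi * real \<kappa>)) = Psi_trunc m psi \<tau> e \<theta> \<sigma> + of_int i * (2 * pi)"
  by (simp add: Psi_trunc_def partial_expansion_def psi_periodic)

text \<open>Branches of the angle differ by multiples of \<open>2\<pi>\<close>, so \<open>V_traj\<close> does not depend on
  the branch and \<open>Psi_traj\<close> depends on it only modulo \<open>2\<pi>\<close>.\<close>

lemma traj_branch:
  assumes "p = (x t, y t)" "H0p p > 0" "sqrt (H0p p) \<in> {0<..z1}" "Phi (sqrt (H0p p), \<phi>) = p" "action_curve x y t \<in> {0..R}"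
    and \<sigma>: "\<sigma> = S t + of_int b * (2 * pi * real \<kappa>)"
  shows "V_traj x y t = V_trunc N v (tau t) (action_curve x y t) (\<phi> - \<sigma> / real \<kappa>) \<sigma>"
    "\<exists>k::int. Psi_traj x y t = Psi_trunc m psi (tau t) (action_curve x y t) (\<phi> - \<sigma> / real \<kappa>) \<sigma> + of_int k * (2 * pi)"
proof -
  have "Phi (sqrt (H0p p), ang0 p) = p" unfolding ang0_def by (rule someI[of _ \<phi>]) (rule assms(4))
  then obtain k :: int where k: "ang0 p - \<phi> = of_int k * (2 * pi)"
    using Phi_inj[OF z1_range(1)[OF assms(3)], of "ang0 p" \<phi>] wpos[OF assms(3)] assms(4) by auto
  have kp: "real \<kappa> > 0" using kappa by simp
  have th: "ang0 p - S t / real \<kappa> = (\<phi> - \<sigma> / real \<kappa>) + of_int (k + b) * (2 * pi)"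
    using k kp by (simp add: \<sigma> field_simps)
  have sg: "S t = \<sigma> + of_int (- b) * (2 * pi * real \<kappa>)" by (simp add: \<sigma>)
  show "V_traj x y t = V_trunc N v (tau t) (action_curve x y t) (\<phi> - \<sigma> / real \<kappa>) \<sigma>"
    unfolding V_traj_def assms(1)[symmetric] th
    by (subst sg) (rule V_trunc_periodic[OF assms(5)])
  have "Psi_traj x y t = Psi_trunc m psi (tau t) (action_curve x y t) (\<phi> - \<sigma> / real \<kappa>) \<sigma> + of_int (k + b) * (2 * pi)"
    unfolding Psi_traj_def assms(1)[symmetric] th
    by (subst sg) (rule Psi_trunc_periodic[OF assms(5)])
  then show "\<exists>k::int. Psi_traj x y t = Psi_trunc m psi (tau t) (action_curve x y t) (\<phi> - \<sigma> / real \<kappa>) \<sigma> + of_int k * (2 * pi)"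
    by blast
qed

end

context domain
begin

lemma AA_bounds:
  obtains B where "B > 0" "\<And>x. x \<in> AA \<Longrightarrow> \<bar>Vh x + fst (snd x) / 2 * Vz x\<bar> \<le> B \<and> \<bar>Vt x\<bar> \<le> B \<and> \<bar>Vs x\<bar> \<le> B
     \<and> \<bar>fst (snd x) / 2 * Pz x\<bar> \<le> B \<and> \<bar>Pt x\<bar> \<le> B \<and> \<bar>Ps x\<bar> \<le> B"
proof -
  have cA: "compact AA" by (intro compact_Times compact_CC) auto
  have s1: "smooth_near AA (\<lambda>x. Vh x + fst (snd x) / 2 * Vz x)"
    by (intro smooth_near_add smooth_near_mult smooth_near_divide_const sm_V sm_coords)
  have s2: "smooth_near AA (\<lambda>x. fst (snd x) / 2 * Pz x)"
    by (intro smooth_near_add smooth_near_mult smooth_near_divide_const sm_P sm_coords)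
  obtain B1 where B1: "B1 > 0" "\<And>x. x \<in> AA \<Longrightarrow> \<bar>Vh x + fst (snd x) / 2 * Vz x\<bar> \<le> B1"
    by (rule smooth_near_bounded[OF s1 cA]) blast
  obtain B2 where B2: "B2 > 0" "\<And>x. x \<in> AA \<Longrightarrow> \<bar>Vt x\<bar> \<le> B2"
    by (rule smooth_near_bounded[OF sm_V(3) cA]) blast
  obtain B3 where B3: "B3 > 0" "\<And>x. x \<in> AA \<Longrightarrow> \<bar>Vs x\<bar> \<le> B3"
    by (rule smooth_near_bounded[OF sm_V(4) cA]) blast
  obtain B4 where B4: "B4 > 0" "\<And>x. x \<in> AA \<Longrightarrow> \<bar>fst (snd x) / 2 * Pz x\<bar> \<le> B4"
    by (rule smooth_near_bounded[OF s2 cA]) blast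
  obtain B5 where B5: "B5 > 0" "\<And>x. x \<in> AA \<Longrightarrow> \<bar>Pt x\<bar> \<le> B5"
    by (rule smooth_near_bounded[OF sm_P(3) cA]) blast
  obtain B6 where B6: "B6 > 0" "\<And>x. x \<in> AA \<Longrightarrow> \<bar>Ps x\<bar> \<le> B6"
    by (rule smooth_near_bounded[OF sm_P(4) cA]) blast
  define B where "B = B1 + B2 + B3 + B4 + B5 + B6"
  have le: "B1 \<le> B" "B2 \<le> B" "B3 \<le> B" "B4 \<le> B" "B5 \<le> B" "B6 \<le> B" "B > 0"
    using B1(1) B2(1) B3(1) B4(1) B5(1) B6(1) by (simp_all add: B_def)
  show ?thesis
    by (rule that[of B]) (use le in \<open>blast intro: order_trans[OF B1(2)] order_trans[OF B2(2)] order_trans[OF B3(2)]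
       order_trans[OF B4(2)] order_trans[OF B5(2)] order_trans[OF B6(2)]\<close>)+
qed

text \<open>\<open>D\<close> is a formal defect, and \<open>r1\<close>, \<open>r2\<close>,
  \<open>r3\<close> are the differences between true and formal rates of action, angle and phase,
  which enter linearly with bounded coefficients. As \<open>\<kappa> \<ge> 1\<close>, division by it
  does no harm.\<close>

lemma error_bound:
  fixes D a b c r1 r2 r3 :: real
  assumes "\<bar>D\<bar> \<le> B1 * \<tau> ^ k" "\<bar>a\<bar> \<le> B" "\<bar>b\<bar> \<le> B" "\<bar>c\<bar> \<le> B" "\<bar>r1\<bar> \<le> C1 * \<tau> ^ k1" "\<bar>r2\<bar> \<le> C1 * \<tau> ^ k1" "\<bar>r3\<bar> \<le> C3 * \<tau> ^ k3"
    "k1 \<ge> k" "k3 \<ge> k" "0 \<le> \<tau>" "\<tau> \<le> 1" "C1 > 0" "C3 > 0" "B > 0"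
  shows "\<bar>D + a * r1 + b * (r2 - r3 / real \<kappa>) + c * r3\<bar> \<le> (B1 + 2 * B * (C1 + C3)) * \<tau> ^ k"
proof -
  have t: "\<tau> ^ k1 \<le> \<tau> ^ k" "\<tau> ^ k3 \<le> \<tau> ^ k" using assms by (auto intro!: power_decreasing)
  have "C1 * \<tau> ^ k1 \<le> C1 * \<tau> ^ k" "C3 * \<tau> ^ k3 \<le> C3 * \<tau> ^ k" using t assms by (auto intro!: mult_left_mono)
  then have r: "\<bar>r1\<bar> \<le> C1 * \<tau> ^ k" "\<bar>r2\<bar> \<le> C1 * \<tau> ^ k" "\<bar>r3\<bar> \<le> C3 * \<tau> ^ k" using assms by linarith+
  have "\<bar>r3 / real \<kappa>\<bar> \<le> \<bar>r3\<bar> / 1" unfolding abs_divide using kappa by (intro divide_left_mono) auto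
  then have r4: "\<bar>r2 - r3 / real \<kappa>\<bar> \<le> C1 * \<tau> ^ k + C3 * \<tau> ^ k" using r by linarith
  have B0: "B \<ge> 0" using assms by simp
  have "\<bar>a * r1\<bar> \<le> B * (C1 * \<tau> ^ k)" "\<bar>b * (r2 - r3 / real \<kappa>)\<bar> \<le> B * (C1 * \<tau> ^ k + C3 * \<tau> ^ k)" "\<bar>c * r3\<bar> \<le> B * (C3 * \<tau> ^ k)"
    unfolding abs_mult by (intro mult_mono assms r r4 B0; simp)+
  then have "\<bar>D + a * r1 + b * (r2 - r3 / real \<kappa>) + c * r3\<bar> \<le> B1 * \<tau> ^ k + B * (C1 * \<tau> ^ k) + B * (C1 * \<tau> ^ k + C3 * \<tau> ^ k) + B * (C3 * \<tau> ^ k)"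
    using assms(1) by linarith
  also have "\<dots> = (B1 + 2 * B * (C1 + C3)) * \<tau> ^ k" by (simp add: algebra_simps)
  finally show ?thesis .
qed

lemma dS_tau: "\<exists>C>0. \<forall>\<^sub>F t in at_top. \<bar>deriv S t - formal_dS q s (tau t)\<bar> \<le> C * tau t ^ (2 * q + 2)"
proof -
  obtain C where C: "C > 0" "\<forall>\<^sub>F t in at_top. \<bar>deriv S t - formal_dS q s (t powr (- 1 / (2 * real q)))\<bar>
    \<le> C * t powr (- (1 / real q) - 1)" by (rule dS_expansion)
  have "\<forall>\<^sub>F t in at_top. \<bar>deriv S t - formal_dS q s (tau t)\<bar> \<le> C * tau t ^ (2 * q + 2)"
    using C(2) eventually_gt_at_top[of 0]
  proof eventually_elim
    case (elim t)
    have "t powr (- (1 / real q) - 1) = tau t ^ (2 * q + 2)"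
      using tau_even[OF elim(2), of "q + 1"] q1 by (simp add: add_divide_distrib)
    then show ?case using elim(1) by (simp add: tau_def)
  qed
  with C(1) show ?thesis by blast
qed

text \<open>Since \<open>V_traj\<close> and \<open>Psi_traj\<close> depend on an arbitrary choice of
  the angle, derivatives are taken of local representatives \<open>Vl\<close> and \<open>Pl\<close>.
  The latter agrees with \<open>Psi_traj\<close> modulo 2\<pi>, possibly with different multiples at
  different times.\<close>

definition "rate_at C t x y \<longleftrightarrow> (\<exists>Vl Pl dV dP.
   (\<forall>\<^sub>F u in nhds t. V_traj x y u = Vl u \<and> (\<exists>k::int. Psi_traj x y u = Pl u + of_int k * (2 * pi))) \<and>
   (Vl has_real_derivative dV) (at t) \<and> (Pl has_real_derivative dP) (at t) \<and>
   action_curve x y t / 2 \<le> Vl t \<and> Vl t \<le> 2 * action_curve x y t \<and> Vl t \<in> {0..D0} \<and>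
   \<bar>dV - (\<Sum>j=n..n + d. tau t ^ j * Lam j (Vl t) (Pl t))\<bar> \<le> C * tau t ^ (n + d + 1) * action_curve x y t \<and>
   \<bar>dP - tau t ^ m * Om m (Vl t) (Pl t)\<bar> \<le> C * tau t ^ (m + 1))"

text \<open>The coordinates are moved into the compact domain by shifting the phase by a multiple of
  2\<pi>\<kappa> and choosing the angle suitably. There the derivative along the solution is the
  formal one plus the errors of the rates, and the formal one has the defect bounded by
  \<open>DV_flat\<close> and \<open>DP_flat\<close>. The constants \<open>C\<close> and
  \<open>T\<close> do not depend on the solution.\<close>

lemma local_rates:
  obtains C T where "C > 0" "T \<ge> 1"
    "\<And>t x y. t \<ge> T \<Longrightarrow> (x has_real_derivative HY (x t) (y t) t) (at t) \<Longrightarrow>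
       (y has_real_derivative - HX (x t) (y t) t + F (x t) (y t) t) (at t) \<Longrightarrow> (x t)\<^sup>2 + (y t)\<^sup>2 < r0\<^sup>2 \<Longrightarrow>
       0 < H0p (x t, y t) \<Longrightarrow> action_curve x y t \<le> z2\<^sup>2 \<Longrightarrow> rate_at C t x y"
proof -
  obtain B where B: "B > 0" "\<And>x. x \<in> AA \<Longrightarrow> \<bar>Vh x + fst (snd x) / 2 * Vz x\<bar> \<le> B \<and> \<bar>Vt x\<bar> \<le> B \<and> \<bar>Vs x\<bar> \<le> B
     \<and> \<bar>fst (snd x) / 2 * Pz x\<bar> \<le> B \<and> \<bar>Pt x\<bar> \<le> B \<and> \<bar>Ps x\<bar> \<le> B"
    by (rule AA_bounds) blast
  obtain BV where BV: "BV > 0" "\<And>\<tau> p. \<tau> \<in> {0..\<tau>1} \<Longrightarrow> p \<in> PP \<Longrightarrow> \<bar>DV (\<tau>, p)\<bar> \<le> BV * \<tau> ^ (n + d + 1)"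
    by (rule DV_flat) blast
  obtain BP where BP: "BP > 0" "\<And>\<tau> p. \<tau> \<in> {0..\<tau>1} \<Longrightarrow> p \<in> PP \<Longrightarrow> \<bar>DP (\<tau>, p)\<bar> \<le> BP * \<tau> ^ (m + 1)"
    by (rule DP_flat) blast
  define RT where "RT = (\<lambda>K C t. \<forall>z\<in>{0<..z1}. \<forall>\<phi>\<in>{0..4 * pi}. \<forall>b::int. \<forall>\<sigma>. \<sigma> = S t + of_int b * (2 * pi * real \<kappa>) \<longrightarrow>
     \<bar>energy_rate z \<phi> t / z\<^sup>2 - (\<Sum>i=1..K. tau t ^ (2 * i) * fq i (z, \<phi>, \<sigma>))\<bar> \<le> C * tau t ^ (2 * K + 2) \<and>
     \<bar>angle_rate z \<phi> t - wz z - (\<Sum>i=1..K. tau t ^ (2 * i) * gq i (z, \<phi>, \<sigma>))\<bar> \<le> C * tau t ^ (2 * K + 2))"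
  obtain CN where CN: "CN > 0" "\<forall>\<^sub>F t in at_top. RT N CN t" using rates_tau[of N] unfolding RT_def by blast
  obtain Cm where Cm: "Cm > 0" "\<forall>\<^sub>F t in at_top. RT m Cm t" using rates_tau[of m] unfolding RT_def by blast
  obtain CS where CS: "CS > 0" "\<forall>\<^sub>F t in at_top. \<bar>deriv S t - formal_dS q s (tau t)\<bar> \<le> CS * tau t ^ (2 * q + 2)"
    using dS_tau by blast
  have "\<forall>\<^sub>F t in at_top. tau t < \<tau>1" using tau_tendsto dom(1) by (rule order_tendstoD)
  then have "\<forall>\<^sub>F t in at_top. RT N CN t \<and> RT m Cm t \<and> \<bar>deriv S t - formal_dS q s (tau t)\<bar> \<le> CS * tau t ^ (2 * q + 2) \<and> tau t < \<tau>1"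
    using CN(2) Cm(2) CS(2) by eventually_elim blast
  then obtain T' where T': "\<And>t. t \<ge> T' \<Longrightarrow> RT N CN t \<and> RT m Cm t \<and>
     \<bar>deriv S t - formal_dS q s (tau t)\<bar> \<le> CS * tau t ^ (2 * q + 2) \<and> tau t < \<tau>1"
    by (auto simp: eventually_at_top_linorder)
  define C where "C = (BV + 2 * B * (CN + CS)) + (BP + 2 * B * (Cm + CS))"
  have C: "BV + 2 * B * (CN + CS) \<le> C" "BP + 2 * B * (Cm + CS) \<le> C" "C > 0"
    using BV(1) BP(1) B(1) CN(1) Cm(1) CS(1) by (auto simp: C_def intro!: add_pos_pos mult_pos_pos)
  show ?thesis
  proof (rule that[of C "max T' 1"])
    fix t x y
    assume tT: "t \<ge> max T' 1" and dx: "(x has_real_derivative HY (x t) (y t) t) (at t)"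
      and dy: "(y has_real_derivative - HX (x t) (y t) t + F (x t) (y t) t) (at t)"
      and xy: "(x t)\<^sup>2 + (y t)\<^sup>2 < r0\<^sup>2" and H: "0 < H0p (x t, y t)" and az: "action_curve x y t \<le> z2\<^sup>2"
    have t: "t > 0" "t \<ge> T'" using tT by auto
    define p where "p = (x t, y t)"
    have pd: "p \<in> disc r0" using xy by (auto simp: p_def disc_def)
    define \<tau> where "\<tau> = tau t"
    have \<tau>: "\<tau> \<in> {0<..\<tau>1}" "\<tau> \<in> {0..\<tau>1}" "0 \<le> \<tau>" "\<tau> \<le> 1" using tau_pos[OF t(1)] T'[OF t(2)] dom(2) by (auto simp: \<tau>_def)
    define E where "E = H0p p"
    have E: "E > 0" using H by (simp add: E_def p_def)
    define e where "e = action_curve x y t"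
    have te: "t powr (real l / real q) * \<tau> ^ (2 * l) = 1"
      using t by (simp add: \<tau>_def tau_even powr_add[symmetric])
    have e: "e = t powr (real l / real q) * E" "e > 0" "e * \<tau> ^ (2 * l) = E"
      using E t te by (auto simp: e_def E_def p_def action_curve_def algebra_simps)
    define z where "z = sqrt e"
    have z: "z \<in> {0<..z2}" "z\<^sup>2 = e" using e az dom(3)
      by (auto simp: z_def e_def[symmetric] intro!: real_le_lsqrt)
    have zr: "z \<in> {0<..<rho}" using z dom by auto
    define \<zeta> where "\<zeta> = \<tau> ^ l * z"
    have \<zeta>: "\<zeta> \<in> {0<..<z1}" "\<zeta> \<in> {0<..z1}" using scaled_range(2)[OF \<tau>(1) z(1)] by (auto simp: \<zeta>_def)
    have \<zeta>2: "\<zeta>\<^sup>2 = E" using e(3) z(2) by (simp add: \<zeta>_def power_mult_distrib power_mult[symmetric] mult.commute)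
    have sE: "sqrt E = \<zeta>" using \<zeta> \<zeta>2 by (metis abs_of_pos greaterThanLessThan_iff real_sqrt_abs)
    have kp: "real \<kappa> > 0" using kappa by simp
    obtain b :: int where b: "S t + of_int b * (2 * pi * real \<kappa>) \<in> {0..<0 + 2 * pi * real \<kappa>}"
      using mod_interval[of "2 * pi * real \<kappa>" "S t" 0] kp by auto
    define sg where "sg = (\<lambda>u. S u + of_int b * (2 * pi * real \<kappa>))"
    define \<sigma> where "\<sigma> = sg t"
    have \<sigma>: "\<sigma> \<in> {0..2 * pi * real \<kappa>}" "\<sigma> / real \<kappa> \<in> {0..<2 * pi}" using b kp by (auto simp: \<sigma>_def sg_def field_simps)
    \<comment> \<open>The window for \<phi> starts at \<open>\<sigma> / real \<kappa>\<close>, so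
      that \<theta> = \<phi> - \<sigma> / \<kappa> falls into one period.\<close>
    obtain \<phi> where \<phi>: "\<phi> \<in> {\<sigma> / real \<kappa>..<\<sigma> / real \<kappa> + 2 * pi}" "Phi (\<zeta>, \<phi>) = p"
      by (rule Phi_surj[OF z1_range(1)[OF \<zeta>(2)] pd, where c="\<sigma> / real \<kappa>"]) (use \<zeta>2 E_def in auto)
    define \<theta> where "\<theta> = \<phi> - \<sigma> / real \<kappa>"
    have \<theta>: "\<theta> \<in> {0..2 * pi}" "\<phi> \<in> {0..4 * pi}" "\<theta> + \<sigma> / real \<kappa> = \<phi>"
      using \<phi>(1) \<sigma>(2) pi_gt_zero unfolding \<theta>_def atLeastLessThan_iff atLeastAtMost_iff by linarith+
    have PPi: "(z, \<theta>, \<sigma>) \<in> PP" using z \<theta> \<sigma> by auto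
    have AAi: "(\<tau>, z, \<theta>, \<sigma>) \<in> AA" by (rule PP_AA[OF \<tau>(2) PPi])
    have xX: "x t = Xz (\<zeta>, \<phi>)" "y t = Yz (\<zeta>, \<phi>)" using \<phi>(2) by (auto simp: Phi_def p_def)
    obtain ang where ang: "ang (Phi (\<zeta>, \<phi>)) = \<phi>"
      "(ang has_derivative (\<lambda>k. \<omega> (\<zeta>\<^sup>2) * (Y1 (\<zeta>, \<phi>) * fst k - X1 (\<zeta>, \<phi>) * snd k) / (2 * \<zeta>))) (at (Phi (\<zeta>, \<phi>)))"
      "\<And>q. q \<in> disc r0 \<Longrightarrow> 0 < H0p q \<Longrightarrow> H0p q < z1\<^sup>2 \<Longrightarrow> Phi (sqrt (H0p q), ang q) = q"
      by (rule angle_branch[OF \<zeta>(1)]) blast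
    define x' y' where "x' = HY (x t) (y t) t" and "y' = - HX (x t) (y t) t + F (x t) (y t) t"
    have dxy: "((\<lambda>u. (x u, y u)) has_derivative (\<lambda>h. (x' * h, y' * h))) (at t)"
      using dx dy by (intro has_derivative_Pair) (auto simp: has_field_derivative_def x'_def y'_def)
    define pl where "pl = (\<lambda>u. ang (x u, y u))"
    have "(pl has_derivative (\<lambda>h. \<omega> (\<zeta>\<^sup>2) * (Y1 (\<zeta>, \<phi>) * (x' * h) - X1 (\<zeta>, \<phi>) * (y' * h)) / (2 * \<zeta>))) (at t)"
      using has_derivative_compose[OF dxy ang(2)[unfolded \<phi>(2) p_def]] unfolding pl_def
      by (simp only: fst_conv snd_conv)
    then have dpl: "(pl has_real_derivative angle_rate \<zeta> \<phi> t) (at t)"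
      unfolding has_field_derivative_def
      by (rule has_derivative_eq_rhs)
         (auto simp: angle_rate_def Let_def xX x'_def y'_def field_simps simp del: iter_dderiv.simps)
    have plt: "pl t = \<phi>" using ang(1) \<phi>(2) by (simp add: pl_def p_def)
    have dE: "((\<lambda>u. H0p (x u, y u)) has_real_derivative energy_rate \<zeta> \<phi> t) (at t)"
      using chain2[OF smH0 dx dy] pd \<phi>(2)
      by (simp add: energy_rate_def Let_def xX[symmetric] p_def Hx_def Hy_def mult.commute del: iter_dderiv.simps)
    have de: "((\<lambda>u. action_curve x y u) has_real_derivative
        z\<^sup>2 * (energy_rate \<zeta> \<phi> t / \<zeta>\<^sup>2 + \<tau> ^ (2 * q) * (real l / real q))) (at t)"
    proof -
      have "((\<lambda>u. u powr (real l / real q)) has_real_derivative (real l / real q) * t powr (real l / real q - 1)) (at t)"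
        by (rule has_real_derivative_powr[OF t(1)])
      from DERIV_mult[OF this dE]
      have D: "((\<lambda>u. action_curve x y u) has_real_derivative
         (real l / real q) * t powr (real l / real q - 1) * E + energy_rate \<zeta> \<phi> t * t powr (real l / real q)) (at t)"
        by (simp add: action_curve_def E_def p_def)
      have "(real l / real q) * t powr (real l / real q - 1) * E = z\<^sup>2 * (\<tau> ^ (2 * q) * (real l / real q))"
        using t tau_2q[OF t(1)] unfolding z(2) e(1) \<tau>_def by (simp only: powr_diff) (simp add: mult_ac)
      moreover have "energy_rate \<zeta> \<phi> t * t powr (real l / real q) = z\<^sup>2 * (energy_rate \<zeta> \<phi> t / \<zeta>\<^sup>2)"
        using E unfolding z(2) e(1) \<zeta>2 by simp
      ultimately show ?thesis by (intro DERIV_cong[OF D]) (simp only: distrib_left add.commute)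
    qed
    have dsg: "(sg has_real_derivative deriv S t) (at t)"
      unfolding sg_def using S_deriv[OF t(1)] by (auto intro!: derivative_eq_intros)
    have dth: "((\<lambda>u. pl u - sg u / real \<kappa>) has_real_derivative angle_rate \<zeta> \<phi> t - deriv S t / real \<kappa>) (at t)"
      by (intro DERIV_diff dpl DERIV_cdivide dsg)
    have tht: "pl t - sg t / real \<kappa> = \<theta>" "pl t - \<sigma> / real \<kappa> = \<theta>" by (simp_all add: plt \<theta>_def \<sigma>_def)
    define Vl Pl where "Vl = (\<lambda>u. V_trunc N v (tau u) (action_curve x y u) (pl u - sg u / real \<kappa>) (sg u))"
      and "Pl = (\<lambda>u. Psi_trunc m psi (tau u) (action_curve x y u) (pl u - sg u / real \<kappa>) (sg u))"
    define X0 where "X0 = (\<tau>, z, \<theta>, \<sigma>)"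
    have Vlt: "Vl t = z\<^sup>2 * Vh X0" "Pl t = Ph X0"
      using V_range[OF \<tau>(2) PPi] V_eq[of z \<tau> \<theta> \<sigma>] zr tht
      by (auto simp: Vl_def Pl_def \<sigma>_def[symmetric] \<tau>_def[symmetric] e_def[symmetric] z(2)[symmetric] X0_def)
    \<comment> \<open>\<open>QG\<close> is the formal rate of \<theta> = \<phi> - \<sigma> /
      \<kappa>; to compare it with the rate of \<phi>, the share of the phase is added back.\<close>
    define r1 r2 r3 where "r1 = (\<lambda>K. energy_rate \<zeta> \<phi> t / \<zeta>\<^sup>2 - QF K X0)"
      and "r2 = (\<lambda>K. angle_rate \<zeta> \<phi> t - (QG K X0 + formal_dS q s \<tau> / real \<kappa>))"
      and "r3 = deriv S t - formal_dS q s \<tau>"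
    have r: "\<bar>r1 K\<bar> \<le> C' * \<tau> ^ (2 * K + 2)" "\<bar>r2 K\<bar> \<le> C' * \<tau> ^ (2 * K + 2)" if RT: "RT K C' t" for K C'
    proof -
      have *: "\<bar>energy_rate \<zeta> \<phi> t / \<zeta>\<^sup>2 - (\<Sum>i=1..K. tau t ^ (2 * i) * fq i (\<zeta>, \<phi>, \<sigma>))\<bar> \<le> C' * tau t ^ (2 * K + 2) \<and>
         \<bar>angle_rate \<zeta> \<phi> t - wz \<zeta> - (\<Sum>i=1..K. tau t ^ (2 * i) * gq i (\<zeta>, \<phi>, \<sigma>))\<bar> \<le> C' * tau t ^ (2 * K + 2)"
        using RT[unfolded RT_def, rule_format, OF \<zeta>(2) \<theta>(2), of \<sigma> b] by (simp add: \<sigma>_def sg_def)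
      have "QF K X0 = (\<Sum>i=1..K. tau t ^ (2 * i) * fq i (\<zeta>, \<phi>, \<sigma>))"
        "QG K X0 + formal_dS q s \<tau> / real \<kappa> = wz \<zeta> + (\<Sum>i=1..K. tau t ^ (2 * i) * gq i (\<zeta>, \<phi>, \<sigma>))"
        by (simp_all add: QF_def QG_def X0_def \<theta>(3) \<zeta>_def[symmetric] \<tau>_def[symmetric])
      then show "\<bar>r1 K\<bar> \<le> C' * \<tau> ^ (2 * K + 2)" "\<bar>r2 K\<bar> \<le> C' * \<tau> ^ (2 * K + 2)"
        using * by (simp_all add: r1_def r2_def \<tau>_def diff_diff_add)
    qed
    have r3: "\<bar>r3\<bar> \<le> CS * \<tau> ^ (2 * q + 2)" using T'[OF t(2)] by (simp add: r3_def \<tau>_def)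
    note bnds = B(2)[OF AAi]
    have at: "action_curve x y t = z\<^sup>2" by (simp add: z(2) e_def)
    define dV where "dV = z\<^sup>2 * (energy_rate \<zeta> \<phi> t / \<zeta>\<^sup>2 + \<tau> ^ (2 * q) * (real l / real q)) * (Vh X0 + z / 2 * Vz X0)
      + z\<^sup>2 * ((angle_rate \<zeta> \<phi> t - deriv S t / real \<kappa>) * Vt X0 + deriv S t * Vs X0 + (- (\<tau> ^ (2 * q + 1) / (2 * real q))) * Vtau X0)"
    have dVl: "(Vl has_real_derivative dV) (at t)"
      using V_curve[OF zr at tau_deriv[OF t(1)] de dth dsg]
      by (simp only: Vl_def dV_def X0_def tht \<sigma>_def[symmetric] \<tau>_def[symmetric])
    define dP where "dP = z\<^sup>2 * (energy_rate \<zeta> \<phi> t / \<zeta>\<^sup>2 + \<tau> ^ (2 * q) * (real l / real q)) / (2 * z) * Pz X0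
      + (angle_rate \<zeta> \<phi> t - deriv S t / real \<kappa>) * Pt X0 + deriv S t * Ps X0 + (- (\<tau> ^ (2 * q + 1) / (2 * real q))) * Ptau X0"
    have dPl: "(Pl has_real_derivative dP) (at t)"
      using Psi_curve[OF zr at tau_deriv[OF t(1)] de dth dsg]
      by (simp only: Pl_def dP_def X0_def tht \<sigma>_def[symmetric] \<tau>_def[symmetric])
    have rg: "z * sqrt (Vh X0) \<in> {0..rho}" "(z * sqrt (Vh X0))\<^sup>2 = z\<^sup>2 * Vh X0" "z\<^sup>2 * Vh X0 \<in> {0..D0}"
      using z_sqrt_range[OF AAi] by (auto simp: X0_def)
    have ang_e: "angle_rate \<zeta> \<phi> t = r2 K + (QG K X0 + formal_dS q s \<tau> / real \<kappa>)" "energy_rate \<zeta> \<phi> t / \<zeta>\<^sup>2 = r1 K + QF K X0" for K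
      by (simp_all add: r1_def r2_def)
    have dS_e: "deriv S t = r3 + formal_dS q s \<tau>" by (simp add: r3_def)
    have LamE: "(\<Sum>j=n..n + d. tau t ^ j * Lam j (Vl t) (Pl t)) = z\<^sup>2 * (\<Sum>j=n..n + d. \<tau> ^ j * (Vh X0 * Lh j (z * sqrt (Vh X0), Ph X0)))"
      unfolding sum_distrib_left
    proof (intro sum.cong refl)
      fix j assume j: "j \<in> {n..n + d}"
      show "tau t ^ j * Lam j (Vl t) (Pl t) = z\<^sup>2 * (\<tau> ^ j * (Vh X0 * Lh j (z * sqrt (Vh X0), Ph X0)))"
        using Lheq[OF j rg(1), of "Ph X0"] unfolding rg(2) Vlt by (simp add: \<tau>_def mult_ac)
    qed
    have DVe: "DV X0 = (Vh X0 + z / 2 * Vz X0) * (QF N X0 + \<tau> ^ (2 * q) * (real l / real q))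
       + Vt X0 * QG N X0 + Vs X0 * formal_dS q s \<tau> - Vtau X0 * \<tau> ^ (2 * q + 1) / (2 * real q)
       - (\<Sum>j=n..n + d. \<tau> ^ j * (Vh X0 * Lh j (z * sqrt (Vh X0), Ph X0)))"
      by (simp add: DV_def X0_def)
    \<comment> \<open>All formal terms combine to \<open>z\<^sup>2 * DV X0\<close>; what is left is
      linear in the rate errors.\<close>
    have eq1: "dV - (\<Sum>j=n..n + d. tau t ^ j * Lam j (Vl t) (Pl t)) = z\<^sup>2 * (DV X0 + (Vh X0 + z / 2 * Vz X0) * r1 N + Vt X0 * (r2 N - r3 / real \<kappa>) + Vs X0 * r3)"
      unfolding LamE dV_def DVe ang_e[of N] dS_e by (simp add: algebra_simps add_divide_distrib)
    have "\<bar>dV - (\<Sum>j=n..n + d. tau t ^ j * Lam j (Vl t) (Pl t))\<bar> = z\<^sup>2 * \<bar>DV X0 + (Vh X0 + z / 2 * Vz X0) * r1 N + Vt X0 * (r2 N - r3 / real \<kappa>) + Vs X0 * r3\<bar>"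
      unfolding eq1 by (simp add: abs_mult)
    also have "\<dots> \<le> z\<^sup>2 * ((BV + 2 * B * (CN + CS)) * \<tau> ^ (n + d + 1))"
    proof (intro mult_left_mono error_bound)
      show "\<bar>DV X0\<bar> \<le> BV * \<tau> ^ (n + d + 1)" unfolding X0_def by (rule BV(2)[OF \<tau>(2) PPi])
      show "\<bar>r3\<bar> \<le> CS * \<tau> ^ (2 * q + 2)" by (rule r3)
      show "\<bar>r1 N\<bar> \<le> CN * \<tau> ^ (2 * N + 2)" "\<bar>r2 N\<bar> \<le> CN * \<tau> ^ (2 * N + 2)" using r[of N CN] T'[OF t(2)] by blast+
    qed (use bnds \<tau> r3 CN(1) CS(1) B(1) nd in \<open>auto simp: X0_def\<close>)
    also have "\<dots> \<le> z\<^sup>2 * (C * \<tau> ^ (n + d + 1))" using C(1) \<tau>(3) by (intro mult_left_mono mult_right_mono) auto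
    finally have bV: "\<bar>dV - (\<Sum>j=n..n + d. tau t ^ j * Lam j (Vl t) (Pl t))\<bar> \<le> C * tau t ^ (n + d + 1) * action_curve x y t"
      by (simp only: at \<tau>_def mult_ac)
    have OmE: "tau t ^ m * Om m (Vl t) (Pl t) = \<tau> ^ m * Oh (z * sqrt (Vh X0), Ph X0)"
      using Oheq[OF rg(1), of "Ph X0"] unfolding rg(2) Vlt by (simp add: \<tau>_def)
    have DPe: "DP X0 = z / 2 * Pz X0 * (QF m X0 + \<tau> ^ (2 * q) * (real l / real q))
       + Pt X0 * QG m X0 + Ps X0 * formal_dS q s \<tau> - Ptau X0 * \<tau> ^ (2 * q + 1) / (2 * real q)
       - \<tau> ^ m * Oh (z * sqrt (Vh X0), Ph X0)"
      by (simp add: DP_def X0_def)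
    have zz: "z\<^sup>2 * w / (2 * z) = z / 2 * w" for w using zr by (simp add: power2_eq_square)
    have eq2: "dP - tau t ^ m * Om m (Vl t) (Pl t) = DP X0 + (z / 2 * Pz X0) * r1 m + Pt X0 * (r2 m - r3 / real \<kappa>) + Ps X0 * r3"
      unfolding OmE dP_def DPe zz ang_e[of m] dS_e by (simp add: algebra_simps add_divide_distrib)
    have "\<bar>dP - tau t ^ m * Om m (Vl t) (Pl t)\<bar> \<le> (BP + 2 * B * (Cm + CS)) * \<tau> ^ (m + 1)"
      unfolding eq2
    proof (rule error_bound)
      show "\<bar>DP X0\<bar> \<le> BP * \<tau> ^ (m + 1)" unfolding X0_def by (rule BP(2)[OF \<tau>(2) PPi])
      show "\<bar>r3\<bar> \<le> CS * \<tau> ^ (2 * q + 2)" by (rule r3)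
      show "\<bar>r1 m\<bar> \<le> Cm * \<tau> ^ (2 * m + 2)" "\<bar>r2 m\<bar> \<le> Cm * \<tau> ^ (2 * m + 2)" using r[of m Cm] T'[OF t(2)] by blast+
    qed (use bnds \<tau> r3 Cm(1) CS(1) B(1) m2 in \<open>auto simp: X0_def\<close>)
    also have "\<dots> \<le> C * \<tau> ^ (m + 1)" using C(2) \<tau>(3) by (intro mult_right_mono) auto
    finally have bP: "\<bar>dP - tau t ^ m * Om m (Vl t) (Pl t)\<bar> \<le> C * tau t ^ (m + 1)" by (simp only: \<tau>_def)
    \<comment> \<open>The conditions on radius, energy and action are open, so near \<open>t\<close>
      the same branch and the same shift of the phase represent \<open>V_traj\<close> and
      \<open>Psi_traj\<close>.\<close>
    have ev: "\<forall>\<^sub>F u in nhds t. V_traj x y u = Vl u \<and> (\<exists>k::int. Psi_traj x y u = Pl u + of_int k * (2 * pi))"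
    proof -
      have lim: "filterlim f (nhds (f t)) (nhds t)" if "(f has_real_derivative f') (at t)" for f f'
        using DERIV_isCont[OF that] by (simp add: continuous_at tendsto_nhds_iff)
      have "((\<lambda>u. (x u)\<^sup>2 + (y u)\<^sup>2) \<longlongrightarrow> (x t)\<^sup>2 + (y t)\<^sup>2) (nhds t)"
        by (intro tendsto_intros lim[OF dx] lim[OF dy])
      then have e1: "\<forall>\<^sub>F u in nhds t. (x u)\<^sup>2 + (y u)\<^sup>2 < r0\<^sup>2" using xy by (rule order_tendstoD)
      have e2: "\<forall>\<^sub>F u in nhds t. H0p (x u, y u) > 0" using lim[OF dE] H by (rule order_tendstoD)
      have "\<zeta>\<^sup>2 < z1\<^sup>2" using \<zeta>(1) by (intro power_strict_mono) auto
      then have "H0p (x t, y t) < z1\<^sup>2" by (simp add: \<zeta>2 E_def p_def)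
      with lim[OF dE] have e3: "\<forall>\<^sub>F u in nhds t. H0p (x u, y u) < z1\<^sup>2" by (rule order_tendstoD)
      have "action_curve x y t < R" using rho(3)[OF zr] by (simp add: at)
      with lim[OF de] have e4: "\<forall>\<^sub>F u in nhds t. action_curve x y u < R" by (rule order_tendstoD)
      show ?thesis using e1 e2 e3 e4
      proof eventually_elim
        case (elim u)
        have d: "(x u, y u) \<in> disc r0" using elim(1) by (simp add: disc_def)
        have s: "sqrt (H0p (x u, y u)) \<in> {0<..z1}" using elim z1 by (auto intro!: real_less_lsqrt less_imp_le)
        have a: "action_curve x y u \<in> {0..R}" using elim by (auto simp: action_curve_def)
        show ?case
          using traj_branch[OF refl elim(2) s ang(3)[OF d elim(2,3)] a, of "sg u" b]
          by (simp add: Vl_def Pl_def pl_def sg_def)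
      qed
    qed
    have V12: "Vh X0 \<in> {1 / 2..2}" unfolding X0_def by (rule dom(7)[OF AAi])
    have v12: "z\<^sup>2 * (1 / 2) \<le> z\<^sup>2 * Vh X0" "z\<^sup>2 * Vh X0 \<le> z\<^sup>2 * 2" using V12 mult_left_mono[of "1 / 2" "Vh X0" "z\<^sup>2"] mult_left_mono[of "Vh X0" 2 "z\<^sup>2"] by auto
    show "rate_at C t x y"
      unfolding rate_at_def
      by (intro exI[of _ Vl] exI[of _ Pl] exI[of _ dV] exI[of _ dP] conjI ev dVl dPl bV bP)
         (use v12 rg(3) in \<open>simp_all add: Vlt at\<close>)
  qed (use C in auto)
qed

end

section \<open>A Lyapunov function\<close>

lemma periodic_bounded:
  fixes f :: "real \<Rightarrow> real"
  assumes "continuous_on UNIV f" "periodic T f" "T > 0"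
  obtains B where "B > 0" "\<And>x. \<bar>f x\<bar> \<le> B"
proof -
  have "compact (f ` {0..0 + T})"
    by (intro compact_continuous_image continuous_on_subset[OF assms(1)]) auto
  then obtain B where B: "B > 0" "\<And>y. y \<in> f ` {0..0 + T} \<Longrightarrow> norm y \<le> B"
    using compact_imp_bounded bounded_pos by metis
  have "\<bar>f x\<bar> \<le> B" for x
  proof -
    obtain k :: int where "x + of_int k * T \<in> {0..<0 + T}" by (rule mod_interval[OF assms(3)])
    then have "norm (f (x + of_int k * T)) \<le> B" by (intro B(2) imageI) auto
    then show ?thesis using periodic_int[OF assms(2), of x k] by simp
  qed
  then show ?thesis using that B(1) by blast
qed

lemma nonvanishing_sign:
  fixes f :: "real \<Rightarrow> real"
  assumes "continuous_on UNIV f" "\<And>x. f x \<noteq> 0"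
  obtains c :: real where "c = 1 \<or> c = - 1" "\<And>x. c * f x = \<bar>f x\<bar>"
proof -
  have con: "connected (range f)" by (rule connected_continuous_image[OF assms(1)]) simp
  have "(\<forall>x. f x > 0) \<or> (\<forall>x. f x < 0)"
  proof (rule ccontr)
    assume "\<not> ?thesis"
    then obtain x y where "f x \<le> 0" "0 \<le> f y" by (auto simp: not_less)
    then have "0 \<in> range f" using connectedD_interval[OF con, of "f x" "f y" 0] by auto
    then show False using assms(2) by auto
  qed
  then show ?thesis
  proof
    assume "\<forall>x. f x > 0"
    then have "1 * f x = \<bar>f x\<bar>" for x by (simp add: abs_of_pos)
    then show ?thesis by (intro that[of 1]) blast+
  next
    assume "\<forall>x. f x < 0"
    then have "- 1 * f x = \<bar>f x\<bar>" for x by (simp add: abs_of_neg)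
    then show ?thesis by (intro that[of "- 1"]) blast+
  qed
qed

text \<open>A primitive of a periodic function changes over a period by a constant, the integral
  over one period, which is zero here.\<close>

lemma periodic_primitive:
  fixes g :: "real \<Rightarrow> real"
  assumes "continuous_on UNIV g" "periodic (2 * pi) g" "integral {0..2 * pi} g = 0"
  obtains P B where "B > 0" "\<And>x. (P has_real_derivative g x) (at x)" "\<And>x (k::int). P (x + of_int k * (2 * pi)) = P x"
    "\<And>x. \<bar>P x\<bar> \<le> B"
proof -
  have "\<exists>F. \<forall>x::real. - \<infinity> < ereal x \<longrightarrow> ereal x < \<infinity> \<longrightarrow> (F has_vector_derivative g x) (at x)"
    by (rule einterval_antiderivative) (use assms(1) in \<open>auto simp: continuous_on_eq_continuous_at\<close>)
  then obtain P where P: "\<And>x. (P has_real_derivative g x) (at x)"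
    by (auto simp: has_real_derivative_iff_has_vector_derivative)
  have per: "periodic (2 * pi) P"
    unfolding periodic_def
  proof
    fix u
    have "((\<lambda>x. P (x + 2 * pi) - P x) has_real_derivative 0) (at x)" for x
    proof -
      have "((\<lambda>x. P (x + 2 * pi)) has_real_derivative g (x + 2 * pi)) (at x)"
        using P[of "x + 2 * pi"] by (simp add: DERIV_shift)
      from DERIV_diff[OF this P[of x]] show ?thesis using assms(2) by (simp add: periodic_def)
    qed
    then have "P (u + 2 * pi) - P u = P (0 + 2 * pi) - P 0"
      by (intro DERIV_isconst_all[of "\<lambda>x. P (x + 2 * pi) - P x"]) auto
    moreover have "(g has_integral (P (2 * pi) - P 0)) {0..2 * pi}"
      by (rule fundamental_theorem_of_calculus)
         (auto simp: has_real_derivative_iff_has_vector_derivative[symmetric] intro: has_field_derivative_at_within P)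
    then have "P (2 * pi) - P 0 = 0" using assms(3) by (simp add: has_integral_iff)
    ultimately show "P (u + 2 * pi) = P u" by simp
  qed
  have "continuous_on UNIV P" by (intro continuous_at_imp_continuous_on ballI DERIV_isCont[OF P])
  then obtain B where "B > 0" "\<And>x. \<bar>P x\<bar> \<le> B" using periodic_bounded[OF _ per] by auto
  then show ?thesis using that P periodic_int[OF per] by blast
qed

section \<open>Leading coefficients of the averaged equations\<close>

locale leading = domain +
  fixes sg :: nat and Ds :: real and lamN :: "nat \<Rightarrow> real \<Rightarrow> real" and lamN' :: "nat \<Rightarrow> real \<Rightarrow> real \<Rightarrow> real"
    and lamL :: "real \<Rightarrow> real" and lamL' :: "real \<Rightarrow> real \<Rightarrow> real"
  assumes sg2: "sg \<ge> 2" and d1: "d \<ge> 1" and mnd: "m < n + d" and D0R: "D0 \<le> R"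
    and LamN: "\<And>j u \<psi>. j \<in> {n..<n + d} \<Longrightarrow> u \<in> {0..D0} \<Longrightarrow>
       Lam j u \<psi> = u powr ((real sg + 1) / 2) * (lamN j \<psi> + lamN' j u \<psi>) + u * kronecker j (2 * q) * (real l / real q)"
    and LamL: "\<And>u \<psi>. u \<in> {0..D0} \<Longrightarrow>
       Lam (n + d) u \<psi> = u * (lamL \<psi> + lamL' u \<psi> + kronecker (n + d) (2 * q) * (real l / real q))"
    and ubN: "\<And>j. j \<in> {n..<n + d} \<Longrightarrow> unif_bigo (lamN' j) sqrt" and ubL: "unif_bigo lamL' sqrt"
    and Ds: "0 < Ds" "Ds \<le> D0" and Omne: "\<And>u \<psi>. u \<in> {0..Ds} \<Longrightarrow> Om m u \<psi> \<noteq> 0"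
    and mean: "psi_mean (\<lambda>\<psi>. lamN n \<psi> * inverse \<bar>Om m 0 \<psi>\<bar>) < 0"
begin

text \<open>The nonlinearity has degree \<open>a + 1\<close>; hence \<open>- a\<close> is the
  exponent for which \<open>v powr (- a)\<close> has constant speed under
  \<open>v' = v powr (a + 1)\<close>.\<close>

definition "a = (real sg - 1) / 2"

lemma a_pos: "a \<ge> 1 / 2" "(real sg + 1) / 2 = a + 1" using sg2 by (auto simp: a_def field_simps)

lemma nN: "j \<in> {n..n + d} \<Longrightarrow> j \<in> {2..N}" using nd by auto

lemma Lam_periodic: "j \<in> {2..N} \<Longrightarrow> u \<in> {0..R} \<Longrightarrow> periodic (2 * pi) (Lam j u)"
  using av unfolding averaging_def by blast

lemma Om_periodic: "u \<in> {0..R} \<Longrightarrow> periodic (2 * pi) (Om m u)"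
  using av m2 unfolding averaging_def by auto

lemma sqrt_rho: "u \<in> {0..R} \<Longrightarrow> sqrt u \<in> {0..rho}" "u \<in> {0..R} \<Longrightarrow> (sqrt u)\<^sup>2 = u" by auto

lemma Lam_continuous:
  assumes "j \<in> {2..N}" "u \<in> {0..R}" shows "continuous_on UNIV (Lam j u)"
proof -
  have "continuous_on UNIV (\<lambda>\<psi>. La j (sqrt u, \<psi>))"
    by (rule continuous_on_compose2[OF smooth_near_continuous_on[OF smLa[OF assms(1)]]])
       (use sqrt_rho(1)[OF assms(2)] in \<open>auto intro!: continuous_intros\<close>)
  moreover have "Lam j u = (\<lambda>\<psi>. La j (sqrt u, \<psi>))"
    using Laeq[OF assms(1) sqrt_rho(1)[OF assms(2)]] sqrt_rho(2)[OF assms(2)] by (auto simp: fun_eq_iff)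
  ultimately show ?thesis by simp
qed

text \<open>The finitely many implied constants are merged, so that one neighbourhood of zero serves
  all orders.\<close>

lemma remainder_bound:
  obtains C where "C > 0" "\<forall>\<^sub>F u in at_right 0. u \<in> {0<..D0} \<and> (\<forall>j\<in>{n..<n + d}. \<forall>\<psi>. \<bar>lamN' j u \<psi>\<bar> \<le> C * sqrt u)
     \<and> (\<forall>\<psi>. \<bar>lamL' u \<psi>\<bar> \<le> C * sqrt u)"
proof -
  have "\<forall>j\<in>{n..<n + d}. \<exists>c. \<forall>\<^sub>F u in at_right 0. \<forall>\<psi>. \<bar>lamN' j u \<psi>\<bar> \<le> c * sqrt u"
    using ubN unfolding unif_bigo_def by blast
  from bchoice[OF this] obtain c where
    c: "\<forall>j\<in>{n..<n + d}. \<forall>\<^sub>F u in at_right 0. \<forall>\<psi>. \<bar>lamN' j u \<psi>\<bar> \<le> c j * sqrt u" ..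
  obtain cL where cL: "\<forall>\<^sub>F u in at_right 0. \<forall>\<psi>. \<bar>lamL' u \<psi>\<bar> \<le> cL * sqrt u"
    using ubL unfolding unif_bigo_def by metis
  define C where "C = (\<Sum>j=n..<n + d. \<bar>c j\<bar>) + \<bar>cL\<bar> + 1"
  have C: "c j \<le> C" if "j \<in> {n..<n + d}" for j
    using member_le_sum[OF that, of "\<lambda>j. \<bar>c j\<bar>"] by (simp add: C_def)
  have "(\<Sum>j=n..<n + d. \<bar>c j\<bar>) \<ge> 0" by (rule sum_nonneg) simp
  then have CL: "cL \<le> C" "C > 0" unfolding C_def by linarith+
  have "\<forall>\<^sub>F u in at_right 0. \<forall>j\<in>{n..<n + d}. \<forall>\<psi>. \<bar>lamN' j u \<psi>\<bar> \<le> c j * sqrt u"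
    using c by (intro eventually_ball_finite) auto
  then have "\<forall>\<^sub>F u in at_right 0. u \<in> {0<..D0} \<and> (\<forall>j\<in>{n..<n + d}. \<forall>\<psi>. \<bar>lamN' j u \<psi>\<bar> \<le> C * sqrt u)
     \<and> (\<forall>\<psi>. \<bar>lamL' u \<psi>\<bar> \<le> C * sqrt u)"
    using cL eventually_at_right_real[OF D0]
  proof eventually_elim
    case (elim u)
    have up: "c' * sqrt u \<le> C * sqrt u" if "c' \<le> C" for c' using that elim(3) by (intro mult_right_mono) auto
    show ?case
    proof (intro conjI ballI allI)
      show "u \<in> {0<..D0}" using elim(3) by auto
      show "\<bar>lamN' j u \<psi>\<bar> \<le> C * sqrt u" if "j \<in> {n..<n + d}" for j \<psi>
        by (rule order_trans[OF _ up[OF C[OF that]]]) (use elim(1) that in blast)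
      show "\<bar>lamL' u \<psi>\<bar> \<le> C * sqrt u" for \<psi>
        by (rule order_trans[OF _ up[OF CL(1)]]) (use elim(2) in blast)
    qed
  qed
  then show ?thesis using that CL(2) by blast
qed

text \<open>At one fixed small \<open>u\<close>, \<open>lamN j\<close> differs from a multiple of
  the continuous periodic function \<open>Lam j u\<close> by a bounded remainder.\<close>

lemma lamN_bounded:
  assumes j: "j \<in> {n..<n + d}" shows "\<exists>B>0. \<forall>\<psi>. \<bar>lamN j \<psi>\<bar> \<le> B"
proof -
  obtain C where "C > 0" and C: "\<forall>\<^sub>F u in at_right 0. u \<in> {0<..D0} \<and> (\<forall>j\<in>{n..<n + d}. \<forall>\<psi>. \<bar>lamN' j u \<psi>\<bar> \<le> C * sqrt u)
     \<and> (\<forall>\<psi>. \<bar>lamL' u \<psi>\<bar> \<le> C * sqrt u)" by (rule remainder_bound)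
  obtain u where u: "u \<in> {0<..D0}" "\<And>\<psi>. \<bar>lamN' j u \<psi>\<bar> \<le> C * sqrt u"
    using eventually_happens[OF C] j by auto
  have jN: "j \<in> {2..N}" and uR: "u \<in> {0..R}" "u \<in> {0..D0}" using nN[of j] j u D0R by auto
  obtain B where B: "B > 0" "\<And>\<psi>. \<bar>Lam j u \<psi>\<bar> \<le> B"
    using periodic_bounded[OF Lam_continuous[OF jN uR(1)] Lam_periodic[OF jN uR(1)]] by auto
  define w where "w = u powr ((real sg + 1) / 2)"
  have w: "w > 0" using u by (simp add: w_def)
  \<comment> \<open>\<open>j < n + d \<le> 2 * q\<close>, so the contribution of the scaling is
    absent at the orders below \<open>n + d\<close>.\<close>
  have k: "kronecker j (2 * q) = 0" using j nd by (simp add: kronecker_def)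
  have "\<bar>lamN j \<psi>\<bar> \<le> B / w + C * sqrt u" for \<psi>
  proof -
    have "Lam j u \<psi> = w * (lamN j \<psi> + lamN' j u \<psi>)" using LamN[OF j uR(2)] by (simp add: w_def k)
    then have "lamN j \<psi> = Lam j u \<psi> / w - lamN' j u \<psi>" using w by (simp add: field_simps)
    moreover have "\<bar>Lam j u \<psi> / w\<bar> \<le> B / w" using B(2)[of \<psi>] w by (simp add: abs_divide divide_right_mono)
    ultimately show ?thesis using u(2)[of \<psi>] by linarith
  qed
  moreover have "B / w + C * sqrt u > 0" using B(1) w \<open>C > 0\<close> u by (auto intro!: add_pos_pos)
  ultimately show ?thesis by blast
qed

lemma lamL_bounded: "\<exists>B>0. \<forall>\<psi>. \<bar>lamL \<psi>\<bar> \<le> B"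
proof -
  obtain C where "C > 0" and C: "\<forall>\<^sub>F u in at_right 0. u \<in> {0<..D0} \<and> (\<forall>j\<in>{n..<n + d}. \<forall>\<psi>. \<bar>lamN' j u \<psi>\<bar> \<le> C * sqrt u)
     \<and> (\<forall>\<psi>. \<bar>lamL' u \<psi>\<bar> \<le> C * sqrt u)" by (rule remainder_bound)
  obtain u where u: "u \<in> {0<..D0}" "\<And>\<psi>. \<bar>lamL' u \<psi>\<bar> \<le> C * sqrt u"
    using eventually_happens[OF C] by auto
  have jN: "n + d \<in> {2..N}" and uR: "u \<in> {0..R}" "u \<in> {0..D0}" using nN[of "n + d"] u D0R by auto
  obtain B where B: "B > 0" "\<And>\<psi>. \<bar>Lam (n + d) u \<psi>\<bar> \<le> B"
    using periodic_bounded[OF Lam_continuous[OF jN uR(1)] Lam_periodic[OF jN uR(1)]] by auto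
  define k where "k = kronecker (n + d) (2 * q) * (real l / real q)"
  have u0: "u > 0" using u by simp
  have "\<bar>lamL \<psi>\<bar> \<le> B / u + C * sqrt u + \<bar>k\<bar>" for \<psi>
  proof -
    have "Lam (n + d) u \<psi> = u * (lamL \<psi> + lamL' u \<psi> + k)" using LamL[OF uR(2)] by (simp add: k_def)
    then have "lamL \<psi> = Lam (n + d) u \<psi> / u - lamL' u \<psi> - k" using u0 by (simp add: field_simps)
    moreover have "\<bar>Lam (n + d) u \<psi> / u\<bar> \<le> B / u" using B(2)[of \<psi>] u0 by (simp add: abs_divide divide_right_mono)
    ultimately show ?thesis using u(2)[of \<psi>] by linarith
  qed
  moreover have "B / u + C * sqrt u + \<bar>k\<bar> > 0" using B(1) \<open>C > 0\<close> u by (auto intro!: add_pos_nonneg)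
  ultimately show ?thesis by blast
qed

text \<open>The coefficient is a uniform limit of the continuous functions
  \<open>Lam n u / u powr (a + 1)\<close> as \<open>u\<close> tends to zero. Continuity is what
  later provides a differentiable primitive.\<close>

lemma lamN_continuous: "continuous_on UNIV (lamN n)"
proof (rule uniform_limit_theorem[where F="at_right (0::real)" and f="\<lambda>u \<psi>. Lam n u \<psi> / u powr ((real sg + 1) / 2)"])
  have n: "n \<in> {n..<n + d}" "n \<in> {2..N}" using d1 nN[of n] by auto
  obtain C where "C > 0" and C: "\<forall>\<^sub>F u in at_right 0. u \<in> {0<..D0} \<and> (\<forall>j\<in>{n..<n + d}. \<forall>\<psi>. \<bar>lamN' j u \<psi>\<bar> \<le> C * sqrt u)
     \<and> (\<forall>\<psi>. \<bar>lamL' u \<psi>\<bar> \<le> C * sqrt u)" by (rule remainder_bound)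
  show "\<forall>\<^sub>F u in at_right 0. continuous_on UNIV (\<lambda>\<psi>. Lam n u \<psi> / u powr ((real sg + 1) / 2))"
    using C
  proof eventually_elim
    case (elim u)
    then have "u \<in> {0..R}" using D0R by auto
    then show ?case using elim by (intro continuous_on_divide Lam_continuous[OF n(2)] continuous_intros) auto
  qed
  show "uniform_limit UNIV (\<lambda>u \<psi>. Lam n u \<psi> / u powr ((real sg + 1) / 2)) (lamN n) (at_right 0)"
  proof (rule uniform_limitI)
    fix e :: real assume "e > 0"
    have "((\<lambda>u. C * sqrt u) \<longlongrightarrow> C * sqrt 0) (at_right 0)" by (intro tendsto_intros)
    then have "\<forall>\<^sub>F u in at_right 0. C * sqrt u < e" using \<open>e > 0\<close> by (intro order_tendstoD(2)) auto
    then show "\<forall>\<^sub>F u in at_right 0. \<forall>\<psi>\<in>UNIV. dist (Lam n u \<psi> / u powr ((real sg + 1) / 2)) (lamN n \<psi>) < e"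
      using C
    proof eventually_elim
      case (elim u)
      have u: "u > 0" "u \<in> {0..D0}" using elim by auto
      have k: "kronecker n (2 * q) = 0" using n(1) nd by (simp add: kronecker_def)
      show ?case
      proof
        fix \<psi>
        have "Lam n u \<psi> / u powr ((real sg + 1) / 2) = lamN n \<psi> + lamN' n u \<psi>"
          using LamN[OF n(1) u(2)] u(1) by (simp add: k)
        moreover have "\<bar>lamN' n u \<psi>\<bar> \<le> C * sqrt u" using elim n(1) by blast
        ultimately show "dist (Lam n u \<psi> / u powr ((real sg + 1) / 2)) (lamN n \<psi>) < e"
          using elim(1) by (simp add: dist_real_def)
      qed
    qed
  qed
qed simp

lemma lamN_periodic: "periodic (2 * pi) (lamN n)"
  unfolding periodic_def
proof
  fix \<psi>
  have n: "n \<in> {n..<n + d}" "n \<in> {2..N}" using d1 nN[of n] by auto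
  obtain C where "C > 0" and C: "\<forall>\<^sub>F u in at_right 0. u \<in> {0<..D0} \<and> (\<forall>j\<in>{n..<n + d}. \<forall>\<psi>. \<bar>lamN' j u \<psi>\<bar> \<le> C * sqrt u)
     \<and> (\<forall>\<psi>. \<bar>lamL' u \<psi>\<bar> \<le> C * sqrt u)" by (rule remainder_bound)
  have k: "kronecker n (2 * q) = 0" using n(1) nd by (simp add: kronecker_def)
  have "\<forall>\<^sub>F u in at_right 0. norm (lamN n (\<psi> + 2 * pi) - lamN n \<psi>) \<le> 2 * (C * sqrt u)"
    using C
  proof eventually_elim
    case (elim u)
    then have u: "u > 0" "u \<in> {0..D0}" "u \<in> {0..R}" using D0R by auto
    have "Lam n u (\<psi> + 2 * pi) = Lam n u \<psi>" using Lam_periodic[OF n(2) u(3)] by (simp add: periodic_def)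
    then have "lamN n (\<psi> + 2 * pi) + lamN' n u (\<psi> + 2 * pi) = lamN n \<psi> + lamN' n u \<psi>"
      using u(1) unfolding LamN[OF n(1) u(2)] by (simp add: k)
    moreover have "\<bar>lamN' n u \<psi>\<bar> \<le> C * sqrt u" "\<bar>lamN' n u (\<psi> + 2 * pi)\<bar> \<le> C * sqrt u" using elim n(1) by blast+
    ultimately show ?case unfolding real_norm_def by linarith
  qed
  moreover have "((\<lambda>u. 2 * (C * sqrt u)) \<longlongrightarrow> 2 * (C * sqrt 0)) (at_right 0)" by (intro tendsto_intros)
  then have "((\<lambda>u. 2 * (C * sqrt u)) \<longlongrightarrow> 0) (at_right 0)" by simp
  ultimately have "((\<lambda>u::real. lamN n (\<psi> + 2 * pi) - lamN n \<psi>) \<longlongrightarrow> 0) (at_right 0)" by (rule Lim_null_comparison)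
  then show "lamN n (\<psi> + 2 * pi) = lamN n \<psi>" by (simp add: tendsto_const_iff)
qed

text \<open>The order \<open>n\<close> enters with its leading coefficient. The orders between
  \<open>n\<close> and \<open>n + d\<close> have the same degree in \<open>u\<close> but are smaller
  by powers of \<tau>, so a crude bound suffices; the order \<open>n + d\<close> is merely linear in
  \<open>u\<close>.\<close>

lemma Lam_bounds:
  obtains u1 CL where "u1 > 0" "CL > 0"
    "\<And>u \<psi>. u \<in> {0<..u1} \<Longrightarrow> \<bar>Lam n u \<psi> - u powr (a + 1) * lamN n \<psi>\<bar> \<le> CL * u powr (a + 1) * sqrt u"
    "\<And>u \<psi> j. u \<in> {0<..u1} \<Longrightarrow> j \<in> {n<..<n + d} \<Longrightarrow> \<bar>Lam j u \<psi>\<bar> \<le> CL * u powr (a + 1)"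
    "\<And>u \<psi>. u \<in> {0<..u1} \<Longrightarrow> \<bar>Lam (n + d) u \<psi>\<bar> \<le> CL * u"
proof -
  obtain C where "C > 0" and C: "\<forall>\<^sub>F u in at_right 0. u \<in> {0<..D0} \<and> (\<forall>j\<in>{n..<n + d}. \<forall>\<psi>. \<bar>lamN' j u \<psi>\<bar> \<le> C * sqrt u)
     \<and> (\<forall>\<psi>. \<bar>lamL' u \<psi>\<bar> \<le> C * sqrt u)" by (rule remainder_bound)
  obtain b where b: "b > 0" "\<And>u. 0 < u \<Longrightarrow> u < b \<Longrightarrow> u \<in> {0<..D0} \<and> (\<forall>j\<in>{n..<n + d}. \<forall>\<psi>. \<bar>lamN' j u \<psi>\<bar> \<le> C * sqrt u)
     \<and> (\<forall>\<psi>. \<bar>lamL' u \<psi>\<bar> \<le> C * sqrt u)"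
    using C unfolding eventually_at_right_field by blast
  define u1 where "u1 = min (b / 2) 1"
  have u1: "u1 > 0" "u1 < b" "u1 \<le> 1" using b by (auto simp: u1_def)
  obtain B where B: "\<And>j. j \<in> {n..<n + d} \<Longrightarrow> B j > 0 \<and> (\<forall>\<psi>. \<bar>lamN j \<psi>\<bar> \<le> B j)" using lamN_bounded by metis
  obtain BL where BL: "BL > 0" "\<And>\<psi>. \<bar>lamL \<psi>\<bar> \<le> BL" using lamL_bounded by blast
  define k where "k = kronecker (n + d) (2 * q) * (real l / real q)"
  define CL where "CL = C + (\<Sum>j=n..<n + d. B j) + BL + \<bar>k\<bar>"
  have S0: "(\<Sum>j=n..<n + d. B j) \<ge> 0" using B by (intro sum_nonneg) (auto intro: less_imp_le)
  have CL: "CL > 0" "C \<le> CL" "BL + C + \<bar>k\<bar> \<le> CL" using S0 BL(1) \<open>C > 0\<close> by (auto simp: CL_def)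
  have CLB: "B j + C \<le> CL" if "j \<in> {n..<n + d}" for j
  proof -
    have "B j \<le> (\<Sum>j=n..<n + d. B j)"
      by (rule member_le_sum[OF that]) (use B in \<open>auto intro: less_imp_le\<close>)
    then show ?thesis using BL(1) by (simp add: CL_def)
  qed
  have ur: "u > 0" "u \<in> {0..D0}" "sqrt u \<le> 1" "\<And>j \<psi>. j \<in> {n..<n + d} \<Longrightarrow> \<bar>lamN' j u \<psi>\<bar> \<le> C * sqrt u" "\<And>\<psi>. \<bar>lamL' u \<psi>\<bar> \<le> C * sqrt u"
    if "u \<in> {0<..u1}" for u
    using b(2)[of u] that u1 by auto
  have k0: "kronecker j (2 * q) = 0" if "j \<in> {n..<n + d}" for j using that nd by (simp add: kronecker_def)
  have Cu: "C * sqrt u \<le> C" if "u \<in> {0<..u1}" for u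
    using mult_left_mono[OF ur(3)[OF that], of C] \<open>C > 0\<close> by simp
  show ?thesis
  proof (rule that[OF u1(1) CL(1)])
    fix u \<psi> assume u: "u \<in> {0<..u1}"
    have n: "n \<in> {n..<n + d}" using d1 by auto
    have "Lam n u \<psi> - u powr (a + 1) * lamN n \<psi> = u powr (a + 1) * lamN' n u \<psi>"
      unfolding LamN[OF n ur(2)[OF u]] k0[OF n] a_pos(2) by (simp add: algebra_simps)
    also have "\<bar>\<dots>\<bar> \<le> u powr (a + 1) * (C * sqrt u)"
      unfolding abs_mult using ur(4)[OF u n, of \<psi>] by (auto intro!: mult_left_mono)
    also have "\<dots> \<le> u powr (a + 1) * (CL * sqrt u)"
      using CL(2) ur(1)[OF u] by (intro mult_left_mono mult_right_mono) auto
    finally show "\<bar>Lam n u \<psi> - u powr (a + 1) * lamN n \<psi>\<bar> \<le> CL * u powr (a + 1) * sqrt u" by (simp add: mult_ac)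
  next
    fix u \<psi> j assume u: "u \<in> {0<..u1}" and j': "j \<in> {n<..<n + d}"
    then have j: "j \<in> {n..<n + d}" by auto
    have "\<bar>lamN j \<psi> + lamN' j u \<psi>\<bar> \<le> CL"
      using B[OF j] ur(4)[OF u j, of \<psi>] Cu[OF u] CLB[OF j] by (smt (verit))
    then have "\<bar>u powr (a + 1) * (lamN j \<psi> + lamN' j u \<psi>)\<bar> \<le> u powr (a + 1) * CL"
      unfolding abs_mult by (auto intro!: mult_left_mono)
    then show "\<bar>Lam j u \<psi>\<bar> \<le> CL * u powr (a + 1)"
      unfolding LamN[OF j ur(2)[OF u]] k0[OF j] a_pos(2) by (simp add: mult.commute)
  next
    fix u \<psi> assume u: "u \<in> {0<..u1}"
    have "\<bar>lamL \<psi> + lamL' u \<psi> + k\<bar> \<le> CL"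
      using BL(2)[of \<psi>] ur(5)[OF u, of \<psi>] Cu[OF u] CL(3) by linarith
    then have "\<bar>u * (lamL \<psi> + lamL' u \<psi> + k)\<bar> \<le> u * CL"
      unfolding abs_mult using ur(1)[OF u] by (auto intro!: mult_left_mono)
    then show "\<bar>Lam (n + d) u \<psi>\<bar> \<le> CL * u"
      unfolding LamL[OF ur(2)[OF u]] k_def by (simp add: mult.commute)
  qed
qed

definition "om \<psi> = Om m 0 \<psi>"

lemma om_Oh: "om \<psi> = Oh (0, \<psi>)"
  using Oheq[of 0 \<psi>] R by (simp add: om_def)

lemma om_continuous: "continuous_on UNIV om"
proof -
  have "continuous_on UNIV (\<lambda>\<psi>. Oh (0, \<psi>))"
    by (rule continuous_on_compose2[OF smooth_near_continuous_on[OF smOh]])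
       (use R in \<open>auto intro!: continuous_intros\<close>)
  then show ?thesis by (simp add: om_Oh[abs_def])
qed

lemma om_periodic: "periodic (2 * pi) om"
  using Om_periodic[of 0] R by (simp add: om_def[abs_def])

lemma om_nonzero: "om \<psi> \<noteq> 0" using Omne[of 0 \<psi>] Ds by (simp add: om_def)

lemma om_lower: obtains c0 where "c0 > 0" "\<And>\<psi>. \<bar>om \<psi>\<bar> \<ge> c0"
proof -
  have "continuous_on UNIV (\<lambda>\<psi>. inverse (om \<psi>))" by (intro continuous_on_inverse om_continuous) (use om_nonzero in auto)
  moreover have "periodic (2 * pi) (\<lambda>\<psi>. inverse (om \<psi>))" using om_periodic by (simp add: periodic_def)
  ultimately obtain B where B: "B > 0" "\<And>\<psi>. \<bar>inverse (om \<psi>)\<bar> \<le> B" by (rule periodic_bounded) auto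
  have "1 / B \<le> \<bar>om \<psi>\<bar>" for \<psi>
    using B(2)[of \<psi>] B(1) om_nonzero[of \<psi>] by (simp add: field_simps)
  then show ?thesis using B(1) by (intro that[of "1 / B"]) auto
qed

text \<open>Hadamard's lemma in the root of the action; periodicity reduces the bound on the
  quotient to a compact set.\<close>

lemma om_close: obtains C where "C > 0" "\<And>u \<psi>. u \<in> {0..R} \<Longrightarrow> \<bar>Om m u \<psi> - om \<psi>\<bar> \<le> C * sqrt u"
proof -
  obtain O1 where O1: "smooth_near ({0..rho} \<times> UNIV) O1"
    "\<And>z p. (z, p) \<in> {0..rho} \<times> UNIV \<Longrightarrow> Oh (z, p) = Oh (0, p) + z * O1 (z, p)"
    by (rule hadamard[OF smOh]) (auto simp del: atLeastAtMost_iff intro: unit_mult_Icc)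
  have "compact ({0..rho} \<times> {0..2 * pi})" by (intro compact_Times) auto
  then obtain B where B: "B > 0" "\<And>p. p \<in> {0..rho} \<times> {0..2 * pi} \<Longrightarrow> \<bar>O1 p\<bar> \<le> B"
    by (rule smooth_near_bounded[OF smooth_near_subset[OF O1(1)], rotated]) auto
  have "\<bar>Om m u \<psi> - om \<psi>\<bar> \<le> B * sqrt u" if u: "u \<in> {0..R}" for u \<psi>
  proof -
    obtain k :: int where k: "\<psi> + of_int k * (2 * pi) \<in> {0..<0 + 2 * pi}" using mod_interval[of "2 * pi" \<psi> 0] by auto
    define \<psi>' where "\<psi>' = \<psi> + of_int k * (2 * pi)"
    have "Om m u \<psi> - om \<psi> = Om m u \<psi>' - om \<psi>'"
      using periodic_int[OF Om_periodic[OF u]] periodic_int[OF om_periodic] by (simp add: \<psi>'_def)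
    also have "\<dots> = sqrt u * O1 (sqrt u, \<psi>')"
      using Oheq[OF sqrt_rho(1)[OF u], of \<psi>'] O1(2)[of "sqrt u" \<psi>'] sqrt_rho[OF u] by (simp add: om_Oh)
    also have "\<bar>\<dots>\<bar> \<le> sqrt u * B"
      unfolding abs_mult using B(2)[of "(sqrt u, \<psi>')"] k sqrt_rho(1)[OF u] u by (auto simp: \<psi>'_def intro!: mult_left_mono)
    finally show ?thesis by (simp add: mult.commute)
  qed
  then show ?thesis using that B(1) by blast
qed

definition "gam = psi_mean (\<lambda>\<psi>. lamN n \<psi> * inverse \<bar>om \<psi>\<bar>)"

lemma gam_neg: "gam < 0" using mean by (simp add: gam_def om_def)

text \<open>Subtracting the mean makes the integral over a period zero. The division by
  \<open>\<bar>om x\<bar>\<close> anticipates that \<open>P\<close> will be differentiated along an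
  angle whose speed is proportional to \<open>om\<close>.\<close>

lemma corrector:
  obtains P B where "B > 0" "\<And>x. (P has_real_derivative lamN n x / \<bar>om x\<bar> - gam) (at x)"
    "\<And>x (k::int). P (x + of_int k * (2 * pi)) = P x" "\<And>x. \<bar>P x\<bar> \<le> B" "\<And>x. \<bar>lamN n x / \<bar>om x\<bar> - gam\<bar> \<le> B"
proof -
  let ?g = "\<lambda>x. lamN n x / \<bar>om x\<bar> - gam"
  have c0: "continuous_on UNIV (\<lambda>x. lamN n x / \<bar>om x\<bar>)"
    by (intro continuous_intros lamN_continuous om_continuous) (use om_nonzero in auto)
  have c: "continuous_on UNIV ?g" by (rule continuous_on_diff[OF c0 continuous_on_const])
  have p: "periodic (2 * pi) ?g" using lamN_periodic om_periodic by (simp add: periodic_def)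
  have i: "(\<lambda>x. lamN n x / \<bar>om x\<bar>) integrable_on {0..2 * pi}"
    by (intro integrable_continuous_interval continuous_on_subset[OF c0]) auto
  have "integral {0..2 * pi} ?g = integral {0..2 * pi} (\<lambda>x. lamN n x / \<bar>om x\<bar>) - integral {0..2 * pi} (\<lambda>x. gam)"
    by (rule integral_diff[OF i]) auto
  also have "integral {0..2 * pi} (\<lambda>x. gam) = 2 * pi * gam" by simp
  also have "integral {0..2 * pi} (\<lambda>x. lamN n x / \<bar>om x\<bar>) = 2 * pi * gam"
    unfolding gam_def psi_mean_def divide_inverse[of "lamN n _"] by simp
  finally have z: "integral {0..2 * pi} ?g = 0" by simp
  obtain P B where P: "B > 0" "\<And>x. (P has_real_derivative ?g x) (at x)" "\<And>x (k::int). P (x + of_int k * (2 * pi)) = P x" "\<And>x. \<bar>P x\<bar> \<le> B"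
    by (rule periodic_primitive[OF c p z]) blast
  obtain B' where B': "B' > 0" "\<And>x. \<bar>?g x\<bar> \<le> B'" using periodic_bounded[OF c p] by auto
  show ?thesis
    by (rule that[of "max B B'" P]) (use P B' in \<open>auto simp: le_max_iff_disj\<close>)
qed

end

text \<open>A statement about numbers at one instant: \<open>h\<close> stands for \<tau>,
  \<open>A\<close> for the main term of the Lyapunov function, \<open>lam\<close> and
  \<open>w\<close> for the leading coefficients at the current angle. The leading order is
  \<open>g\<close>; every error is a constant times \<open>g * sqrt V\<close> or
  \<open>g * r\<close>, and \<open>K\<close> collects these constants. The oscillating
  \<open>lam\<close> cancels between the two parts and leaves \<open>- gam * \<bar>w\<bar>\<close>,
  which is positive.\<close>

lemma lyapunov_rate:
  fixes h V a dd A M CL C Cw B c0 g r lam w P P' s dV dP OmV gam mu :: real and n m d q :: nat and L :: "nat \<Rightarrow> real"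
  assumes h: "0 < h" "h < 1" and V: "V > 0" and a: "a > 0" and dd: "dd = real d - 1 / 2" and d: "d \<ge> 1"
    and m: "m < n + d" "n + d \<le> 2 * q" and mu: "mu = real n + dd - real m"
    and A: "A = h powr dd * V powr (- a)" "A \<le> M"
    and pos: "CL > 0" "C > 0" "Cw > 0" "B > 0" "c0 > 0"
    and L1: "\<bar>L n - V powr (a + 1) * lam\<bar> \<le> CL * V powr (a + 1) * sqrt V"
    and L2: "\<And>j. j \<in> {n<..<n + d} \<Longrightarrow> \<bar>L j\<bar> \<le> CL * V powr (a + 1)"
    and L3: "\<bar>L (n + d)\<bar> \<le> CL * V"
    and dV: "\<bar>dV - (\<Sum>j=n..n + d. h ^ j * L j)\<bar> \<le> 2 * C * h ^ (n + d + 1) * V"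
    and dP: "\<bar>dP - h ^ m * OmV\<bar> \<le> C * h ^ (m + 1)"
    and Om: "\<bar>OmV - w\<bar> \<le> Cw * sqrt V"
    and P: "\<bar>P\<bar> \<le> B" "P' = lam / \<bar>w\<bar> - gam" "\<bar>P'\<bar> \<le> B"
    and s: "s * w = \<bar>w\<bar>" "\<bar>s\<bar> = 1" "\<bar>w\<bar> \<ge> c0" and gam: "gam < 0"
    and K: "K = dd * M + a * (CL + real d * CL + M * CL + 2 * M * C) + a * mu * B + a * B * (Cw + C)"
    and g: "g = h powr (real n + dd)" and r: "r = h powr (1 / 2)"
  shows "g * (a * (- gam) * c0 - K * (sqrt V + r)) \<le>
    (- (dd / (2 * real q)) * h ^ (2 * q) * A - a * (A / V) * dV)
    + a * s * (- (mu / (2 * real q)) * h powr mu * h ^ (2 * q) * P + h powr mu * P' * dP)"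
proof -
  have g0: "g > 0" and r0: "r > 0" and hd0: "h powr dd > 0" using h by (simp_all add: g r)
  have dd0: "dd > 0" and mu0: "mu \<ge> 1 / 2" using d m by (auto simp: dd mu)
  have q: "real q \<ge> 1" using m by auto
  have A0: "A > 0" using h V by (simp add: A)
  have M0: "M > 0" using A0 A(2) by linarith
  have hp: "h ^ k = h powr real k" for k using h by (simp add: powr_realpow)
  \<comment> \<open>Here \<open>dd = d - 1 / 2\<close> pays off: the exponent \<open>n + d\<close>
    of the linear term exceeds the leading exponent \<open>n + dd\<close> by
    \<open>1 / 2\<close>.\<close>
  have hnd: "h ^ (n + d) = g * r" unfolding hp g r by (simp add: powr_add[symmetric] dd)
  have h2q: "h ^ (2 * q) \<le> g * r" unfolding hnd[symmetric] using h m by (intro power_decreasing) auto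
  have hn: "h powr dd * h ^ n = g" unfolding hp g by (simp add: powr_add[symmetric] add.commute)
  have hr: "h \<le> r"
    using powr_mono'[of "1 / 2" 1 h] h by (simp add: r)
  have AV: "A / V * V powr (a + 1) = h powr dd"
    using V by (simp add: A powr_add powr_minus field_simps)
  have AV0: "A / V > 0" using A0 V by simp
  have AVm: "\<bar>A / V * X\<bar> = A / V * \<bar>X\<bar>" for X by (simp only: abs_mult abs_of_pos[OF AV0])
  have E1: "\<bar>dd / (2 * real q) * h ^ (2 * q) * A\<bar> \<le> dd * M * (g * r)"
  proof -
    have "dd / (2 * real q) \<le> dd / 1" using dd0 q by (intro divide_left_mono) auto
    then have "dd / (2 * real q) * h ^ (2 * q) * A \<le> dd * (g * r) * M"
      using dd0 h2q A A0 g0 r0 h q by (intro mult_mono) auto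
    moreover have "dd / (2 * real q) * h ^ (2 * q) * A \<ge> 0" using dd0 h A0 q by (intro mult_nonneg_nonneg) auto
    ultimately show ?thesis by (simp add: mult_ac)
  qed
  have E2a: "\<bar>A / V * (h ^ n * L n) - g * lam\<bar> \<le> CL * (g * sqrt V)"
  proof -
    have "A / V * h ^ n * (L n - V powr (a + 1) * lam) = A / V * (h ^ n * L n) - (A / V * V powr (a + 1)) * h ^ n * lam"
      by (simp only: right_diff_distrib mult_ac)
    then have "A / V * (h ^ n * L n) - g * lam = A / V * h ^ n * (L n - V powr (a + 1) * lam)" unfolding AV hn by simp
    also have "\<bar>\<dots>\<bar> \<le> A / V * h ^ n * (CL * V powr (a + 1) * sqrt V)"
    proof -
      have p: "0 \<le> A / V * h ^ n" using AV0 h by (intro mult_nonneg_nonneg) auto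
      show ?thesis unfolding abs_mult[of "A / V * h ^ n"] abs_of_nonneg[OF p] by (rule mult_left_mono[OF L1 p])
    qed
    also have "\<dots> = CL * ((A / V * V powr (a + 1)) * h ^ n * sqrt V)" by simp
    also have "\<dots> = CL * (g * sqrt V)" unfolding AV hn ..
    finally show ?thesis .
  qed
  have E2b: "\<bar>A / V * (\<Sum>j\<in>{n<..<n + d}. h ^ j * L j)\<bar> \<le> real d * CL * (g * r)"
  proof -
    have "\<bar>A / V * (\<Sum>j\<in>{n<..<n + d}. h ^ j * L j)\<bar> \<le> (\<Sum>j\<in>{n<..<n + d}. \<bar>A / V * (h ^ j * L j)\<bar>)"
      unfolding sum_distrib_left by (rule sum_abs)
    also have "\<dots> \<le> (\<Sum>j\<in>{n<..<n + d}. CL * (g * r))"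
    proof (rule sum_mono)
      fix j assume j: "j \<in> {n<..<n + d}"
      have "\<bar>A / V * (h ^ j * L j)\<bar> = A / V * (h ^ j * \<bar>L j\<bar>)" unfolding AVm using h by (simp add: abs_mult)
      also have "\<dots> \<le> A / V * (h ^ (n + 1) * (CL * V powr (a + 1)))"
        using AV0 h j L2[OF j] by (intro mult_left_mono mult_mono power_decreasing) auto
      also have "\<dots> = CL * ((A / V * V powr (a + 1)) * h ^ n * h)" by simp
      also have "\<dots> = CL * (g * h)" unfolding AV hn ..
      also have "\<dots> \<le> CL * (g * r)" using hr g0 pos by (intro mult_left_mono) auto
      finally show "\<bar>A / V * (h ^ j * L j)\<bar> \<le> CL * (g * r)" .
    qed
    also have "\<dots> = real (card {n<..<n + d}) * (CL * (g * r))" by simp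
    also have "\<dots> \<le> real d * (CL * (g * r))" using pos g0 r0 by (intro mult_right_mono) auto
    finally show ?thesis by (simp add: mult_ac)
  qed
  have E2c: "\<bar>A / V * (h ^ (n + d) * L (n + d))\<bar> \<le> M * CL * (g * r)"
  proof -
    have "\<bar>A / V * (h ^ (n + d) * L (n + d))\<bar> = A / V * (h ^ (n + d) * \<bar>L (n + d)\<bar>)" unfolding AVm using h by (simp add: abs_mult)
    also have "\<dots> \<le> A / V * (h ^ (n + d) * (CL * V))" using AV0 h L3 by (intro mult_left_mono) auto
    also have "\<dots> = A * (CL * (g * r))" unfolding hnd using V by simp
    also have "\<dots> \<le> M * (CL * (g * r))" using A(2) pos g0 r0 by (intro mult_right_mono) auto
    finally show ?thesis by (simp add: mult_ac)
  qed
  have E2d: "\<bar>A / V * (dV - (\<Sum>j=n..n + d. h ^ j * L j))\<bar> \<le> 2 * M * C * (g * r)"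
  proof -
    have "\<bar>A / V * (dV - (\<Sum>j=n..n + d. h ^ j * L j))\<bar> = A / V * \<bar>dV - (\<Sum>j=n..n + d. h ^ j * L j)\<bar>"
      by (rule AVm)
    also have "\<dots> \<le> A / V * (2 * C * h ^ (n + d + 1) * V)" using AV0 dV by (intro mult_left_mono) auto
    also have "\<dots> = A * (2 * C * (h ^ (n + d) * h))" using V by simp
    also have "\<dots> \<le> M * (2 * C * (h ^ (n + d) * 1))" using A(2) A0 M0 pos h by (intro mult_mono mult_left_mono) auto
    finally show ?thesis unfolding hnd by (simp add: mult_ac)
  qed
  have split: "(\<Sum>j=n..n + d. h ^ j * L j) = h ^ n * L n + (\<Sum>j\<in>{n<..<n + d}. h ^ j * L j) + h ^ (n + d) * L (n + d)"
  proof -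
    have "{n..n + d} = insert n (insert (n + d) {n<..<n + d})" using d by auto
    then show ?thesis using d by simp
  qed
  define X where "X = CL * (g * sqrt V) + (real d * CL + M * CL + 2 * M * C) * (g * r)"
  have "A / V * dV - g * lam = (A / V * (h ^ n * L n) - g * lam) + A / V * (\<Sum>j\<in>{n<..<n + d}. h ^ j * L j)
     + A / V * (h ^ (n + d) * L (n + d)) + A / V * (dV - (\<Sum>j=n..n + d. h ^ j * L j))"
    unfolding split by (simp add: algebra_simps)
  then have E2: "\<bar>A / V * dV - g * lam\<bar> \<le> X"
    using E2a E2b E2c E2d unfolding X_def distrib_right[of _ _ "g * r"] by linarith
  have hmu: "h powr mu * h ^ m = g" unfolding hp g mu by (simp add: powr_add[symmetric])
  have E3: "\<bar>mu / (2 * real q) * h powr mu * h ^ (2 * q) * P\<bar> \<le> mu * B * (g * r)"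
  proof -
    have "mu / (2 * real q) \<le> mu / 1" using mu0 q by (intro divide_left_mono) auto
    moreover have "h powr mu * h ^ (2 * q) \<le> g * r"
    proof -
      have "h powr mu * h ^ (2 * q) = h powr (mu + real (2 * q))" unfolding hp by (simp add: powr_add)
      \<comment> \<open>The exponent is \<open>n + dd + (2 * q - m)\<close>, and
        \<open>m < n + d \<le> 2 * q\<close> makes the last part at least 1.\<close>
      also have "\<dots> \<le> h powr (real n + dd + 1 / 2)" using h m by (intro powr_mono') (auto simp: mu)
      finally show ?thesis by (simp add: g r powr_add)
    qed
    ultimately have le: "mu / (2 * real q) * (h powr mu * h ^ (2 * q)) \<le> mu * (g * r)"
      using mu0 h by (intro mult_mono[where b="mu"]) auto
    have nn: "mu / (2 * real q) * (h powr mu * h ^ (2 * q)) \<ge> 0" using mu0 h q by (intro mult_nonneg_nonneg) auto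
    have "mu / (2 * real q) * h powr mu * h ^ (2 * q) * P = (mu / (2 * real q) * (h powr mu * h ^ (2 * q))) * P"
      by (simp only: mult.assoc)
    also have "\<bar>\<dots>\<bar> \<le> (mu * (g * r)) * B"
      unfolding abs_mult[of _ P] abs_of_nonneg[OF nn] by (intro mult_mono le P(1)) (use nn le in linarith)+
    finally show ?thesis by (simp only: mult_ac)
  qed
  have E4: "\<bar>h powr mu * P' * dP - g * P' * w\<bar> \<le> B * Cw * (g * sqrt V) + B * C * (g * r)"
  proof -
    have "h powr mu * P' * dP - g * P' * w = P' * (g * (OmV - w) + h powr mu * (dP - h ^ m * OmV))"
      unfolding hmu[symmetric] by (simp add: algebra_simps)
    also have "\<bar>\<dots>\<bar> \<le> B * (g * (Cw * sqrt V) + g * r * C)"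
      unfolding abs_mult[of P']
    proof (intro mult_mono P(3))
      have "\<bar>g * (OmV - w)\<bar> \<le> g * (Cw * sqrt V)" unfolding abs_mult using g0 Om by (simp add: mult_left_mono)
      moreover have "\<bar>h powr mu * (dP - h ^ m * OmV)\<bar> \<le> g * r * C"
      proof -
        have "\<bar>h powr mu * (dP - h ^ m * OmV)\<bar> \<le> h powr mu * (C * h ^ (m + 1))"
          unfolding abs_mult using dP by (simp add: mult_left_mono)
        also have "\<dots> = (h powr mu * h ^ m) * h * C" by simp
        also have "\<dots> \<le> g * r * C" unfolding hmu using hr g0 pos by (intro mult_right_mono mult_left_mono) auto
        finally show ?thesis .
      qed
      ultimately show "\<bar>g * (OmV - w) + h powr mu * (dP - h ^ m * OmV)\<bar> \<le> g * (Cw * sqrt V) + g * r * C" by linarith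
    qed (use pos in auto)
    finally show ?thesis by (simp add: algebra_simps)
  qed
  have sw: "s * (g * P' * w) = g * lam - g * gam * \<bar>w\<bar>"
  proof -
    have w: "\<bar>w\<bar> > 0" using s(3) pos by linarith
    have "s * (g * P' * w) = g * P' * \<bar>w\<bar>" using s(1) by (metis (no_types) mult.assoc mult.commute)
    also have "\<dots> = g * lam - g * gam * \<bar>w\<bar>" using w by (simp add: P(2) field_simps)
    finally show ?thesis .
  qed
  define e1 e2 e3 e4 where "e1 = dd / (2 * real q) * h ^ (2 * q) * A" and "e2 = A / V * dV - g * lam"
    and "e3 = mu / (2 * real q) * h powr mu * h ^ (2 * q) * P" and "e4 = h powr mu * P' * dP - g * P' * w"
  have total: "(- (dd / (2 * real q)) * h ^ (2 * q) * A - a * (A / V) * dV)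
    + a * s * (- (mu / (2 * real q)) * h powr mu * h ^ (2 * q) * P + h powr mu * P' * dP)
    = - e1 - a * (e2 + g * lam) + a * (s * (- e3)) + a * (s * e4) + a * (s * (g * P' * w))"
    by (simp add: e1_def e2_def e3_def e4_def algebra_simps)
  have se: "\<bar>s * (- e3)\<bar> = \<bar>e3\<bar>" "\<bar>s * e4\<bar> = \<bar>e4\<bar>" using s(2) by (simp_all add: abs_mult)
  have b3: "- (mu * B * (g * r)) \<le> s * (- e3)" using E3 se(1) unfolding e3_def[symmetric] by linarith
  have b4: "- (B * Cw * (g * sqrt V) + B * C * (g * r)) \<le> s * e4" using E4 se(2) unfolding e4_def[symmetric] by linarith
  have b2: "e2 \<le> X" using E2 unfolding e2_def[symmetric] by linarith
  have b1: "- (dd * M * (g * r)) \<le> - e1" using E1 unfolding e1_def[symmetric] by linarith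
  have b5: "g * (- gam) * c0 \<le> - g * gam * \<bar>w\<bar>"
    using mult_left_mono[OF s(3), of "g * (- gam)"] g0 gam by (simp add: mult_nonneg_nonpos less_imp_le)
  have "- (dd * M * (g * r)) - a * X - a * (mu * B * (g * r)) - a * (B * Cw * (g * sqrt V) + B * C * (g * r)) + a * (g * (- gam) * c0)
    \<le> - e1 - a * e2 + a * (s * (- e3)) + a * (s * e4) + a * (- g * gam * \<bar>w\<bar>)"
    using b1 mult_left_mono[OF b2, of a] mult_left_mono[OF b3, of a] mult_left_mono[OF b4, of a] mult_left_mono[OF b5, of a] a
    by linarith
  also have "\<dots> = - e1 - a * (e2 + g * lam) + a * (s * (- e3)) + a * (s * e4) + a * (s * (g * P' * w))"
    unfolding sw by (simp add: algebra_simps)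
  finally have fin: "- (dd * M * (g * r)) - a * X - a * (mu * B * (g * r)) - a * (B * Cw * (g * sqrt V) + B * C * (g * r)) + a * (g * (- gam) * c0)
    \<le> - e1 - a * (e2 + g * lam) + a * (s * (- e3)) + a * (s * e4) + a * (s * (g * P' * w))" .
  \<comment> \<open>\<open>K * (sqrt V + r)\<close> contains each constant with both factors; the
    surplus products listed here are nonnegative.\<close>
  have nn: "dd * M * (g * sqrt V) \<ge> 0" "a * (real d * CL + M * CL + 2 * M * C) * (g * sqrt V) \<ge> 0"
    "a * (mu * B) * (g * sqrt V) \<ge> 0" "a * (B * C) * (g * sqrt V) \<ge> 0"
    "a * CL * (g * r) \<ge> 0" "a * (B * Cw) * (g * r) \<ge> 0"
    using dd0 M0 g0 r0 a pos mu0 V by (auto intro!: mult_nonneg_nonneg add_nonneg_nonneg)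
  have "g * (a * (- gam) * c0 - K * (sqrt V + r)) =
    - (dd * M * (g * r)) - a * X - a * (mu * B * (g * r)) - a * (B * Cw * (g * sqrt V) + B * C * (g * r)) + a * (g * (- gam) * c0)
    - dd * M * (g * sqrt V) - a * (real d * CL + M * CL + 2 * M * C) * (g * sqrt V)
    - a * (mu * B) * (g * sqrt V) - a * (B * C) * (g * sqrt V) - a * CL * (g * r) - a * (B * Cw) * (g * r)"
    by (simp add: K X_def algebra_simps)
  then show ?thesis unfolding total using fin nn by linarith
qed

context leading
begin

text \<open>\<open>be\<close> is chosen so that \<open>V \<sim> t\<^sup>-\<^sup>b\<^sup>e\<close> corresponds to \<open>\<tau>\<^sup>d\<^sup>d V\<^sup>-\<^sup>a \<sim> 1\<close>. On this scale the nonlinear term of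
  order \<open>n\<close> dominates the linear one of order \<open>n + d\<close>, because \<open>dd < d\<close>.\<close>

definition "dd = real d - 1 / 2"
definition "be = dd / (real q * (real sg - 1))"
definition "mu = real n + dd - real m"

lemma dd_pos: "dd \<ge> 1 / 2" and be_pos: "be > 0" and mu_pos: "mu \<ge> 1 / 2" and be_a: "be * a = dd / (2 * real q)"
proof -
  show d: "dd \<ge> 1 / 2" using d1 by (simp add: dd_def)
  show "mu \<ge> 1 / 2" using mnd by (simp add: mu_def dd_def)
  have "real q * (real sg - 1) > 0" using q1 sg2 by (intro mult_pos_pos) auto
  then show "be > 0" using d by (simp add: be_def)
  have "real sg - 1 > 0" "real q > 0" using q1 sg2 by auto
  then show "be * a = dd / (2 * real q)" by (simp add: be_def a_def)
qed

lemma tau_powr: "t > 0 \<Longrightarrow> tau t powr c = t powr (- c / (2 * real q))"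
  by (simp add: tau_def powr_powr)

lemma be_tau: "t > 0 \<Longrightarrow> (t powr (- be)) powr a = tau t powr dd"
  using be_a by (simp add: tau_powr powr_powr)

lemma tau_powr_deriv:
  assumes "t > 0"
  shows "((\<lambda>u. tau u powr c) has_real_derivative - (c / (2 * real q)) * tau t powr c * tau t ^ (2 * q)) (at t)"
proof -
  have h: "tau t > 0" by (rule tau_pos[OF assms])
  have "((\<lambda>u. tau u powr c) has_real_derivative c * tau t powr (c - 1) * (- (tau t ^ (2 * q + 1) / (2 * real q)))) (at t)"
    by (rule DERIV_chain2[OF has_real_derivative_powr[OF h] tau_deriv[OF assms]])
  moreover have "c * tau t powr (c - 1) * (- (tau t ^ (2 * q + 1) / (2 * real q))) = - (c / (2 * real q)) * tau t powr c * tau t ^ (2 * q)"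
    using h by (simp add: powr_diff)
  ultimately show ?thesis by (rule DERIV_cong)
qed

text \<open>The derivative of the second term replaces \<open>\<lambda>\<^sub>n\<^sub>,\<^sub>\<sigma>\<close> in the leading part of the derivative of the
  first one by a negative mean value, if \<open>P' = \<lambda>\<^sub>n\<^sub>,\<^sub>\<sigma> / \<bar>\<omega>\<^sub>m\<bar> - gam\<close> and \<open>sgm\<close> is the sign of \<open>\<omega>\<^sub>m\<close>.\<close>

definition "lyap P sgm x y u = tau u powr dd * V_traj x y u powr (- a) + a * sgm * (tau u powr mu * P (Psi_traj x y u))"

text \<open>The lower bound on the action keeps the main term of the Lyapunov function bounded, the
  upper one makes the action small at large times.\<close>

definition "window x y t \<longleftrightarrow> (x t)\<^sup>2 + (y t)\<^sup>2 < r0\<^sup>2 \<and> 0 < H0p (x t, y t) \<and>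
   action_curve x y t * t powr be \<in> {1 / 16..1 / 2}"

text \<open>In the window \<open>V\<close> is at most \<open>t powr (- be)\<close>, so at large
  times the errors in \<open>lyapunov_rate\<close> fall below the drift
  \<open>a * (- gam) * c0\<close>. The time \<open>T\<close> depends on the system and not on the
  solution.\<close>

lemma lyapunov_increasing:
  obtains P sgm B T where "\<bar>sgm\<bar> = 1" "B > 0" "\<And>\<psi>. \<bar>P \<psi>\<bar> \<le> B" "T \<ge> 1"
    "\<And>t x y. t \<ge> T \<Longrightarrow> (x has_real_derivative HY (x t) (y t) t) (at t) \<Longrightarrow>
       (y has_real_derivative - HX (x t) (y t) t + F (x t) (y t) t) (at t) \<Longrightarrow> window x y t \<Longrightarrow>
       (\<exists>D>0. (lyap P sgm x y has_real_derivative D) (at t)) \<and>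
       action_curve x y t / 2 \<le> V_traj x y t \<and> V_traj x y t \<le> 2 * action_curve x y t"
proof -
  obtain C T1 where C: "C > 0" "T1 \<ge> 1"
    "\<And>t x y. t \<ge> T1 \<Longrightarrow> (x has_real_derivative HY (x t) (y t) t) (at t) \<Longrightarrow>
       (y has_real_derivative - HX (x t) (y t) t + F (x t) (y t) t) (at t) \<Longrightarrow> (x t)\<^sup>2 + (y t)\<^sup>2 < r0\<^sup>2 \<Longrightarrow>
       0 < H0p (x t, y t) \<Longrightarrow> action_curve x y t \<le> z2\<^sup>2 \<Longrightarrow> rate_at C t x y"
    by (rule local_rates) blast
  obtain u1 CL where CL: "u1 > 0" "CL > 0"
    "\<And>u \<psi>. u \<in> {0<..u1} \<Longrightarrow> \<bar>Lam n u \<psi> - u powr (a + 1) * lamN n \<psi>\<bar> \<le> CL * u powr (a + 1) * sqrt u"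
    "\<And>u \<psi> j. u \<in> {0<..u1} \<Longrightarrow> j \<in> {n<..<n + d} \<Longrightarrow> \<bar>Lam j u \<psi>\<bar> \<le> CL * u powr (a + 1)"
    "\<And>u \<psi>. u \<in> {0<..u1} \<Longrightarrow> \<bar>Lam (n + d) u \<psi>\<bar> \<le> CL * u"
    by (rule Lam_bounds) blast
  obtain c0 where c0: "c0 > 0" "\<And>\<psi>. \<bar>om \<psi>\<bar> \<ge> c0" by (rule om_lower) blast
  obtain Cw where Cw: "Cw > 0" "\<And>u \<psi>. u \<in> {0..R} \<Longrightarrow> \<bar>Om m u \<psi> - om \<psi>\<bar> \<le> Cw * sqrt u" by (rule om_close) blast
  obtain sgm where sgm: "sgm = 1 \<or> sgm = - 1" "\<And>\<psi>. sgm * om \<psi> = \<bar>om \<psi>\<bar>"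
    using nonvanishing_sign[OF om_continuous om_nonzero] by blast
  obtain P B where P: "B > 0" "\<And>x. (P has_real_derivative lamN n x / \<bar>om x\<bar> - gam) (at x)"
    "\<And>x (k::int). P (x + of_int k * (2 * pi)) = P x" "\<And>x. \<bar>P x\<bar> \<le> B" "\<And>x. \<bar>lamN n x / \<bar>om x\<bar> - gam\<bar> \<le> B"
    by (rule corrector) blast
  \<comment> \<open>In the window the action is at least \<open>b / 16\<close> and \<open>V\<close>
    at least half of it, so \<open>V \<ge> b / 32\<close>, and the main term is at most
    \<open>32 powr a\<close>.\<close>
  define M where "M = 32 powr a"
  define K where "K = dd * M + a * (CL + real d * CL + M * CL + 2 * M * C) + a * mu * B + a * B * (Cw + C)"
  have lim1: "((\<lambda>t. t powr (- be)) \<longlongrightarrow> 0) at_top"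
    using tendsto_neg_powr[OF _ filterlim_ident, of "- be"] be_pos by simp
  have "((\<lambda>t. sqrt (t powr (- be)) + tau t powr (1 / 2)) \<longlongrightarrow> sqrt 0 + 0 powr (1 / 2)) at_top"
    by (intro tendsto_add tendsto_real_sqrt lim1 tendsto_powr' tau_tendsto tendsto_const) (use tau_def in auto)
  then have "((\<lambda>t. a * (- gam) * c0 - K * (sqrt (t powr (- be)) + tau t powr (1 / 2))) \<longlongrightarrow> a * (- gam) * c0 - K * 0) at_top"
    by (intro tendsto_intros) simp
  moreover have ag: "a * (- gam) * c0 > 0" using a_pos gam_neg c0 by (intro mult_pos_pos) auto
  ultimately have "\<forall>\<^sub>F t in at_top. a * (- gam) * c0 - K * (sqrt (t powr (- be)) + tau t powr (1 / 2)) > 0"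
    by (intro order_tendstoD(1)) auto
  moreover have "\<forall>\<^sub>F t in at_top. t powr (- be) < min u1 (z2\<^sup>2)" using lim1 by (rule order_tendstoD) (use CL dom in auto)
  moreover have "\<forall>\<^sub>F t in at_top. tau t < 1" using tau_tendsto by (rule order_tendstoD) simp
  ultimately have "\<forall>\<^sub>F t in at_top. a * (- gam) * c0 - K * (sqrt (t powr (- be)) + tau t powr (1 / 2)) > 0
     \<and> t powr (- be) < u1 \<and> t powr (- be) < z2\<^sup>2 \<and> tau t < 1"
    by eventually_elim auto
  then obtain T2 where T2: "\<And>t. t \<ge> T2 \<Longrightarrow> a * (- gam) * c0 - K * (sqrt (t powr (- be)) + tau t powr (1 / 2)) > 0
     \<and> t powr (- be) < u1 \<and> t powr (- be) < z2\<^sup>2 \<and> tau t < 1"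
    by (auto simp: eventually_at_top_linorder)
  show ?thesis
  proof (rule that[of sgm B P "max T1 T2"])
    fix t x y assume tT: "t \<ge> max T1 T2" and dx: "(x has_real_derivative HY (x t) (y t) t) (at t)"
      and dy: "(y has_real_derivative - HX (x t) (y t) t + F (x t) (y t) t) (at t)" and win: "window x y t"
    have t: "t > 0" "t \<ge> T1" "t \<ge> T2" using tT C(2) by auto
    define e where "e = action_curve x y t"
    define b where "b = t powr (- be)"
    have b: "b > 0" "b * t powr be = 1" using t by (simp_all add: b_def powr_minus)
    have eb: "e = (e * t powr be) * b" using b(2) by (metis mult.assoc mult.commute mult.right_neutral)
    have w: "e * t powr be \<in> {1 / 16..1 / 2}" using win by (simp add: window_def e_def)
    have e: "b / 16 \<le> e" "e \<le> b / 2"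
      using mult_right_mono[of "1 / 16" "e * t powr be" b] mult_right_mono[of "e * t powr be" "1 / 2" b] w b eb by auto
    have "rate_at C t x y"
      using C(3)[OF t(2) dx dy] win e T2[OF t(3)] b by (auto simp: window_def e_def b_def)
    then obtain Vl Pl dV dP where R:
      "\<forall>\<^sub>F u in nhds t. V_traj x y u = Vl u \<and> (\<exists>k::int. Psi_traj x y u = Pl u + of_int k * (2 * pi))"
      "(Vl has_real_derivative dV) (at t)" "(Pl has_real_derivative dP) (at t)"
      "e / 2 \<le> Vl t" "Vl t \<le> 2 * e" "Vl t \<in> {0..D0}"
      "\<bar>dV - (\<Sum>j=n..n + d. tau t ^ j * Lam j (Vl t) (Pl t))\<bar> \<le> C * tau t ^ (n + d + 1) * e"
      "\<bar>dP - tau t ^ m * Om m (Vl t) (Pl t)\<bar> \<le> C * tau t ^ (m + 1)"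
      unfolding rate_at_def e_def by blast
    define V \<psi> h where "V = Vl t" and "\<psi> = Pl t" and "h = tau t"
    have V: "b / 32 \<le> V" "V \<le> b" "V > 0" using R(4,5) e b by (auto simp: V_def)
    have h: "h > 0" "h < 1" using tau_pos[OF t(1)] T2[OF t(3)] by (auto simp: h_def)
    have Vu: "V \<in> {0<..u1}" using V T2[OF t(3)] by (auto simp: b_def)
    have VR: "V \<in> {0..R}" using R(6) D0R by (auto simp: V_def)
    define A where "A = h powr dd * V powr (- a)"
    have AM: "A \<le> M"
    proof -
      have "V powr (- a) \<le> (b / 32) powr (- a)" using V b a_pos by (intro powr_mono2') auto
      also have "\<dots> = M / (b powr a)" unfolding M_def powr_minus_divide using b by (simp add: powr_divide)
      also have "b powr a = h powr dd" unfolding b_def h_def by (rule be_tau[OF t(1)])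
      finally have "V powr (- a) \<le> M / h powr dd" .
      then have "h powr dd * V powr (- a) \<le> h powr dd * (M / h powr dd)" using h by (intro mult_left_mono) auto
      then show ?thesis using h by (simp add: A_def)
    qed
    define D where "D = (- (dd / (2 * real q)) * h ^ (2 * q) * A - a * (A / V) * dV)
      + a * sgm * (- (mu / (2 * real q)) * h powr mu * h ^ (2 * q) * P \<psi> + h powr mu * (lamN n \<psi> / \<bar>om \<psi>\<bar> - gam) * dP)"
    have "C * h ^ (n + d + 1) * e \<le> C * h ^ (n + d + 1) * (2 * V)"
      using R(4) C(1) h by (intro mult_left_mono) (auto simp: V_def)
    then have dV: "\<bar>dV - (\<Sum>j=n..n + d. h ^ j * Lam j V \<psi>)\<bar> \<le> 2 * C * h ^ (n + d + 1) * V"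
      using R(7) by (simp add: h_def V_def \<psi>_def mult_ac)
    have "h powr (real n + dd) * (a * (- gam) * c0 - K * (sqrt V + h powr (1 / 2))) \<le> D"
      unfolding D_def
      by (rule lyapunov_rate[where L="\<lambda>j. Lam j V \<psi>" and lam="lamN n \<psi>" and w="om \<psi>" and OmV="Om m V \<psi>" and P="P \<psi>"
            and dd=dd and M=M and CL=CL and C=C and Cw=Cw and B=B and d=d and m=m and gam=gam,
            OF h V(3) _ dd_def d1 mnd nd(3) mu_def A_def AM CL(2) C(1) Cw(1) P(1) c0(1) CL(3)[OF Vu] CL(4)[OF Vu] CL(5)[OF Vu] dV
              _ Cw(2)[OF VR] P(4) refl P(5) sgm(2) _ c0(2) gam_neg K_def refl refl])
         (use a_pos sgm(1) R(8) in \<open>auto simp: h_def V_def \<psi>_def\<close>)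
    moreover have "h powr (real n + dd) * (a * (- gam) * c0 - K * (sqrt V + h powr (1 / 2))) > 0"
    proof (rule mult_pos_pos)
      have K0: "K \<ge> 0" unfolding K_def M_def using dd_pos a_pos CL(2) C(1) P(1) Cw(1) mu_pos
        by (intro add_nonneg_nonneg mult_nonneg_nonneg) auto
      have "K * (sqrt V + h powr (1 / 2)) \<le> K * (sqrt (t powr (- be)) + tau t powr (1 / 2))"
        using V(2) K0 by (intro mult_left_mono) (auto simp: b_def h_def)
      then show "a * (- gam) * c0 - K * (sqrt V + h powr (1 / 2)) > 0" using T2[OF t(3)] by linarith
    qed (use h in simp)
    ultimately have D0: "D > 0" by linarith
    have d1: "((\<lambda>u. tau u powr dd * Vl u powr (- a)) has_real_derivative
        - (dd / (2 * real q)) * h ^ (2 * q) * A - a * (A / V) * dV) (at t)"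
    proof -
      have "((\<lambda>u. Vl u powr (- a)) has_real_derivative (- a) * V powr (- a - 1) * dV) (at t)"
        unfolding V_def by (rule DERIV_chain2[OF has_real_derivative_powr R(2)]) (use V in \<open>simp add: V_def\<close>)
      from DERIV_mult[OF tau_powr_deriv[OF t(1), of dd] this]
      show ?thesis
        by (rule DERIV_cong) (use V in \<open>simp add: A_def V_def[symmetric] h_def powr_diff mult_ac\<close>)
    qed
    have d2: "((\<lambda>u. a * sgm * (tau u powr mu * P (Pl u))) has_real_derivative
        a * sgm * (- (mu / (2 * real q)) * h powr mu * h ^ (2 * q) * P \<psi> + h powr mu * (lamN n \<psi> / \<bar>om \<psi>\<bar> - gam) * dP)) (at t)"
      unfolding \<psi>_def
      by (rule DERIV_cmult, rule DERIV_cong[OF DERIV_mult[OF tau_powr_deriv[OF t(1), of mu] DERIV_chain2[OF P(2) R(3)]]])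
         (simp add: h_def mult_ac)
    have dL: "((\<lambda>u. tau u powr dd * Vl u powr (- a) + a * sgm * (tau u powr mu * P (Pl u))) has_real_derivative D) (at t)"
      unfolding D_def by (rule DERIV_add[OF d1 d2])
    \<comment> \<open>\<open>P\<close> has period 2\<pi>, so the unknown multiples of 2\<pi> in
      \<open>Psi_traj\<close> do not matter.\<close>
    have "\<forall>\<^sub>F u in nhds t. tau u powr dd * Vl u powr (- a) + a * sgm * (tau u powr mu * P (Pl u)) = lyap P sgm x y u"
      using R(1) by eventually_elim (auto simp: lyap_def P(3))
    from iffD1[OF DERIV_cong_ev[OF refl this refl] dL]
    have "(lyap P sgm x y has_real_derivative D) (at t)" .
    moreover have "V_traj x y t = Vl t" using eventually_nhds_x_imp_x[OF R(1)] by blast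
    ultimately show "(\<exists>D>0. (lyap P sgm x y has_real_derivative D) (at t)) \<and>
       action_curve x y t / 2 \<le> V_traj x y t \<and> V_traj x y t \<le> 2 * action_curve x y t"
      using D0 R(4,5) by (auto simp: e_def)
  qed (use sgm P C in auto)
qed

end

section \<open>Stability\<close>

lemma smooth_near_lipschitz:
  fixes G :: "'a::euclidean_space \<Rightarrow> real"
  assumes sm: "smooth_near A G" and A: "compact A" "convex A"
  obtains L where "L \<ge> 0" "\<And>p q. p \<in> A \<Longrightarrow> q \<in> A \<Longrightarrow> \<bar>G p - G q\<bar> \<le> L * norm (p - q)"
proof -
  have "\<exists>B. \<forall>p\<in>A. \<bar>iter_dderiv G [b] p\<bar> \<le> B" if "b \<in> Basis" for b
    using smooth_near_bounded[OF smooth_near_iter_dderiv[OF sm, of "[b]"] A(1)] that by (metis set_ConsD empty_iff empty_set list.set(1) subsetI)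
  then obtain B where B: "\<And>b p. b \<in> Basis \<Longrightarrow> p \<in> A \<Longrightarrow> \<bar>iter_dderiv G [b] p\<bar> \<le> B b" by metis
  define L where "L = (\<Sum>b\<in>Basis. \<bar>B b\<bar>)"
  show ?thesis
  proof (rule that[of L])
    fix p q assume pq: "p \<in> A" "q \<in> A"
    have "norm (G p - G q) \<le> L * norm (p - q)"
    proof (rule differentiable_bound[OF A(2) has_derivative_at_withinI[OF smooth_near_has_derivative[OF sm]] onorm_le _ _])
      fix x h assume x: "x \<in> A"
      have "norm (\<Sum>b\<in>Basis. (h \<bullet> b) * iter_dderiv G [b] x) \<le> (\<Sum>b\<in>Basis. \<bar>B b\<bar> * norm h)"
      proof (rule sum_norm_le)
        fix b :: 'a assume b: "b \<in> Basis"
        have "\<bar>iter_dderiv G [b] x\<bar> \<le> \<bar>B b\<bar>" using B[OF b x] by linarith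
        moreover have "\<bar>h \<bullet> b\<bar> \<le> norm h" by (rule Basis_le_norm[OF b])
        ultimately show "norm ((h \<bullet> b) * iter_dderiv G [b] x) \<le> \<bar>B b\<bar> * norm h"
          unfolding real_norm_def abs_mult by (subst mult.commute) (intro mult_mono, auto)
      qed
      then show "norm (\<Sum>b\<in>Basis. (h \<bullet> b) * iter_dderiv G [b] x) \<le> L * norm h"
        by (simp add: L_def sum_distrib_right del: iter_dderiv.simps)
    qed (use pq in auto)
    then show "\<bar>G p - G q\<bar> \<le> L * norm (p - q)" by simp
  qed (auto simp: L_def intro: sum_nonneg)
qed

lemma first_hit:
  fixes g :: "real \<Rightarrow> real"
  assumes c: "continuous_on {p..q} g" and pq: "p \<le> q" "g p < c" "c \<le> g q"
  obtains t where "t \<in> {p<..q}" "g t = c" "\<And>u. u \<in> {p..<t} \<Longrightarrow> g u < c"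
proof -
  let ?A = "{u \<in> {p..q}. c \<le> g u}"
  have "closed ?A" by (intro continuous_on_closed_Collect_le c continuous_intros closed_atLeastAtMost)
  moreover have "bounded ?A" by (rule bounded_subset[OF bounded_closed_interval]) auto
  ultimately have "compact ?A" by (simp add: compact_eq_bounded_closed)
  moreover have "?A \<noteq> {}" using pq by auto
  ultimately obtain t where t: "t \<in> ?A" "\<And>u. u \<in> ?A \<Longrightarrow> t \<le> u" using compact_attains_inf[of ?A] by blast
  have lt: "g u < c" if "u \<in> {p..<t}" for u using t(2)[of u] t(1) that by force
  have "\<exists>u\<ge>p. u \<le> t \<and> g u = c"
    by (rule IVT'[OF _ _ _ continuous_on_subset[OF c]]) (use t pq in auto)
  then obtain u where u: "p \<le> u" "u \<le> t" "g u = c" by blast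
  then have "u = t" using lt[of u] by force
  then show ?thesis using that[of t] t(1) lt u pq(2) by force
qed

text \<open>The first passage through \<beta> and the last passage through \<alpha> before it; the
  latter is a first passage of the time-reversed function \<open>- w (s - u)\<close>.\<close>

lemma crossing:
  fixes w :: "real \<Rightarrow> real"
  assumes c: "continuous_on {p..q} w" and w: "w p < \<alpha>" "\<alpha> < \<beta>" "\<beta> < w q" and pq: "p \<le> q"
  obtains r s where "p < r" "r < s" "s < q" "w r = \<alpha>" "w s = \<beta>" "\<And>t. t \<in> {r..s} \<Longrightarrow> w t \<in> {\<alpha>..\<beta>}"
proof -
  obtain s where s: "s \<in> {p<..q}" "w s = \<beta>" "\<And>u. u \<in> {p..<s} \<Longrightarrow> w u < \<beta>"
    by (rule first_hit[OF c, of \<beta>]) (use w pq in auto)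
  have "continuous_on {0..s - p} (\<lambda>u. - w (s - u))"
    by (rule continuous_on_minus, rule continuous_on_compose2[OF c]) (use s in \<open>auto intro!: continuous_intros\<close>)
  then obtain k where k: "k \<in> {0<..s - p}" "- w (s - k) = - \<alpha>" "\<And>u. u \<in> {0..<k} \<Longrightarrow> - w (s - u) < - \<alpha>"
    by (rule first_hit[of 0 "s - p" _ "- \<alpha>"]) (use s w in auto)
  have "s - k \<noteq> p" using k w by auto
  moreover have "s \<noteq> q" using s w by auto
  moreover have "w t \<in> {\<alpha>..\<beta>}" if "t \<in> {s - k..s}" for t
  proof -
    have "t \<noteq> s - k \<Longrightarrow> - w (s - (s - t)) < - \<alpha>" using that by (intro k(3)) auto
    moreover have "t \<noteq> s \<Longrightarrow> w t < \<beta>" using that k by (intro s(3)) auto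
    ultimately show ?thesis using k(2) s(2) w by (cases "t = s"; cases "t = s - k") auto
  qed
  ultimately show ?thesis using that[of "s - k" s] s k by auto
qed

lemma (in center) energy_bounds:
  obtains \<rho> where "0 < \<rho>" "\<rho> < r0"
    "\<And>x y. x\<^sup>2 + y\<^sup>2 \<le> \<rho>\<^sup>2 \<Longrightarrow> (x\<^sup>2 + y\<^sup>2) / 4 \<le> H0p (x, y) \<and> H0p (x, y) \<le> x\<^sup>2 + y\<^sup>2"
proof -
  have "(\<lambda>(x, y). H0 x y - (x\<^sup>2 + y\<^sup>2) / 2) \<in> O[nhds (0, 0)](\<lambda>(x, y). sqrt (x\<^sup>2 + y\<^sup>2) ^ 3)"
    using lc by (simp add: limiting_center_def)
  then obtain c where c: "c > 0" "\<forall>\<^sub>F p in nhds (0, 0). norm ((\<lambda>(x, y). H0 x y - (x\<^sup>2 + y\<^sup>2) / 2) p) \<le> c * norm ((\<lambda>(x, y). sqrt (x\<^sup>2 + y\<^sup>2) ^ 3) p)"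
    by (rule landau_o.bigE) blast
  then obtain e where e: "e > 0" "\<And>p. dist p (0, 0) < e \<Longrightarrow> norm ((\<lambda>(x, y). H0 x y - (x\<^sup>2 + y\<^sup>2) / 2) p) \<le> c * norm ((\<lambda>(x, y). sqrt (x\<^sup>2 + y\<^sup>2) ^ 3) p)"
    unfolding eventually_nhds_metric by blast
  \<comment> \<open>For \<open>r \<le> 1 / (4 * c)\<close> the cubic error is at most
    \<open>r\<^sup>2 / 4\<close>, which leaves \<open>H0\<close> between
    \<open>r\<^sup>2 / 4\<close> and \<open>3 * r\<^sup>2 / 4\<close>.\<close>
  define \<rho> where "\<rho> = min (min (e / 2) (r0 / 2)) (1 / (4 * c))"
  have \<rho>: "0 < \<rho>" "\<rho> < r0" "\<rho> < e" "c * \<rho> \<le> 1 / 4"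
  proof -
    show "0 < \<rho>" using e(1) r0 c(1) by (simp add: \<rho>_def)
    have "\<rho> \<le> e / 2" "\<rho> \<le> r0 / 2" "\<rho> \<le> 1 / (4 * c)" by (simp_all add: \<rho>_def)
    then show "\<rho> < r0" "\<rho> < e" "c * \<rho> \<le> 1 / 4" using e(1) r0 c(1) by (auto simp: pos_le_divide_eq mult.commute)
  qed
  show ?thesis
  proof (rule that[OF \<rho>(1,2)])
    fix x y :: real assume xy: "x\<^sup>2 + y\<^sup>2 \<le> \<rho>\<^sup>2"
    define r where "r = sqrt (x\<^sup>2 + y\<^sup>2)"
    have r: "0 \<le> r" "r \<le> \<rho>" "r\<^sup>2 = x\<^sup>2 + y\<^sup>2" using xy \<rho>(1) by (auto simp: r_def intro: real_le_lsqrt)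
    have "dist (x, y) (0, 0) < e" using r \<rho>(3) by (simp add: dist_norm norm_pair_eq r_def)
    from e(2)[OF this] have "\<bar>H0p (x, y) - r\<^sup>2 / 2\<bar> \<le> c * r ^ 3"
      by (simp add: H0p_def r_def)
    also have "c * r ^ 3 = (c * r) * r\<^sup>2" by (simp add: power2_eq_square power3_eq_cube)
    also have "\<dots> \<le> (c * \<rho>) * r\<^sup>2" using r c(1) by (intro mult_right_mono mult_left_mono) auto
    also have "\<dots> \<le> 1 / 4 * r\<^sup>2" using \<rho>(4) by (intro mult_right_mono) auto
    finally show "(x\<^sup>2 + y\<^sup>2) / 4 \<le> H0p (x, y) \<and> H0p (x, y) \<le> x\<^sup>2 + y\<^sup>2"
      using zero_le_power2[of r] unfolding r(3)[symmetric] by (intro conjI; linarith)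
  qed
qed

section \<open>Trapping, continuous dependence and existence\<close>

context leading
begin

definition "decay = be + real l / real q"

lemma decay_pos: "decay > 0" using be_pos by (simp add: decay_def add_pos_nonneg)

lemma action_decay: "t > 0 \<Longrightarrow> action_curve x y t * t powr be = H0p (x t, y t) * t powr decay"
  by (simp add: action_curve_def decay_def powr_add mult_ac)

lemma energy_continuous:
  assumes "continuous_on A x" "continuous_on A y" "\<And>t. t \<in> A \<Longrightarrow> (x t)\<^sup>2 + (y t)\<^sup>2 \<le> r0\<^sup>2" "A \<subseteq> {0<..}"
  shows "continuous_on A (\<lambda>t. H0p (x t, y t) * t powr decay)"
proof -
  have "smooth_near (disc r0) H0p" using lc by (simp add: H0p_def limiting_center_def)
  then have "continuous_on A (\<lambda>t. H0p (x t, y t))"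
    by (rule continuous_on_compose2[OF smooth_near_continuous_on]) (use assms in \<open>auto simp: disc_def intro!: continuous_intros\<close>)
  then show ?thesis using assms(4) by (intro continuous_intros) auto
qed

text \<open>A barrier argument: a passage of the rescaled energy from 1 / 16 up to 1 / 2 takes place
  inside the window, so the Lyapunov function increases during it, while its values at the two ends
  force it to decrease.\<close>

lemma trap:
  obtains T where "T \<ge> 1"
    "\<And>p t2 x y. T \<le> p \<Longrightarrow> p \<le> t2 \<Longrightarrow> continuous_on {p..t2} x \<Longrightarrow> continuous_on {p..t2} y \<Longrightarrow>
      (\<And>t. t \<in> {p<..<t2} \<Longrightarrow> (x has_real_derivative HY (x t) (y t) t) (at t) \<and>
         (y has_real_derivative - HX (x t) (y t) t + F (x t) (y t) t) (at t)) \<Longrightarrow>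
      (\<And>t. t \<in> {p..t2} \<Longrightarrow> (x t)\<^sup>2 + (y t)\<^sup>2 < r0\<^sup>2) \<Longrightarrow>
      H0p (x p, y p) * p powr decay < 1 / 16 \<Longrightarrow> H0p (x t2, y t2) * t2 powr decay \<le> 1 / 2"
proof -
  obtain P sgm B T0 where L: "\<bar>sgm\<bar> = 1" "B > 0" "\<And>\<psi>. \<bar>P \<psi>\<bar> \<le> B" "T0 \<ge> 1"
    "\<And>t x y. t \<ge> T0 \<Longrightarrow> (x has_real_derivative HY (x t) (y t) t) (at t) \<Longrightarrow>
       (y has_real_derivative - HX (x t) (y t) t + F (x t) (y t) t) (at t) \<Longrightarrow> window x y t \<Longrightarrow>
       (\<exists>D>0. (lyap P sgm x y has_real_derivative D) (at t)) \<and>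
       action_curve x y t / 2 \<le> V_traj x y t \<and> V_traj x y t \<le> 2 * action_curve x y t"
    by (rule lyapunov_increasing) blast
  \<comment> \<open>Half of this gap is allowed to the corrector at each end of the passage.\<close>
  have gap: "(8::real) powr a - 4 powr a > 0" using a_pos by (simp add: powr_less_mono2)
  have "((\<lambda>t. a * B * tau t powr mu) \<longlongrightarrow> a * B * 0 powr mu) at_top"
    by (intro tendsto_mult tendsto_const tendsto_powr' tau_tendsto) (use mu_pos in \<open>auto simp: tau_def\<close>)
  then have "((\<lambda>t. a * B * tau t powr mu) \<longlongrightarrow> 0) at_top" using mu_pos by simp
  then have "\<forall>\<^sub>F t in at_top. a * B * tau t powr mu < (8 powr a - 4 powr a) / 2"
    by (rule order_tendstoD(2)) (use gap in simp)
  then obtain T1 where T1: "\<And>t. t \<ge> T1 \<Longrightarrow> a * B * tau t powr mu < (8 powr a - 4 powr a) / 2"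
    by (auto simp: eventually_at_top_linorder)
  show ?thesis
  proof (rule that[of "max T0 T1"])
    fix p t2 x y
    assume T: "max T0 T1 \<le> p" "p \<le> t2" and c: "continuous_on {p..t2} x" "continuous_on {p..t2} y"
      and ode: "\<And>t. t \<in> {p<..<t2} \<Longrightarrow> (x has_real_derivative HY (x t) (y t) t) (at t) \<and>
         (y has_real_derivative - HX (x t) (y t) t + F (x t) (y t) t) (at t)"
      and dsc: "\<And>t. t \<in> {p..t2} \<Longrightarrow> (x t)\<^sup>2 + (y t)\<^sup>2 < r0\<^sup>2"
      and start: "H0p (x p, y p) * p powr decay < 1 / 16"
    define w where "w t = H0p (x t, y t) * t powr decay" for t
    have cw: "continuous_on {p..t2} w"
      unfolding w_def using T L(4) dsc by (intro energy_continuous c) (auto intro: less_imp_le)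
    show "H0p (x t2, y t2) * t2 powr decay \<le> 1 / 2"
    proof (rule ccontr)
      assume "\<not> ?thesis"
      then obtain r s where rs: "p < r" "r < s" "s < t2" "w r = 1 / 16" "w s = 1 / 2" "\<And>t. t \<in> {r..s} \<Longrightarrow> w t \<in> {1 / 16..1 / 2}"
        using crossing[OF cw, of "1 / 16" "1 / 2"] start T(2) by (auto simp: w_def)
      have tp: "t > 0" "t \<ge> T0" "t \<ge> T1" if "t \<in> {r..s}" for t using that T L(4) rs(1) by auto
      have wa: "action_curve x y t * t powr be = w t" if "t \<in> {r..s}" for t
        using action_decay[OF tp(1)[OF that]] by (simp add: w_def)
      have win: "window x y t" if t: "t \<in> {r..s}" for t
        unfolding window_def wa[OF t]
      proof (intro conjI rs(6)[OF t])
        show "(x t)\<^sup>2 + (y t)\<^sup>2 < r0\<^sup>2" using t rs by (intro dsc) auto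
        have "w t > 0" using rs(6)[OF t] by auto
        then show "H0p (x t, y t) > 0" using tp(1)[OF t] by (simp add: w_def zero_less_mult_iff)
      qed
      have step: "(\<exists>D>0. (lyap P sgm x y has_real_derivative D) (at t)) \<and>
         action_curve x y t / 2 \<le> V_traj x y t \<and> V_traj x y t \<le> 2 * action_curve x y t" if t: "t \<in> {r..s}" for t
      proof -
        have "t \<in> {p<..<t2}" using t rs by auto
        then show ?thesis using ode[of t] L(5)[OF tp(2)[OF t] _ _ win[OF t]] by blast
      qed
      have incr: "lyap P sgm x y r < lyap P sgm x y s"
      proof (rule DERIV_pos_imp_increasing[OF rs(2)])
        fix t assume "r \<le> t" "t \<le> s"
        then show "\<exists>D. (lyap P sgm x y has_real_derivative D) (at t) \<and> 0 < D" using step[of t] by auto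
      qed
      have corr: "\<bar>a * sgm * (tau t powr mu * P \<psi>)\<bar> < (8 powr a - 4 powr a) / 2" if "t \<in> {r..s}" for t \<psi>
      proof -
        have "\<bar>a * sgm * (tau t powr mu * P \<psi>)\<bar> = a * (tau t powr mu * \<bar>P \<psi>\<bar>)"
          using a_pos L(1) by (simp add: abs_mult)
        also have "\<dots> \<le> a * (tau t powr mu * B)" using a_pos L(3) by (intro mult_left_mono) auto
        also have "\<dots> < (8 powr a - 4 powr a) / 2" using T1[OF tp(3)[OF that]] by (simp add: mult_ac)
        finally show ?thesis .
      qed
      \<comment> \<open>On the scale \<open>V = c * t powr (- be)\<close> the time dependence of the
        main term cancels.\<close>
      have main: "tau t powr dd * (c * t powr (- be)) powr (- a) = c powr (- a)" if "t \<in> {r..s}" "c > 0" for t c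
      proof -
        have "(c * t powr (- be)) powr (- a) = c powr (- a) * inverse ((t powr (- be)) powr a)"
          using that by (simp add: powr_mult powr_minus)
        then show ?thesis using be_tau[OF tp(1)[OF that(1)]] tau_pos[OF tp(1)[OF that(1)]] by simp
      qed
      have act: "action_curve x y t = w t * t powr (- be)" if "t \<in> {r..s}" for t
        using wa[OF that] tp(1)[OF that] by (simp add: powr_minus field_simps)
      have r: "r \<in> {r..s}" and s: "s \<in> {r..s}" using rs by auto
      have V: "V_traj x y r \<le> 1 / 8 * r powr (- be)" "V_traj x y r > 0" "1 / 4 * s powr (- be) \<le> V_traj x y s"
      proof -
        have "action_curve x y r = 1 / 16 * r powr (- be)" "action_curve x y s = 1 / 2 * s powr (- be)"
          using act[OF r] act[OF s] rs(4,5) by simp_all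
        moreover have "r powr (- be) > 0" using tp(1)[OF r] by simp
        moreover have "action_curve x y r / 2 \<le> V_traj x y r" "V_traj x y r \<le> 2 * action_curve x y r"
          "action_curve x y s / 2 \<le> V_traj x y s" using step[OF r] step[OF s] by blast+
        ultimately show "V_traj x y r \<le> 1 / 8 * r powr (- be)" "V_traj x y r > 0" "1 / 4 * s powr (- be) \<le> V_traj x y s"
          by linarith+
      qed
      have "8 powr a = tau r powr dd * (1 / 8 * r powr (- be)) powr (- a)"
        using main[OF r, of "1 / 8"] by (simp add: powr_minus powr_divide)
      also have "\<dots> \<le> tau r powr dd * V_traj x y r powr (- a)"
        using V a_pos by (intro mult_left_mono powr_mono2') auto
      finally have lo: "8 powr a \<le> tau r powr dd * V_traj x y r powr (- a)" .
      have "tau s powr dd * V_traj x y s powr (- a) \<le> tau s powr dd * (1 / 4 * s powr (- be)) powr (- a)"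
        using V(3) a_pos tp(1)[OF s] by (intro mult_left_mono powr_mono2') auto
      also have "\<dots> = 4 powr a" using main[OF s, of "1 / 4"] by (simp add: powr_minus powr_divide)
      finally have hi: "tau s powr dd * V_traj x y s powr (- a) \<le> 4 powr a" .
      have "\<not> p1 + c1 < p2 + c2" if "b1 \<le> p1" "p2 \<le> b2" "\<bar>c1\<bar> < (b1 - b2) / 2" "\<bar>c2\<bar> < (b1 - b2) / 2" for p1 p2 c1 c2 b1 b2 :: real
        using that by (simp add: abs_less_iff field_simps)
      from this[OF lo hi corr[OF r, of "Psi_traj x y r"] corr[OF s, of "Psi_traj x y s"]]
      show False using incr unfolding lyap_def by blast
    qed
  qed (use L in auto)
qed


definition "fld t p = (HY (fst p) (snd p) t, - HX (fst p) (snd p) t + F (fst p) (snd p) t)"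

lemma fld_smooth:
  "smooth_near (UNIV \<times> UNIV \<times> {0<..}) (\<lambda>(x, y, t). HY x y t)"
  "smooth_near (UNIV \<times> UNIV \<times> {0<..}) (\<lambda>(x, y, t). - HX x y t + F x y t)"
proof -
  have U: "smooth_near (UNIV \<times> UNIV \<times> {0<..}) (\<lambda>(x, y, t). H x y t)"
    by (rule smooth_near_on[OF HE.smG order_refl])
  have b: "(1, 0, 0) \<in> (Basis :: (real \<times> real \<times> real) set)" "(0, 1, 0) \<in> (Basis :: (real \<times> real \<times> real) set)"
    by (auto simp: Basis_prod_def zero_prod_def)
  have o: "open ((UNIV :: real set) \<times> (UNIV :: real set) \<times> {0::real<..})" by (intro open_Times) auto
  show HY: "smooth_near (UNIV \<times> UNIV \<times> {0<..}) (\<lambda>(x, y, t). HY x y t)"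
    by (rule smooth_near_cong[OF smooth_near_iter_dderiv[OF U, of "[(0, 1, 0)]"] order_refl o]) (use b HXY(2) in \<open>auto simp del: iter_dderiv.simps\<close>)
  have HX: "smooth_near (UNIV \<times> UNIV \<times> {0<..}) (\<lambda>(x, y, t). HX x y t)"
    by (rule smooth_near_cong[OF smooth_near_iter_dderiv[OF U, of "[(1, 0, 0)]"] order_refl o]) (use b HXY(1) in \<open>auto simp del: iter_dderiv.simps\<close>)
  have FF: "smooth_near (UNIV \<times> UNIV \<times> {0<..}) (\<lambda>(x, y, t). F x y t)"
    by (rule smooth_near_on[OF FE.smG order_refl])
  show "smooth_near (UNIV \<times> UNIV \<times> {0<..}) (\<lambda>(x, y, t). - HX x y t + F x y t)"
    using smooth_near_add[OF smooth_near_minus[OF HX] FF] by (simp add: case_prod_unfold)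
qed

lemma fld_continuous: "continuous_on ({0<..} \<times> UNIV) (\<lambda>(t, p). fld t p)"
  unfolding fld_def case_prod_unfold
proof (intro continuous_on_Pair)
  show "continuous_on ({0<..} \<times> UNIV) (\<lambda>q. HY (fst (snd q)) (snd (snd q)) (fst q))"
    by (rule continuous_on_compose2[OF smooth_near_continuous_on[OF fld_smooth(1)], where f="\<lambda>q. (fst (snd q), snd (snd q), fst q)", unfolded prod.case])
       (auto intro!: continuous_intros)
  show "continuous_on ({0<..} \<times> UNIV) (\<lambda>q. - HX (fst (snd q)) (snd (snd q)) (fst q) + F (fst (snd q)) (snd (snd q)) (fst q))"
    by (rule continuous_on_compose2[OF smooth_near_continuous_on[OF fld_smooth(2)], where f="\<lambda>q. (fst (snd q), snd (snd q), fst q)", unfolded prod.case])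
       (auto intro!: continuous_intros)
qed

lemma fld_zero: "t > 0 \<Longrightarrow> fld t 0 = 0"
  using equilibrium by (simp add: fld_def HX_def HY_def zero_prod_def)

text \<open>The ball is enclosed in a box; together with the time interval it is compact and convex,
  which gives one constant for all times up to \<open>T\<close>.\<close>

lemma fld_lipschitz:
  assumes "t1 > 0"
  shows "\<exists>L\<ge>0. \<forall>t\<in>{t1..T}. \<forall>p\<in>cball 0 \<rho>. \<forall>p'\<in>cball 0 \<rho>. norm (fld t p - fld t p') \<le> L * norm (p - p')"
proof -
  let ?A = "{- \<rho>..\<rho>} \<times> {- \<rho>..\<rho>} \<times> {t1..T}"
  have A: "compact ?A" "convex ?A" by (auto intro!: compact_Times convex_Times)
  have sub: "?A \<subseteq> UNIV \<times> UNIV \<times> {0<..}" using assms by auto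
  obtain L1 where L1: "L1 \<ge> 0" "\<And>p q. p \<in> ?A \<Longrightarrow> q \<in> ?A \<Longrightarrow> \<bar>(\<lambda>(x, y, t). HY x y t) p - (\<lambda>(x, y, t). HY x y t) q\<bar> \<le> L1 * norm (p - q)"
    by (rule smooth_near_lipschitz[OF smooth_near_subset[OF fld_smooth(1) sub] A]) blast
  obtain L2 where L2: "L2 \<ge> 0" "\<And>p q. p \<in> ?A \<Longrightarrow> q \<in> ?A \<Longrightarrow>
      \<bar>(\<lambda>(x, y, t). - HX x y t + F x y t) p - (\<lambda>(x, y, t). - HX x y t + F x y t) q\<bar> \<le> L2 * norm (p - q)"
    by (rule smooth_near_lipschitz[OF smooth_near_subset[OF fld_smooth(2) sub] A]) blast
  show ?thesis
  proof (intro exI[of _ "L1 + L2"] conjI ballI)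
    fix t and p p' :: "real \<times> real" assume t: "t \<in> {t1..T}" and p: "p \<in> cball 0 \<rho>" "p' \<in> cball 0 \<rho>"
    have mem: "(fst p, snd p, t) \<in> ?A" if "p \<in> cball 0 \<rho>" for p :: "real \<times> real"
      using abs_le_norm_pair(1)[of "fst p" "snd p"] abs_le_norm_pair(2)[of "snd p" "fst p"] that t by (auto simp: abs_le_iff)
    have nrm: "norm ((fst p, snd p, t) - (fst p', snd p', t)) = norm (p - p')" by (simp add: norm_Pair norm_prod_def)
    have "norm (fld t p - fld t p') \<le> \<bar>fst (fld t p - fld t p')\<bar> + \<bar>snd (fld t p - fld t p')\<bar>"
      by (metis norm_Pair_le prod.collapse real_norm_def)
    also have "\<dots> \<le> L1 * norm (p - p') + L2 * norm (p - p')"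
      using L1(2)[OF mem[OF p(1)] mem[OF p(2)]] L2(2)[OF mem[OF p(1)] mem[OF p(2)]] unfolding nrm
      by (intro add_mono) (simp_all add: fld_def)
    finally show "norm (fld t p - fld t p') \<le> (L1 + L2) * norm (p - p')" by (simp add: distrib_right)
  qed (use L1 L2 in auto)
qed

text \<open>Solutions of the system truncated outside the ball of radius \<open>\<rho>\<close> satisfy this condition as well,
  so that the estimates below also give the existence of global solutions.\<close>

definition "solves_in \<rho> t1 u \<longleftrightarrow> continuous_on {t1..} u \<and>
  (\<forall>t\<ge>t1. norm (u t) \<le> \<rho> \<longrightarrow> (u has_vector_derivative fld t (u t)) (at t within {t1..}))"

lemma solves_in_at:
  assumes "solves_in \<rho> t1 u" "t > t1" "norm (u t) \<le> \<rho>"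
  shows "(u has_vector_derivative fld t (u t)) (at t)"
proof -
  have "(u has_vector_derivative fld t (u t)) (at t within {t1..})" using assms by (simp add: solves_in_def)
  moreover have "at t within {t1..} = at t" using assms(2) by (intro at_within_interior) simp
  ultimately show ?thesis by simp
qed

text \<open>Gronwall's argument: the field vanishes at the origin, so it grows at most linearly, and
  the squared norm times \<open>exp (- 2 * L * (v - t1))\<close> does not increase while the
  solution stays in the ball. At a first exit from the radius \<open>k\<close> this would contradict
  the choice of \<delta>.\<close>

lemma short_time:
  assumes t: "0 < t1" "t1 \<le> T" and k: "0 < k" "k \<le> \<rho>"
  obtains \<delta> where "\<delta> > 0" "\<And>u t. solves_in \<rho> t1 u \<Longrightarrow> norm (u t1) < \<delta> \<Longrightarrow> t \<in> {t1..T} \<Longrightarrow> norm (u t) < k"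
proof -
  obtain L where L: "L \<ge> 0" "\<And>t p p'. t \<in> {t1..T} \<Longrightarrow> p \<in> cball 0 \<rho> \<Longrightarrow> p' \<in> cball 0 \<rho> \<Longrightarrow> norm (fld t p - fld t p') \<le> L * norm (p - p')"
    using fld_lipschitz[OF t(1), of T \<rho>] by blast
  have grow: "norm (fld t p) \<le> L * norm p" if "t \<in> {t1..T}" "norm p \<le> \<rho>" for t p
    using L(2)[of t p 0] that fld_zero[of t] t k by simp
  define \<delta> where "\<delta> = k * exp (- L * (T - t1))"
  have \<delta>: "\<delta> > 0" "\<delta> \<le> k" using k L(1) t by (auto simp: \<delta>_def mult_le_cancel_left1)
  show ?thesis
  proof (rule that[OF \<delta>(1)])
    fix u t assume u: "solves_in \<rho> t1 u" "norm (u t1) < \<delta>" and tt: "t \<in> {t1..T}"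
    have cu: "continuous_on {t1..t} u" using u(1) by (auto simp: solves_in_def intro: continuous_on_subset)
    show "norm (u t) < k"
    proof (rule ccontr)
      assume "\<not> norm (u t) < k"
      then obtain r where r: "r \<in> {t1<..t}" "norm (u r) = k" "\<And>v. v \<in> {t1..<r} \<Longrightarrow> norm (u v) < k"
        using first_hit[of t1 t "\<lambda>v. norm (u v)" k] tt u(2) \<delta>(2) continuous_on_norm[OF cu] by auto
      let ?g = "\<lambda>v. (u v \<bullet> u v) * exp (- 2 * L * (v - t1))"
      have "?g r \<le> ?g t1"
      proof (rule DERIV_nonpos_imp_decreasing_open[where f="?g"])
        show "t1 \<le> r" using r by simp
        show "continuous_on {t1..r} ?g"
          by (intro continuous_intros continuous_on_subset[OF cu]) (use r in auto)
        fix v assume v: "t1 < v" "v < r"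
        have nv: "norm (u v) \<le> \<rho>" "v \<in> {t1..T}" using r(3)[of v] v k r(1) tt by auto
        have "((\<lambda>v. u v \<bullet> u v) has_real_derivative 2 * (u v \<bullet> fld v (u v))) (at v)"
        proof -
          have "((\<lambda>v. u v \<bullet> u v) has_derivative (\<lambda>h. u v \<bullet> (h *\<^sub>R fld v (u v)) + (h *\<^sub>R fld v (u v)) \<bullet> u v)) (at v)"
            using has_derivative_inner[of u "\<lambda>h. h *\<^sub>R fld v (u v)" v UNIV u "\<lambda>h. h *\<^sub>R fld v (u v)"]
              solves_in_at[OF u(1) v(1) nv(1)] by (simp add: has_vector_derivative_def)
          then show ?thesis
            unfolding has_field_derivative_def by (rule has_derivative_eq_rhs) (auto simp: fun_eq_iff inner_commute)
        qed
        then have "(?g has_real_derivative 2 * (u v \<bullet> fld v (u v)) * exp (- 2 * L * (v - t1))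
           + exp (- 2 * L * (v - t1)) * (- 2 * L) * (u v \<bullet> u v)) (at v)"
          by (rule DERIV_mult) (auto intro!: derivative_eq_intros)
        moreover have "u v \<bullet> fld v (u v) \<le> L * (u v \<bullet> u v)"
        proof -
          have "u v \<bullet> fld v (u v) \<le> norm (u v) * norm (fld v (u v))" by (rule norm_cauchy_schwarz)
          also have "\<dots> \<le> norm (u v) * (L * norm (u v))" by (intro mult_left_mono grow nv) auto
          finally show ?thesis by (simp add: dot_square_norm power2_eq_square mult_ac)
        qed
        then have "2 * (u v \<bullet> fld v (u v)) * exp (- 2 * L * (v - t1))
           + exp (- 2 * L * (v - t1)) * (- 2 * L) * (u v \<bullet> u v) \<le> 0"
          using mult_right_mono[of "u v \<bullet> fld v (u v)" "L * (u v \<bullet> u v)" "2 * exp (- 2 * L * (v - t1))"]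
          by (simp add: mult_ac)
        ultimately show "\<exists>y. (?g has_real_derivative y) (at v) \<and> y \<le> 0" by blast
      qed
      then have "k\<^sup>2 * exp (- 2 * L * (r - t1)) \<le> (norm (u t1))\<^sup>2" using r(2) by (simp add: dot_square_norm)
      moreover have "(norm (u t1))\<^sup>2 < \<delta>\<^sup>2" using u(2) by (intro power_strict_mono) auto
      moreover have "\<delta>\<^sup>2 \<le> k\<^sup>2 * exp (- 2 * L * (r - t1))"
      proof -
        have "exp (- L * (T - t1)) ^ 2 = exp (- 2 * L * (T - t1))"
          by (simp add: power2_eq_square exp_add[symmetric] algebra_simps)
        moreover have "- 2 * L * (T - t1) \<le> - 2 * L * (r - t1)" using L(1) r(1) tt by (simp add: mult_left_mono)
        ultimately show ?thesis unfolding \<delta>_def power_mult_distrib by (simp add: mult_left_mono)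
      qed
      ultimately show False by linarith
    qed
  qed
qed

text \<open>Continuous dependence carries small data to a late time \<open>p\<close>, where
  \<open>trap\<close> takes over. That the solution stays in the disc meanwhile is shown by a
  bootstrap: the squared norm times \<open>t powr decay\<close> would have to reach 4 for a first
  time, whereas the energy bound \<open>1 / 2\<close> allows at most 2.\<close>

lemma confinement:
  obtains \<rho> where "\<rho> > 0" "\<And>t1 \<epsilon>. t1 > 0 \<Longrightarrow> \<epsilon> > 0 \<Longrightarrow> \<exists>\<delta>>0. \<exists>T. \<forall>u. solves_in \<rho> t1 u \<and> norm (u t1) < \<delta> \<longrightarrow>
     (\<forall>t\<ge>t1. norm (u t) < min \<epsilon> \<rho>) \<and> (\<forall>t\<ge>T. (norm (u t))\<^sup>2 \<le> 4 * t powr (- decay))"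
proof -
  obtain \<rho> where \<rho>: "0 < \<rho>" "\<rho> < r0"
    "\<And>x y. x\<^sup>2 + y\<^sup>2 \<le> \<rho>\<^sup>2 \<Longrightarrow> (x\<^sup>2 + y\<^sup>2) / 4 \<le> H0p (x, y) \<and> H0p (x, y) \<le> x\<^sup>2 + y\<^sup>2"
    by (rule energy_bounds) blast
  have nsq: "(fst p)\<^sup>2 + (snd p)\<^sup>2 = (norm p)\<^sup>2" for p :: "real \<times> real"
    by (simp add: norm_prod_def)
  have en: "(norm p)\<^sup>2 / 4 \<le> H0p p \<and> H0p p \<le> (norm p)\<^sup>2" if "norm p \<le> \<rho>" for p
    using \<rho>(3)[of "fst p" "snd p"] that unfolding nsq by (simp add: power_mono)
  obtain T where T: "T \<ge> 1"
    "\<And>p t2 x y. T \<le> p \<Longrightarrow> p \<le> t2 \<Longrightarrow> continuous_on {p..t2} x \<Longrightarrow> continuous_on {p..t2} y \<Longrightarrow>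
      (\<And>t. t \<in> {p<..<t2} \<Longrightarrow> (x has_real_derivative HY (x t) (y t) t) (at t) \<and>
         (y has_real_derivative - HX (x t) (y t) t + F (x t) (y t) t) (at t)) \<Longrightarrow>
      (\<And>t. t \<in> {p..t2} \<Longrightarrow> (x t)\<^sup>2 + (y t)\<^sup>2 < r0\<^sup>2) \<Longrightarrow>
      H0p (x p, y p) * p powr decay < 1 / 16 \<Longrightarrow> H0p (x t2, y t2) * t2 powr decay \<le> 1 / 2"
    by (rule trap) blast
  show ?thesis
  proof (rule that[OF \<rho>(1)])
    fix t1 \<epsilon> :: real assume t1: "t1 > 0" and \<epsilon>: "\<epsilon> > 0"
    define \<eta> where "\<eta> = min \<epsilon> \<rho>"
    have \<eta>: "\<eta> > 0" "\<eta> \<le> \<rho>" using \<epsilon> \<rho>(1) by (auto simp: \<eta>_def)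
    have "((\<lambda>t. t powr (- decay)) \<longlongrightarrow> 0) at_top"
      using tendsto_neg_powr[OF _ filterlim_ident, of "- decay"] decay_pos by simp
    then have "\<forall>\<^sub>F t in at_top. t powr (- decay) < \<eta>\<^sup>2 / 4" by (rule order_tendstoD) (use \<eta> in simp)
    then obtain T1 where T1: "\<And>t. t \<ge> T1 \<Longrightarrow> t powr (- decay) < \<eta>\<^sup>2 / 4" by (auto simp: eventually_at_top_linorder)
    define p where "p = max (max T T1) t1"
    have p: "p \<ge> T" "p \<ge> T1" "p \<ge> t1" "p > 0" using T(1) by (auto simp: p_def)
    \<comment> \<open>This radius puts the rescaled energy at time \<open>p\<close> below the entry
      threshold \<open>1 / 16\<close>, as \<open>H0\<close> is at most the squared norm.\<close>
    define k where "k = min \<eta> (sqrt (p powr (- decay) / 16))"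
    have k: "0 < k" "k \<le> \<rho>" "k \<le> \<eta>" using \<eta> p by (auto simp: k_def)
    have k2: "k\<^sup>2 \<le> p powr (- decay) / 16"
    proof -
      have "k\<^sup>2 \<le> (sqrt (p powr (- decay) / 16))\<^sup>2" using k(1) by (intro power_mono) (auto simp: k_def)
      then show ?thesis by simp
    qed
    obtain \<delta> where \<delta>: "\<delta> > 0" "\<And>u t. solves_in \<rho> t1 u \<Longrightarrow> norm (u t1) < \<delta> \<Longrightarrow> t \<in> {t1..p} \<Longrightarrow> norm (u t) < k"
      by (rule short_time[OF t1 p(3) k(1,2)]) blast
    show "\<exists>\<delta>>0. \<exists>T. \<forall>u. solves_in \<rho> t1 u \<and> norm (u t1) < \<delta> \<longrightarrow>
     (\<forall>t\<ge>t1. norm (u t) < min \<epsilon> \<rho>) \<and> (\<forall>t\<ge>T. (norm (u t))\<^sup>2 \<le> 4 * t powr (- decay))"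
    proof (rule exI[of _ \<delta>], intro conjI \<delta>(1), rule exI[of _ p], intro allI impI conjI)
      fix u assume "solves_in \<rho> t1 u \<and> norm (u t1) < \<delta>"
      then have u: "solves_in \<rho> t1 u" "norm (u t1) < \<delta>" by auto
      have up: "norm (u p) < k" using \<delta>(2)[OF u] p by auto
      have small: "norm (u t) < \<eta>" if "(norm (u t))\<^sup>2 \<le> 4 * t powr (- decay)" "t \<ge> p" for t
      proof (rule power2_less_imp_less)
        show "(norm (u t))\<^sup>2 < \<eta>\<^sup>2" using that T1[of t] p(2) by linarith
      qed (use \<eta> in simp)
      have ineq: "(norm (u t))\<^sup>2 \<le> 4 * t powr (- decay) \<longleftrightarrow> (norm (u t))\<^sup>2 * t powr decay \<le> 4" if "t \<ge> p" for t
        using that p(4) by (simp add: powr_minus field_simps)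
      have long: "(norm (u t))\<^sup>2 \<le> 4 * t powr (- decay)" if t: "t \<ge> p" for t
      proof (rule ccontr)
        assume n: "\<not> ?thesis"
        have cu: "continuous_on {p..t} u"
          using u(1) p(3) by (auto simp: solves_in_def intro: continuous_on_subset)
        have start: "H0p (u p) * p powr decay < 1 / 16"
        proof -
          have "H0p (u p) \<le> (norm (u p))\<^sup>2" using en[of "u p"] up k(2) by simp
          also have "\<dots> < k\<^sup>2" using up by (intro power_strict_mono) auto
          finally have "H0p (u p) < p powr (- decay) / 16" using k2 by linarith
          then show ?thesis using p(4) by (simp add: powr_minus field_simps)
        qed
        have ini: "(norm (u p))\<^sup>2 * p powr decay < 4"
        proof -
          have "(norm (u p))\<^sup>2 < k\<^sup>2" using up by (intro power_strict_mono) auto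
          then have "(norm (u p))\<^sup>2 < 4 * p powr (- decay)" using k2 p(4) powr_gt_zero[of p "- decay"] by linarith
          then show ?thesis using p(4) by (simp add: powr_minus field_simps)
        qed
        have cN: "continuous_on {p..t} (\<lambda>v. (norm (u v))\<^sup>2 * v powr decay)"
          using p(4) by (intro continuous_intros cu) auto
        obtain r where r: "r \<in> {p<..t}" "(norm (u r))\<^sup>2 * r powr decay = 4"
          "\<And>v. v \<in> {p..<r} \<Longrightarrow> (norm (u v))\<^sup>2 * v powr decay < 4"
          by (rule first_hit[OF cN t ini]) (use n ineq[OF t] in auto)
        have inb: "norm (u v) < \<eta>" if v: "v \<in> {p..r}" for v
        proof -
          have "(norm (u v))\<^sup>2 * v powr decay \<le> 4" using r(2) r(3)[of v] v by (cases "v = r") auto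
          then show ?thesis using small[of v] ineq[of v] v by auto
        qed
        have "H0p (fst (u r), snd (u r)) * r powr decay \<le> 1 / 2"
        proof (rule T(2)[OF p(1), of r "\<lambda>t. fst (u t)" "\<lambda>t. snd (u t)"])
          show "p \<le> r" using r by simp
          show "continuous_on {p..r} (\<lambda>t. fst (u t))" "continuous_on {p..r} (\<lambda>t. snd (u t))"
            using r by (auto intro!: continuous_intros continuous_on_subset[OF cu])
          show "H0p (fst (u p), snd (u p)) * p powr decay < 1 / 16" using start by simp
          fix v
          show "v \<in> {p..r} \<Longrightarrow> (fst (u v))\<^sup>2 + (snd (u v))\<^sup>2 < r0\<^sup>2"
            unfolding nsq using inb[of v] \<eta> \<rho> by (intro power_strict_mono) auto
          assume v: "v \<in> {p<..<r}"
          have "(u has_vector_derivative fld v (u v)) (at v)"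
            using v p(3) inb[of v] \<eta>(2) by (intro solves_in_at[OF u(1)]) auto
          from bounded_linear.has_vector_derivative[OF bounded_linear_fst this]
            bounded_linear.has_vector_derivative[OF bounded_linear_snd this]
          show "((\<lambda>t. fst (u t)) has_real_derivative HY (fst (u v)) (snd (u v)) v) (at v) \<and>
            ((\<lambda>t. snd (u t)) has_real_derivative - HX (fst (u v)) (snd (u v)) v + F (fst (u v)) (snd (u v)) v) (at v)"
            by (simp add: has_real_derivative_iff_has_vector_derivative fld_def)
        qed
        moreover have "(norm (u r))\<^sup>2 / 4 * r powr decay \<le> H0p (u r) * r powr decay"
          using en[of "u r"] inb[of r] r(1) \<eta>(2) by (intro mult_right_mono) auto
        ultimately show False using r(2) by simp
      qed
      show "(norm (u t))\<^sup>2 \<le> 4 * t powr (- decay)" if "t \<ge> p" for t using long that .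
      show "norm (u t) < min \<epsilon> \<rho>" if "t \<ge> t1" for t
      proof (cases "t \<le> p")
        case True then show ?thesis using \<delta>(2)[OF u, of t] that k(3) by (simp add: \<eta>_def)
      next
        case False then show ?thesis using small[OF long, of t] by (simp add: \<eta>_def)
      qed
    qed
  qed
qed

text \<open>The projection onto a ball is 1-Lipschitz, so the field composed with it is globally
  Lipschitz in space on bounded time intervals and has solutions for all times. Inside the ball
  nothing is changed.\<close>

lemma truncated_solution:
  assumes "t1 > 0" "\<rho> > 0"
  obtains u where "u t1 = c" "solves_in \<rho> t1 u"
proof -
  let ?B = "cball (0 :: real \<times> real) \<rho>"
  let ?c = "closest_point ?B"
  have B: "closed ?B" "convex ?B" "?B \<noteq> {}" using assms by auto
  have cB: "?c p \<in> ?B" for p by (rule closest_point_in_set[OF B(1,3)])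
  have "continuous_on ({t1..} \<times> UNIV) (\<lambda>q. (\<lambda>(t, p). fld t p) (fst q, ?c (snd q)))"
  proof (rule continuous_on_compose2[OF fld_continuous])
    have "continuous_on UNIV ?c" by (rule continuous_on_closest_point[OF B(2,1,3)])
    then show "continuous_on ({t1..} \<times> UNIV) (\<lambda>q. (fst q, ?c (snd q)))"
      by (intro continuous_on_Pair continuous_on_fst continuous_on_id continuous_on_compose2[OF _ continuous_on_snd[OF continuous_on_id], of UNIV ?c]) auto
  qed (use assms in auto)
  then have cont: "continuous_on ({t1..} \<times> UNIV) (\<lambda>(t, p). fld t (?c p))" by (simp add: case_prod_unfold)
  have lip: "\<exists>L\<ge>0. \<forall>t\<in>{t1..T}. \<forall>p q. norm (fld t (?c p) - fld t (?c q)) \<le> L * norm (p - q)" for T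
  proof -
    obtain L where L: "L \<ge> 0" "\<And>t p p'. t \<in> {t1..T} \<Longrightarrow> p \<in> ?B \<Longrightarrow> p' \<in> ?B \<Longrightarrow> norm (fld t p - fld t p') \<le> L * norm (p - p')"
      using fld_lipschitz[OF assms(1), of T \<rho>] by blast
    have "norm (fld t (?c p) - fld t (?c q)) \<le> L * norm (p - q)" if "t \<in> {t1..T}" for t p q
    proof -
      have "norm (?c p - ?c q) \<le> norm (p - q)"
        using closest_point_lipschitz[OF B(2,1,3), of p q] by (simp add: dist_norm)
      then show ?thesis using L(2)[OF that cB cB, of p q] mult_left_mono[OF _ L(1)] by (meson order_trans)
    qed
    then show ?thesis using L(1) by blast
  qed
  obtain u where u: "u t1 = c" "\<And>t. t \<ge> t1 \<Longrightarrow> (u has_vector_derivative fld t (?c (u t))) (at t within {t1..})"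
    by (rule global_solution[OF cont lip]) blast
  have "solves_in \<rho> t1 u"
    unfolding solves_in_def
  proof (intro conjI allI impI)
    show "continuous_on {t1..} u"
      using u(2) by (auto simp: continuous_on_eq_continuous_within intro: has_vector_derivative_continuous)
    fix t assume t: "t1 \<le> t" "norm (u t) \<le> \<rho>"
    then have "?c (u t) = u t" by (intro closest_point_self) simp
    then show "(u has_vector_derivative fld t (u t)) (at t within {t1..})" using u(2)[OF t(1)] by simp
  qed
  then show ?thesis using that u(1) by blast
qed

lemma solves_iff_fld:
  "solves H F {t1..} x y \<longleftrightarrow> (\<forall>t\<ge>t1. ((\<lambda>t. (x t, y t)) has_vector_derivative fld t (x t, y t)) (at t within {t1..}))"
proof -
  have "((\<lambda>t. (x t, y t)) has_vector_derivative (a, b)) (at t within {t1..}) \<longleftrightarrow>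
     (x has_real_derivative a) (at t within {t1..}) \<and> (y has_real_derivative b) (at t within {t1..})" for t a b
    unfolding has_real_derivative_iff_has_vector_derivative
    using bounded_linear.has_vector_derivative[OF bounded_linear_fst, of "\<lambda>t. (x t, y t)"]
      bounded_linear.has_vector_derivative[OF bounded_linear_snd, of "\<lambda>t. (x t, y t)"]
    by (fastforce intro: has_vector_derivative_Pair)
  then show ?thesis by (auto simp: solves_def fld_def HX_def HY_def)
qed

lemma polynomially_stable: "polynomially_stable H F"
proof -
  obtain \<rho> where \<rho>: "\<rho> > 0" and conf: "\<And>t1 \<epsilon>. t1 > 0 \<Longrightarrow> \<epsilon> > 0 \<Longrightarrow> \<exists>\<delta>>0. \<exists>T. \<forall>u. solves_in \<rho> t1 u \<and> norm (u t1) < \<delta> \<longrightarrow>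
     (\<forall>t\<ge>t1. norm (u t) < min \<epsilon> \<rho>) \<and> (\<forall>t\<ge>T. (norm (u t))\<^sup>2 \<le> 4 * t powr (- decay))"
    by (rule confinement) blast
  have nsq: "(norm (a, b))\<^sup>2 = a\<^sup>2 + b\<^sup>2" for a b :: real by (simp add: norm_pair_eq)
  have nlt: "norm (a, b) < \<delta>" if "a\<^sup>2 + b\<^sup>2 < \<delta>\<^sup>2" "\<delta> > 0" for a b \<delta> :: real
    using that by (intro power2_less_imp_less[of _ \<delta>]) (auto simp: nsq)
  have sol: "solves_in \<rho> t1 (\<lambda>t. (x t, y t))" if "solves H F {t1..} x y" for t1 x y
    using that unfolding solves_iff_fld solves_in_def
    by (auto simp: continuous_on_eq_continuous_within intro: has_vector_derivative_continuous)
  have "lyapunov_stable H F"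
    unfolding lyapunov_stable_def
  proof (intro allI impI)
    fix t1 \<epsilon> :: real assume t1: "t1 > 0" and \<epsilon>: "\<epsilon> > 0"
    from conf[OF this] obtain \<delta> where \<delta>: "\<delta> > 0"
      "\<And>u t. solves_in \<rho> t1 u \<Longrightarrow> norm (u t1) < \<delta> \<Longrightarrow> t \<ge> t1 \<Longrightarrow> norm (u t) < min \<epsilon> \<rho>" by blast
    show "\<exists>\<delta>>0. \<forall>a b. a\<^sup>2 + b\<^sup>2 < \<delta>\<^sup>2 \<longrightarrow> (\<exists>x y. solves H F {t1..} x y \<and> x t1 = a \<and> y t1 = b) \<and>
       (\<forall>x y. solves H F {t1..} x y \<and> x t1 = a \<and> y t1 = b \<longrightarrow> (\<forall>t\<ge>t1. (x t)\<^sup>2 + (y t)\<^sup>2 < \<epsilon>\<^sup>2))"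
    proof (intro exI[of _ \<delta>] conjI allI impI \<delta>(1))
      fix a b assume ab: "a\<^sup>2 + b\<^sup>2 < \<delta>\<^sup>2"
      obtain u where u: "u t1 = (a, b)" "solves_in \<rho> t1 u" by (rule truncated_solution[OF t1 \<rho>])
      \<comment> \<open>The solution of the truncated equation never leaves the ball, hence it
        solves the original system; this settles existence for all times.\<close>
      have "norm (u t) \<le> \<rho>" if "t \<ge> t1" for t
        using \<delta>(2)[OF u(2) _ that] nlt[OF ab \<delta>(1)] u(1) by simp
      then have "solves H F {t1..} (\<lambda>t. fst (u t)) (\<lambda>t. snd (u t))"
        using u(2) unfolding solves_iff_fld solves_in_def by simp
      then show "\<exists>x y. solves H F {t1..} x y \<and> x t1 = a \<and> y t1 = b" using u(1) by fastforce
    next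
      fix a b x y t assume ab: "a\<^sup>2 + b\<^sup>2 < \<delta>\<^sup>2" and xy: "solves H F {t1..} x y \<and> x t1 = a \<and> y t1 = b" and t: "t1 \<le> t"
      have "norm (x t, y t) < \<epsilon>"
        using \<delta>(2)[OF sol[of t1 x y] _ t] xy nlt[OF ab \<delta>(1)] by simp
      then have "(norm (x t, y t))\<^sup>2 < \<epsilon>\<^sup>2" by (intro power_strict_mono) auto
      then show "(x t)\<^sup>2 + (y t)\<^sup>2 < \<epsilon>\<^sup>2" by (simp add: nsq)
    qed
  qed
  moreover have "\<forall>t1>0. \<exists>\<delta>>0. \<forall>x y. solves H F {t1..} x y \<and> (x t1)\<^sup>2 + (y t1)\<^sup>2 < \<delta>\<^sup>2 \<longrightarrow>
        (\<exists>C. \<forall>\<^sub>F t in at_top. (x t)\<^sup>2 + (y t)\<^sup>2 \<le> C * t powr (- decay))"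
  proof (intro allI impI)
    fix t1 :: real assume t1: "t1 > 0"
    from conf[OF this zero_less_one] obtain \<delta> T where \<delta>: "\<delta> > 0"
      "\<And>u t. solves_in \<rho> t1 u \<Longrightarrow> norm (u t1) < \<delta> \<Longrightarrow> t \<ge> T \<Longrightarrow> (norm (u t))\<^sup>2 \<le> 4 * t powr (- decay)" by blast
    show "\<exists>\<delta>>0. \<forall>x y. solves H F {t1..} x y \<and> (x t1)\<^sup>2 + (y t1)\<^sup>2 < \<delta>\<^sup>2 \<longrightarrow>
        (\<exists>C. \<forall>\<^sub>F t in at_top. (x t)\<^sup>2 + (y t)\<^sup>2 \<le> C * t powr (- decay))"
    proof (rule exI[of _ \<delta>], intro conjI allI impI \<delta>(1))
      fix x y assume xy: "solves H F {t1..} x y \<and> (x t1)\<^sup>2 + (y t1)\<^sup>2 < \<delta>\<^sup>2"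
      have "(x t)\<^sup>2 + (y t)\<^sup>2 \<le> 4 * t powr (- decay)" if "t \<ge> T" for t
        using \<delta>(2)[OF sol[of t1 x y] _ that] xy nlt[OF _ \<delta>(1)] by (simp add: nsq)
      then show "\<exists>C. \<forall>\<^sub>F t in at_top. (x t)\<^sup>2 + (y t)\<^sup>2 \<le> C * t powr (- decay)"
        by (intro exI[of _ 4] eventually_at_top_linorderI[of T]) auto
    qed
  qed
  ultimately show ?thesis unfolding polynomially_stable_def using decay_pos by blast
qed

end

text \<open>For small \<open>u\<close> one has \<open>u powr b \<le> u\<close>, so both forms of
  \<Lambda>, with \<open>b = 1\<close> at the order \<open>n + d\<close>, are \<open>O(v)\<close>.
  This is the input for splitting off \<open>z\<^sup>2\<close> by
  \<open>hadamard_square\<close>.\<close>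

lemma linear_order:
  assumes g: "unif_bigo g sqrt" and D: "0 < D" and b: "1 \<le> b"
    and G: "\<And>u \<psi>. u \<in> {0..D} \<Longrightarrow> G u \<psi> = u powr b * (c \<psi> + g u \<psi>) + u * k"
  shows "\<exists>C. \<forall>\<^sub>F u in at_right 0. \<bar>G u \<psi>\<bar> \<le> C * u"
proof -
  obtain C where C: "\<forall>\<^sub>F u in at_right 0. \<forall>\<psi>. \<bar>g u \<psi>\<bar> \<le> C * sqrt u"
    using g unfolding unif_bigo_def by blast
  have "\<forall>\<^sub>F u in at_right 0. \<bar>G u \<psi>\<bar> \<le> (\<bar>c \<psi>\<bar> + \<bar>C\<bar> + \<bar>k\<bar>) * u"
    using C eventually_at_right_real[OF D] eventually_at_right_real[OF zero_less_one]
  proof eventually_elim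
    case (elim u)
    have pw: "u powr b \<le> u" using powr_mono'[OF b, of u] elim by simp
    have "C * sqrt u \<le> \<bar>C\<bar> * 1" using elim by (intro mult_mono) auto
    then have "\<bar>g u \<psi>\<bar> \<le> \<bar>C\<bar>" using elim(1) by (metis mult.right_neutral order_trans)
    then have "\<bar>c \<psi> + g u \<psi>\<bar> \<le> \<bar>c \<psi>\<bar> + \<bar>C\<bar>" by linarith
    then have "\<bar>u powr b * (c \<psi> + g u \<psi>)\<bar> \<le> u * (\<bar>c \<psi>\<bar> + \<bar>C\<bar>)"
      unfolding abs_mult using elim pw by (intro mult_mono) auto
    moreover have "\<bar>u * k\<bar> = u * \<bar>k\<bar>" using elim by (simp add: abs_mult)
    ultimately show ?case using G[of u \<psi>] elim by (simp add: algebra_simps)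
  qed
  then show ?thesis by blast
qed

theorem theorem8:
  fixes H F :: "real \<Rightarrow> real \<Rightarrow> real \<Rightarrow> real"
    and H0 :: "real \<Rightarrow> real \<Rightarrow> real"
    and Hk Fk :: "nat \<Rightarrow> real \<Rightarrow> real \<Rightarrow> real \<Rightarrow> real"
    and S \<omega> :: "real \<Rightarrow> real" and s :: "nat \<Rightarrow> real"
    and x0 y0 :: "real \<Rightarrow> real \<Rightarrow> real"
    and fk gk cF cG v psi :: "nat \<Rightarrow> real \<Rightarrow> real \<Rightarrow> real \<Rightarrow> real"
    and Lam Om :: "nat \<Rightarrow> real \<Rightarrow> real \<Rightarrow> real"
    and \<omega>m \<omega>m1 lamL :: "real \<Rightarrow> real"
    and lamN :: "nat \<Rightarrow> real \<Rightarrow> real"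
    and lamL' :: "real \<Rightarrow> real \<Rightarrow> real"
    and lamN' :: "nat \<Rightarrow> real \<Rightarrow> real \<Rightarrow> real"
    and r0 E0 \<epsilon> t0 calE0 \<Delta>0 \<Delta>s :: real
    and q \<kappa> l N n m d \<sigma> :: nat
  assumes "perturbed_system H F H0 r0 q s S Hk Fk"
    and "limiting_center H0 r0 E0 \<omega> x0 y0"
    and "phase_normalized E0 \<omega> x0 y0"
    and "\<kappa> \<ge> 1" and "s 0 = real \<kappa> * \<omega> 0"
    and "fk = (\<lambda>k. action_coeff \<omega> (angle_par \<omega> x0) (angle_par \<omega> y0) (Hk k) (Fk k))"
    and "gk = (\<lambda>k. angle_coeff \<omega> (angle_par \<omega> x0) (angle_par \<omega> y0) (Hk k) (Fk k))"
    and "scale_exponent q \<kappa> s \<omega> E0 fk gk l"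
    and "0 < \<epsilon>" and "\<epsilon> < 1" and "t0 > 1"
    and "calE0 = E0 * t0 powr (real l / (2 * real q))" and "\<Delta>0 = (1 - \<epsilon>) * calE0"
    and "scaled_expansion q l \<kappa> s \<omega> calE0 fk gk cF cG"
    and "averaging q l \<kappa> s calE0 cF cG N m v psi Lam Om"
    and "near_identity q S \<epsilon> t0 calE0 N m v psi"
    and "2 \<le> n" and "n \<le> 2 * q" and "2 \<le> m" and "m \<le> 2 * q"
    and "\<sigma> \<ge> 2" and "d \<ge> 1" and "N \<ge> n + d"
    and "\<forall>j\<in>{2..<n}. \<forall>u\<in>{0..\<Delta>0}. \<forall>\<psi>. Lam j u \<psi> = 0"
    and "\<forall>i\<in>{2..<m}. \<forall>u\<in>{0..\<Delta>0}. \<forall>\<psi>. Om i u \<psi> = 0"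
    and "\<forall>z\<in>{n..<n + d}. \<forall>u\<in>{0..\<Delta>0}. \<forall>\<psi>.
           Lam z u \<psi> = u powr ((real \<sigma> + 1) / 2) * (lamN z \<psi> + lamN' z u \<psi>)
             + u * kronecker z (2 * q) * (real l / real q)"
    and "\<forall>u\<in>{0..\<Delta>0}. \<forall>\<psi>.
           Lam (n + d) u \<psi> =
             u * (lamL \<psi> + lamL' u \<psi> + kronecker (n + d) (2 * q) * (real l / real q))"
    and "\<forall>z\<in>{n..<n + d}. periodic (2 * pi) (lamN z)
           \<and> (\<forall>u\<in>{0..\<Delta>0}. periodic (2 * pi) (lamN' z u)) \<and> unif_bigo (lamN' z) sqrt"
    and "periodic (2 * pi) lamL"
    and "\<forall>u\<in>{0..\<Delta>0}. periodic (2 * pi) (lamL' u)" and "unif_bigo lamL' sqrt"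
    and "\<omega>m = (\<lambda>\<psi>. Om m 0 \<psi>)"
    and "periodic (2 * pi) \<omega>m" and "\<exists>\<psi>. \<omega>m \<psi> \<noteq> 0" and "periodic (2 * pi) \<omega>m1"
    and "unif_bigo (\<lambda>u \<psi>. Om m u \<psi> - \<omega>m \<psi> - \<omega>m1 \<psi> * sqrt u) (\<lambda>u. u)"
    and "0 < \<Delta>s" and "\<Delta>s \<le> \<Delta>0"
    and "\<forall>u\<in>{0..\<Delta>s}. \<forall>\<psi>. Om m u \<psi> \<noteq> 0"
    and "m < n + d" and "n + d \<le> 2 * q"
    and "psi_mean (\<lambda>\<psi>. lamL \<psi> * inverse \<bar>\<omega>m \<psi>\<bar>) > 0"
    and "psi_mean (\<lambda>\<psi>. lamN n \<psi> * inverse \<bar>\<omega>m \<psi>\<bar>) < 0"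
  shows "polynomially_stable H F"
proof -
  note LamN = \<open>\<forall>z\<in>{n..<n + d}. \<forall>u\<in>{0..\<Delta>0}. \<forall>\<psi>. Lam z u \<psi> = _\<close>
  note LamL = \<open>\<forall>u\<in>{0..\<Delta>0}. \<forall>\<psi>. Lam (n + d) u \<psi> = _\<close>
  note av = \<open>averaging q l \<kappa> s calE0 cF cG N m v psi Lam Om\<close>
  obtain Xz Yz where XY: "smooth_near ({0..sqrt E0} \<times> UNIV) Xz" "smooth_near ({0..sqrt E0} \<times> UNIV) Yz"
    "\<forall>z\<in>{0..sqrt E0}. \<forall>p. angle_par \<omega> x0 p (z\<^sup>2) = Xz (z, p)"
    "\<forall>z\<in>{0..sqrt E0}. \<forall>p. angle_par \<omega> y0 p (z\<^sup>2) = Yz (z, p)"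
    using \<open>phase_normalized E0 \<omega> x0 y0\<close> unfolding phase_normalized_def sqrt_smooth_def by blast
  interpret center H0 r0 E0 \<omega> x0 y0 Xz Yz
    using XY assms(2,3) by unfold_locales blast+
  obtain a1 where a1: "a1 \<in> {0<..<sqrt E0}" "\<forall>z\<in>{0<..a1}. \<omega> (z\<^sup>2) > 1 / 2" using omega_pos by blast
  obtain a2 wz where a2: "a2 > 0" "smooth_near {0..a2} wz" "\<forall>z\<in>{0<..a2}. \<omega> (z\<^sup>2) = wz z" using omega_smooth by blast
  \<comment> \<open>Up to \<open>z1\<close> the frequency exceeds \<open>1 / 2\<close> and is also
    smooth as a function of \<open>z\<close>.\<close>
  define z1 where "z1 = min a1 a2"
  have smw: "smooth_near {0..z1} wz" by (rule smooth_near_subset[OF a2(2)]) (auto simp: z1_def)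
  interpret center_rate H0 r0 E0 \<omega> x0 y0 Xz Yz z1 wz
  proof unfold_locales
    show "0 < z1" "z1 < sqrt E0" using a1(1) a2(1) by (auto simp: z1_def)
    show "1 / 2 < \<omega> (z\<^sup>2)" if "z \<in> {0<..z1}" for z
      by (rule bspec[OF a1(2)]) (use that in \<open>auto simp: z1_def\<close>)
    show "\<omega> (z\<^sup>2) = wz z" if "z \<in> {0<..z1}" for z
      by (rule bspec[OF a2(3)]) (use that in \<open>auto simp: z1_def\<close>)
  qed (rule smw)
  interpret perturbed H0 r0 E0 \<omega> x0 y0 Xz Yz z1 wz H F q s S Hk Fk
    by unfold_locales fact
  obtain fq gq :: "nat \<Rightarrow> real \<times> real \<times> real \<Rightarrow> real" where fg:
    "\<And>k. k \<ge> 1 \<Longrightarrow> smooth_near ({0..z1} \<times> UNIV) (fq k)"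
    "\<And>k. k \<ge> 1 \<Longrightarrow> smooth_near ({0..z1} \<times> UNIV) (gq k)"
    "\<And>k z \<phi> \<sigma>. k \<ge> 1 \<Longrightarrow> z \<in> {0<..z1} \<Longrightarrow>
       action_coeff \<omega> (angle_par \<omega> x0) (angle_par \<omega> y0) (Hk k) (Fk k) (z\<^sup>2) \<phi> \<sigma> = z\<^sup>2 * fq k (z, \<phi>, \<sigma>)"
    "\<And>k z \<phi> \<sigma>. k \<ge> 1 \<Longrightarrow> z \<in> {0<..z1} \<Longrightarrow>
       angle_coeff \<omega> (angle_par \<omega> x0) (angle_par \<omega> y0) (Hk k) (Fk k) (z\<^sup>2) \<phi> \<sigma> = gq k (z, \<phi>, \<sigma>)"
    "\<And>K. \<exists>C>0. \<forall>\<^sub>F t in at_top. \<forall>z\<in>{0<..z1}. \<forall>\<phi>\<in>{0..4 * pi}.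
       \<bar>energy_rate z \<phi> t - z\<^sup>2 * (\<Sum>k=1..K. t powr (- (real k / real q)) * fq k (z, \<phi>, S t))\<bar>
         \<le> C * z\<^sup>2 * t powr (- (real (K + 1) / real q)) \<and>
       \<bar>angle_rate z \<phi> t - \<omega> (z\<^sup>2) - (\<Sum>k=1..K. t powr (- (real k / real q)) * gq k (z, \<phi>, S t))\<bar>
         \<le> C * t powr (- (real (K + 1) / real q))"
  proof (rule true_rates, goal_cases)
    case (1 fq gq)
    show ?case by (rule 1(1)[OF 1(2-)])
  qed
  have E: "calE0 > 0" using E0 assms(11,12) by simp
  have \<Delta>: "0 < \<Delta>0" "\<Delta>0 \<le> calE0" using assms(9,10,13) E by (simp_all add: mult_left_le_one_le)
  interpret averaged H0 r0 E0 \<omega> x0 y0 Xz Yz z1 wz H F q s S Hk Fk \<kappa> l N m calE0 \<epsilon> t0 cF cG v psi Lam Om fq gq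
    by unfold_locales (use assms(4,6,7,11,14,16) av E fg in simp_all)
  have "\<forall>k\<in>{2..N}. \<exists>vh. smooth_near ({0..rho} \<times> UNIV) vh \<and> (\<forall>z\<in>{0..rho}. \<forall>\<theta> \<sigma>. v k (z\<^sup>2) \<theta> \<sigma> = z\<^sup>2 * vh (z, \<theta>, \<sigma>))"
  proof
    fix k assume "k \<in> {2..N}"
    then show "\<exists>vh. smooth_near ({0..rho} \<times> UNIV) vh \<and> (\<forall>z\<in>{0..rho}. \<forall>\<theta> \<sigma>. v k (z\<^sup>2) \<theta> \<sigma> = z\<^sup>2 * vh (z, \<theta>, \<sigma>))"
      by (rule v_order) blast
  qed
  from bchoice[OF this] obtain vh where vh: "\<forall>k\<in>{2..N}. smooth_near ({0..rho} \<times> UNIV) (vh k) \<and>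
     (\<forall>z\<in>{0..rho}. \<forall>\<theta> \<sigma>. v k (z\<^sup>2) \<theta> \<sigma> = z\<^sup>2 * vh k (z, \<theta>, \<sigma>))" ..
  have "\<forall>k\<in>{2..m}. \<exists>ph. smooth_near ({0..rho} \<times> UNIV) ph \<and> (\<forall>z\<in>{0..rho}. \<forall>p. (case p of (\<theta>, \<sigma>) \<Rightarrow> psi k (z\<^sup>2) \<theta> \<sigma>) = ph (z, p))"
    using av unfolding averaging_def sqrt_smooth_def by blast
  from bchoice[OF this] obtain ph where ph: "\<forall>k\<in>{2..m}. smooth_near ({0..rho} \<times> UNIV) (ph k) \<and>
     (\<forall>z\<in>{0..rho}. \<forall>p. (case p of (\<theta>, \<sigma>) \<Rightarrow> psi k (z\<^sup>2) \<theta> \<sigma>) = ph k (z, p))" ..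
  have "\<forall>k\<in>{2..N}. \<exists>La. smooth_near ({0..rho} \<times> UNIV) La \<and> (\<forall>z\<in>{0..rho}. \<forall>p. Lam k (z\<^sup>2) p = La (z, p))"
    using av unfolding averaging_def sqrt_smooth_def by blast
  from bchoice[OF this] obtain La where La: "\<forall>k\<in>{2..N}. smooth_near ({0..rho} \<times> UNIV) (La k) \<and>
     (\<forall>z\<in>{0..rho}. \<forall>p. Lam k (z\<^sup>2) p = La k (z, p))" ..
  have "m \<in> {2..m}" using assms(19) by simp
  then have "sqrt_smooth calE0 (Om m)" using av unfolding averaging_def by blast
  then obtain Oh where Oh: "smooth_near ({0..rho} \<times> UNIV) Oh" "\<forall>z\<in>{0..rho}. \<forall>p. Om m (z\<^sup>2) p = Oh (z, p)"
    unfolding sqrt_smooth_def by blast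
  have "\<forall>j\<in>{n..n + d}. \<exists>Lh. smooth_near ({0..rho} \<times> UNIV) Lh \<and> (\<forall>z\<in>{0..rho}. \<forall>p. La j (z, p) = z\<^sup>2 * Lh (z, p))"
  proof
    fix j assume j: "j \<in> {n..n + d}"
    then have jN: "j \<in> {2..N}" using assms(17,23) by auto
    have lin: "\<exists>C. \<forall>\<^sub>F u in at_right 0. \<bar>Lam j u \<psi>\<bar> \<le> C * u" for \<psi>
    proof (cases "j = n + d")
      case True
      show ?thesis
        by (rule linear_order[of lamL' \<Delta>0 1 _ lamL "kronecker (n + d) (2 * q) * (real l / real q)"])
           (use LamL \<Delta> assms(31) True in \<open>auto simp: algebra_simps\<close>)
    next
      case False
      then have "j \<in> {n..<n + d}" using j by auto
      then show ?thesis
        by (intro linear_order[of "lamN' j" \<Delta>0 "(real \<sigma> + 1) / 2" _ "lamN j" "kronecker j (2 * q) * (real l / real q)"])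
           (use LamN \<Delta> assms(21,28) in \<open>auto simp: mult.assoc\<close>)
    qed
    have bd: "\<exists>C. \<forall>\<^sub>F z in at_right 0. \<bar>La j (z, p)\<bar> \<le> C * z\<^sup>2" for p
    proof -
      obtain C where "\<forall>\<^sub>F u in at_right 0. \<bar>Lam j u p\<bar> \<le> C * u" using lin by blast
      then have "\<forall>\<^sub>F z in at_right 0. \<bar>Lam j (z\<^sup>2) p\<bar> \<le> C * z\<^sup>2"
        by (rule eventually_compose_filterlim[OF _ filterlim_square_at_right])
      moreover have "\<forall>\<^sub>F z in at_right 0. z \<in> {0<..<rho}" using E by (intro eventually_at_right_real) simp
      ultimately have "\<forall>\<^sub>F z in at_right 0. \<bar>La j (z, p)\<bar> \<le> C * z\<^sup>2"
        by eventually_elim (use La jN in auto)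
      then show ?thesis by blast
    qed
    have "smooth_near ({0..rho} \<times> UNIV) (La j)" "rho > 0" using La jN E by auto
    then show "\<exists>Lh. smooth_near ({0..rho} \<times> UNIV) Lh \<and> (\<forall>z\<in>{0..rho}. \<forall>p. La j (z, p) = z\<^sup>2 * Lh (z, p))"
      by (rule hadamard_square[OF _ _ bd]) blast
  qed
  from bchoice[OF this] obtain Lh where Lh: "\<forall>j\<in>{n..n + d}. smooth_near ({0..rho} \<times> UNIV) (Lh j) \<and>
     (\<forall>z\<in>{0..rho}. \<forall>p. La j (z, p) = z\<^sup>2 * Lh j (z, p))" ..
  have Lam_Lh: "Lam j (z\<^sup>2) \<psi> = z\<^sup>2 * Lh j (z, \<psi>)" if "j \<in> {n..n + d}" "z \<in> {0..rho}" for j z \<psi>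
    using La Lh that assms(17,23) by auto
  interpret reduced H0 r0 E0 \<omega> x0 y0 Xz Yz z1 wz H F q s S Hk Fk \<kappa> l N m calE0 \<epsilon> t0 cF cG v psi Lam Om fq gq n d \<Delta>0 vh ph La Lh Oh
    by unfold_locales (use \<Delta> assms(17,19,20,23-25,41) vh ph La Lh Oh Lam_Lh in auto)
  obtain \<tau>1 z2 where dom: "0 < \<tau>1" "\<tau>1 \<le> 1" "0 < z2" "z2 < z1" "2 * z2 < rho" "2 * z2\<^sup>2 \<le> \<Delta>0"
    "\<And>x. x \<in> {0..\<tau>1} \<times> {0..z2} \<times> {0..2 * pi} \<times> {0..2 * pi * real \<kappa>} \<Longrightarrow> Vh x \<in> {1 / 2..2}"
    by (rule domain_exists) (rule that; blast)
  interpret domain H0 r0 E0 \<omega> x0 y0 Xz Yz z1 wz H F q s S Hk Fk \<kappa> l N m calE0 \<epsilon> t0 cF cG v psi Lam Om fq gq n d \<Delta>0 vh ph La Lh Oh \<tau>1 z2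
    by unfold_locales (fact dom)+
  have mean: "psi_mean (\<lambda>\<psi>. lamN n \<psi> * inverse \<bar>Om m 0 \<psi>\<bar>) < 0" using assms(43) unfolding assms(32) .
  interpret leading H0 r0 E0 \<omega> x0 y0 Xz Yz z1 wz H F q s S Hk Fk \<kappa> l N m calE0 \<epsilon> t0 cF cG v psi Lam Om fq gq n d \<Delta>0 vh ph La Lh Oh \<tau>1 z2
      \<sigma> \<Delta>s lamN lamN' lamL lamL'
    by unfold_locales (use \<Delta> LamN LamL assms(21,22,28,31,32,37-40) mean in simp_all)
  show ?thesis by (rule polynomially_stable)
qed

end
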